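(* Synchronous machines form a $\mathcal{W}_{\widetilde{\mathrm{Int}}/\mathsf{Sync}}$-algebra $\mathsf{Mch}_{\mathsf{Sync}}\colon\mathcal{W}_{\widetilde{\mathrm{Int}}/\mathsf{Sync}}\to\mathbf{Cat}$ (namely the algebra of $\widetilde{\mathrm{Int}}/\mathsf{Sync}$-span systems). Inertial, total, and deterministic synchronous machines form subalgebras $\mathsf{Mch}_{\mathsf{Sync}}^{\mathrm{in}}$, $\mathsf{Mch}_{\mathsf{Sync}}^{\mathrm{t}}$, $\mathsf{Mch}_{\mathsf{Sync}}^{\mathrm{d}}$, and so do the machines that are both total and deterministic, $\mathsf{Mch}_{\mathsf{Sync}}^{\mathrm{td}}$.
   Context: Interval sheaves. $\mathrm{Int}$ is the category with objects $\ell\in\mathbb{R}_{\ge0}$, morphisms $\ell'\to\ell$ the symbols $\mathrm{Tr}_p$ with $p\in\mathbb{R}_{\ge0}$, $p\le\ell-\ell'$, composition $\mathrm{Tr}_p\circ\mathrm{Tr}_{p'}=\mathrm{Tr}_{p+p'}$, identities $\mathrm{Tr}_0$. For a presheaf $X$ and $x\in X(\ell)$, write $x|_{[p,p+\ell']}=X(\mathrm{Tr}_p)(x)$. An $\mathrm{Int}$-sheaf is a presheaf $X$ such that for all $x_1\in X(\ell_1)$, $x_2\in X(\ell_2)$ with $x_1|_{[\ell_1,\ell_1]}=x_2|_{[0,0]}$ there is a unique element of $X(\ell_1+\ell_2)$ restricting to $x_1$ on $[0,\ell_1]$ and to $x_2$ on $[\ell_1,\ell_1+\ell_2]$. $\widetilde{\mathrm{Int}}$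 is the topos of such sheaves. For $\epsilon\ge0$, $(\mathsf{Ext}_\epsilon A)(\ell)=A(\ell+\epsilon)$ defines $\mathsf{Ext}_\epsilon\colon\widetilde{\mathrm{Int}}\to\widetilde{\mathrm{Int}}$, and $\lambda\colon\mathsf{Ext}_\epsilon\Rightarrow\mathrm{id}$ is left restriction $x\mapsto x|_{[0,\ell]}$. $\mathsf{Sync}\in\widetilde{\mathrm{Int}}$ is the sheaf $\mathsf{Sync}(\ell)=\mathbb{R}/\mathbb{Z}$, with restriction along $\mathrm{Tr}_p$ given by $[\theta]\mapsto[\theta+p]$. Machines. A map $p\colon S\to A$ in $\widetilde{\mathrm{Int}}$ is total (resp. deterministic) if for all $\epsilon>0$ the induced map $h^\epsilon\colon\mathsf{Ext}_\epsilon S\to\mathsf{Ext}_\epsilon A\times_AS$ (pullback of $\lambda_A$ and $p$; $h^\epsilon$ induced by $\mathsf{Ext}_\epsilon p$ and $\lambda_S$) is an epimorphism (resp. monomorphism); it is inertial if for some $\epsilon>0$ it factors through $\lambda\colon\mathsf{Ext}_\epsilon A\to A$. A synchronous machine is a span $A\xleftarrow{p^i}S\xrightarrow{p^o}B$ in the slice topos $\widetilde{\mathrm{Int}}/\mathsf{Sync}$. It is inertial if the map in $\widetilde{\mathrm{Int}}$ underlying $p^o$ is inertial; it is total (resp. deterministic) if moreover the map in $\widetilde{\mathrm{Int}}$ underlying $p^i$ is total (resp. deterministic). Wiring diagrams, with $\mathcal{C}=\widetilde{\mathrm{Int}}/\mathsf{Sync}$. A $\mathcal{C}$-typed finite set is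 a finite set $X$ with $\tau\colon X\to\mathrm{ob}\,\mathcal{C}$; typed functions preserve types; $\widehat{X}=\prod_{x\in X}\tau(x)$ (product in $\mathcal{C}$); a typed function $f\colon X\to X'$ induces $\widehat{f}\colon\widehat{X'}\to\widehat{X}$ by reindexing. $\mathcal{W}_{\mathcal{C}}$ is the symmetric monoidal category whose objects (boxes) are pairs $X=(X^{\mathrm{in}},X^{\mathrm{out}})$ of $\mathcal{C}$-typed finite sets and whose morphisms (wiring diagrams) $\phi\colon X\to Y$ are pairs of typed functions $\phi^{\mathrm{in}}\colon X^{\mathrm{in}}\to X^{\mathrm{out}}+Y^{\mathrm{in}}$, $\phi^{\mathrm{out}}\colon Y^{\mathrm{out}}\to X^{\mathrm{out}}$. The composite $\omega=\psi\circ\phi$ has $\omega^{\mathrm{out}}=\phi^{\mathrm{out}}\circ\psi^{\mathrm{out}}$ and $\omega^{\mathrm{in}}=(\nabla+1)\circ(1+\phi^{\mathrm{out}}+1)\circ(1+\psi^{\mathrm{in}})\circ\phi^{\mathrm{in}}$; the identity is (coproduct inclusion, identity). The tensor $\oplus$ is componentwise disjoint union with unit $0=(\emptyset,\emptyset)$. $\phi$ induces $\widehat{\phi^{\mathrm{in}}}\colon\widehat{Y^{\mathrm{in}}}\times\widehat{X^{\mathrm{out}}}\to\widehat{X^{\mathrm{in}}}$ and $\widehat{\phi^{\mathrm{out}}}\colon\widehat{X^{\mathrm{out}}}\to\widehat{Y^{\mathrm{out}}}$ in $\mathcal{C}$. A $\mathcal{W}_{\mathcal{C}}$-algebra is a symmetric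 lax monoidal functor $(\mathcal{W}_{\mathcal{C}},\oplus,0)\to(\mathbf{Cat},\times,\mathbf{1})$, in the pseudo sense (axioms up to coherent natural isomorphism). For finitely complete $\mathcal{C}$, the algebra of $\mathcal{C}$-span systems sends $X$ to the category $\mathcal{C}/(\widehat{X^{\mathrm{in}}}\times\widehat{X^{\mathrm{out}}})$ of spans, and $\phi\colon X\to Y$ to pullback along $(\widehat{\phi^{\mathrm{in}}},\pi_2)\colon\widehat{Y^{\mathrm{in}}}\times\widehat{X^{\mathrm{out}}}\to\widehat{X^{\mathrm{in}}}\times\widehat{X^{\mathrm{out}}}$ followed by postcomposition with $1\times\widehat{\phi^{\mathrm{out}}}$; its lax structure is cartesian product of spans. A class of machines forms a subalgebra if the corresponding full subcategories are preserved by the functors assigned to all wiring diagrams and by the lax monoidal structure maps (including the unit). *)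

theory Defs
  imports Complex_Main "HOL-Library.FuncSet"
begin

section \<open>Categories, functors and natural isomorphisms\<close>

record ('o, 'm) category =
  Obj :: "'o set"
  Arr :: "'m set"
  Dom :: "'m \<Rightarrow> 'o"
  Cod :: "'m \<Rightarrow> 'o"
  Ident :: "'o \<Rightarrow> 'm"
  Comp :: "'m \<Rightarrow> 'm \<Rightarrow> 'm"

abbreviation Comp_in :: "'m \<Rightarrow> ('o, 'm, 'z) category_scheme \<Rightarrow> 'm \<Rightarrow> 'm"
    ("_ \<cdot>\<^bsub>_\<^esub> _" [56, 0, 55] 55) where
  "g \<cdot>\<^bsub>C\<^esub> f \<equiv> Comp C g f"

definition Hom :: "('o, 'm, 'z) category_scheme \<Rightarrow> 'o \<Rightarrow> 'o \<Rightarrow> 'm set" where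
  "Hom C a b = {f \<in> Arr C. Dom C f = a \<and> Cod C f = b}"

definition is_category :: "('o, 'm, 'z) category_scheme \<Rightarrow> bool" where
  "is_category C \<longleftrightarrow>
     (\<forall>f\<in>Arr C. Dom C f \<in> Obj C \<and> Cod C f \<in> Obj C) \<and>
     (\<forall>a\<in>Obj C. Ident C a \<in> Hom C a a) \<and>
     (\<forall>f\<in>Arr C. \<forall>g\<in>Arr C. Dom C g = Cod C f \<longrightarrow> g \<cdot>\<^bsub>C\<^esub> f \<in> Hom C (Dom C f) (Cod C g)) \<and>
     (\<forall>f\<in>Arr C. f \<cdot>\<^bsub>C\<^esub> Ident C (Dom C f) = f \<and> Ident C (Cod C f) \<cdot>\<^bsub>C\<^esub> f = f) \<and>
     (\<forall>f\<in>Arr C. \<forall>g\<in>Arr C. \<forall>h\<in>Arr C. Dom C g = Cod C f \<longrightarrow> Dom C h = Cod C g \<longrightarrow>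
        (h \<cdot>\<^bsub>C\<^esub> g) \<cdot>\<^bsub>C\<^esub> f = h \<cdot>\<^bsub>C\<^esub> (g \<cdot>\<^bsub>C\<^esub> f))"

definition inverse_arrows :: "('o, 'm, 'z) category_scheme \<Rightarrow> 'm \<Rightarrow> 'm \<Rightarrow> bool" where
  "inverse_arrows C f g \<longleftrightarrow> f \<in> Arr C \<and> g \<in> Hom C (Cod C f) (Dom C f) \<and>
     g \<cdot>\<^bsub>C\<^esub> f = Ident C (Dom C f) \<and> f \<cdot>\<^bsub>C\<^esub> g = Ident C (Cod C f)"

definition is_iso :: "('o, 'm, 'z) category_scheme \<Rightarrow> 'm \<Rightarrow> bool" where
  "is_iso C f \<longleftrightarrow> (\<exists>g. inverse_arrows C f g)"

definition inv_arr :: "('o, 'm, 'z) category_scheme \<Rightarrow> 'm \<Rightarrow> 'm" where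
  "inv_arr C f = (THE g. inverse_arrows C f g)"

definition is_epi :: "('o, 'm, 'z) category_scheme \<Rightarrow> 'm \<Rightarrow> bool" where
  "is_epi C f \<longleftrightarrow> f \<in> Arr C \<and>
     (\<forall>g\<in>Arr C. \<forall>h\<in>Arr C. Dom C g = Cod C f \<longrightarrow> Dom C h = Cod C f \<longrightarrow> Cod C g = Cod C h \<longrightarrow>
        g \<cdot>\<^bsub>C\<^esub> f = h \<cdot>\<^bsub>C\<^esub> f \<longrightarrow> g = h)"

definition is_mono :: "('o, 'm, 'z) category_scheme \<Rightarrow> 'm \<Rightarrow> bool" where
  "is_mono C f \<longleftrightarrow> f \<in> Arr C \<and>
     (\<forall>g\<in>Arr C. \<forall>h\<in>Arr C. Cod C g = Dom C f \<longrightarrow> Cod C h = Dom C f \<longrightarrow> Dom C g = Dom C h \<longrightarrow>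
        f \<cdot>\<^bsub>C\<^esub> g = f \<cdot>\<^bsub>C\<^esub> h \<longrightarrow> g = h)"

record ('o, 'm, 'p, 'n) cat_functor =
  OM :: "'o \<Rightarrow> 'p"
  AM :: "'m \<Rightarrow> 'n"

definition is_functor :: "('o, 'm, 'y) category_scheme \<Rightarrow> ('p, 'n, 'z) category_scheme \<Rightarrow>
    ('o, 'm, 'p, 'n) cat_functor \<Rightarrow> bool" where
  "is_functor A B F \<longleftrightarrow>
     (\<forall>a\<in>Obj A. OM F a \<in> Obj B) \<and>
     (\<forall>f\<in>Arr A. AM F f \<in> Hom B (OM F (Dom A f)) (OM F (Cod A f))) \<and>
     (\<forall>a\<in>Obj A. AM F (Ident A a) = Ident B (OM F a)) \<and>
     (\<forall>f\<in>Arr A. \<forall>g\<in>Arr A. Dom A g = Cod A f \<longrightarrow> AM F (g \<cdot>\<^bsub>A\<^esub> f) = AM F g \<cdot>\<^bsub>B\<^esub> AM F f)"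

definition id_functor :: "('o, 'm, 'o, 'm) cat_functor" where
  "id_functor = \<lparr>OM = id, AM = id\<rparr>"

definition comp_functor :: "('p, 'n, 'q, 'k) cat_functor \<Rightarrow> ('o, 'm, 'p, 'n) cat_functor \<Rightarrow>
    ('o, 'm, 'q, 'k) cat_functor" (infixl "\<circ>\<^sub>F" 55) where
  "G \<circ>\<^sub>F F = \<lparr>OM = OM G \<circ> OM F, AM = AM G \<circ> AM F\<rparr>"

definition prod_functor :: "('o, 'm, 'p, 'n) cat_functor \<Rightarrow> ('o', 'm', 'p', 'n') cat_functor \<Rightarrow>
    ('o \<times> 'o', 'm \<times> 'm', 'p \<times> 'p', 'n \<times> 'n') cat_functor" (infixr "\<times>\<^sub>F" 60) where
  "F \<times>\<^sub>F G = \<lparr>OM = map_prod (OM F) (OM G), AM = map_prod (AM F) (AM G)\<rparr>"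

definition prod_category :: "('o, 'm, 'y) category_scheme \<Rightarrow> ('p, 'n, 'z) category_scheme \<Rightarrow>
    ('o \<times> 'p, 'm \<times> 'n) category" (infixr "\<times>\<^sub>C" 60) where
  "A \<times>\<^sub>C B = \<lparr>Obj = Obj A \<times> Obj B, Arr = Arr A \<times> Arr B,
     Dom = map_prod (Dom A) (Dom B), Cod = map_prod (Cod A) (Cod B),
     Ident = map_prod (Ident A) (Ident B),
     Comp = (\<lambda>(g, g') (f, f'). (g \<cdot>\<^bsub>A\<^esub> f, g' \<cdot>\<^bsub>B\<^esub> f'))\<rparr>"

definition nat_iso :: "('o, 'm, 'y) category_scheme \<Rightarrow> ('p, 'n, 'z) category_scheme \<Rightarrow>
    ('o, 'm, 'p, 'n) cat_functor \<Rightarrow> ('o, 'm, 'p, 'n) cat_functor \<Rightarrow> ('o \<Rightarrow> 'n) \<Rightarrow> bool" where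
  "nat_iso A B F G \<theta> \<longleftrightarrow>
     is_functor A B F \<and> is_functor A B G \<and>
     (\<forall>a\<in>Obj A. \<theta> a \<in> Hom B (OM F a) (OM G a) \<and> is_iso B (\<theta> a)) \<and>
     (\<forall>f\<in>Arr A. \<theta> (Cod A f) \<cdot>\<^bsub>B\<^esub> AM F f = AM G f \<cdot>\<^bsub>B\<^esub> \<theta> (Dom A f))"

definition slice :: "('o, 'm, 'z) category_scheme \<Rightarrow> 'o \<Rightarrow> ('m, 'm \<times> 'm \<times> 'm) category" where
  "slice C b = \<lparr>
     Obj = {f \<in> Arr C. Cod C f = b},
     Arr = {(f, f', h). f \<in> Arr C \<and> Cod C f = b \<and> f' \<in> Arr C \<and> Cod C f' = b \<and>
              h \<in> Hom C (Dom C f) (Dom C f') \<and> f' \<cdot>\<^bsub>C\<^esub> h = f},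
     Dom = (\<lambda>(f, f', h). f), Cod = (\<lambda>(f, f', h). f'),
     Ident = (\<lambda>f. (f, f, Ident C (Dom C f))),
     Comp = (\<lambda>(g, g', k) (f, f', h). (f, g', k \<cdot>\<^bsub>C\<^esub> h))\<rparr>"

definition underlying :: "'m \<times> 'm \<times> 'm \<Rightarrow> 'm" where
  "underlying = (\<lambda>(f, f', h). h)"


section \<open>Chosen finite products and pullbacks\<close>

definition is_product :: "('o, 'm, 'z) category_scheme \<Rightarrow> 'i set \<Rightarrow> ('i \<Rightarrow> 'o) \<Rightarrow>
    'o \<Rightarrow> ('i \<Rightarrow> 'm) \<Rightarrow> bool" where
  "is_product C I A p \<pi> \<longleftrightarrow> p \<in> Obj C \<and> (\<forall>i\<in>I. \<pi> i \<in> Hom C p (A i)) \<and>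
     (\<forall>q\<in>Obj C. \<forall>r. (\<forall>i\<in>I. r i \<in> Hom C q (A i)) \<longrightarrow>
        (\<exists>!u. u \<in> Hom C q p \<and> (\<forall>i\<in>I. \<pi> i \<cdot>\<^bsub>C\<^esub> u = r i)))"

definition prod_cone :: "('o, 'm, 'z) category_scheme \<Rightarrow> 'i set \<Rightarrow> ('i \<Rightarrow> 'o) \<Rightarrow>
    'o \<times> ('i \<Rightarrow> 'm)" where
  "prod_cone C I A = (SOME (p, \<pi>). is_product C I A p \<pi>)"

definition prod_ob :: "('o, 'm, 'z) category_scheme \<Rightarrow> 'i set \<Rightarrow> ('i \<Rightarrow> 'o) \<Rightarrow> 'o" where
  "prod_ob C I A = fst (prod_cone C I A)"

definition prod_pr :: "('o, 'm, 'z) category_scheme \<Rightarrow> 'i set \<Rightarrow> ('i \<Rightarrow> 'o) \<Rightarrow> 'i \<Rightarrow> 'm" where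
  "prod_pr C I A = snd (prod_cone C I A)"

definition tuple :: "('o, 'm, 'z) category_scheme \<Rightarrow> 'i set \<Rightarrow> ('i \<Rightarrow> 'o) \<Rightarrow>
    'o \<Rightarrow> ('i \<Rightarrow> 'm) \<Rightarrow> 'm" where
  "tuple C I A q r =
     (THE u. u \<in> Hom C q (prod_ob C I A) \<and> (\<forall>i\<in>I. prod_pr C I A i \<cdot>\<^bsub>C\<^esub> u = r i))"

text \<open>Binary products are products of families indexed by \<^typ>\<open>bool\<close>, with \<^term>\<open>True\<close>
  indexing the first factor.\<close>

definition bprod :: "('o, 'm, 'z) category_scheme \<Rightarrow> 'o \<Rightarrow> 'o \<Rightarrow> 'o" where
  "bprod C a b = prod_ob C UNIV (case_bool a b)"

definition pr1 :: "('o, 'm, 'z) category_scheme \<Rightarrow> 'o \<Rightarrow> 'o \<Rightarrow> 'm" where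
  "pr1 C a b = prod_pr C UNIV (case_bool a b) True"

definition pr2 :: "('o, 'm, 'z) category_scheme \<Rightarrow> 'o \<Rightarrow> 'o \<Rightarrow> 'm" where
  "pr2 C a b = prod_pr C UNIV (case_bool a b) False"

definition pairing :: "('o, 'm, 'z) category_scheme \<Rightarrow> 'm \<Rightarrow> 'm \<Rightarrow> 'm" where
  "pairing C f g = tuple C UNIV (case_bool (Cod C f) (Cod C g)) (Dom C f) (case_bool f g)"

definition par :: "('o, 'm, 'z) category_scheme \<Rightarrow> 'm \<Rightarrow> 'm \<Rightarrow> 'm" where
  "par C f g = pairing C (f \<cdot>\<^bsub>C\<^esub> pr1 C (Dom C f) (Dom C g)) (g \<cdot>\<^bsub>C\<^esub> pr2 C (Dom C f) (Dom C g))"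

definition is_pullback :: "('o, 'm, 'z) category_scheme \<Rightarrow> 'm \<Rightarrow> 'm \<Rightarrow> 'm \<Rightarrow> 'm \<Rightarrow> bool" where
  "is_pullback C f g p q \<longleftrightarrow>
     p \<in> Arr C \<and> q \<in> Arr C \<and> Dom C p = Dom C q \<and> Cod C p = Dom C f \<and> Cod C q = Dom C g \<and>
     f \<cdot>\<^bsub>C\<^esub> p = g \<cdot>\<^bsub>C\<^esub> q \<and>
     (\<forall>u\<in>Arr C. \<forall>v\<in>Arr C. Dom C u = Dom C v \<longrightarrow> Cod C u = Dom C f \<longrightarrow> Cod C v = Dom C g \<longrightarrow>
        f \<cdot>\<^bsub>C\<^esub> u = g \<cdot>\<^bsub>C\<^esub> v \<longrightarrow>
        (\<exists>!w. w \<in> Hom C (Dom C u) (Dom C p) \<and> p \<cdot>\<^bsub>C\<^esub> w = u \<and> q \<cdot>\<^bsub>C\<^esub> w = v))"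

definition pb_cone :: "('o, 'm, 'z) category_scheme \<Rightarrow> 'm \<Rightarrow> 'm \<Rightarrow> 'm \<times> 'm" where
  "pb_cone C f g = (SOME (p, q). is_pullback C f g p q)"

definition pb1 :: "('o, 'm, 'z) category_scheme \<Rightarrow> 'm \<Rightarrow> 'm \<Rightarrow> 'm" where
  "pb1 C f g = fst (pb_cone C f g)"

definition pb2 :: "('o, 'm, 'z) category_scheme \<Rightarrow> 'm \<Rightarrow> 'm \<Rightarrow> 'm" where
  "pb2 C f g = snd (pb_cone C f g)"

definition pb_pair :: "('o, 'm, 'z) category_scheme \<Rightarrow> 'm \<Rightarrow> 'm \<Rightarrow> 'm \<Rightarrow> 'm \<Rightarrow> 'm" where
  "pb_pair C f g u v = (THE w. w \<in> Hom C (Dom C u) (Dom C (pb1 C f g)) \<and>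
     pb1 C f g \<cdot>\<^bsub>C\<^esub> w = u \<and> pb2 C f g \<cdot>\<^bsub>C\<^esub> w = v)"

definition base_change :: "('o, 'm, 'z) category_scheme \<Rightarrow> 'm \<Rightarrow>
    ('m, 'm \<times> 'm \<times> 'm, 'm, 'm \<times> 'm \<times> 'm) cat_functor" where
  "base_change C k = \<lparr>
     OM = pb1 C k,
     AM = (\<lambda>(s, s', h). (pb1 C k s, pb1 C k s', pb_pair C k s' (pb1 C k s) (h \<cdot>\<^bsub>C\<^esub> pb2 C k s)))\<rparr>"

definition postcompose :: "('o, 'm, 'z) category_scheme \<Rightarrow> 'm \<Rightarrow>
    ('m, 'm \<times> 'm \<times> 'm, 'm, 'm \<times> 'm \<times> 'm) cat_functor" where
  "postcompose C k = \<lparr>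
     OM = (\<lambda>s. k \<cdot>\<^bsub>C\<^esub> s),
     AM = (\<lambda>(s, s', h). (k \<cdot>\<^bsub>C\<^esub> s, k \<cdot>\<^bsub>C\<^esub> s', h))\<rparr>"


section \<open>Symmetric lax monoidal pseudofunctors to Cat\<close>

record ('x, 'w) monoidal_category = "('x, 'w) category" +
  Tensor :: "('x \<times> 'x, 'w \<times> 'w, 'x, 'w) cat_functor"
  Unit :: 'x
  Assoc :: "'x \<Rightarrow> 'x \<Rightarrow> 'x \<Rightarrow> 'w"
  LUnit :: "'x \<Rightarrow> 'w"
  RUnit :: "'x \<Rightarrow> 'w"
  Braid :: "'x \<Rightarrow> 'x \<Rightarrow> 'w"

abbreviation tensor_ob :: "'x \<Rightarrow> ('x, 'w, 'z) monoidal_category_scheme \<Rightarrow> 'x \<Rightarrow> 'x"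
    ("_ \<oplus>\<^bsub>_\<^esub> _" [66, 0, 65] 65) where
  "x \<oplus>\<^bsub>M\<^esub> y \<equiv> OM (Tensor M) (x, y)"

abbreviation tensor_arr :: "'w \<Rightarrow> ('x, 'w, 'z) monoidal_category_scheme \<Rightarrow> 'w \<Rightarrow> 'w"
    ("_ \<otimes>\<^bsub>_\<^esub> _" [66, 0, 65] 65) where
  "f \<otimes>\<^bsub>M\<^esub> g \<equiv> AM (Tensor M) (f, g)"

definition symmetric_monoidal :: "('x, 'w, 'z) monoidal_category_scheme \<Rightarrow> bool" where
  "symmetric_monoidal M \<longleftrightarrow>
     is_category M \<and> is_functor (M \<times>\<^sub>C M) M (Tensor M) \<and> Unit M \<in> Obj M \<and>
     (\<forall>x\<in>Obj M. \<forall>y\<in>Obj M. \<forall>z\<in>Obj M. is_iso M (Assoc M x y z) \<and>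
        Assoc M x y z \<in> Hom M ((x \<oplus>\<^bsub>M\<^esub> y) \<oplus>\<^bsub>M\<^esub> z) (x \<oplus>\<^bsub>M\<^esub> (y \<oplus>\<^bsub>M\<^esub> z))) \<and>
     (\<forall>x\<in>Obj M. is_iso M (LUnit M x) \<and> LUnit M x \<in> Hom M (Unit M \<oplus>\<^bsub>M\<^esub> x) x) \<and>
     (\<forall>x\<in>Obj M. is_iso M (RUnit M x) \<and> RUnit M x \<in> Hom M (x \<oplus>\<^bsub>M\<^esub> Unit M) x) \<and>
     (\<forall>x\<in>Obj M. \<forall>y\<in>Obj M. is_iso M (Braid M x y) \<and>
        Braid M x y \<in> Hom M (x \<oplus>\<^bsub>M\<^esub> y) (y \<oplus>\<^bsub>M\<^esub> x)) \<and>
     (\<forall>f\<in>Arr M. \<forall>g\<in>Arr M. \<forall>h\<in>Arr M.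
        Assoc M (Cod M f) (Cod M g) (Cod M h) \<cdot>\<^bsub>M\<^esub> ((f \<otimes>\<^bsub>M\<^esub> g) \<otimes>\<^bsub>M\<^esub> h) =
        (f \<otimes>\<^bsub>M\<^esub> (g \<otimes>\<^bsub>M\<^esub> h)) \<cdot>\<^bsub>M\<^esub> Assoc M (Dom M f) (Dom M g) (Dom M h)) \<and>
     (\<forall>f\<in>Arr M. LUnit M (Cod M f) \<cdot>\<^bsub>M\<^esub> (Ident M (Unit M) \<otimes>\<^bsub>M\<^esub> f) = f \<cdot>\<^bsub>M\<^esub> LUnit M (Dom M f)) \<and>
     (\<forall>f\<in>Arr M. RUnit M (Cod M f) \<cdot>\<^bsub>M\<^esub> (f \<otimes>\<^bsub>M\<^esub> Ident M (Unit M)) = f \<cdot>\<^bsub>M\<^esub> RUnit M (Dom M f)) \<and>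
     (\<forall>f\<in>Arr M. \<forall>g\<in>Arr M.
        Braid M (Cod M f) (Cod M g) \<cdot>\<^bsub>M\<^esub> (f \<otimes>\<^bsub>M\<^esub> g) =
        (g \<otimes>\<^bsub>M\<^esub> f) \<cdot>\<^bsub>M\<^esub> Braid M (Dom M f) (Dom M g)) \<and>
     (\<forall>w\<in>Obj M. \<forall>x\<in>Obj M. \<forall>y\<in>Obj M. \<forall>z\<in>Obj M.
        Assoc M w x (y \<oplus>\<^bsub>M\<^esub> z) \<cdot>\<^bsub>M\<^esub> Assoc M (w \<oplus>\<^bsub>M\<^esub> x) y z =
        (Ident M w \<otimes>\<^bsub>M\<^esub> Assoc M x y z) \<cdot>\<^bsub>M\<^esub>
          (Assoc M w (x \<oplus>\<^bsub>M\<^esub> y) z \<cdot>\<^bsub>M\<^esub> (Assoc M w x y \<otimes>\<^bsub>M\<^esub> Ident M z))) \<and>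
     (\<forall>x\<in>Obj M. \<forall>y\<in>Obj M.
        (Ident M x \<otimes>\<^bsub>M\<^esub> LUnit M y) \<cdot>\<^bsub>M\<^esub> Assoc M x (Unit M) y = RUnit M x \<otimes>\<^bsub>M\<^esub> Ident M y) \<and>
     (\<forall>x\<in>Obj M. \<forall>y\<in>Obj M. \<forall>z\<in>Obj M.
        Assoc M y z x \<cdot>\<^bsub>M\<^esub> (Braid M x (y \<oplus>\<^bsub>M\<^esub> z) \<cdot>\<^bsub>M\<^esub> Assoc M x y z) =
        (Ident M y \<otimes>\<^bsub>M\<^esub> Braid M x z) \<cdot>\<^bsub>M\<^esub>
          (Assoc M y x z \<cdot>\<^bsub>M\<^esub> (Braid M x y \<otimes>\<^bsub>M\<^esub> Ident M z))) \<and>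
     (\<forall>x\<in>Obj M. \<forall>y\<in>Obj M. Braid M y x \<cdot>\<^bsub>M\<^esub> Braid M x y = Ident M (x \<oplus>\<^bsub>M\<^esub> y))"

text \<open>The data of a lax monoidal pseudofunctor \<open>F\<close> are the categories \<open>F x\<close>
  (\<open>Fib\<close>), the functors \<open>F \<phi>\<close> (\<open>Act\<close>), the laxators \<open>F x \<times> F y \<rightarrow> F (x \<oplus> y)\<close>
  (\<open>Mul\<close>), and the unit \<open>1 \<rightarrow> F I\<close>, given as an object of \<open>F I\<close>.\<close>

record ('x, 'w, 'p, 'n) lax_functor_data =
  Fib :: "'x \<Rightarrow> ('p, 'n) category"
  Act :: "'w \<Rightarrow> ('p, 'n, 'p, 'n) cat_functor"
  Mul :: "'x \<Rightarrow> 'x \<Rightarrow> ('p \<times> 'p, 'n \<times> 'n, 'p, 'n) cat_functor"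
  Eta :: 'p

text \<open>The structural isomorphisms, with \<open>\<mu> = Mul\<close>, \<open>\<eta> = Eta\<close>:
  \<open>CoId x s : s \<rightarrow> F 1 s\<close>,
  \<open>CoComp \<psi> \<phi> s : F \<psi> (F \<phi> s) \<rightarrow> F (\<psi> \<circ> \<phi>) s\<close>,
  \<open>CoMul \<phi> \<psi> (s, t) : \<mu> (F \<phi> s, F \<psi> t) \<rightarrow> F (\<phi> \<oplus> \<psi>) (\<mu> (s, t))\<close>,
  \<open>CoAssoc x y z s t u : F \<alpha> (\<mu> (\<mu> (s, t), u)) \<rightarrow> \<mu> (s, \<mu> (t, u))\<close>,
  \<open>CoLUnit x s : F \<lambda> (\<mu> (\<eta>, s)) \<rightarrow> s\<close>,
  \<open>CoRUnit x s : F \<rho> (\<mu> (s, \<eta>)) \<rightarrow> s\<close>,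
  \<open>CoBraid x y s t : F \<beta> (\<mu> (s, t)) \<rightarrow> \<mu> (t, s)\<close>.\<close>

record ('x, 'w, 'p, 'n) coherence_data =
  CoId :: "'x \<Rightarrow> 'p \<Rightarrow> 'n"
  CoComp :: "'w \<Rightarrow> 'w \<Rightarrow> 'p \<Rightarrow> 'n"
  CoMul :: "'w \<Rightarrow> 'w \<Rightarrow> 'p \<times> 'p \<Rightarrow> 'n"
  CoAssoc :: "'x \<Rightarrow> 'x \<Rightarrow> 'x \<Rightarrow> 'p \<Rightarrow> 'p \<Rightarrow> 'p \<Rightarrow> 'n"
  CoLUnit :: "'x \<Rightarrow> 'p \<Rightarrow> 'n"
  CoRUnit :: "'x \<Rightarrow> 'p \<Rightarrow> 'n"
  CoBraid :: "'x \<Rightarrow> 'x \<Rightarrow> 'p \<Rightarrow> 'p \<Rightarrow> 'n"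

definition pseudofunctor :: "('x, 'w, 'z) monoidal_category_scheme \<Rightarrow>
    ('x, 'w, 'p, 'n) lax_functor_data \<Rightarrow> ('x, 'w, 'p, 'n) coherence_data \<Rightarrow> bool" where
  "pseudofunctor M F K \<longleftrightarrow>
     (\<forall>x\<in>Obj M. is_category (Fib F x)) \<and>
     (\<forall>\<phi>\<in>Arr M. is_functor (Fib F (Dom M \<phi>)) (Fib F (Cod M \<phi>)) (Act F \<phi>)) \<and>
     (\<forall>x\<in>Obj M. nat_iso (Fib F x) (Fib F x) id_functor (Act F (Ident M x)) (CoId K x)) \<and>
     (\<forall>\<phi>\<in>Arr M. \<forall>\<psi>\<in>Arr M. Dom M \<psi> = Cod M \<phi> \<longrightarrow>
        nat_iso (Fib F (Dom M \<phi>)) (Fib F (Cod M \<psi>))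
          (Act F \<psi> \<circ>\<^sub>F Act F \<phi>) (Act F (\<psi> \<cdot>\<^bsub>M\<^esub> \<phi>)) (CoComp K \<psi> \<phi>)) \<and>
     (\<forall>\<phi>\<in>Arr M. \<forall>\<psi>\<in>Arr M. \<forall>\<chi>\<in>Arr M. \<forall>s\<in>Obj (Fib F (Dom M \<phi>)).
        Dom M \<psi> = Cod M \<phi> \<longrightarrow> Dom M \<chi> = Cod M \<psi> \<longrightarrow>
        (let D = Fib F (Cod M \<chi>) in
          CoComp K \<chi> (\<psi> \<cdot>\<^bsub>M\<^esub> \<phi>) s \<cdot>\<^bsub>D\<^esub> AM (Act F \<chi>) (CoComp K \<psi> \<phi> s) =
          CoComp K (\<chi> \<cdot>\<^bsub>M\<^esub> \<psi>) \<phi> s \<cdot>\<^bsub>D\<^esub> CoComp K \<chi> \<psi> (OM (Act F \<phi>) s))) \<and>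
     (\<forall>\<phi>\<in>Arr M. \<forall>s\<in>Obj (Fib F (Dom M \<phi>)).
        (let D = Fib F (Cod M \<phi>); t = OM (Act F \<phi>) s in
          CoComp K \<phi> (Ident M (Dom M \<phi>)) s \<cdot>\<^bsub>D\<^esub> AM (Act F \<phi>) (CoId K (Dom M \<phi>) s) = Ident D t \<and>
          CoComp K (Ident M (Cod M \<phi>)) \<phi> s \<cdot>\<^bsub>D\<^esub> CoId K (Cod M \<phi>) t = Ident D t))"

definition pseudonatural_laxator :: "('x, 'w, 'z) monoidal_category_scheme \<Rightarrow>
    ('x, 'w, 'p, 'n) lax_functor_data \<Rightarrow> ('x, 'w, 'p, 'n) coherence_data \<Rightarrow> bool" where
  "pseudonatural_laxator M F K \<longleftrightarrow>
     (\<forall>x\<in>Obj M. \<forall>y\<in>Obj M. is_functor (Fib F x \<times>\<^sub>C Fib F y) (Fib F (x \<oplus>\<^bsub>M\<^esub> y)) (Mul F x y)) \<and>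
     (\<forall>\<phi>\<in>Arr M. \<forall>\<psi>\<in>Arr M.
        nat_iso (Fib F (Dom M \<phi>) \<times>\<^sub>C Fib F (Dom M \<psi>)) (Fib F (Cod M \<phi> \<oplus>\<^bsub>M\<^esub> Cod M \<psi>))
          (Mul F (Cod M \<phi>) (Cod M \<psi>) \<circ>\<^sub>F (Act F \<phi> \<times>\<^sub>F Act F \<psi>))
          (Act F (\<phi> \<otimes>\<^bsub>M\<^esub> \<psi>) \<circ>\<^sub>F Mul F (Dom M \<phi>) (Dom M \<psi>))
          (CoMul K \<phi> \<psi>)) \<and>
     (\<forall>x\<in>Obj M. \<forall>y\<in>Obj M. \<forall>s\<in>Obj (Fib F x). \<forall>t\<in>Obj (Fib F y).
        CoMul K (Ident M x) (Ident M y) (s, t) \<cdot>\<^bsub>Fib F (x \<oplus>\<^bsub>M\<^esub> y)\<^esub>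
          AM (Mul F x y) (CoId K x s, CoId K y t) =
        CoId K (x \<oplus>\<^bsub>M\<^esub> y) (OM (Mul F x y) (s, t))) \<and>
     (\<forall>\<phi>\<in>Arr M. \<forall>\<phi>'\<in>Arr M. \<forall>\<psi>\<in>Arr M. \<forall>\<psi>'\<in>Arr M.
        Dom M \<phi>' = Cod M \<phi> \<longrightarrow> Dom M \<psi>' = Cod M \<psi> \<longrightarrow>
        (\<forall>s\<in>Obj (Fib F (Dom M \<phi>)). \<forall>t\<in>Obj (Fib F (Dom M \<psi>)).
          let D = Fib F (Cod M \<phi>' \<oplus>\<^bsub>M\<^esub> Cod M \<psi>') in
          CoMul K (\<phi>' \<cdot>\<^bsub>M\<^esub> \<phi>) (\<psi>' \<cdot>\<^bsub>M\<^esub> \<psi>) (s, t) \<cdot>\<^bsub>D\<^esub>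
            AM (Mul F (Cod M \<phi>') (Cod M \<psi>')) (CoComp K \<phi>' \<phi> s, CoComp K \<psi>' \<psi> t) =
          CoComp K (\<phi>' \<otimes>\<^bsub>M\<^esub> \<psi>') (\<phi> \<otimes>\<^bsub>M\<^esub> \<psi>) (OM (Mul F (Dom M \<phi>) (Dom M \<psi>)) (s, t)) \<cdot>\<^bsub>D\<^esub>
            (AM (Act F (\<phi>' \<otimes>\<^bsub>M\<^esub> \<psi>')) (CoMul K \<phi> \<psi> (s, t)) \<cdot>\<^bsub>D\<^esub>
             CoMul K \<phi>' \<psi>' (OM (Act F \<phi>) s, OM (Act F \<psi>) t))))"

text \<open>The remaining axioms equate pastings of 2-cells. A cell over \<open>\<phi> : x \<rightarrow> y\<close> from \<open>s \<in> F x\<close> to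
  \<open>t \<in> F y\<close> is an arrow \<open>f : F \<phi> s \<rightarrow> t\<close> of \<open>F y\<close>, kept as the triple \<open>(s, \<phi>, f)\<close>; cells are
  pasted along \<open>CoComp\<close> and multiplied along \<open>CoMul\<close>. Components of \<open>CoAssoc\<close>, \<open>CoLUnit\<close>,
  \<open>CoRUnit\<close> and \<open>CoBraid\<close> are cells over the structural isomorphisms of the domain. Their
  compatibility with all cells (\<open>modifications\<close>) is naturality within the fibres (cells over
  identities) together with the modification axiom (cells given by identity arrows of \<open>F \<phi> s\<close>).\<close>

type_synonym ('p, 'w, 'n) cell = "'p \<times> 'w \<times> 'n"

definition is_cell :: "('x, 'w, 'z) monoidal_category_scheme \<Rightarrow>
    ('x, 'w, 'p, 'n) lax_functor_data \<Rightarrow> ('p, 'w, 'n) cell \<Rightarrow> bool" where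
  "is_cell M F = (\<lambda>(s, \<phi>, f). \<phi> \<in> Arr M \<and> s \<in> Obj (Fib F (Dom M \<phi>)) \<and>
     f \<in> Arr (Fib F (Cod M \<phi>)) \<and> Dom (Fib F (Cod M \<phi>)) f = OM (Act F \<phi>) s)"

definition cell_base_dom :: "('x, 'w, 'z) monoidal_category_scheme \<Rightarrow> ('p, 'w, 'n) cell \<Rightarrow> 'x" where
  "cell_base_dom M = (\<lambda>(s, \<phi>, f). Dom M \<phi>)"

definition cell_base_cod :: "('x, 'w, 'z) monoidal_category_scheme \<Rightarrow> ('p, 'w, 'n) cell \<Rightarrow> 'x" where
  "cell_base_cod M = (\<lambda>(s, \<phi>, f). Cod M \<phi>)"

definition cell_source :: "('p, 'w, 'n) cell \<Rightarrow> 'p" where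
  "cell_source = (\<lambda>(s, \<phi>, f). s)"

definition cell_target :: "('x, 'w, 'z) monoidal_category_scheme \<Rightarrow>
    ('x, 'w, 'p, 'n) lax_functor_data \<Rightarrow> ('p, 'w, 'n) cell \<Rightarrow> 'p" where
  "cell_target M F = (\<lambda>(s, \<phi>, f). Cod (Fib F (Cod M \<phi>)) f)"

definition cell_id :: "('x, 'w, 'z) monoidal_category_scheme \<Rightarrow>
    ('x, 'w, 'p, 'n) lax_functor_data \<Rightarrow> ('x, 'w, 'p, 'n) coherence_data \<Rightarrow>
    'x \<Rightarrow> 'p \<Rightarrow> ('p, 'w, 'n) cell" where
  "cell_id M F K x s = (s, Ident M x, inv_arr (Fib F x) (CoId K x s))"

definition cell_comp :: "('x, 'w, 'z) monoidal_category_scheme \<Rightarrow>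
    ('x, 'w, 'p, 'n) lax_functor_data \<Rightarrow> ('x, 'w, 'p, 'n) coherence_data \<Rightarrow>
    ('p, 'w, 'n) cell \<Rightarrow> ('p, 'w, 'n) cell \<Rightarrow> ('p, 'w, 'n) cell" where
  "cell_comp M F K = (\<lambda>(t, \<psi>, g) (s, \<phi>, f).
     let D = Fib F (Cod M \<psi>) in
     (s, \<psi> \<cdot>\<^bsub>M\<^esub> \<phi>, g \<cdot>\<^bsub>D\<^esub> (AM (Act F \<psi>) f \<cdot>\<^bsub>D\<^esub> inv_arr D (CoComp K \<psi> \<phi> s))))"

definition cell_mul :: "('x, 'w, 'z) monoidal_category_scheme \<Rightarrow>
    ('x, 'w, 'p, 'n) lax_functor_data \<Rightarrow> ('x, 'w, 'p, 'n) coherence_data \<Rightarrow>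
    ('p, 'w, 'n) cell \<Rightarrow> ('p, 'w, 'n) cell \<Rightarrow> ('p, 'w, 'n) cell" where
  "cell_mul M F K = (\<lambda>(s, \<phi>, f) (t, \<psi>, g).
     let D = Fib F (Cod M \<phi> \<oplus>\<^bsub>M\<^esub> Cod M \<psi>) in
     (OM (Mul F (Dom M \<phi>) (Dom M \<psi>)) (s, t), \<phi> \<otimes>\<^bsub>M\<^esub> \<psi>,
      AM (Mul F (Cod M \<phi>) (Cod M \<psi>)) (f, g) \<cdot>\<^bsub>D\<^esub> inv_arr D (CoMul K \<phi> \<psi> (s, t))))"

definition assoc_cell :: "('x, 'w, 'z) monoidal_category_scheme \<Rightarrow>
    ('x, 'w, 'p, 'n) lax_functor_data \<Rightarrow> ('x, 'w, 'p, 'n) coherence_data \<Rightarrow>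
    'x \<Rightarrow> 'x \<Rightarrow> 'x \<Rightarrow> 'p \<Rightarrow> 'p \<Rightarrow> 'p \<Rightarrow> ('p, 'w, 'n) cell" where
  "assoc_cell M F K x y z s t u =
     (OM (Mul F (x \<oplus>\<^bsub>M\<^esub> y) z) (OM (Mul F x y) (s, t), u), Assoc M x y z, CoAssoc K x y z s t u)"

definition lunit_cell :: "('x, 'w, 'z) monoidal_category_scheme \<Rightarrow>
    ('x, 'w, 'p, 'n) lax_functor_data \<Rightarrow> ('x, 'w, 'p, 'n) coherence_data \<Rightarrow>
    'x \<Rightarrow> 'p \<Rightarrow> ('p, 'w, 'n) cell" where
  "lunit_cell M F K x s = (OM (Mul F (Unit M) x) (Eta F, s), LUnit M x, CoLUnit K x s)"

definition runit_cell :: "('x, 'w, 'z) monoidal_category_scheme \<Rightarrow>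
    ('x, 'w, 'p, 'n) lax_functor_data \<Rightarrow> ('x, 'w, 'p, 'n) coherence_data \<Rightarrow>
    'x \<Rightarrow> 'p \<Rightarrow> ('p, 'w, 'n) cell" where
  "runit_cell M F K x s = (OM (Mul F x (Unit M)) (s, Eta F), RUnit M x, CoRUnit K x s)"

definition braid_cell :: "('x, 'w, 'z) monoidal_category_scheme \<Rightarrow>
    ('x, 'w, 'p, 'n) lax_functor_data \<Rightarrow> ('x, 'w, 'p, 'n) coherence_data \<Rightarrow>
    'x \<Rightarrow> 'x \<Rightarrow> 'p \<Rightarrow> 'p \<Rightarrow> ('p, 'w, 'n) cell" where
  "braid_cell M F K x y s t = (OM (Mul F x y) (s, t), Braid M x y, CoBraid K x y s t)"

definition modifications :: "('x, 'w, 'z) monoidal_category_scheme \<Rightarrow>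
    ('x, 'w, 'p, 'n) lax_functor_data \<Rightarrow> ('x, 'w, 'p, 'n) coherence_data \<Rightarrow> bool" where
  "modifications M F K \<longleftrightarrow>
     (\<forall>x\<in>Obj M. \<forall>y\<in>Obj M. \<forall>z\<in>Obj M.
      \<forall>s\<in>Obj (Fib F x). \<forall>t\<in>Obj (Fib F y). \<forall>u\<in>Obj (Fib F z).
        (let D = Fib F (x \<oplus>\<^bsub>M\<^esub> (y \<oplus>\<^bsub>M\<^esub> z)) in
          is_iso D (CoAssoc K x y z s t u) \<and>
          CoAssoc K x y z s t u \<in> Hom D
            (OM (Act F (Assoc M x y z)) (OM (Mul F (x \<oplus>\<^bsub>M\<^esub> y) z) (OM (Mul F x y) (s, t), u)))
            (OM (Mul F x (y \<oplus>\<^bsub>M\<^esub> z)) (s, OM (Mul F y z) (t, u))))) \<and>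
     (\<forall>x\<in>Obj M. \<forall>s\<in>Obj (Fib F x).
        is_iso (Fib F x) (CoLUnit K x s) \<and>
        CoLUnit K x s \<in> Hom (Fib F x) (OM (Act F (LUnit M x)) (OM (Mul F (Unit M) x) (Eta F, s))) s) \<and>
     (\<forall>x\<in>Obj M. \<forall>s\<in>Obj (Fib F x).
        is_iso (Fib F x) (CoRUnit K x s) \<and>
        CoRUnit K x s \<in> Hom (Fib F x) (OM (Act F (RUnit M x)) (OM (Mul F x (Unit M)) (s, Eta F))) s) \<and>
     (\<forall>x\<in>Obj M. \<forall>y\<in>Obj M. \<forall>s\<in>Obj (Fib F x). \<forall>t\<in>Obj (Fib F y).
        (let D = Fib F (y \<oplus>\<^bsub>M\<^esub> x) in
          is_iso D (CoBraid K x y s t) \<and>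
          CoBraid K x y s t \<in> Hom D
            (OM (Act F (Braid M x y)) (OM (Mul F x y) (s, t))) (OM (Mul F y x) (t, s)))) \<and>
     (\<forall>a b c. is_cell M F a \<longrightarrow> is_cell M F b \<longrightarrow> is_cell M F c \<longrightarrow>
        cell_comp M F K
          (assoc_cell M F K (cell_base_cod M a) (cell_base_cod M b) (cell_base_cod M c)
             (cell_target M F a) (cell_target M F b) (cell_target M F c))
          (cell_mul M F K (cell_mul M F K a b) c) =
        cell_comp M F K
          (cell_mul M F K a (cell_mul M F K b c))
          (assoc_cell M F K (cell_base_dom M a) (cell_base_dom M b) (cell_base_dom M c)
             (cell_source a) (cell_source b) (cell_source c))) \<and>
     (\<forall>a. is_cell M F a \<longrightarrow>
        cell_comp M F K (lunit_cell M F K (cell_base_cod M a) (cell_target M F a))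
          (cell_mul M F K (cell_id M F K (Unit M) (Eta F)) a) =
        cell_comp M F K a (lunit_cell M F K (cell_base_dom M a) (cell_source a))) \<and>
     (\<forall>a. is_cell M F a \<longrightarrow>
        cell_comp M F K (runit_cell M F K (cell_base_cod M a) (cell_target M F a))
          (cell_mul M F K a (cell_id M F K (Unit M) (Eta F))) =
        cell_comp M F K a (runit_cell M F K (cell_base_dom M a) (cell_source a))) \<and>
     (\<forall>a b. is_cell M F a \<longrightarrow> is_cell M F b \<longrightarrow>
        cell_comp M F K
          (braid_cell M F K (cell_base_cod M a) (cell_base_cod M b)
             (cell_target M F a) (cell_target M F b))
          (cell_mul M F K a b) =
        cell_comp M F K (cell_mul M F K b a)
          (braid_cell M F K (cell_base_dom M a) (cell_base_dom M b)
             (cell_source a) (cell_source b)))"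

definition monoidal_coherence :: "('x, 'w, 'z) monoidal_category_scheme \<Rightarrow>
    ('x, 'w, 'p, 'n) lax_functor_data \<Rightarrow> ('x, 'w, 'p, 'n) coherence_data \<Rightarrow> bool" where
  "monoidal_coherence M F K \<longleftrightarrow>
     (\<forall>w\<in>Obj M. \<forall>x\<in>Obj M. \<forall>y\<in>Obj M. \<forall>z\<in>Obj M.
      \<forall>r\<in>Obj (Fib F w). \<forall>s\<in>Obj (Fib F x). \<forall>t\<in>Obj (Fib F y). \<forall>u\<in>Obj (Fib F z).
        cell_comp M F K
          (assoc_cell M F K w x (y \<oplus>\<^bsub>M\<^esub> z) r s (OM (Mul F y z) (t, u)))
          (assoc_cell M F K (w \<oplus>\<^bsub>M\<^esub> x) y z (OM (Mul F w x) (r, s)) t u) =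
        cell_comp M F K
          (cell_mul M F K (cell_id M F K w r) (assoc_cell M F K x y z s t u))
          (cell_comp M F K
            (assoc_cell M F K w (x \<oplus>\<^bsub>M\<^esub> y) z r (OM (Mul F x y) (s, t)) u)
            (cell_mul M F K (assoc_cell M F K w x y r s t) (cell_id M F K z u)))) \<and>
     (\<forall>x\<in>Obj M. \<forall>y\<in>Obj M. \<forall>s\<in>Obj (Fib F x). \<forall>t\<in>Obj (Fib F y).
        cell_comp M F K
          (cell_mul M F K (cell_id M F K x s) (lunit_cell M F K y t))
          (assoc_cell M F K x (Unit M) y s (Eta F) t) =
        cell_mul M F K (runit_cell M F K x s) (cell_id M F K y t)) \<and>
     (\<forall>x\<in>Obj M. \<forall>y\<in>Obj M. \<forall>z\<in>Obj M.
      \<forall>s\<in>Obj (Fib F x). \<forall>t\<in>Obj (Fib F y). \<forall>u\<in>Obj (Fib F z).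
        cell_comp M F K
          (assoc_cell M F K y z x t u s)
          (cell_comp M F K
            (braid_cell M F K x (y \<oplus>\<^bsub>M\<^esub> z) s (OM (Mul F y z) (t, u)))
            (assoc_cell M F K x y z s t u)) =
        cell_comp M F K
          (cell_mul M F K (cell_id M F K y t) (braid_cell M F K x z s u))
          (cell_comp M F K
            (assoc_cell M F K y x z t s u)
            (cell_mul M F K (braid_cell M F K x y s t) (cell_id M F K z u)))) \<and>
     (\<forall>x\<in>Obj M. \<forall>y\<in>Obj M. \<forall>s\<in>Obj (Fib F x). \<forall>t\<in>Obj (Fib F y).
        cell_comp M F K (braid_cell M F K y x t s) (braid_cell M F K x y s t) =
        cell_id M F K (x \<oplus>\<^bsub>M\<^esub> y) (OM (Mul F x y) (s, t)))"

definition symmetric_lax_monoidal_pseudofunctor :: "('x, 'w, 'z) monoidal_category_scheme \<Rightarrow>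
    ('x, 'w, 'p, 'n) lax_functor_data \<Rightarrow> ('x, 'w, 'p, 'n) coherence_data \<Rightarrow> bool" where
  "symmetric_lax_monoidal_pseudofunctor M F K \<longleftrightarrow>
     symmetric_monoidal M \<and> pseudofunctor M F K \<and> pseudonatural_laxator M F K \<and>
     Eta F \<in> Obj (Fib F (Unit M)) \<and> modifications M F K \<and> monoidal_coherence M F K"

definition is_algebra :: "('x, 'w, 'z) monoidal_category_scheme \<Rightarrow>
    ('x, 'w, 'p, 'n) lax_functor_data \<Rightarrow> bool" where
  "is_algebra M F \<longleftrightarrow> (\<exists>K. symmetric_lax_monoidal_pseudofunctor M F K)"

text \<open>\<open>P x\<close> is the class of objects of a full subcategory of \<open>F x\<close>; since the subcategories are
  full, a functor preserves them as soon as it preserves their objects.\<close>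

definition is_subalgebra :: "('x, 'w, 'z) monoidal_category_scheme \<Rightarrow>
    ('x, 'w, 'p, 'n) lax_functor_data \<Rightarrow> ('x \<Rightarrow> 'p set) \<Rightarrow> bool" where
  "is_subalgebra M F P \<longleftrightarrow>
     (\<forall>x\<in>Obj M. P x \<subseteq> Obj (Fib F x)) \<and>
     (\<forall>\<phi>\<in>Arr M. \<forall>s\<in>P (Dom M \<phi>). OM (Act F \<phi>) s \<in> P (Cod M \<phi>)) \<and>
     (\<forall>x\<in>Obj M. \<forall>y\<in>Obj M. \<forall>s\<in>P x. \<forall>t\<in>P y. OM (Mul F x y) (s, t) \<in> P (x \<oplus>\<^bsub>M\<^esub> y)) \<and>
     Eta F \<in> P (Unit M)"


section \<open>Wiring diagrams\<close>

text \<open>Typed finite sets are finite partial maps from labels to types, so that a typed function is a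
  partial map of labels. Labels over an arbitrary type \<open>'l\<close> are closed under disjoint union.\<close>

datatype 'l label = Port 'l | InL "'l label" | InR "'l label"

type_synonym ('l, 'o) typed_set = "'l label \<rightharpoonup> 'o"
type_synonym 'l port_map = "'l label \<rightharpoonup> 'l label"
type_synonym ('l, 'o) box = "('l, 'o) typed_set \<times> ('l, 'o) typed_set"
type_synonym ('l, 'o) wiring_diagram =
  "('l, 'o) box \<times> ('l, 'o) box \<times> 'l port_map \<times> 'l port_map"

definition typed_sets :: "('o, 'm, 'z) category_scheme \<Rightarrow> ('l, 'o) typed_set set" where
  "typed_sets C = {X. finite (dom X) \<and> ran X \<subseteq> Obj C}"

definition typed_function :: "('l, 'o) typed_set \<Rightarrow> ('l, 'o) typed_set \<Rightarrow> 'l port_map \<Rightarrow> bool" where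
  "typed_function X Y f \<longleftrightarrow> dom f = dom X \<and> Y \<circ>\<^sub>m f = X"

definition copair :: "('l label \<rightharpoonup> 'b) \<Rightarrow> ('l label \<rightharpoonup> 'b) \<Rightarrow> 'l label \<rightharpoonup> 'b" where
  "copair f g = (\<lambda>z. case z of Port _ \<Rightarrow> None | InL x \<Rightarrow> f x | InR y \<Rightarrow> g y)"

definition typed_sum :: "('l, 'o) typed_set \<Rightarrow> ('l, 'o) typed_set \<Rightarrow> ('l, 'o) typed_set" where
  "typed_sum X Y = copair X Y"

definition inl :: "'l port_map" where
  "inl x = Some (InL x)"

definition inr :: "'l port_map" where
  "inr x = Some (InR x)"

definition sum_map :: "'l port_map \<Rightarrow> 'l port_map \<Rightarrow> 'l port_map" where
  "sum_map f g = copair (inl \<circ>\<^sub>m f) (inr \<circ>\<^sub>m g)"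

definition reassoc :: "'l port_map" where
  "reassoc = copair (copair inl (inr \<circ>\<^sub>m inl)) (inr \<circ>\<^sub>m inr)"

definition unassoc :: "'l port_map" where
  "unassoc = copair (inl \<circ>\<^sub>m inl) (copair (inl \<circ>\<^sub>m inr) inr)"

definition codiagonal :: "'l port_map" where
  "codiagonal = copair Some Some"

definition box_sum :: "('l, 'o) box \<Rightarrow> ('l, 'o) box \<Rightarrow> ('l, 'o) box" where
  "box_sum X Y = (typed_sum (fst X) (fst Y), typed_sum (snd X) (snd Y))"

definition empty_box :: "('l, 'o) box" where
  "empty_box = (Map.empty, Map.empty)"

definition wiring_diagrams :: "('o, 'm, 'z) category_scheme \<Rightarrow> ('l, 'o) wiring_diagram set" where
  "wiring_diagrams C = {(X, Y, \<phi>in, \<phi>out).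
     X \<in> typed_sets C \<times> typed_sets C \<and> Y \<in> typed_sets C \<times> typed_sets C \<and>
     typed_function (fst X) (typed_sum (snd X) (fst Y)) \<phi>in \<and>
     typed_function (snd Y) (snd X) \<phi>out}"

definition wiring_comp :: "('l, 'o) wiring_diagram \<Rightarrow> ('l, 'o) wiring_diagram \<Rightarrow>
    ('l, 'o) wiring_diagram" where
  "wiring_comp = (\<lambda>(Y, Z, \<psi>in, \<psi>out) (X, Y', \<phi>in, \<phi>out).
     (X, Z,
      (sum_map codiagonal Some \<circ>\<^sub>m unassoc) \<circ>\<^sub>m sum_map Some (sum_map \<phi>out Some) \<circ>\<^sub>m
        sum_map Some \<psi>in \<circ>\<^sub>m \<phi>in,
      \<phi>out \<circ>\<^sub>m \<psi>out))"

definition interchange :: "'l port_map" where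
  "interchange = copair (sum_map inl inl) (sum_map inr inr)"

definition wiring_sum :: "('l, 'o) wiring_diagram \<Rightarrow> ('l, 'o) wiring_diagram \<Rightarrow>
    ('l, 'o) wiring_diagram" where
  "wiring_sum = (\<lambda>(X, Y, \<phi>in, \<phi>out) (X', Y', \<psi>in, \<psi>out).
     (box_sum X X', box_sum Y Y', interchange \<circ>\<^sub>m sum_map \<phi>in \<psi>in, sum_map \<phi>out \<psi>out))"

text \<open>The wiring diagram \<open>X \<rightarrow> Y\<close> induced by typed functions \<open>f : X\<^sup>i\<^sup>n \<rightarrow> Y\<^sup>i\<^sup>n\<close> and
  \<open>g : Y\<^sup>o\<^sup>u\<^sup>t \<rightarrow> X\<^sup>o\<^sup>u\<^sup>t\<close>.\<close>

definition plain_wiring :: "('l, 'o) box \<Rightarrow> ('l, 'o) box \<Rightarrow> 'l port_map \<Rightarrow> 'l port_map \<Rightarrow>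
    ('l, 'o) wiring_diagram" where
  "plain_wiring X Y f g = (X, Y, inr \<circ>\<^sub>m f |` dom (fst X), g |` dom (snd Y))"

definition wiring :: "('o, 'm, 'z) category_scheme \<Rightarrow>
    (('l, 'o) box, ('l, 'o) wiring_diagram) monoidal_category" where
  "wiring C = \<lparr>
     Obj = typed_sets C \<times> typed_sets C,
     Arr = wiring_diagrams C,
     Dom = (\<lambda>(X, Y, \<phi>in, \<phi>out). X),
     Cod = (\<lambda>(X, Y, \<phi>in, \<phi>out). Y),
     Ident = (\<lambda>X. plain_wiring X X Some Some),
     Comp = wiring_comp,
     Tensor = \<lparr>OM = (\<lambda>(X, Y). box_sum X Y), AM = (\<lambda>(\<phi>, \<psi>). wiring_sum \<phi> \<psi>)\<rparr>,
     Unit = empty_box,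
     Assoc = (\<lambda>X Y Z. plain_wiring (box_sum (box_sum X Y) Z) (box_sum X (box_sum Y Z))
                reassoc unassoc),
     LUnit = (\<lambda>X. plain_wiring (box_sum empty_box X) X (copair Map.empty Some) inr),
     RUnit = (\<lambda>X. plain_wiring (box_sum X empty_box) X (copair Some Map.empty) inl),
     Braid = (\<lambda>X Y. plain_wiring (box_sum X Y) (box_sum Y X) (copair inr inl) (copair inr inl))\<rparr>"


section \<open>The algebra of span systems\<close>

definition hat :: "('o, 'm, 'z) category_scheme \<Rightarrow> ('l, 'o) typed_set \<Rightarrow> 'o" where
  "hat C X = prod_ob C (dom X) (the \<circ> X)"

definition hat_pr :: "('o, 'm, 'z) category_scheme \<Rightarrow> ('l, 'o) typed_set \<Rightarrow> 'l label \<Rightarrow> 'm" where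
  "hat_pr C X = prod_pr C (dom X) (the \<circ> X)"

definition hat_tuple :: "('o, 'm, 'z) category_scheme \<Rightarrow> ('l, 'o) typed_set \<Rightarrow> 'o \<Rightarrow>
    ('l label \<Rightarrow> 'm) \<Rightarrow> 'm" where
  "hat_tuple C X q r = tuple C (dom X) (the \<circ> X) q r"

definition hat_map :: "('o, 'm, 'z) category_scheme \<Rightarrow> ('l, 'o) typed_set \<Rightarrow> ('l, 'o) typed_set \<Rightarrow>
    'l port_map \<Rightarrow> 'm" where
  "hat_map C X X' f = hat_tuple C X (hat C X') (\<lambda>x. hat_pr C X' (the (f x)))"

text \<open>The canonical isomorphism from the product of \<open>hat C X\<close> and \<open>hat C Y\<close> to
  \<open>hat C (typed_sum X Y)\<close>.\<close>

definition hat_join :: "('o, 'm, 'z) category_scheme \<Rightarrow> ('l, 'o) typed_set \<Rightarrow> ('l, 'o) typed_set \<Rightarrow>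
    'm" where
  "hat_join C X Y = hat_tuple C (typed_sum X Y) (bprod C (hat C X) (hat C Y))
     (\<lambda>z. case z of
        InL x \<Rightarrow> hat_pr C X x \<cdot>\<^bsub>C\<^esub> pr1 C (hat C X) (hat C Y)
      | InR y \<Rightarrow> hat_pr C Y y \<cdot>\<^bsub>C\<^esub> pr2 C (hat C X) (hat C Y))"

definition hat_in :: "('o, 'm, 'z) category_scheme \<Rightarrow> ('l, 'o) wiring_diagram \<Rightarrow> 'm" where
  "hat_in C = (\<lambda>(X, Y, \<phi>in, \<phi>out).
     hat_map C (fst X) (typed_sum (snd X) (fst Y)) \<phi>in \<cdot>\<^bsub>C\<^esub>
       (hat_join C (snd X) (fst Y) \<cdot>\<^bsub>C\<^esub>
        pairing C (pr2 C (hat C (fst Y)) (hat C (snd X))) (pr1 C (hat C (fst Y)) (hat C (snd X)))))"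

definition hat_out :: "('o, 'm, 'z) category_scheme \<Rightarrow> ('l, 'o) wiring_diagram \<Rightarrow> 'm" where
  "hat_out C = (\<lambda>(X, Y, \<phi>in, \<phi>out). hat_map C (snd Y) (snd X) \<phi>out)"

definition interface :: "('o, 'm, 'z) category_scheme \<Rightarrow> ('l, 'o) box \<Rightarrow> 'o" where
  "interface C X = bprod C (hat C (fst X)) (hat C (snd X))"

definition leg_in :: "('o, 'm, 'z) category_scheme \<Rightarrow> ('l, 'o) box \<Rightarrow> 'm \<Rightarrow> 'm" where
  "leg_in C X s = pr1 C (hat C (fst X)) (hat C (snd X)) \<cdot>\<^bsub>C\<^esub> s"

definition leg_out :: "('o, 'm, 'z) category_scheme \<Rightarrow> ('l, 'o) box \<Rightarrow> 'm \<Rightarrow> 'm" where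
  "leg_out C X s = pr2 C (hat C (fst X)) (hat C (snd X)) \<cdot>\<^bsub>C\<^esub> s"

definition span_act :: "('o, 'm, 'z) category_scheme \<Rightarrow> ('l, 'o) wiring_diagram \<Rightarrow>
    ('m, 'm \<times> 'm \<times> 'm, 'm, 'm \<times> 'm \<times> 'm) cat_functor" where
  "span_act C \<phi> =
     (let X = fst \<phi>; Y = fst (snd \<phi>); yin = hat C (fst Y); xout = hat C (snd X) in
      postcompose C (par C (Ident C yin) (hat_out C \<phi>)) \<circ>\<^sub>F
      base_change C (pairing C (hat_in C \<phi>) (pr2 C yin xout)))"

definition span_mul_ob :: "('o, 'm, 'z) category_scheme \<Rightarrow> ('l, 'o) box \<Rightarrow> ('l, 'o) box \<Rightarrow>
    'm \<Rightarrow> 'm \<Rightarrow> 'm" where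
  "span_mul_ob C X Y s t =
     pairing C
       (hat_join C (fst X) (fst Y) \<cdot>\<^bsub>C\<^esub> par C (leg_in C X s) (leg_in C Y t))
       (hat_join C (snd X) (snd Y) \<cdot>\<^bsub>C\<^esub> par C (leg_out C X s) (leg_out C Y t))"

definition span_mul :: "('o, 'm, 'z) category_scheme \<Rightarrow> ('l, 'o) box \<Rightarrow> ('l, 'o) box \<Rightarrow>
    ('m \<times> 'm, ('m \<times> 'm \<times> 'm) \<times> ('m \<times> 'm \<times> 'm), 'm, 'm \<times> 'm \<times> 'm) cat_functor" where
  "span_mul C X Y = \<lparr>
     OM = (\<lambda>(s, t). span_mul_ob C X Y s t),
     AM = (\<lambda>((s, s', h), (t, t', k)). (span_mul_ob C X Y s t, span_mul_ob C X Y s' t', par C h k))\<rparr>"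

type_synonym ('l, 'o, 'm) span_algebra =
  "(('l, 'o) box, ('l, 'o) wiring_diagram, 'm, 'm \<times> 'm \<times> 'm) lax_functor_data"

text \<open>The unit is the product of no spans: its apex is the terminal object \<open>hat C Map.empty\<close>.\<close>

definition span_systems :: "('o, 'm, 'z) category_scheme \<Rightarrow> ('l, 'o, 'm) span_algebra" where
  "span_systems C = \<lparr>
     Fib = (\<lambda>X. slice C (interface C X)),
     Act = span_act C,
     Mul = span_mul C,
     Eta = (let i = Ident C (hat C (Map.empty :: ('l, 'o) typed_set)) in pairing C i i)\<rparr>"


section \<open>Interval sheaves\<close>

text \<open>\<open>res X l l' p\<close> is the restriction along \<open>Tr\<^sub>p : l' \<rightarrow> l\<close>. Sections live in a type \<open>'u\<close> that
  plays the role of a universe: as soon as \<open>'u\<close> has at least the cardinality of the continuum,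
  the sheaves below contain \<open>Sync\<close> and are closed under finite limits and the functors
  \<open>Ext \<epsilon>\<close>. The presheaf data are fixed to be trivial where they carry no meaning, so that
  equality of records is equality of presheaves.\<close>

record 'u presheaf =
  sec :: "real \<Rightarrow> 'u set"
  res :: "real \<Rightarrow> real \<Rightarrow> real \<Rightarrow> 'u \<Rightarrow> 'u"

definition int_arr :: "real \<Rightarrow> real \<Rightarrow> real \<Rightarrow> bool" where
  "int_arr l l' p \<longleftrightarrow> 0 \<le> l' \<and> 0 \<le> p \<and> p \<le> l - l'"

definition is_presheaf :: "'u presheaf \<Rightarrow> bool" where
  "is_presheaf X \<longleftrightarrow>
     (\<forall>l<0. sec X l = {}) \<and>
     (\<forall>l l' p. \<not> int_arr l l' p \<longrightarrow> res X l l' p = (\<lambda>_. undefined)) \<and>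
     (\<forall>l l' p. int_arr l l' p \<longrightarrow> res X l l' p \<in> sec X l \<rightarrow>\<^sub>E sec X l') \<and>
     (\<forall>l\<ge>0. \<forall>x\<in>sec X l. res X l l 0 x = x) \<and>
     (\<forall>l l' l'' p p'. int_arr l l' p \<longrightarrow> int_arr l' l'' p' \<longrightarrow>
        (\<forall>x\<in>sec X l. res X l' l'' p' (res X l l' p x) = res X l l'' (p + p') x))"

definition is_sheaf :: "'u presheaf \<Rightarrow> bool" where
  "is_sheaf X \<longleftrightarrow> is_presheaf X \<and>
     (\<forall>l1\<ge>0. \<forall>l2\<ge>0. \<forall>x1\<in>sec X l1. \<forall>x2\<in>sec X l2.
        res X l1 0 l1 x1 = res X l2 0 0 x2 \<longrightarrow>
        (\<exists>!x. x \<in> sec X (l1 + l2) \<and>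
           res X (l1 + l2) l1 0 x = x1 \<and> res X (l1 + l2) l2 l1 x = x2))"

type_synonym 'u sheaf_map = "'u presheaf \<times> 'u presheaf \<times> (real \<Rightarrow> 'u \<Rightarrow> 'u)"

definition sheaf_maps :: "'u sheaf_map set" where
  "sheaf_maps = {(X, Y, f). is_sheaf X \<and> is_sheaf Y \<and>
     (\<forall>l. f l \<in> sec X l \<rightarrow>\<^sub>E sec Y l) \<and>
     (\<forall>l l' p. int_arr l l' p \<longrightarrow> (\<forall>x\<in>sec X l. f l' (res X l l' p x) = res Y l l' p (f l x)))}"

definition Int_sheaves :: "('u presheaf, 'u sheaf_map) category" where
  "Int_sheaves = \<lparr>
     Obj = {X. is_sheaf X},
     Arr = sheaf_maps,
     Dom = (\<lambda>(X, Y, f). X), Cod = (\<lambda>(X, Y, f). Y),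
     Ident = (\<lambda>X. (X, X, \<lambda>l. restrict id (sec X l))),
     Comp = (\<lambda>(Y', Z, g) (X, Y, f). (X, Z, \<lambda>l. compose (sec X l) (g l) (f l)))\<rparr>"

definition Ext :: "real \<Rightarrow> 'u presheaf \<Rightarrow> 'u presheaf" where
  "Ext \<epsilon> A = \<lparr>
     sec = (\<lambda>l. if 0 \<le> l then sec A (l + \<epsilon>) else {}),
     res = (\<lambda>l l' p. if int_arr l l' p then res A (l + \<epsilon>) (l' + \<epsilon>) p else (\<lambda>_. undefined))\<rparr>"

definition Ext_map :: "real \<Rightarrow> 'u sheaf_map \<Rightarrow> 'u sheaf_map" where
  "Ext_map \<epsilon> = (\<lambda>(X, Y, f). (Ext \<epsilon> X, Ext \<epsilon> Y, \<lambda>l. restrict (f (l + \<epsilon>)) (sec (Ext \<epsilon> X) l)))"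

definition left_restriction :: "real \<Rightarrow> 'u presheaf \<Rightarrow> 'u sheaf_map" where
  "left_restriction \<epsilon> A = (Ext \<epsilon> A, A, \<lambda>l. restrict (res A (l + \<epsilon>) l 0) (sec (Ext \<epsilon> A) l))"

text \<open>A copy of the quotient of the reals by the integers inside \<open>'u\<close>: \<open>phase \<theta>\<close> represents the
  class of \<open>\<theta>\<close>.\<close>

definition phase :: "real \<Rightarrow> 'u" where
  "phase = (SOME c. \<forall>x y. c x = c y \<longleftrightarrow> x - y \<in> \<int>)"

definition Sync :: "'u presheaf" where
  "Sync = \<lparr>
     sec = (\<lambda>l. if 0 \<le> l then range phase else {}),
     res = (\<lambda>l l' p. if int_arr l l' p
              then restrict (\<lambda>x. phase ((SOME \<theta>. phase \<theta> = x) + p)) (range phase)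
              else (\<lambda>_. undefined))\<rparr>"

definition Int_Sync :: "('u sheaf_map, 'u sheaf_map \<times> 'u sheaf_map \<times> 'u sheaf_map) category" where
  "Int_Sync = slice Int_sheaves Sync"


section \<open>Synchronous machines\<close>

text \<open>The induced map from \<open>Ext \<epsilon> S\<close> to the pullback of \<open>Ext \<epsilon> A\<close> and \<open>S\<close> over \<open>A\<close>,
  for \<open>p : S \<rightarrow> A\<close>.\<close>

definition ext_comparison :: "real \<Rightarrow> 'u sheaf_map \<Rightarrow> 'u sheaf_map" where
  "ext_comparison \<epsilon> p =
     pb_pair Int_sheaves (left_restriction \<epsilon> (Cod Int_sheaves p)) p
       (Ext_map \<epsilon> p) (left_restriction \<epsilon> (Dom Int_sheaves p))"

definition total_map :: "'u sheaf_map \<Rightarrow> bool" where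
  "total_map p \<longleftrightarrow> (\<forall>\<epsilon>>0. is_epi Int_sheaves (ext_comparison \<epsilon> p))"

definition deterministic_map :: "'u sheaf_map \<Rightarrow> bool" where
  "deterministic_map p \<longleftrightarrow> (\<forall>\<epsilon>>0. is_mono Int_sheaves (ext_comparison \<epsilon> p))"

definition inertial_map :: "'u sheaf_map \<Rightarrow> bool" where
  "inertial_map p \<longleftrightarrow>
     (\<exists>\<epsilon>>0. \<exists>g. g \<in> Hom Int_sheaves (Dom Int_sheaves p) (Ext \<epsilon> (Cod Int_sheaves p)) \<and>
        left_restriction \<epsilon> (Cod Int_sheaves p) \<cdot>\<^bsub>Int_sheaves\<^esub> g = p)"

type_synonym 'u sync_map = "'u sheaf_map \<times> 'u sheaf_map \<times> 'u sheaf_map"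
type_synonym ('l, 'u) sync_box = "('l, 'u sheaf_map) box"
type_synonym ('l, 'u) sync_algebra = "('l, 'u sheaf_map, 'u sync_map) span_algebra"
type_synonym ('l, 'u) sync_wiring =
  "(('l, 'u sheaf_map) box, ('l, 'u sheaf_map) wiring_diagram) monoidal_category"

definition W_Sync :: "('l, 'u) sync_wiring" where
  "W_Sync = wiring Int_Sync"

definition Mch_Sync :: "('l, 'u) sync_algebra" where
  "Mch_Sync = span_systems Int_Sync"

definition inertial_machines :: "('l, 'u) sync_box \<Rightarrow> 'u sync_map set" where
  "inertial_machines X = {s \<in> Obj (Fib Mch_Sync X). inertial_map (underlying (leg_out Int_Sync X s))}"

definition total_machines :: "('l, 'u) sync_box \<Rightarrow> 'u sync_map set" where
  "total_machines X =
     {s \<in> inertial_machines X. total_map (underlying (leg_in Int_Sync X s))}"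

definition deterministic_machines :: "('l, 'u) sync_box \<Rightarrow> 'u sync_map set" where
  "deterministic_machines X =
     {s \<in> inertial_machines X. deterministic_map (underlying (leg_in Int_Sync X s))}"

end

theory Submission imports Defs
begin

text \<open>
  In a finitely complete category a generalised element of \<open>\<phi>(s)\<close> is a generalised element of the
  system \<open>s\<close> together with an external input for which \<open>\<phi>\<close> closes the feedback loop. All structure
  maps of span systems are therefore prescribed on components, and every coherence law is an
  equality of maps into a product or pullback that can be tested on components.

  For machines, everything is read off on sections. By the Yoneda lemma monomorphisms are the
  sectionwise injections. Whether a pair \<open>(a, s)\<close> lifts along the comparison map \<open>h\<close> of totality
  depends only on its restriction to the last point, because extensions can be glued; hence the
  times at which a section fails to lift form an up-set of \<open>[0, l]\<close>. The sheaf of such up-sets has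
  continuum many sections and tests that an epimorphic \<open>h\<close> is surjective on sections. So total
  (deterministic) means that a state has at least (at most) one extension over a prolonged input.

  Inertia makes the output on \<open>[0, l + \<delta>]\<close> a function of the state on \<open>[0, l]\<close>. Extending a state
  of \<open>\<phi>(s)\<close> by at most \<open>\<delta>\<close> is then the same as extending the underlying state of \<open>s\<close> along a
  known input, and longer extensions are reached in finitely many steps. Products over
  \<open>Sync\<close> impose no further condition, since left restriction does not change the phase.
\<close>

section \<open>Categories with finite limits\<close>

text \<open>The fibres are slices over products and pullbacks picked by \<open>SOME\<close>, so
  hardly any law of the algebra is an equality of spans: the 2-cells must be built, proved
  invertible and compared. An action \<open>act d s\<close> is used only through the projection
  \<open>act_pr\<close> to the states of \<open>s\<close> and its values \<open>port_in\<close> on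
  outer inputs; these are jointly monic (\<open>act_eqI\<close>), and compatible values lift
  (\<open>act_elem\<close>).

  The injection of the reals into \<open>'u\<close> enters four times: \<open>'u\<close> becomes
  infinite, so that pairs can be coded and pullbacks exist; representables are coded by their
  translations; reals modulo the integers find room; and so do the up-sets of an interval.

  On the machine side an epimorphism of sheaves is a priori only locally surjective: lifts of the
  pieces need not match at the cut points. The other obstacle is feedback, since the input of
  \<open>s\<close> under \<open>act d s\<close> depends on the very output that an extension is to
  produce; the delay from inertia breaks this circle.\<close>

locale cat =
  fixes C :: "('o, 'm) category"
  assumes is_category: "is_category C"
begin

abbreviation comp (infixr "**" 70) where "g ** f \<equiv> Comp C g f"
abbreviation arr :: "'m \<Rightarrow> bool" where "arr f \<equiv> f \<in> Arr C"
abbreviation src :: "'m \<Rightarrow> 'o" where "src \<equiv> Dom C"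
abbreviation tgt :: "'m \<Rightarrow> 'o" where "tgt \<equiv> Cod C"

lemma Dom_Obj [simp]: "arr f \<Longrightarrow> src f \<in> Obj C"
  and Cod_Obj [simp]: "arr f \<Longrightarrow> tgt f \<in> Obj C"
  and Ident_Arr [simp]: "a \<in> Obj C \<Longrightarrow> Ident C a \<in> Arr C"
  and Dom_Ident [simp]: "a \<in> Obj C \<Longrightarrow> src (Ident C a) = a"
  and Cod_Ident [simp]: "a \<in> Obj C \<Longrightarrow> tgt (Ident C a) = a"
  using is_category by (auto simp: is_category_def Hom_def)

lemma comp_Arr [simp]: "\<lbrakk>arr f; arr g; tgt f = src g\<rbrakk> \<Longrightarrow> g ** f \<in> Arr C"
  and Dom_comp [simp]: "\<lbrakk>arr f; arr g; tgt f = src g\<rbrakk> \<Longrightarrow> src (g ** f) = src f"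
  and Cod_comp [simp]: "\<lbrakk>arr f; arr g; tgt f = src g\<rbrakk> \<Longrightarrow> tgt (g ** f) = tgt g"
  using is_category by (auto simp: is_category_def Hom_def)

lemma comp_Ident [simp]: "\<lbrakk>arr f; src f = a\<rbrakk> \<Longrightarrow> f ** Ident C a = f"
  and Ident_comp [simp]: "\<lbrakk>arr f; tgt f = a\<rbrakk> \<Longrightarrow> Ident C a ** f = f"
  using is_category by (auto simp: is_category_def)

lemma comp_assoc [simp]:
  "\<lbrakk>arr f; arr g; arr h; tgt f = src g; tgt g = src h\<rbrakk> \<Longrightarrow>
     (h ** g) ** f = h ** g ** f"
  using is_category by (simp add: is_category_def)

lemma Hom_iff: "f \<in> Hom C a b \<longleftrightarrow> f \<in> Arr C \<and> src f = a \<and> tgt f = b"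
  by (simp add: Hom_def)

text \<open>Testing at the identity suffices. The point is the form of the test: after an arbitrary
  \<open>x\<close> both sides are right-nested composites, the shape for which the later simp rules
  are stated.\<close>

lemma arr_eqI:
  assumes "arr f" "arr g" "src f = src g"
    and "\<And>x. \<lbrakk>arr x; tgt x = src f\<rbrakk> \<Longrightarrow> f ** x = g ** x"
  shows "f = g"
  using assms(4)[of "Ident C (src f)"] assms(1-3) by simp

lemma inverse_arrows_unique:
  assumes "inverse_arrows C f g" "inverse_arrows C f h"
  shows "g = h"
proof -
  note * = assms[unfolded inverse_arrows_def Hom_iff]
  have "g = g ** f ** h" using * by (metis comp_Ident)
  also have "\<dots> = (g ** f) ** h" using * by (intro comp_assoc[symmetric]) auto
  also have "\<dots> = h" using * by (metis Ident_comp)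
  finally show ?thesis .
qed

lemma inv_arr: "is_iso C f \<Longrightarrow> inverse_arrows C f (inv_arr C f)"
  unfolding is_iso_def inv_arr_def by (metis inverse_arrows_unique theI')

lemma is_productE:
  assumes "is_product C I A p \<pi>"
  shows "p \<in> Obj C" "i \<in> I \<Longrightarrow> \<pi> i \<in> Arr C" "i \<in> I \<Longrightarrow> src (\<pi> i) = p" "i \<in> I \<Longrightarrow> tgt (\<pi> i) = A i"
  using assms by (auto simp: is_product_def Hom_def)

lemma is_product_tuple:
  assumes "is_product C I A p \<pi>" "q \<in> Obj C" "\<And>i. i \<in> I \<Longrightarrow> r i \<in> Hom C q (A i)"
  obtains u where "u \<in> Hom C q p" "\<And>i. i \<in> I \<Longrightarrow> \<pi> i ** u = r i"
proof -
  have "\<exists>!u. u \<in> Hom C q p \<and> (\<forall>i\<in>I. \<pi> i ** u = r i)"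
    using assms unfolding is_product_def by blast
  then show thesis using that by blast
qed

lemma is_product_eqI:
  assumes "is_product C I A p \<pi>" "arr u" "arr v" "tgt u = p" "tgt v = p" "src u = src v"
    and "\<And>i. i \<in> I \<Longrightarrow> \<pi> i ** u = \<pi> i ** v"
  shows "u = v"
proof -
  have "\<exists>!w. w \<in> Hom C (src u) p \<and> (\<forall>i\<in>I. \<pi> i ** w = \<pi> i ** u)"
    using assms(1,2,4) unfolding is_product_def by (auto simp: Hom_def)
  then show ?thesis using assms by (metis Hom_iff)
qed

lemma is_pullback_ex1:
  assumes "is_pullback C f g p q" "u \<in> Hom C c (src f)" "v \<in> Hom C c (src g)" "f ** u = g ** v"
  shows "\<exists>!w. w \<in> Hom C c (src p) \<and> p ** w = u \<and> q ** w = v"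
proof -
  have u: "arr u" "src u = c" "tgt u = src f" and v: "arr v" "src v = c" "tgt v = src g"
    using assms(2,3) by (auto simp: Hom_iff)
  have "\<And>u v. \<lbrakk>arr u; arr v; src u = src v; tgt u = src f; tgt v = src g; f ** u = g ** v\<rbrakk>
     \<Longrightarrow> \<exists>!w. w \<in> Hom C (src u) (src p) \<and> p ** w = u \<and> q ** w = v"
    using assms(1) unfolding is_pullback_def by blast
  from this[OF u(1) v(1)] show ?thesis using assms(4) u v by simp
qed

end

text \<open>Only these two limits are built by hand for interval sheaves and their slices; finite
  products, and with them all chosen cones, follow from them.\<close>

locale fincomplete = cat C for C :: "('o, 'm) category" +
  assumes terminal: "\<exists>t\<in>Obj C. \<forall>a\<in>Obj C. \<exists>!u. u \<in> Hom C a t"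
    and pullbacks: "\<lbrakk>arr f; arr g; tgt f = tgt g\<rbrakk> \<Longrightarrow> \<exists>p q. is_pullback C f g p q"
begin

text \<open>The product is the pullback over the terminal object, where any pair of maps is
  compatible.\<close>

lemma binary_products:
  assumes "a \<in> Obj C" "b \<in> Obj C"
  obtains p f g where "f \<in> Hom C p a" "g \<in> Hom C p b"
    "\<And>q u v. \<lbrakk>u \<in> Hom C q a; v \<in> Hom C q b\<rbrakk> \<Longrightarrow> \<exists>!w. w \<in> Hom C q p \<and> f ** w = u \<and> g ** w = v"
proof -
  obtain t where t: "t \<in> Obj C" "\<And>a. a \<in> Obj C \<Longrightarrow> \<exists>!u. u \<in> Hom C a t" using terminal by blast
  obtain x y where x: "x \<in> Hom C a t" and y: "y \<in> Hom C b t" using t assms by meson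
  obtain f g where fg: "is_pullback C x y f g" using pullbacks x y by (metis Hom_iff)
  have H: "\<exists>!w. w \<in> Hom C q (src f) \<and> f ** w = u \<and> g ** w = v"
    if u: "u \<in> Hom C q a" and v: "v \<in> Hom C q b" for q u v
  proof -
    have "x ** u \<in> Hom C q t" "y ** v \<in> Hom C q t" "q \<in> Obj C" using u v x y by (auto simp: Hom_iff)
    then have "x ** u = y ** v" using t by blast
    moreover have "u \<in> Hom C q (src x)" "v \<in> Hom C q (src y)" using u v x y by (auto simp: Hom_iff)
    ultimately show ?thesis using is_pullback_ex1[OF fg] by blast
  qed
  show thesis
    by (rule that[of f "src f" g]) (use fg x y H in \<open>auto simp: is_pullback_def Hom_iff\<close>)
qed

text \<open>Induction on the index set: the product over \<open>insert i I\<close> is the binary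
  product of the one over \<open>I\<close> with \<open>A i\<close>, and the terminal object is the
  empty product.\<close>

lemma finite_products:
  assumes "finite I" "\<And>i. i \<in> I \<Longrightarrow> A i \<in> Obj C"
  shows "\<exists>p \<pi>. is_product C I A p \<pi>"
  using assms
proof (induction I)
  case empty
  show ?case using terminal by (auto simp: is_product_def)
next
  case (insert i I)
  then obtain p \<pi> where p: "is_product C I A p \<pi>" by auto
  note pE = is_productE[OF p]
  obtain r f g where fg: "f \<in> Hom C r p" "g \<in> Hom C r (A i)"
    and U: "\<And>q u v. \<lbrakk>u \<in> Hom C q p; v \<in> Hom C q (A i)\<rbrakk> \<Longrightarrow> \<exists>!w. w \<in> Hom C q r \<and> f ** w = u \<and> g ** w = v"
    by (rule binary_products[of p "A i"]) (use pE(1) insert.prems in auto)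
  define \<rho> where "\<rho> j = (if j = i then g else \<pi> j ** f)" for j
  have "is_product C (insert i I) A r \<rho>"
    unfolding is_product_def
  proof (intro conjI ballI allI impI)
    show "r \<in> Obj C" using fg by (auto simp: Hom_iff)
    show "\<rho> j \<in> Hom C r (A j)" if "j \<in> insert i I" for j
      using that fg pE insert.hyps by (auto simp: Hom_iff \<rho>_def)
    fix q s assume q: "q \<in> Obj C" and s: "\<forall>j\<in>insert i I. s j \<in> Hom C q (A j)"
    obtain u where u: "u \<in> Hom C q p" "\<And>j. j \<in> I \<Longrightarrow> \<pi> j ** u = s j"
      using is_product_tuple[OF p q, of s] s by blast
    obtain w where w: "w \<in> Hom C q r" "f ** w = u" "g ** w = s i" using U[OF u(1), of "s i"] s by blast
    show "\<exists>!w. w \<in> Hom C q r \<and> (\<forall>j\<in>insert i I. \<rho> j ** w = s j)"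
    proof (rule ex1I[of _ w])
      show "w \<in> Hom C q r \<and> (\<forall>j\<in>insert i I. \<rho> j ** w = s j)"
        using w u fg pE insert.hyps by (auto simp: Hom_iff \<rho>_def)
      fix v assume v: "v \<in> Hom C q r \<and> (\<forall>j\<in>insert i I. \<rho> j ** v = s j)"
      have "f ** v = u"
      proof (rule is_product_eqI[OF p])
        fix j assume "j \<in> I"
        moreover from this have "\<rho> j ** v = s j" "j \<noteq> i" using v insert.hyps by auto
        ultimately show "\<pi> j ** f ** v = \<pi> j ** u" using u(2) v fg pE by (auto simp: \<rho>_def Hom_iff)
      qed (use v u fg in \<open>auto simp: Hom_iff\<close>)
      moreover have "g ** v = s i" using v by (auto simp: \<rho>_def)
      ultimately show "v = w" using U[OF u(1), of "s i"] s v w by blast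
    qed
  qed
  then show ?case by blast
qed

lemma prod_cone:
  assumes "finite I" "\<And>i. i \<in> I \<Longrightarrow> A i \<in> Obj C"
  shows "is_product C I A (prod_ob C I A) (prod_pr C I A)"
proof -
  have "\<exists>x. case x of (p, \<pi>) \<Rightarrow> is_product C I A p \<pi>" using finite_products[OF assms] by auto
  then show ?thesis unfolding prod_ob_def prod_pr_def prod_cone_def
    by (metis (mono_tags, lifting) case_prod_beta someI_ex)
qed

lemma tuple:
  assumes "finite I" "\<And>i. i \<in> I \<Longrightarrow> r i \<in> Hom C q (A i)" "q \<in> Obj C"
  shows "tuple C I A q r \<in> Hom C q (prod_ob C I A)" "i \<in> I \<Longrightarrow> prod_pr C I A i ** tuple C I A q r = r i"
proof -
  have A: "A i \<in> Obj C" if "i \<in> I" for i using assms(2)[OF that] Cod_Obj by (metis Hom_iff)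
  have "\<exists>!u. u \<in> Hom C q (prod_ob C I A) \<and> (\<forall>i\<in>I. prod_pr C I A i ** u = r i)"
    using prod_cone[of I A, OF assms(1) A] assms(2,3) unfolding is_product_def by blast
  from theI'[OF this] show "tuple C I A q r \<in> Hom C q (prod_ob C I A)"
      "i \<in> I \<Longrightarrow> prod_pr C I A i ** tuple C I A q r = r i"
    unfolding tuple_def by auto
qed

lemma bprod_cone:
  assumes "a \<in> Obj C" "b \<in> Obj C"
  shows "is_product C UNIV (case_bool a b) (bprod C a b) (prod_pr C UNIV (case_bool a b))"
  unfolding bprod_def using assms by (intro prod_cone) (auto split: bool.split)

lemma bprod_Obj [simp]: "\<lbrakk>a \<in> Obj C; b \<in> Obj C\<rbrakk> \<Longrightarrow> bprod C a b \<in> Obj C"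
  using is_productE[OF bprod_cone] by blast

lemma pr_simps [simp]:
  assumes "a \<in> Obj C" "b \<in> Obj C"
  shows "arr (pr1 C a b)" "src (pr1 C a b) = bprod C a b" "tgt (pr1 C a b) = a"
    "arr (pr2 C a b)" "src (pr2 C a b) = bprod C a b" "tgt (pr2 C a b) = b"
  using is_productE[OF bprod_cone[OF assms]] unfolding pr1_def pr2_def by auto

lemma bprod_eqI:
  assumes "arr u" "arr v" "tgt u = bprod C a b" "tgt v = bprod C a b" "src u = src v"
    "a \<in> Obj C" "b \<in> Obj C" "pr1 C a b ** u = pr1 C a b ** v" "pr2 C a b ** u = pr2 C a b ** v"
  shows "u = v"
  by (rule is_product_eqI[OF bprod_cone[OF assms(6,7)]])
    (use assms in \<open>auto simp: pr1_def pr2_def\<close>, metis (full_types))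

lemma pairing_props:
  assumes "arr f" "arr g" "src f = src g"
  shows "pairing C f g \<in> Hom C (src f) (bprod C (tgt f) (tgt g))"
    "pr1 C (tgt f) (tgt g) ** pairing C f g = f" "pr2 C (tgt f) (tgt g) ** pairing C f g = g"
proof -
  have *: "case_bool f g i \<in> Hom C (src f) (case_bool (tgt f) (tgt g) i)" for i
    using assms by (auto simp: Hom_iff split: bool.split)
  note t = tuple[of UNIV "case_bool f g" "src f" "case_bool (tgt f) (tgt g)", OF _ *]
  show "pairing C f g \<in> Hom C (src f) (bprod C (tgt f) (tgt g))"
    "pr1 C (tgt f) (tgt g) ** pairing C f g = f" "pr2 C (tgt f) (tgt g) ** pairing C f g = g"
    unfolding pairing_def bprod_def pr1_def pr2_def using t(1) t(2)[of True] t(2)[of False] assms by auto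
qed

lemma pairing_simps [simp]:
  assumes "arr f" "arr g" "src f = src g"
  shows "arr (pairing C f g)" "src (pairing C f g) = src g"
    "tgt (pairing C f g) = bprod C (tgt f) (tgt g)"
    "\<lbrakk>a = tgt f; b = tgt g\<rbrakk> \<Longrightarrow> pr1 C a b ** pairing C f g = f"
    "\<lbrakk>a = tgt f; b = tgt g\<rbrakk> \<Longrightarrow> pr2 C a b ** pairing C f g = g"
  using pairing_props[OF assms] assms by (auto simp: Hom_iff)

lemma pairing_comp [simp]:
  assumes "arr f" "arr g" "src f = src g" "arr x" "tgt x = src g"
  shows "pairing C f g ** x = pairing C (f ** x) (g ** x)"
proof (rule bprod_eqI[of _ _ "tgt f" "tgt g"])
  \<comment> \<open>The cancellation rules are withheld so that simp only reassociates; the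
    projections cancel in the next line.\<close>
  have "pr1 C (tgt f) (tgt g) ** pairing C f g ** x = (pr1 C (tgt f) (tgt g) ** pairing C f g) ** x"
    using assms by (simp del: pairing_simps(4,5))
  then show "pr1 C (tgt f) (tgt g) ** pairing C f g ** x = pr1 C (tgt f) (tgt g) ** pairing C (f ** x) (g ** x)"
    using assms by simp
  have "pr2 C (tgt f) (tgt g) ** pairing C f g ** x = (pr2 C (tgt f) (tgt g) ** pairing C f g) ** x"
    using assms by (simp del: pairing_simps(4,5))
  then show "pr2 C (tgt f) (tgt g) ** pairing C f g ** x = pr2 C (tgt f) (tgt g) ** pairing C (f ** x) (g ** x)"
    using assms by simp
qed (use assms in auto)

text \<open>The last rule evaluates \<open>par\<close> at an argument. It is deleted where a
  composite with \<open>par\<close> is to stay an arrow whose source and target simp should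
  compute.\<close>

lemma par_simps [simp]:
  assumes "arr f" "arr g"
  shows "arr (par C f g)" "src (par C f g) = bprod C (src f) (src g)"
    "tgt (par C f g) = bprod C (tgt f) (tgt g)"
    "\<lbrakk>arr x; tgt x = bprod C (src f) (src g)\<rbrakk> \<Longrightarrow>
      par C f g ** x = pairing C (f ** pr1 C (src f) (src g) ** x) (g ** pr2 C (src f) (src g) ** x)"
  unfolding par_def using assms by auto

lemma pb_cone:
  assumes "arr f" "arr g" "tgt f = tgt g"
  shows "is_pullback C f g (pb1 C f g) (pb2 C f g)"
proof -
  have "\<exists>x. case x of (p, q) \<Rightarrow> is_pullback C f g p q" using pullbacks[OF assms] by auto
  then show ?thesis unfolding pb1_def pb2_def pb_cone_def
    by (metis (mono_tags, lifting) case_prod_beta someI_ex)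
qed

lemma pb_simps [simp]:
  assumes "arr f" "arr g" "tgt f = tgt g"
  shows "arr (pb1 C f g)" "arr (pb2 C f g)" "src (pb2 C f g) = src (pb1 C f g)"
    "tgt (pb1 C f g) = src f" "tgt (pb2 C f g) = src g"
  using pb_cone[OF assms] unfolding is_pullback_def by auto

lemma pb_commute:
  assumes "arr f" "arr g" "tgt f = tgt g" "arr x" "tgt x = src (pb1 C f g)"
  shows "f ** pb1 C f g ** x = g ** pb2 C f g ** x"
proof -
  have "f ** pb1 C f g = g ** pb2 C f g" using pb_cone[OF assms(1-3)] unfolding is_pullback_def by blast
  then have "(f ** pb1 C f g) ** x = (g ** pb2 C f g) ** x" by simp
  then show ?thesis using assms by simp
qed

lemma pb_eqI:
  assumes "arr f" "arr g" "tgt f = tgt g"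
    and "arr x" "tgt x = src (pb1 C f g)" "arr y" "tgt y = src (pb1 C f g)" "src x = src y"
    and "pb1 C f g ** x = pb1 C f g ** y" "pb2 C f g ** x = pb2 C f g ** y"
  shows "x = y"
proof -
  let ?u = "pb1 C f g ** x" and ?v = "pb2 C f g ** x"
  have "\<exists>!w. w \<in> Hom C (src x) (src (pb1 C f g)) \<and> pb1 C f g ** w = ?u \<and> pb2 C f g ** w = ?v"
    by (rule is_pullback_ex1[OF pb_cone[OF assms(1-3)] _ _ pb_commute[OF assms(1-5)]])
      (use assms(1-5) in \<open>auto simp: Hom_iff\<close>)
  then show ?thesis using assms by (auto simp: Hom_iff)
qed

lemma pb_pair:
  assumes "arr f" "arr g" "tgt f = tgt g"
    and "arr u" "arr v" "src u = src v" "tgt u = src f" "tgt v = src g" "f ** u = g ** v"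
  shows "arr (pb_pair C f g u v)" "src (pb_pair C f g u v) = src v"
    "tgt (pb_pair C f g u v) = src (pb1 C f g)"
    "pb1 C f g ** pb_pair C f g u v = u" "pb2 C f g ** pb_pair C f g u v = v"
proof -
  have "\<exists>!w. w \<in> Hom C (src u) (src (pb1 C f g)) \<and> pb1 C f g ** w = u \<and> pb2 C f g ** w = v"
    by (rule is_pullback_ex1[OF pb_cone[OF assms(1-3)]]) (use assms in \<open>auto simp: Hom_iff\<close>)
  from theI'[OF this] show "arr (pb_pair C f g u v)" "src (pb_pair C f g u v) = src v"
    "tgt (pb_pair C f g u v) = src (pb1 C f g)"
    "pb1 C f g ** pb_pair C f g u v = u" "pb2 C f g ** pb_pair C f g u v = v"
    unfolding pb_pair_def Hom_iff using assms by auto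
qed

end

section \<open>Finite limits in slice categories\<close>

lemma slice_simps [simp]:
  "f \<in> Obj (slice C b) \<longleftrightarrow> f \<in> Arr C \<and> Cod C f = b"
  "(f, f', h) \<in> Arr (slice C b) \<longleftrightarrow> f \<in> Arr C \<and> Cod C f = b \<and> f' \<in> Arr C \<and> Cod C f' = b \<and>
      h \<in> Hom C (Dom C f) (Dom C f') \<and> f' \<cdot>\<^bsub>C\<^esub> h = f"
  "Dom (slice C b) (f, f', h) = f" "Cod (slice C b) (f, f', h) = f'"
  "Ident (slice C b) f = (f, f, Ident C (Dom C f))"
  "(g, g', k) \<cdot>\<^bsub>slice C b\<^esub> (f, f', h) = (f, g', k \<cdot>\<^bsub>C\<^esub> h)"
  by (auto simp: slice_def)

context cat
begin

lemma slice_category: "is_category (slice C b)"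
  unfolding is_category_def by (auto simp: Hom_def comp_assoc[symmetric] simp del: comp_assoc)

text \<open>The identity of \<open>b\<close> is terminal: the only map from \<open>a\<close> to it
  over \<open>b\<close> is \<open>a\<close> itself.\<close>

lemma slice_terminal:
  assumes "b \<in> Obj C"
  shows "\<exists>t\<in>Obj (slice C b). \<forall>a\<in>Obj (slice C b). \<exists>!u. u \<in> Hom (slice C b) a t"
proof (rule bexI[of _ "Ident C b"], intro ballI)
  fix a assume a: "a \<in> Obj (slice C b)"
  show "\<exists>!u. u \<in> Hom (slice C b) a (Ident C b)"
    by (rule ex1I[of _ "(a, Ident C b, a)"]) (use a assms in \<open>auto simp: Hom_def\<close>)
qed (use assms in auto)

text \<open>The forgetful functor of a slice creates pullbacks: the apex of the underlying square
  receives the common composite to \<open>b\<close> as its structure map, and the mediating map is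
  automatically one over \<open>b\<close>.\<close>

lemma slice_pullback:
  assumes pb: "is_pullback C (underlying f) (underlying g) p q"
    and f: "f \<in> Arr (slice C b)" and g: "g \<in> Arr (slice C b)" and fg: "Cod (slice C b) f = Cod (slice C b) g"
  shows "\<exists>p q. is_pullback (slice C b) f g p q"
proof -
  obtain f1 g1 c h k where f': "f = (f1, c, h)" and g': "g = (g1, c, k)"
    using fg by (metis prod_cases3 slice_simps(4))
  note ar = f[unfolded f' slice_simps Hom_iff] g[unfolded g' slice_simps Hom_iff]
  have pb: "is_pullback C h k p q" using pb by (simp add: f' g' underlying_def)
  note pq = pb[unfolded is_pullback_def]
  have e: "f1 ** p = g1 ** q"
  proof -
    have "f1 ** p = (c ** h) ** p" using ar by simp
    also have "\<dots> = c ** h ** p" using ar pq by (subst comp_assoc) auto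
    also have "\<dots> = c ** k ** q" using pq by simp
    also have "\<dots> = (c ** k) ** q" using ar pq by (subst comp_assoc) auto
    finally show ?thesis using ar by simp
  qed
  have "is_pullback (slice C b) f g (f1 ** p, f1, p) (f1 ** p, g1, q)"
    unfolding is_pullback_def
  proof (intro conjI ballI impI)
    fix u v
    assume u: "u \<in> Arr (slice C b)" and v: "v \<in> Arr (slice C b)"
      and uv: "Dom (slice C b) u = Dom (slice C b) v" "Cod (slice C b) u = Dom (slice C b) f"
         "Cod (slice C b) v = Dom (slice C b) g"
      and eq: "f \<cdot>\<^bsub>slice C b\<^esub> u = g \<cdot>\<^bsub>slice C b\<^esub> v"
    obtain a u' v' where u': "u = (a, f1, u')" and v': "v = (a, g1, v')"
      using uv f' g' by (metis prod_cases3 slice_simps(3,4))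
    note uv' = u[unfolded u' slice_simps Hom_iff] v[unfolded v' slice_simps Hom_iff]
    have "h ** u' = k ** v'" using eq by (simp add: f' g' u' v')
    then have "\<exists>!w. w \<in> Hom C (src u') (src p) \<and> p ** w = u' \<and> q ** w = v'"
      by (rule is_pullback_ex1[OF pb, rotated 2]) (use uv' ar in \<open>auto simp: Hom_iff\<close>)
    then obtain w where w: "w \<in> Hom C (src u') (src p)" "p ** w = u'" "q ** w = v'"
      and wu: "\<And>w'. \<lbrakk>w' \<in> Hom C (src u') (src p); p ** w' = u'; q ** w' = v'\<rbrakk> \<Longrightarrow> w' = w" by blast
    show "\<exists>!w. w \<in> Hom (slice C b) (Dom (slice C b) u) (Dom (slice C b) (f1 ** p, f1, p)) \<and>
       (f1 ** p, f1, p) \<cdot>\<^bsub>slice C b\<^esub> w = u \<and> (f1 ** p, g1, q) \<cdot>\<^bsub>slice C b\<^esub> w = v"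
    proof (rule ex1I[of _ "(a, f1 ** p, w)"])
      show "(a, f1 ** p, w) \<in> Hom (slice C b) (Dom (slice C b) u) (Dom (slice C b) (f1 ** p, f1, p)) \<and>
       (f1 ** p, f1, p) \<cdot>\<^bsub>slice C b\<^esub> (a, f1 ** p, w) = u \<and> (f1 ** p, g1, q) \<cdot>\<^bsub>slice C b\<^esub> (a, f1 ** p, w) = v"
        using w pq uv' ar by (auto simp: u' v' Hom_def)
      fix x
      assume x: "x \<in> Hom (slice C b) (Dom (slice C b) u) (Dom (slice C b) (f1 ** p, f1, p)) \<and>
       (f1 ** p, f1, p) \<cdot>\<^bsub>slice C b\<^esub> x = u \<and> (f1 ** p, g1, q) \<cdot>\<^bsub>slice C b\<^esub> x = v"
      obtain x1 x2 x3 where x': "x = (x1, x2, x3)" by (cases x)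
      have "x1 = a" "x2 = f1 ** p" "arr x3" "src x3 = src x1" "tgt x3 = src x2" "p ** x3 = u'" "q ** x3 = v'"
        using x unfolding x' Hom_iff u' v' by (simp_all add: Hom_def)
      then have "x3 = w" using uv' ar pq by (intro wu) (auto simp: Hom_iff)
      with \<open>x1 = a\<close> \<open>x2 = f1 ** p\<close> show "x = (a, f1 ** p, w)" by (simp add: x')
    qed
  qed (use pq ar e in \<open>auto simp: f' g' Hom_def\<close>)
  then show ?thesis by blast
qed

end

lemma slice_fincomplete:
  fixes C :: "('o, 'm) category"
  assumes "is_category C" "b \<in> Obj C"
    and "\<And>f g. \<lbrakk>f \<in> Arr C; g \<in> Arr C; Cod C f = Cod C g\<rbrakk> \<Longrightarrow> \<exists>p q. is_pullback C f g p q"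
  shows "fincomplete (slice C b)"
proof -
  interpret cat C by (rule cat.intro[OF assms(1)])
  show ?thesis
  proof (unfold_locales)
    show "is_category (slice C b)" by (rule slice_category)
    show "\<exists>t\<in>Obj (slice C b). \<forall>a\<in>Obj (slice C b). \<exists>!u. u \<in> Hom (slice C b) a t"
      by (rule slice_terminal[OF assms(2)])
    fix f g assume fg: "f \<in> Arr (slice C b)" "g \<in> Arr (slice C b)" "Cod (slice C b) f = Cod (slice C b) g"
    obtain f1 c h g1 d k where "f = (f1, c, h)" "g = (g1, d, k)" by (metis prod_cases3)
    then have "underlying f \<in> Arr C" "underlying g \<in> Arr C" "Cod C (underlying f) = Cod C (underlying g)"
      using fg by (simp_all add: underlying_def Hom_def)
    then have "\<exists>p q. is_pullback C (underlying f) (underlying g) p q" by (rule assms(3))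
    then show "\<exists>p q. is_pullback (slice C b) f g p q" using slice_pullback fg by blast
  qed
qed

section \<open>The category of wiring diagrams\<close>

lemma copair_simps [simp]:
  "copair f g (InL x) = f x" "copair f g (InR y) = g y" "copair f g (Port p) = None"
  by (simp_all add: copair_def)

lemma typed_sum_simps [simp]:
  "typed_sum X Y (InL x) = X x" "typed_sum X Y (InR y) = Y y" "typed_sum X Y (Port p) = None"
  by (simp_all add: typed_sum_def)

lemma typed_sum_eq_Some:
  "typed_sum X Y z = Some t \<longleftrightarrow> (\<exists>x. z = InL x \<and> X x = Some t) \<or> (\<exists>y. z = InR y \<and> Y y = Some t)"
  by (cases z) auto

lemma dom_typed_sum: "dom (typed_sum X Y) = InL ` dom X \<union> InR ` dom Y"
  by (auto simp: dom_def typed_sum_eq_Some)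

lemma sum_map_simps [simp]:
  "sum_map f g (InL x) = map_option InL (f x)" "sum_map f g (InR y) = map_option InR (g y)"
  "sum_map f g (Port p) = None"
  by (auto simp: sum_map_def map_comp_def inl_def inr_def split: option.split)

lemma typed_sum_typed_sets [simp]:
  "\<lbrakk>X \<in> typed_sets C; Y \<in> typed_sets C\<rbrakk> \<Longrightarrow> typed_sum X Y \<in> typed_sets C"
  by (auto simp: typed_sets_def dom_typed_sum ran_def typed_sum_eq_Some)

lemma empty_typed_sets [simp]: "Map.empty \<in> typed_sets C"
  by (simp add: typed_sets_def)

lemma typed_setsD: "\<lbrakk>X \<in> typed_sets C; X x = Some a\<rbrakk> \<Longrightarrow> a \<in> Obj C"
  by (auto simp: typed_sets_def ran_def)

text \<open>\<open>typed_function\<close> without the demand that the map be undefined outside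
  \<open>X\<close>. Structural maps such as \<open>inr\<close> and \<open>reassoc\<close> are
  defined on far more labels than a given typed set has, so they satisfy only this part;
  \<open>plain_wiring\<close> restricts them afterwards.\<close>

definition respects_types :: "('l, 'o) typed_set \<Rightarrow> ('l, 'o) typed_set \<Rightarrow> 'l port_map \<Rightarrow> bool" where
  "respects_types X Y f \<longleftrightarrow> (\<forall>x a. X x = Some a \<longrightarrow> (\<exists>y. f x = Some y \<and> Y y = Some a))"

lemma typed_function_iff:
  "typed_function X Y f \<longleftrightarrow> respects_types X Y f \<and> (\<forall>x. X x = None \<longrightarrow> f x = None)"
proof
  assume "typed_function X Y f"
  then have d: "dom f = dom X" and c: "\<And>x. (Y \<circ>\<^sub>m f) x = X x" by (auto simp: typed_function_def)
  show "respects_types X Y f \<and> (\<forall>x. X x = None \<longrightarrow> f x = None)"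
    unfolding respects_types_def
  proof (intro conjI allI impI)
    fix x a assume "X x = Some a"
    then show "\<exists>y. f x = Some y \<and> Y y = Some a" using c[of x] by (auto simp: map_comp_def split: option.splits)
  next
    fix x assume "X x = None" then show "f x = None" using d by (metis domIff)
  qed
next
  assume r: "respects_types X Y f \<and> (\<forall>x. X x = None \<longrightarrow> f x = None)"
  have "f x = None \<longleftrightarrow> X x = None" "(Y \<circ>\<^sub>m f) x = X x" for x
    using r by (cases "X x"; force simp: respects_types_def)+
  then show "typed_function X Y f" unfolding typed_function_def by (auto simp: dom_def)
qed

lemma typed_functionD:
  "\<lbrakk>typed_function X Y f; f x = Some y\<rbrakk> \<Longrightarrow> Y y = X x \<and> X x \<noteq> None"
  "typed_function X Y f \<Longrightarrow> f x = None \<longleftrightarrow> X x = None"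
  by (metis domIff map_comp_simps(2) option.distinct(1) typed_function_def)
     (metis domIff typed_function_def)

lemma respects_typesD: "\<lbrakk>respects_types X Y f; X x = Some a\<rbrakk> \<Longrightarrow> \<exists>y. f x = Some y \<and> Y y = Some a"
  by (simp add: respects_types_def)

lemma respects_types_intros:
  "respects_types X X Some"
  "respects_types X (typed_sum X Y) inl" "respects_types Y (typed_sum X Y) inr"
  "\<lbrakk>respects_types X Z f; respects_types Y Z g\<rbrakk> \<Longrightarrow> respects_types (typed_sum X Y) Z (copair f g)"
  "\<lbrakk>respects_types X X' f; respects_types Y Y' g\<rbrakk> \<Longrightarrow> respects_types (typed_sum X Y) (typed_sum X' Y') (sum_map f g)"
  "respects_types Map.empty Y f"
  by (fastforce simp: respects_types_def inl_def inr_def typed_sum_eq_Some)+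

lemma respects_types_comp:
  "\<lbrakk>respects_types Y Z g; respects_types X Y f\<rbrakk> \<Longrightarrow> respects_types X Z (g \<circ>\<^sub>m f)"
  by (fastforce simp: respects_types_def)

text \<open>Substitution of ports in a composite: an output of the inner box stays, and an input of
  the middle box is replaced by what \<open>inn\<close> feeds into it, an output of the middle box
  being traced back along \<open>out\<close>.\<close>

definition plug :: "'l port_map \<Rightarrow> 'l port_map \<Rightarrow> 'l port_map" where
  "plug out inn = copair inl (\<lambda>y. case inn y of None \<Rightarrow> None | Some z \<Rightarrow> sum_map out Some z)"

lemma plug_simps [simp]:
  "plug out inn (InL x) = Some (InL x)" "plug out inn (Port p) = None"
  "plug out inn (InR y) = (case inn y of None \<Rightarrow> None | Some z \<Rightarrow> sum_map out Some z)"
  by (simp_all add: plug_def inl_def)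

text \<open>The threefold composite on the input side collapses to one substitution. It is checked
  label by label, as the shape of the nested sums changes at each stage.\<close>

lemma wiring_comp_eq:
  "wiring_comp (Y, Z, ein, eout) (X, Y', din, dout) =
     (X, Z, plug dout ein \<circ>\<^sub>m din, dout \<circ>\<^sub>m eout)"
proof -
  have *: "(sum_map codiagonal Some \<circ>\<^sub>m unassoc) \<circ>\<^sub>m sum_map Some (sum_map dout Some) \<circ>\<^sub>m
        sum_map Some ein = plug dout ein"
  proof
    fix z show "((sum_map codiagonal Some \<circ>\<^sub>m unassoc) \<circ>\<^sub>m sum_map Some (sum_map dout Some) \<circ>\<^sub>m
        sum_map Some ein) z = plug dout ein z"
    proof (cases z)
      case (InR y)
      show ?thesis
      proof (cases "ein y")
        case (Some w) then show ?thesis using InR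
          by (cases w; cases "dout (case w of InL v \<Rightarrow> v)")
             (auto simp: map_comp_def codiagonal_def unassoc_def inl_def inr_def)
      qed (simp add: InR)
    qed (auto simp: map_comp_def codiagonal_def unassoc_def inl_def inr_def)
  qed
  show ?thesis unfolding wiring_comp_def split_conv *[symmetric]
    by (simp add: map_comp_def fun_eq_iff split: option.split)
qed

lemma interchange_simps [simp]:
  "interchange (InL z) = sum_map inl inl z" "interchange (InR z) = sum_map inr inr z"
  "interchange (Port p) = None"
  by (simp_all add: interchange_def)

lemma respects_types_plug:
  assumes "typed_function Y X out"
    and "typed_function Y0 (typed_sum Y Z) inn0"
    and "typed_function Y1 (typed_sum X Y0) inn1"
  shows "typed_function Y1 (typed_sum X Z) (plug out inn0 \<circ>\<^sub>m inn1)"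
  using assms unfolding typed_function_iff
proof (intro conjI; elim conjE)
  assume a: "respects_types Y X out" "respects_types Y0 (typed_sum Y Z) inn0" "respects_types Y1 (typed_sum X Y0) inn1"
  have "respects_types (typed_sum X Y0) (typed_sum X Z) (plug out inn0)"
    unfolding plug_def using a(1,2)
    by (fastforce simp: respects_types_def typed_sum_eq_Some inl_def)
  then show "respects_types Y1 (typed_sum X Z) (plug out inn0 \<circ>\<^sub>m inn1)" using a(3) by (rule respects_types_comp)
qed auto

lemma wiring_simps [simp]:
  "Obj (wiring C) = typed_sets C \<times> typed_sets C" "Arr (wiring C) = wiring_diagrams C"
  "Dom (wiring C) d = fst d" "Cod (wiring C) d = fst (snd d)"
  "Ident (wiring C) X = plain_wiring X X Some Some"
  "e \<cdot>\<^bsub>wiring C\<^esub> d = wiring_comp e d"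
  "x \<oplus>\<^bsub>wiring C\<^esub> y = box_sum x y" "f \<otimes>\<^bsub>wiring C\<^esub> g = wiring_sum f g"
  "Unit (wiring C) = empty_box"
  "Assoc (wiring C) X Y Z = plain_wiring (box_sum (box_sum X Y) Z) (box_sum X (box_sum Y Z)) reassoc unassoc"
  "LUnit (wiring C) X = plain_wiring (box_sum empty_box X) X (copair Map.empty Some) inr"
  "RUnit (wiring C) X = plain_wiring (box_sum X empty_box) X (copair Some Map.empty) inl"
  "Braid (wiring C) X Y = plain_wiring (box_sum X Y) (box_sum Y X) (copair inr inl) (copair inr inl)"
  by (auto simp: wiring_def split: prod.split)

lemma box_sum_simps [simp]:
  "fst (box_sum X Y) = typed_sum (fst X) (fst Y)" "snd (box_sum X Y) = typed_sum (snd X) (snd Y)"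
  "fst empty_box = Map.empty" "snd empty_box = Map.empty"
  by (simp_all add: box_sum_def empty_box_def)

lemma wiring_diagrams_iff:
  "(X, Y, din, dout) \<in> wiring_diagrams C \<longleftrightarrow>
     fst X \<in> typed_sets C \<and> snd X \<in> typed_sets C \<and> fst Y \<in> typed_sets C \<and> snd Y \<in> typed_sets C \<and>
     typed_function (fst X) (typed_sum (snd X) (fst Y)) din \<and> typed_function (snd Y) (snd X) dout"
  by (auto simp: wiring_diagrams_def mem_Times_iff)

lemma typed_function_restrict:
  "respects_types X Y f \<Longrightarrow> typed_function X Y (f |` dom X)"
  by (fastforce simp: typed_function_iff respects_types_def restrict_map_def)

lemma plain_wiring_diagram:
  assumes "X \<in> Obj (wiring C)" "Y \<in> Obj (wiring C)"
    "respects_types (fst X) (fst Y) f" "respects_types (snd Y) (snd X) g"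
  shows "plain_wiring X Y f g \<in> wiring_diagrams C"
proof -
  have "typed_function (fst X) (typed_sum (snd X) (fst Y)) (inr \<circ>\<^sub>m f |` dom (fst X))"
    using assms(3) by (fastforce simp: typed_function_iff respects_types_def restrict_map_def inr_def map_comp_def)
  moreover have "typed_function (snd Y) (snd X) (g |` dom (snd Y))"
    by (rule typed_function_restrict[OF assms(4)])
  ultimately show ?thesis using assms(1,2)
    by (auto simp: plain_wiring_def wiring_diagrams_iff)
qed

lemma plain_wiring_ends [simp]:
  "fst (plain_wiring X Y f g) = X" "fst (snd (plain_wiring X Y f g)) = Y"
  by (simp_all add: plain_wiring_def)

lemma plain_wiring_cong:
  assumes "\<And>x. x \<in> dom (fst X) \<Longrightarrow> f x = f' x" "\<And>x. x \<in> dom (snd Y) \<Longrightarrow> g x = g' x"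
  shows "plain_wiring X Y f g = plain_wiring X Y f' g'"
  using assms by (auto simp: plain_wiring_def restrict_map_def fun_eq_iff map_comp_def)

text \<open>Without feedback, wiring diagrams compose as pairs of label maps, contravariantly in the
  outputs. The coherence laws of the structural diagrams thereby become identities between label
  maps.\<close>

lemma plain_wiring_comp:
  assumes "respects_types (fst X) (fst Y) f" "respects_types (snd Z) (snd Y) g'"
  shows "wiring_comp (plain_wiring Y Z f' g') (plain_wiring X Y f g) =
    plain_wiring X Z (f' \<circ>\<^sub>m f) (g \<circ>\<^sub>m g')"
proof -
  have 1: "f x = Some y \<and> y \<in> dom (fst Y)" if "fst X x = Some a" "f x = Some y \<or> True" "y = the (f x)" for x a y
    using respects_typesD[OF assms(1) that(1)] that by auto
  have 2: "g' x = Some y \<and> y \<in> dom (snd Y)" if "snd Z x = Some a" "y = the (g' x)" for x a y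
    using respects_typesD[OF assms(2) that(1)] that by auto
  have "plug (g |` dom (snd Y)) (inr \<circ>\<^sub>m f' |` dom (fst Y)) \<circ>\<^sub>m (inr \<circ>\<^sub>m f |` dom (fst X)) =
     inr \<circ>\<^sub>m (f' \<circ>\<^sub>m f) |` dom (fst X)"
  proof
    fix x show "(plug (g |` dom (snd Y)) (inr \<circ>\<^sub>m f' |` dom (fst Y)) \<circ>\<^sub>m (inr \<circ>\<^sub>m f |` dom (fst X))) x =
      (inr \<circ>\<^sub>m (f' \<circ>\<^sub>m f) |` dom (fst X)) x"
      using 1[of x _ "the (f x)"] by (cases "fst X x") (auto simp: map_comp_def restrict_map_def inr_def dom_def split: option.split)
  qed
  moreover have "(g |` dom (snd Y)) \<circ>\<^sub>m (g' |` dom (snd Z)) = (g \<circ>\<^sub>m g') |` dom (snd Z)"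
  proof
    fix x show "((g |` dom (snd Y)) \<circ>\<^sub>m (g' |` dom (snd Z))) x = ((g \<circ>\<^sub>m g') |` dom (snd Z)) x"
      using 2[of x _ "the (g' x)"] by (cases "snd Z x"; cases "g' x") (auto simp: map_comp_def restrict_map_def dom_def)
  qed
  ultimately show ?thesis by (simp add: plain_wiring_def wiring_comp_eq)
qed

lemma plain_wiring_sum:
  "wiring_sum (plain_wiring X Y f g) (plain_wiring X' Y' f' g') =
     plain_wiring (box_sum X X') (box_sum Y Y') (sum_map f f') (sum_map g g')"
proof -
  have "(interchange \<circ>\<^sub>m sum_map (inr \<circ>\<^sub>m f |` dom (fst X)) (inr \<circ>\<^sub>m f' |` dom (fst X'))) x =
    (inr \<circ>\<^sub>m sum_map f f' |` dom (typed_sum (fst X) (fst X'))) x" for x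
    by (cases x) (auto simp: map_comp_def restrict_map_def inl_def inr_def dom_typed_sum dom_def typed_sum_eq_Some image_iff split: option.split)
  moreover have "sum_map (g |` dom (snd Y)) (g' |` dom (snd Y')) x = (sum_map g g' |` dom (typed_sum (snd Y) (snd Y'))) x" for x
    by (cases x) (auto simp: restrict_map_def dom_typed_sum image_iff)
  ultimately show ?thesis by (simp add: plain_wiring_def wiring_sum_def fun_eq_iff)
qed

lemma wiring_sum_diagram:
  assumes "d \<in> wiring_diagrams C" "e \<in> wiring_diagrams C"
  shows "wiring_sum d e \<in> wiring_diagrams C"
proof -
  obtain X Y i out X' Y' i' out' where eq: "d = (X, Y, i, out)" "e = (X', Y', i', out')" by (metis prod_cases4)
  note a = assms[unfolded eq wiring_diagrams_iff typed_function_iff]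
  have "respects_types (typed_sum (fst X) (fst X')) (typed_sum (typed_sum (snd X) (fst Y)) (typed_sum (snd X') (fst Y'))) (sum_map i i')"
    using a by (blast intro: respects_types_intros)
  moreover have "respects_types (typed_sum (typed_sum (snd X) (fst Y)) (typed_sum (snd X') (fst Y')))
     (typed_sum (typed_sum (snd X) (snd X')) (typed_sum (fst Y) (fst Y'))) interchange"
    unfolding interchange_def by (intro respects_types_intros)
  ultimately have "respects_types (typed_sum (fst X) (fst X')) (typed_sum (typed_sum (snd X) (snd X')) (typed_sum (fst Y) (fst Y'))) (interchange \<circ>\<^sub>m sum_map i i')"
    by (blast intro: respects_types_comp)
  moreover have "respects_types (typed_sum (snd Y) (snd Y')) (typed_sum (snd X) (snd X')) (sum_map out out')"
    using a by (blast intro: respects_types_intros)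
  moreover have "sum_map i i' x = None" if "typed_sum (fst X) (fst X') x = None" for x
    using that a by (cases x) auto
  moreover have "sum_map out out' x = None" if "typed_sum (snd Y) (snd Y') x = None" for x
    using that a by (cases x) auto
  ultimately show ?thesis using a
    by (auto simp: eq wiring_sum_def wiring_diagrams_iff typed_function_iff map_comp_def)
qed

lemma wiring_comp_diagram:
  assumes "d \<in> wiring_diagrams C" "e \<in> wiring_diagrams C" "fst e = fst (snd d)"
  shows "wiring_comp e d \<in> wiring_diagrams C"
proof -
  obtain X Y i out Z i' out' where eq: "d = (X, Y, i, out)" "e = (Y, Z, i', out')"
    using assms(3) by (metis fst_conv prod_cases4 snd_conv)
  note a = assms(1,2)[unfolded eq wiring_diagrams_iff]
  have "typed_function (snd Z) (snd X) (out \<circ>\<^sub>m out')"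
    using a by (auto simp: typed_function_iff map_comp_def respects_types_def) (metis option.simps(5))+
  then show ?thesis using a by (auto simp: eq wiring_comp_eq wiring_diagrams_iff intro: respects_types_plug)
qed

lemma wiring_sum_ends [simp]:
  "fst (wiring_sum f g) = box_sum (fst f) (fst g)" "fst (snd (wiring_sum f g)) = box_sum (fst (snd f)) (fst (snd g))"
  by (simp_all add: wiring_sum_def split: prod.split)

lemma wiring_comp_ends [simp]:
  "fst (wiring_comp g f) = fst f" "fst (snd (wiring_comp g f)) = fst (snd g)"
  by (simp_all add: wiring_comp_def split: prod.split)

lemma wiring_category: "is_category (wiring C)"
  unfolding is_category_def
proof (intro conjI ballI impI)
  fix d assume f: "d \<in> Arr (wiring C)"
  obtain X Y i out where eq: "d = (X, Y, i, out)" by (metis prod_cases4)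
  note a = f[unfolded wiring_simps eq wiring_diagrams_iff]
  note t = typed_functionD[of "fst X" "typed_sum (snd X) (fst Y)" i] typed_functionD[of "snd Y" "snd X" out]
  show "Dom (wiring C) d \<in> Obj (wiring C)" "Cod (wiring C) d \<in> Obj (wiring C)"
    using a by (auto simp: eq mem_Times_iff)
  have "(plug (Some |` dom (snd X)) i \<circ>\<^sub>m (inr \<circ>\<^sub>m Some |` dom (fst X))) x = i x" for x
  proof (cases "i x")
    case None
    moreover from this have "fst X x = None" using a t(2) by blast
    ultimately show ?thesis by (simp add: map_comp_def restrict_map_def dom_def)
  next
    case (Some z)
    with a t have "typed_sum (snd X) (fst Y) z = fst X x" "fst X x \<noteq> None" by blast+
    then show ?thesis using Some by (cases z) (auto simp: map_comp_def restrict_map_def inr_def dom_def)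
  qed
  moreover have "(Some |` dom (snd X) \<circ>\<^sub>m out) x = out x" for x
    using a t(3,4)[of x] by (cases "out x"; cases "snd Y x") (auto simp: restrict_map_def dom_def)
  ultimately show "d \<cdot>\<^bsub>wiring C\<^esub> Ident (wiring C) (Dom (wiring C) d) = d"
    by (simp add: eq plain_wiring_def wiring_comp_eq fun_eq_iff)
  have "(plug out (inr \<circ>\<^sub>m Some |` dom (fst Y)) \<circ>\<^sub>m i) x = i x" for x
  proof (cases "i x")
    case (Some z)
    with a t have "typed_sum (snd X) (fst Y) z = fst X x" "fst X x \<noteq> None" by blast+
    then show ?thesis using Some by (cases z) (auto simp: map_comp_def restrict_map_def inr_def dom_def)
  qed auto
  moreover have "(out \<circ>\<^sub>m Some |` dom (snd Y)) x = out x" for x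
    using a t(4)[of x] by (cases "snd Y x"; cases "out x") (simp_all add: restrict_map_def dom_def map_comp_def)
  ultimately show "Ident (wiring C) (Cod (wiring C) d) \<cdot>\<^bsub>wiring C\<^esub> d = d"
    by (simp add: eq plain_wiring_def wiring_comp_eq fun_eq_iff)
next
  fix X assume "X \<in> Obj (wiring C)"
  then show "Ident (wiring C) X \<in> Hom (wiring C) X X"
    by (auto simp: Hom_def respects_types_intros intro!: plain_wiring_diagram)
next
  fix d e assume "d \<in> Arr (wiring C)" "e \<in> Arr (wiring C)" "Dom (wiring C) e = Cod (wiring C) d"
  then show "e \<cdot>\<^bsub>wiring C\<^esub> d \<in> Hom (wiring C) (Dom (wiring C) d) (Cod (wiring C) e)"
    by (auto simp: Hom_def wiring_comp_diagram)
next
  fix d e \<chi> :: "('a, 'b) wiring_diagram"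
  obtain X Y i out X' Y' i' out' X'' Y'' i'' out'' where eq: "d = (X, Y, i, out)"
    "e = (X', Y', i', out')" "\<chi> = (X'', Y'', i'', out'')" by (metis prod_cases4)
  \<comment> \<open>A label is followed through \<open>i\<close>, \<open>i'\<close> and
    \<open>i''\<close>; it either stops at feedback, where the output is carried back along
    \<open>out'\<close> and \<open>out\<close>, or reaches an outer input. Both bracketings perform
    the same trace.\<close>
  have "plug out (plug out' i'' \<circ>\<^sub>m i') \<circ>\<^sub>m i = plug (out \<circ>\<^sub>m out') i'' \<circ>\<^sub>m (plug out i' \<circ>\<^sub>m i)"
  proof
    fix x show "(plug out (plug out' i'' \<circ>\<^sub>m i') \<circ>\<^sub>m i) x = (plug (out \<circ>\<^sub>m out') i'' \<circ>\<^sub>m (plug out i' \<circ>\<^sub>m i)) x"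
    proof (cases "i x")
      case (Some z) then show ?thesis
      proof (cases z)
        case (InR y)
        show ?thesis
        proof (cases "i' y")
          case (Some w)
          show ?thesis
          proof (cases w)
            case (InL u)
            then show ?thesis using \<open>i x = Some z\<close> \<open>z = InR y\<close> Some
              by (cases "out u") (simp_all add: map_comp_def)
          next
            case (InR v)
            then show ?thesis using \<open>i x = Some z\<close> \<open>z = InR y\<close> Some
              by (cases "i'' v"; cases "the (i'' v)") (simp_all add: map_comp_def split: option.split)
          qed (use Some \<open>i x = Some z\<close> \<open>z = InR y\<close> in \<open>simp add: map_comp_def\<close>)
        qed (use Some InR in \<open>simp add: map_comp_def\<close>)
      qed (simp_all add: map_comp_def)
    qed simp
  qed
  then show "(\<chi> \<cdot>\<^bsub>wiring C\<^esub> e) \<cdot>\<^bsub>wiring C\<^esub> d = \<chi> \<cdot>\<^bsub>wiring C\<^esub> (e \<cdot>\<^bsub>wiring C\<^esub> d)"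
    by (auto simp: eq wiring_comp_eq map_comp_def fun_eq_iff split: option.split)
qed

section \<open>Nested disjoint unions and the symmetric monoidal structure\<close>

lemma label_ext:
  assumes "\<And>x. f (InL x) = g (InL x)" "\<And>x. f (InR x) = g (InR x)" "\<And>p. f (Port p) = g (Port p)"
  shows "f = g"
proof
  fix x show "f x = g x" using assms by (cases x) auto
qed

text \<open>The depth of the case split matches the nesting in \<open>(X + Y) + Z\<close>; labels
  \<open>Port p\<close> belong to no summand but have to be compared as well.\<close>

lemma label_ext_left:
  assumes "\<And>x. f (InL (InL x)) = g (InL (InL x))" "\<And>x. f (InL (InR x)) = g (InL (InR x))"
    "\<And>x. f (InR x) = g (InR x)" "\<And>p. f (Port p) = g (Port p)" "\<And>p. f (InL (Port p)) = g (InL (Port p))"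
  shows "f = g"
  using assms label_ext[of "\<lambda>x. f (InL x)" "\<lambda>x. g (InL x)"] by (intro label_ext) (auto dest: fun_cong)

lemma label_ext_right:
  assumes "\<And>x. f (InL x) = g (InL x)" "\<And>x. f (InR (InL x)) = g (InR (InL x))" "\<And>x. f (InR (InR x)) = g (InR (InR x))"
    "\<And>p. f (Port p) = g (Port p)" "\<And>p. f (InR (Port p)) = g (InR (Port p))"
  shows "f = g"
  using assms label_ext[of "\<lambda>x. f (InR x)" "\<lambda>x. g (InR x)"] by (intro label_ext) (auto dest: fun_cong)

text \<open>The three fates of a label: it is no port, it is fed back from an output of the inner
  box, or it is supplied by an outer input. Arguments about inputs split along these lines.\<close>

lemma typed_in_cases:
  assumes "typed_function X (typed_sum U Y) f"
  shows "(f x = None \<and> X x = None) \<or> (\<exists>u t. f x = Some (InL u) \<and> U u = Some t \<and> X x = Some t) \<or>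
    (\<exists>y t. f x = Some (InR y) \<and> Y y = Some t \<and> X x = Some t)"
  using typed_functionD[OF assms, of x]
  by (cases "f x"; cases "X x") (auto simp: typed_sum_eq_Some)

lemma typed_out_cases:
  assumes "typed_function X Y f"
  shows "(f x = None \<and> X x = None) \<or> (\<exists>y t. f x = Some y \<and> Y y = Some t \<and> X x = Some t)"
  using typed_functionD[OF assms, of x] by (cases "f x"; cases "X x") auto

lemma plain_wiring_iso:
  assumes "X \<in> Obj (wiring C)" "Y \<in> Obj (wiring C)"
    and "respects_types (fst X) (fst Y) f" "respects_types (snd Y) (snd X) g"
    and "respects_types (fst Y) (fst X) f'" "respects_types (snd X) (snd Y) g'"
    and "\<And>x a. fst X x = Some a \<Longrightarrow> (f' \<circ>\<^sub>m f) x = Some x" "\<And>x a. fst Y x = Some a \<Longrightarrow> (f \<circ>\<^sub>m f') x = Some x"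
    and "\<And>x a. snd X x = Some a \<Longrightarrow> (g \<circ>\<^sub>m g') x = Some x" "\<And>x a. snd Y x = Some a \<Longrightarrow> (g' \<circ>\<^sub>m g) x = Some x"
  shows "is_iso (wiring C) (plain_wiring X Y f g) \<and> plain_wiring X Y f g \<in> Hom (wiring C) X Y"
proof -
  have "inverse_arrows (wiring C) (plain_wiring X Y f g) (plain_wiring Y X f' g')"
    using assms by (auto simp: inverse_arrows_def Hom_def plain_wiring_comp intro!: plain_wiring_diagram plain_wiring_cong)
  then have "is_iso (wiring C) (plain_wiring X Y f g)" unfolding is_iso_def by blast
  moreover have "plain_wiring X Y f g \<in> wiring_diagrams C" by (rule plain_wiring_diagram[OF assms(1-4)])
  ultimately show ?thesis by (simp add: Hom_def)
qed

lemma reassoc_simps [simp]: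
  "reassoc (InL z) = copair inl (inr \<circ>\<^sub>m inl) z" "reassoc (InR z) = Some (InR (InR z))"
  "unassoc (InR z) = copair (inl \<circ>\<^sub>m inr) inr z" "unassoc (InL z) = Some (InL (InL z))"
  by (simp_all add: reassoc_def unassoc_def inl_def inr_def)

lemma inl_comp [simp]: "(f \<circ>\<^sub>m inl) x = f (InL x)" "(f \<circ>\<^sub>m inr) x = f (InR x)"
  by (simp_all add: inl_def inr_def)

lemma inl_app: "inl x = Some (InL x)" "inr x = Some (InR x)"
  by (simp_all add: inl_def inr_def)

lemma comp_inl [simp]: "(inl \<circ>\<^sub>m f) x = map_option InL (f x)" "(inr \<circ>\<^sub>m f) x = map_option InR (f x)"
  by (simp_all add: map_comp_def inl_def inr_def split: option.split)

lemma respects_reassoc: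
  "respects_types (typed_sum (typed_sum X Y) Z) (typed_sum X (typed_sum Y Z)) reassoc"
  "respects_types (typed_sum X (typed_sum Y Z)) (typed_sum (typed_sum X Y) Z) unassoc"
  by (auto simp: respects_types_def typed_sum_eq_Some inl_app)

lemmas wiring_unfold = wiring_comp_eq wiring_sum_def plain_wiring_def map_comp_def restrict_map_def
  dom_def inl_app

text \<open>All structural arrows are plain wirings, so the coherence laws reduce by
  \<open>plain_wiring_sum\<close> and \<open>plain_wiring_comp\<close> to label maps on occupied
  labels. Only functoriality of the tensor and naturality involve general diagrams and hence
  feedback; there each label is traced by cases.\<close>

theorem wiring_symmetric_monoidal: "symmetric_monoidal (wiring C :: (('l, 'o) box, ('l, 'o) wiring_diagram) monoidal_category)"
  unfolding symmetric_monoidal_def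
proof (intro conjI ballI)
  let ?W = "wiring C :: (('l, 'o) box, ('l, 'o) wiring_diagram) monoidal_category"
  show "is_category ?W" by (rule wiring_category)
  show "is_functor (?W \<times>\<^sub>C ?W) ?W (Tensor ?W)"
    unfolding is_functor_def
  proof (intro conjI ballI impI)
    fix f g assume "f \<in> Arr (?W \<times>\<^sub>C ?W)" "g \<in> Arr (?W \<times>\<^sub>C ?W)" "Dom (?W \<times>\<^sub>C ?W) g = Cod (?W \<times>\<^sub>C ?W) f"
    then obtain X Y i out Z i' out' X2 Y2 i2 out2 Z2 i2' out2' where
      eq: "f = ((X, Y, i, out), (X2, Y2, i2, out2))" "g = ((Y, Z, i', out'), (Y2, Z2, i2', out2'))"
      and a: "(X, Y, i, out) \<in> wiring_diagrams C" "(X2, Y2, i2, out2) \<in> wiring_diagrams C"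
        "(Y, Z, i', out') \<in> wiring_diagrams C" "(Y2, Z2, i2', out2') \<in> wiring_diagrams C"
      by (auto simp: prod_category_def)
    have [simp]: "map_option f (case x of None \<Rightarrow> None | Some y \<Rightarrow> g y) = (case x of None \<Rightarrow> None | Some y \<Rightarrow> map_option f (g y))" for f g and x :: "'x option"
      by (cases x) auto
    \<comment> \<open>Feedback never crosses between the two summands, so substitution can be
      carried out before or after the summands are joined.\<close>
    have 1: "interchange \<circ>\<^sub>m sum_map (plug out i' \<circ>\<^sub>m i) (plug out2 i2' \<circ>\<^sub>m i2) =
      plug (sum_map out out2) (interchange \<circ>\<^sub>m sum_map i' i2') \<circ>\<^sub>m (interchange \<circ>\<^sub>m sum_map i i2)"
    proof (rule label_ext)
      fix z
      show "(interchange \<circ>\<^sub>m sum_map (plug out i' \<circ>\<^sub>m i) (plug out2 i2' \<circ>\<^sub>m i2)) (InL z) =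
        (plug (sum_map out out2) (interchange \<circ>\<^sub>m sum_map i' i2') \<circ>\<^sub>m (interchange \<circ>\<^sub>m sum_map i i2)) (InL z)"
      proof (cases "i z")
        case (Some w)
        show ?thesis
        proof (cases w)
          case (InR y)
          show ?thesis
          proof (cases "i' y")
            case (Some v) then show ?thesis using \<open>i z = Some w\<close> InR
              by (cases v) (auto simp: map_comp_def inl_app split: option.split)
          qed (simp add: Some InR map_comp_def inl_app)
        qed (simp_all add: Some map_comp_def inl_app)
      qed (simp add: map_comp_def)
      show "(interchange \<circ>\<^sub>m sum_map (plug out i' \<circ>\<^sub>m i) (plug out2 i2' \<circ>\<^sub>m i2)) (InR z) =
        (plug (sum_map out out2) (interchange \<circ>\<^sub>m sum_map i' i2') \<circ>\<^sub>m (interchange \<circ>\<^sub>m sum_map i i2)) (InR z)"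
      proof (cases "i2 z")
        case (Some w)
        show ?thesis
        proof (cases w)
          case (InR y)
          show ?thesis
          proof (cases "i2' y")
            case (Some v) then show ?thesis using \<open>i2 z = Some w\<close> InR
              by (cases v) (auto simp: map_comp_def inl_app split: option.split)
          qed (simp add: Some InR map_comp_def inl_app)
        qed (simp_all add: Some map_comp_def inl_app)
      qed (simp add: map_comp_def)
    qed (simp add: map_comp_def)
    have 2: "sum_map (out \<circ>\<^sub>m out') (out2 \<circ>\<^sub>m out2') x = (sum_map out out2 \<circ>\<^sub>m sum_map out' out2') x" for x
      by (cases x) (auto simp: map_comp_def split: option.split)
    show "AM (Tensor ?W) (g \<cdot>\<^bsub>?W \<times>\<^sub>C ?W\<^esub> f) = AM (Tensor ?W) g \<cdot>\<^bsub>?W\<^esub> AM (Tensor ?W) f"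
      using 1 2 by (simp add: eq prod_category_def wiring_comp_eq wiring_sum_def fun_eq_iff)
  next
    fix a assume "a \<in> Obj (?W \<times>\<^sub>C ?W)"
    then obtain X Y where a: "a = (X, Y)" by (cases a)
    show "AM (Tensor ?W) (Ident (?W \<times>\<^sub>C ?W) a) = Ident ?W (OM (Tensor ?W) a)"
      by (simp add: a prod_category_def plain_wiring_sum)
        (intro plain_wiring_cong; auto simp: dom_typed_sum)
  qed (auto simp: prod_category_def Hom_def wiring_sum_diagram mem_Times_iff)
  show "Unit ?W \<in> Obj ?W" by (simp add: empty_box_def)
  {
    fix x y z assume o: "x \<in> Obj ?W" "y \<in> Obj ?W" "z \<in> Obj ?W"
    have "is_iso ?W (Assoc ?W x y z) \<and> Assoc ?W x y z \<in> Hom ?W (box_sum (box_sum x y) z) (box_sum x (box_sum y z))"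
      unfolding wiring_simps
      by (rule plain_wiring_iso[where f' = unassoc and g' = reassoc])
        (use o in \<open>auto simp: mem_Times_iff respects_reassoc typed_sum_eq_Some inl_app map_comp_def\<close>)
    then show "is_iso ?W (Assoc ?W x y z)" "Assoc ?W x y z \<in> Hom ?W ((x \<oplus>\<^bsub>?W\<^esub> y) \<oplus>\<^bsub>?W\<^esub> z) (x \<oplus>\<^bsub>?W\<^esub> (y \<oplus>\<^bsub>?W\<^esub> z))"
      by simp_all
  }
  {
    fix x assume o: "x \<in> Obj ?W"
    have "is_iso ?W (LUnit ?W x) \<and> LUnit ?W x \<in> Hom ?W (box_sum empty_box x) x"
      unfolding wiring_simps
      by (rule plain_wiring_iso[where f' = inr and g' = "copair Map.empty Some"])
        (use o in \<open>auto simp: mem_Times_iff typed_sum_eq_Some inl_app map_comp_def intro: respects_types_intros\<close>)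
    then show "is_iso ?W (LUnit ?W x)" "LUnit ?W x \<in> Hom ?W (Unit ?W \<oplus>\<^bsub>?W\<^esub> x) x" by simp_all
    have "is_iso ?W (RUnit ?W x) \<and> RUnit ?W x \<in> Hom ?W (box_sum x empty_box) x"
      unfolding wiring_simps
      by (rule plain_wiring_iso[where f' = inl and g' = "copair Some Map.empty"])
        (use o in \<open>auto simp: mem_Times_iff typed_sum_eq_Some inl_app map_comp_def intro: respects_types_intros\<close>)
    then show "is_iso ?W (RUnit ?W x)" "RUnit ?W x \<in> Hom ?W (x \<oplus>\<^bsub>?W\<^esub> Unit ?W) x" by simp_all
  }
  {
    fix x y assume o: "x \<in> Obj ?W" "y \<in> Obj ?W"
    have "is_iso ?W (Braid ?W x y) \<and> Braid ?W x y \<in> Hom ?W (box_sum x y) (box_sum y x)"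
      unfolding wiring_simps
      by (rule plain_wiring_iso[where f' = "copair inr inl" and g' = "copair inr inl"])
        (use o in \<open>auto simp: mem_Times_iff typed_sum_eq_Some inl_app map_comp_def intro: respects_types_intros\<close>)
    then show "is_iso ?W (Braid ?W x y)" "Braid ?W x y \<in> Hom ?W (x \<oplus>\<^bsub>?W\<^esub> y) (y \<oplus>\<^bsub>?W\<^esub> x)" by simp_all
    have "wiring_comp (plain_wiring (box_sum y x) (box_sum x y) (copair inr inl) (copair inr inl))
        (plain_wiring (box_sum x y) (box_sum y x) (copair inr inl) (copair inr inl)) =
      plain_wiring (box_sum x y) (box_sum x y) Some Some"
      by (subst plain_wiring_comp) (auto simp: typed_sum_eq_Some inl_app map_comp_def intro: respects_types_intros intro!: plain_wiring_cong)
    then show "Braid ?W y x \<cdot>\<^bsub>?W\<^esub> Braid ?W x y = Ident ?W (x \<oplus>\<^bsub>?W\<^esub> y)" by simp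
    have "wiring_comp (wiring_sum (plain_wiring x x Some Some) (plain_wiring (box_sum empty_box y) y (copair Map.empty Some) inr))
        (plain_wiring (box_sum (box_sum x empty_box) y) (box_sum x (box_sum empty_box y)) reassoc unassoc) =
      wiring_sum (plain_wiring (box_sum x empty_box) x (copair Some Map.empty) inl) (plain_wiring y y Some Some)"
      unfolding plain_wiring_sum
      by (subst plain_wiring_comp) (auto simp: typed_sum_eq_Some inl_app map_comp_def respects_reassoc intro!: respects_types_intros plain_wiring_cong)
    then show "(Ident ?W x \<otimes>\<^bsub>?W\<^esub> LUnit ?W y) \<cdot>\<^bsub>?W\<^esub> Assoc ?W x (Unit ?W) y = RUnit ?W x \<otimes>\<^bsub>?W\<^esub> Ident ?W y" by simp
  }
  {
    fix f g h assume fgh: "f \<in> Arr ?W" "g \<in> Arr ?W" "h \<in> Arr ?W"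
    obtain X Y i out X2 Y2 i2 out2 X3 Y3 i3 out3 where
      eq: "f = (X, Y, i, out)" "g = (X2, Y2, i2, out2)" "h = (X3, Y3, i3, out3)" by (metis prod_cases4)
    note a = fgh[unfolded eq wiring_simps wiring_diagrams_iff]
    note ci = a(1)[THEN conjunct2, THEN conjunct2, THEN conjunct2, THEN conjunct2, THEN conjunct1, THEN typed_in_cases]
      a(2)[THEN conjunct2, THEN conjunct2, THEN conjunct2, THEN conjunct2, THEN conjunct1, THEN typed_in_cases]
      a(3)[THEN conjunct2, THEN conjunct2, THEN conjunct2, THEN conjunct2, THEN conjunct1, THEN typed_in_cases]
    note co = a(1)[THEN conjunct2, THEN conjunct2, THEN conjunct2, THEN conjunct2, THEN conjunct2, THEN typed_out_cases]
      a(2)[THEN conjunct2, THEN conjunct2, THEN conjunct2, THEN conjunct2, THEN conjunct2, THEN typed_out_cases]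
      a(3)[THEN conjunct2, THEN conjunct2, THEN conjunct2, THEN conjunct2, THEN conjunct2, THEN typed_out_cases]
    let ?L = "wiring_comp (plain_wiring (box_sum (box_sum Y Y2) Y3) (box_sum Y (box_sum Y2 Y3)) reassoc unassoc) (wiring_sum (wiring_sum f g) h)"
    let ?R = "wiring_comp (wiring_sum f (wiring_sum g h)) (plain_wiring (box_sum (box_sum X X2) X3) (box_sum X (box_sum X2 X3)) reassoc unassoc)"
    have "fst (snd (snd ?L)) (InL (InL x)) = fst (snd (snd ?R)) (InL (InL x))" for x
      using ci(1)[of x] by (elim disjE exE conjE) (simp_all add: eq wiring_unfold)
    moreover have "fst (snd (snd ?L)) (InL (InR x)) = fst (snd (snd ?R)) (InL (InR x))" for x
      using ci(2)[of x] by (elim disjE exE conjE) (simp_all add: eq wiring_unfold)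
    moreover have "fst (snd (snd ?L)) (InR x) = fst (snd (snd ?R)) (InR x)" for x
      using ci(3)[of x] by (elim disjE exE conjE) (simp_all add: eq wiring_unfold)
    moreover have "fst (snd (snd ?L)) (Port p) = fst (snd (snd ?R)) (Port p)"
      "fst (snd (snd ?L)) (InL (Port p)) = fst (snd (snd ?R)) (InL (Port p))" for p
      by (simp_all add: eq wiring_unfold)
    ultimately have 1: "fst (snd (snd ?L)) = fst (snd (snd ?R))" by (rule label_ext_left)
    have "snd (snd (snd ?L)) (InL x) = snd (snd (snd ?R)) (InL x)" for x
      using co(1)[of x] by (elim disjE exE conjE) (simp_all add: eq wiring_unfold)
    moreover have "snd (snd (snd ?L)) (InR (InL x)) = snd (snd (snd ?R)) (InR (InL x))" for x
      using co(2)[of x] by (elim disjE exE conjE) (simp_all add: eq wiring_unfold)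
    moreover have "snd (snd (snd ?L)) (InR (InR x)) = snd (snd (snd ?R)) (InR (InR x))" for x
      using co(3)[of x] by (elim disjE exE conjE) (simp_all add: eq wiring_unfold)
    moreover have "snd (snd (snd ?L)) (Port p) = snd (snd (snd ?R)) (Port p)"
      "snd (snd (snd ?L)) (InR (Port p)) = snd (snd (snd ?R)) (InR (Port p))" for p
      by (simp_all add: eq wiring_unfold)
    ultimately have 2: "snd (snd (snd ?L)) = snd (snd (snd ?R))" by (rule label_ext_right)
    have "?L = ?R" using 1 2 by (auto simp: prod_eq_iff fun_eq_iff eq)
    then show "Assoc ?W (Cod ?W f) (Cod ?W g) (Cod ?W h) \<cdot>\<^bsub>?W\<^esub> ((f \<otimes>\<^bsub>?W\<^esub> g) \<otimes>\<^bsub>?W\<^esub> h) =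
      (f \<otimes>\<^bsub>?W\<^esub> (g \<otimes>\<^bsub>?W\<^esub> h)) \<cdot>\<^bsub>?W\<^esub> Assoc ?W (Dom ?W f) (Dom ?W g) (Dom ?W h)" by (simp add: eq)

    let ?L = "wiring_comp (plain_wiring (box_sum Y Y2) (box_sum Y2 Y) (copair inr inl) (copair inr inl)) (wiring_sum f g)"
    let ?R = "wiring_comp (wiring_sum g f) (plain_wiring (box_sum X X2) (box_sum X2 X) (copair inr inl) (copair inr inl))"
    have "fst (snd (snd ?L)) (InL x) = fst (snd (snd ?R)) (InL x)" for x
      using ci(1)[of x] by (elim disjE exE conjE) (simp_all add: eq wiring_unfold)
    moreover have "fst (snd (snd ?L)) (InR x) = fst (snd (snd ?R)) (InR x)" for x
      using ci(2)[of x] by (elim disjE exE conjE) (simp_all add: eq wiring_unfold)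
    moreover have "fst (snd (snd ?L)) (Port p) = fst (snd (snd ?R)) (Port p)" for p
      by (simp_all add: eq wiring_unfold)
    ultimately have 1: "fst (snd (snd ?L)) = fst (snd (snd ?R))" by (rule label_ext)
    have "snd (snd (snd ?L)) (InL x) = snd (snd (snd ?R)) (InL x)" for x
      using co(2)[of x] by (elim disjE exE conjE) (simp_all add: eq wiring_unfold)
    moreover have "snd (snd (snd ?L)) (InR x) = snd (snd (snd ?R)) (InR x)" for x
      using co(1)[of x] by (elim disjE exE conjE) (simp_all add: eq wiring_unfold)
    moreover have "snd (snd (snd ?L)) (Port p) = snd (snd (snd ?R)) (Port p)" for p
      by (simp_all add: eq wiring_unfold)
    ultimately have 2: "snd (snd (snd ?L)) = snd (snd (snd ?R))" by (rule label_ext)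
    have "?L = ?R" using 1 2 by (auto simp: prod_eq_iff fun_eq_iff eq)
    then show "Braid ?W (Cod ?W f) (Cod ?W g) \<cdot>\<^bsub>?W\<^esub> (f \<otimes>\<^bsub>?W\<^esub> g) =
      (g \<otimes>\<^bsub>?W\<^esub> f) \<cdot>\<^bsub>?W\<^esub> Braid ?W (Dom ?W f) (Dom ?W g)" by (simp add: eq)

    let ?L = "wiring_comp (plain_wiring (box_sum empty_box Y) Y (copair Map.empty Some) inr) (wiring_sum (plain_wiring empty_box empty_box Some Some) f)"
    let ?R = "wiring_comp f (plain_wiring (box_sum empty_box X) X (copair Map.empty Some) inr)"
    have "fst (snd (snd ?L)) (InL x) = fst (snd (snd ?R)) (InL x)" for x
      by (simp add: eq wiring_unfold)
    moreover have "fst (snd (snd ?L)) (InR x) = fst (snd (snd ?R)) (InR x)" for x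
      using ci(1)[of x] by (elim disjE exE conjE) (simp_all add: eq wiring_unfold)
    moreover have "fst (snd (snd ?L)) (Port p) = fst (snd (snd ?R)) (Port p)" for p
      by (simp add: eq wiring_unfold)
    ultimately have 1: "fst (snd (snd ?L)) = fst (snd (snd ?R))" by (rule label_ext)
    have 2: "snd (snd (snd ?L)) x = snd (snd (snd ?R)) x" for x
      using co(1)[of x] by (elim disjE exE conjE) (simp_all add: eq wiring_unfold)
    have "?L = ?R" using 1 2 by (auto simp: prod_eq_iff fun_eq_iff eq)
    then show "LUnit ?W (Cod ?W f) \<cdot>\<^bsub>?W\<^esub> (Ident ?W (Unit ?W) \<otimes>\<^bsub>?W\<^esub> f) = f \<cdot>\<^bsub>?W\<^esub> LUnit ?W (Dom ?W f)" by (simp add: eq)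

    let ?L = "wiring_comp (plain_wiring (box_sum Y empty_box) Y (copair Some Map.empty) inl) (wiring_sum f (plain_wiring empty_box empty_box Some Some))"
    let ?R = "wiring_comp f (plain_wiring (box_sum X empty_box) X (copair Some Map.empty) inl)"
    have "fst (snd (snd ?L)) (InL x) = fst (snd (snd ?R)) (InL x)" for x
      using ci(1)[of x] by (elim disjE exE conjE) (simp_all add: eq wiring_unfold)
    moreover have "fst (snd (snd ?L)) (InR x) = fst (snd (snd ?R)) (InR x)" for x
      by (simp add: eq wiring_unfold)
    moreover have "fst (snd (snd ?L)) (Port p) = fst (snd (snd ?R)) (Port p)" for p
      by (simp add: eq wiring_unfold)
    ultimately have 1: "fst (snd (snd ?L)) = fst (snd (snd ?R))" by (rule label_ext)
    have 2: "snd (snd (snd ?L)) x = snd (snd (snd ?R)) x" for x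
      using co(1)[of x] by (elim disjE exE conjE) (simp_all add: eq wiring_unfold)
    have "?L = ?R" using 1 2 by (auto simp: prod_eq_iff fun_eq_iff eq)
    then show "RUnit ?W (Cod ?W f) \<cdot>\<^bsub>?W\<^esub> (f \<otimes>\<^bsub>?W\<^esub> Ident ?W (Unit ?W)) = f \<cdot>\<^bsub>?W\<^esub> RUnit ?W (Dom ?W f)" by (simp add: eq)
  }
  {
    fix w x y z :: "('l, 'o) box"
    have r1: "respects_types (typed_sum (typed_sum (typed_sum W X) Y) Z) (typed_sum W (typed_sum (typed_sum X Y) Z))
        (reassoc \<circ>\<^sub>m sum_map reassoc Some)" for W X Y Z :: "('l, 'o) typed_set"
      by (rule respects_types_comp[OF respects_reassoc(1)]) (intro respects_types_intros respects_reassoc)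
    have r2: "respects_types (typed_sum (typed_sum X Y) Z) (typed_sum (typed_sum Y Z) X)
        (copair inr inl \<circ>\<^sub>m reassoc)" for X Y Z :: "('l, 'o) typed_set"
      by (rule respects_types_comp[OF _ respects_reassoc(1)]) (intro respects_types_intros)
    have r3: "respects_types (typed_sum (typed_sum X Y) Z) (typed_sum Y (typed_sum X Z))
        (reassoc \<circ>\<^sub>m sum_map (copair inr inl) Some)" for X Y Z :: "('l, 'o) typed_set"
      by (rule respects_types_comp[OF respects_reassoc(1)]) (intro respects_types_intros)
    have "wiring_comp (plain_wiring (box_sum (box_sum w x) (box_sum y z)) (box_sum w (box_sum x (box_sum y z))) reassoc unassoc)
        (plain_wiring (box_sum (box_sum (box_sum w x) y) z) (box_sum (box_sum w x) (box_sum y z)) reassoc unassoc) =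
      wiring_comp (wiring_sum (plain_wiring w w Some Some) (plain_wiring (box_sum (box_sum x y) z) (box_sum x (box_sum y z)) reassoc unassoc))
       (wiring_comp (plain_wiring (box_sum (box_sum w (box_sum x y)) z) (box_sum w (box_sum (box_sum x y) z)) reassoc unassoc)
          (wiring_sum (plain_wiring (box_sum (box_sum w x) y) (box_sum w (box_sum x y)) reassoc unassoc) (plain_wiring z z Some Some)))"
      by (simp add: plain_wiring_sum plain_wiring_comp respects_reassoc respects_types_intros r1)
        (auto simp: typed_sum_eq_Some inl_app map_comp_def intro!: plain_wiring_cong)
    then show "Assoc ?W w x (y \<oplus>\<^bsub>?W\<^esub> z) \<cdot>\<^bsub>?W\<^esub> Assoc ?W (w \<oplus>\<^bsub>?W\<^esub> x) y z =
        (Ident ?W w \<otimes>\<^bsub>?W\<^esub> Assoc ?W x y z) \<cdot>\<^bsub>?W\<^esub>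
          (Assoc ?W w (x \<oplus>\<^bsub>?W\<^esub> y) z \<cdot>\<^bsub>?W\<^esub> (Assoc ?W w x y \<otimes>\<^bsub>?W\<^esub> Ident ?W z))" by simp
    have "wiring_comp (plain_wiring (box_sum (box_sum y z) x) (box_sum y (box_sum z x)) reassoc unassoc)
       (wiring_comp (plain_wiring (box_sum x (box_sum y z)) (box_sum (box_sum y z) x) (copair inr inl) (copair inr inl))
         (plain_wiring (box_sum (box_sum x y) z) (box_sum x (box_sum y z)) reassoc unassoc)) =
      wiring_comp (wiring_sum (plain_wiring y y Some Some) (plain_wiring (box_sum x z) (box_sum z x) (copair inr inl) (copair inr inl)))
       (wiring_comp (plain_wiring (box_sum (box_sum y x) z) (box_sum y (box_sum x z)) reassoc unassoc)
          (wiring_sum (plain_wiring (box_sum x y) (box_sum y x) (copair inr inl) (copair inr inl)) (plain_wiring z z Some Some)))"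
      by (simp add: plain_wiring_sum plain_wiring_comp respects_reassoc respects_types_intros r2 r3)
        (auto simp: typed_sum_eq_Some inl_app map_comp_def intro!: plain_wiring_cong)
    then show "Assoc ?W y z x \<cdot>\<^bsub>?W\<^esub> (Braid ?W x (y \<oplus>\<^bsub>?W\<^esub> z) \<cdot>\<^bsub>?W\<^esub> Assoc ?W x y z) =
        (Ident ?W y \<otimes>\<^bsub>?W\<^esub> Braid ?W x z) \<cdot>\<^bsub>?W\<^esub>
          (Assoc ?W y x z \<cdot>\<^bsub>?W\<^esub> (Braid ?W x y \<otimes>\<^bsub>?W\<^esub> Ident ?W z))" by simp
  }
qed

section \<open>The action of a wiring diagram on a span\<close>

abbreviation win :: "('l, 'o) wiring_diagram \<Rightarrow> 'l port_map" where "win d \<equiv> fst (snd (snd d))"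
abbreviation wout :: "('l, 'o) wiring_diagram \<Rightarrow> 'l port_map" where "wout d \<equiv> snd (snd (snd d))"
abbreviation wdom :: "('l, 'o) wiring_diagram \<Rightarrow> ('l, 'o) box" where "wdom d \<equiv> fst d"
abbreviation wcod :: "('l, 'o) wiring_diagram \<Rightarrow> ('l, 'o) box" where "wcod d \<equiv> fst (snd d)"

lemma wiring_diagramD:
  assumes "d \<in> wiring_diagrams C"
  shows "fst (wdom d) \<in> typed_sets C" "snd (wdom d) \<in> typed_sets C"
    "fst (wcod d) \<in> typed_sets C" "snd (wcod d) \<in> typed_sets C"
    "typed_function (fst (wdom d)) (typed_sum (snd (wdom d)) (fst (wcod d))) (win d)"
    "typed_function (snd (wcod d)) (snd (wdom d)) (wout d)"
  using assms by (cases d; simp add: wiring_diagrams_iff)+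

context fincomplete
begin

abbreviation diagram :: "('l, 'o) wiring_diagram \<Rightarrow> bool" where "diagram d \<equiv> d \<in> wiring_diagrams C"
abbreviation Sp :: "('l, 'o) box \<Rightarrow> ('m, 'm \<times> 'm \<times> 'm) category" where "Sp X \<equiv> slice C (interface C X)"

section \<open>Maps into a product indexed by ports\<close>

context
  fixes X :: "('l, 'o) typed_set"
  assumes X: "X \<in> typed_sets C"
begin

lemma hat_cone: "is_product C (dom X) (the \<circ> X) (hat C X) (hat_pr C X)"
  unfolding hat_def hat_pr_def using X by (intro prod_cone) (auto simp: typed_sets_def dest: typed_setsD[OF X])

lemma hat_Obj [simp]: "hat C X \<in> Obj C"
  using is_productE[OF hat_cone] by blast

lemma hat_pr_simps [simp]:
  assumes "X x = Some a"
  shows "arr (hat_pr C X x)" "src (hat_pr C X x) = hat C X" "tgt (hat_pr C X x) = a"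
  using is_productE(2-)[OF hat_cone, of x] assms by auto

lemma hat_eqI:
  assumes "arr u" "arr v" "tgt u = hat C X" "tgt v = hat C X" "src u = src v"
    and "\<And>x a. X x = Some a \<Longrightarrow> hat_pr C X x ** u = hat_pr C X x ** v"
  shows "u = v"
  by (rule is_product_eqI[OF hat_cone]) (use assms in auto)

lemma hat_tuple:
  assumes "q \<in> Obj C" "\<And>x a. X x = Some a \<Longrightarrow> r x \<in> Hom C q a"
  shows "arr (hat_tuple C X q r)" "src (hat_tuple C X q r) = q" "tgt (hat_tuple C X q r) = hat C X"
    and "X x = Some a \<Longrightarrow> hat_pr C X x ** hat_tuple C X q r = r x"
proof -
  have r': "r i \<in> Hom C q ((the \<circ> X) i)" if "i \<in> dom X" for i using assms(2) that by auto
  have "finite (dom X)" using X by (simp add: typed_sets_def)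
  then have t: "hat_tuple C X q r \<in> Hom C q (hat C X)" "\<And>x. x \<in> dom X \<Longrightarrow> hat_pr C X x ** hat_tuple C X q r = r x"
    using tuple[of "dom X" r q "the \<circ> X", OF _ r' assms(1)] unfolding hat_tuple_def hat_def hat_pr_def by auto
  show "arr (hat_tuple C X q r)" "src (hat_tuple C X q r) = q" "tgt (hat_tuple C X q r) = hat C X"
    using t(1) by (auto simp: Hom_iff)
  show "X x = Some a \<Longrightarrow> hat_pr C X x ** hat_tuple C X q r = r x" using t(2) by auto
qed

end

text \<open>The projection rule carries a trailing \<open>u\<close>, as do the similar rules further
  on: in a right-nested composite two adjacent arrows in the middle do not form a subterm, so a rule
  without \<open>u\<close> would not match there.\<close>

lemma hat_map:
  assumes "X \<in> typed_sets C" "X' \<in> typed_sets C" "typed_function X X' f"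
  shows "arr (hat_map C X X' f)" "src (hat_map C X X' f) = hat C X'" "tgt (hat_map C X X' f) = hat C X"
    and "\<lbrakk>f x = Some y; arr u; tgt u = hat C X'\<rbrakk> \<Longrightarrow> hat_pr C X x ** hat_map C X X' f ** u = hat_pr C X' y ** u"
proof -
  have r: "hat_pr C X' (the (f x)) \<in> Hom C (hat C X') a" if "X x = Some a" for x a
    using typed_out_cases[OF assms(3), of x] that assms(1,2) by (auto simp: Hom_iff)
  note t = hat_tuple[OF assms(1) hat_Obj[OF assms(2)], of "\<lambda>x. hat_pr C X' (the (f x))", OF r, folded hat_map_def]
  show s: "arr (hat_map C X X' f)" "src (hat_map C X X' f) = hat C X'" "tgt (hat_map C X X' f) = hat C X"
    using t by auto
  show "hat_pr C X x ** hat_map C X X' f ** u = hat_pr C X' y ** u" if u: "f x = Some y" "arr u" "tgt u = hat C X'"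
  proof -
    obtain a where a: "X x = Some a" using typed_out_cases[OF assms(3), of x] u by auto
    have "hat_pr C X x ** hat_map C X X' f ** u = (hat_pr C X x ** hat_map C X X' f) ** u"
      using s a u assms by (simp add: hat_pr_simps[OF assms(1) a])
    then show ?thesis using t(4)[OF _ a] u by simp
  qed
qed

lemma hat_join:
  assumes "X \<in> typed_sets C" "Y \<in> typed_sets C"
  shows "arr (hat_join C X Y)" "src (hat_join C X Y) = bprod C (hat C X) (hat C Y)"
    "tgt (hat_join C X Y) = hat C (typed_sum X Y)"
    and "\<lbrakk>X x = Some a; arr u; tgt u = bprod C (hat C X) (hat C Y)\<rbrakk> \<Longrightarrow>
      hat_pr C (typed_sum X Y) (InL x) ** hat_join C X Y ** u = hat_pr C X x ** pr1 C (hat C X) (hat C Y) ** u"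
    and "\<lbrakk>Y y = Some a; arr u; tgt u = bprod C (hat C X) (hat C Y)\<rbrakk> \<Longrightarrow>
      hat_pr C (typed_sum X Y) (InR y) ** hat_join C X Y ** u = hat_pr C Y y ** pr2 C (hat C X) (hat C Y) ** u"
proof -
  let ?r = "\<lambda>z. case z of InL x \<Rightarrow> hat_pr C X x ** pr1 C (hat C X) (hat C Y) | InR y \<Rightarrow> hat_pr C Y y ** pr2 C (hat C X) (hat C Y)"
  have o: "hat C X \<in> Obj C" "hat C Y \<in> Obj C" using assms by auto
  have r: "?r z \<in> Hom C (bprod C (hat C X) (hat C Y)) a" if "typed_sum X Y z = Some a" for z a
    using that assms by (auto simp: Hom_iff typed_sum_eq_Some)
  have S: "typed_sum X Y \<in> typed_sets C" using assms by simp
  note t = hat_tuple[OF S bprod_Obj[OF o], of ?r, OF r, folded hat_join_def]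
  show s: "arr (hat_join C X Y)" "src (hat_join C X Y) = bprod C (hat C X) (hat C Y)"
    "tgt (hat_join C X Y) = hat C (typed_sum X Y)"
    using t by auto
  { assume a: "X x = Some a" and u: "arr u" "tgt u = bprod C (hat C X) (hat C Y)"
    then have a': "typed_sum X Y (InL x) = Some a" by simp
    have "hat_pr C (typed_sum X Y) (InL x) ** hat_join C X Y ** u = (hat_pr C (typed_sum X Y) (InL x) ** hat_join C X Y) ** u"
      using s u by (simp add: hat_pr_simps[OF S a'])
    then show "hat_pr C (typed_sum X Y) (InL x) ** hat_join C X Y ** u = hat_pr C X x ** pr1 C (hat C X) (hat C Y) ** u"
      using t(4)[OF _ a'] u o a assms by simp }
  { assume a: "Y y = Some a" and u: "arr u" "tgt u = bprod C (hat C X) (hat C Y)"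
    then have a': "typed_sum X Y (InR y) = Some a" by simp
    have "hat_pr C (typed_sum X Y) (InR y) ** hat_join C X Y ** u = (hat_pr C (typed_sum X Y) (InR y) ** hat_join C X Y) ** u"
      using s u by (simp add: hat_pr_simps[OF S a'])
    then show "hat_pr C (typed_sum X Y) (InR y) ** hat_join C X Y ** u = hat_pr C Y y ** pr2 C (hat C X) (hat C Y) ** u"
      using t(4)[OF _ a'] u o a assms by simp }
qed

section \<open>Spans over a box and their ports\<close>

definition is_box :: "('l, 'o) box \<Rightarrow> bool" where
  "is_box X \<longleftrightarrow> fst X \<in> typed_sets C \<and> snd X \<in> typed_sets C"

definition span :: "('l, 'o) box \<Rightarrow> 'm \<Rightarrow> bool" where
  "span X s \<longleftrightarrow> is_box X \<and> arr s \<and> tgt s = interface C X"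

definition port_in :: "('l, 'o) box \<Rightarrow> 'm \<Rightarrow> 'l label \<Rightarrow> 'm" where
  "port_in X s x = hat_pr C (fst X) x ** leg_in C X s"

definition port_out :: "('l, 'o) box \<Rightarrow> 'm \<Rightarrow> 'l label \<Rightarrow> 'm" where
  "port_out X s x = hat_pr C (snd X) x ** leg_out C X s"

lemma is_box_hat [simp]: "is_box X \<Longrightarrow> hat C (fst X) \<in> Obj C" "is_box X \<Longrightarrow> hat C (snd X) \<in> Obj C"
  by (simp_all add: is_box_def)

lemma is_box_sum [simp]: "\<lbrakk>is_box X; is_box Y\<rbrakk> \<Longrightarrow> is_box (box_sum X Y)"
  by (simp add: is_box_def)

lemma is_box_empty [simp]: "is_box empty_box"
  by (simp add: is_box_def)

lemma is_box_ends [simp]: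
  "diagram d \<Longrightarrow> is_box (wdom d)" "diagram d \<Longrightarrow> is_box (wcod d)"
  by (auto simp: is_box_def dest: wiring_diagramD)

lemma span_simps [simp]:
  assumes "span X s"
  shows "arr s" "tgt s = interface C X"
    "arr (leg_in C X s)" "src (leg_in C X s) = src s" "tgt (leg_in C X s) = hat C (fst X)"
    "arr (leg_out C X s)" "src (leg_out C X s) = src s" "tgt (leg_out C X s) = hat C (snd X)"
  using assms by (simp_all add: span_def leg_in_def leg_out_def interface_def)

lemma span_box: "span X s \<Longrightarrow> is_box X"
  by (simp only: span_def)

lemma span_iff: "is_box X \<Longrightarrow> span X s \<longleftrightarrow> s \<in> Arr C \<and> tgt s = interface C X"
  by (simp only: span_def simp_thms)

lemma span_typed_sets: "span X s \<Longrightarrow> fst X \<in> typed_sets C" "span X s \<Longrightarrow> snd X \<in> typed_sets C"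
  by (auto dest: span_box simp: is_box_def)

lemma leg_comp:
  assumes "span X s" "arr x" "tgt x = src s"
  shows "leg_in C X s ** x = pr1 C (hat C (fst X)) (hat C (snd X)) ** s ** x"
    "leg_out C X s ** x = pr2 C (hat C (fst X)) (hat C (snd X)) ** s ** x"
  using assms span_typed_sets[OF assms(1)] by (simp_all add: leg_in_def leg_out_def interface_def)

lemma port_in_simps [simp]:
  assumes "span X s" "fst X x = Some a"
  shows "arr (port_in X s x)" "src (port_in X s x) = src s" "tgt (port_in X s x) = a"
  using assms hat_pr_simps[of "fst X" x a] span_typed_sets[OF assms(1)] by (auto simp: port_in_def)

lemma port_out_simps [simp]:
  assumes "span X s" "snd X x = Some a"
  shows "arr (port_out X s x)" "src (port_out X s x) = src s" "tgt (port_out X s x) = a"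
  using assms hat_pr_simps[of "snd X" x a] span_typed_sets[OF assms(1)] by (auto simp: port_out_def)

lemma port_comp:
  assumes "span X s" "arr x" "tgt x = src s"
  shows "fst X j = Some a \<Longrightarrow> port_in X s j ** x = hat_pr C (fst X) j ** leg_in C X s ** x"
    "snd X j = Some a \<Longrightarrow> port_out X s j ** x = hat_pr C (snd X) j ** leg_out C X s ** x"
  using assms hat_pr_simps[of "fst X" j a] hat_pr_simps[of "snd X" j a] span_typed_sets[OF assms(1)]
  by (auto simp: port_in_def port_out_def)

definition span_map :: "('l, 'o) box \<Rightarrow> 'm \<Rightarrow> 'm \<Rightarrow> 'm \<Rightarrow> bool" where
  "span_map X s t h \<longleftrightarrow> span X s \<and> span X t \<and> arr h \<and> src h = src s \<and> tgt h = src t \<and> t ** h = s"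

lemma leg_eqI:
  assumes "span X s" "arr u" "arr v" "tgt u = src s" "tgt v = src s" "src u = src v"
    and "\<And>j a. fst X j = Some a \<Longrightarrow> port_in X s j ** u = port_in X s j ** v"
  shows "leg_in C X s ** u = leg_in C X s ** v"
proof -
  have *: "hat_pr C (fst X) x ** leg_in C X s ** u = hat_pr C (fst X) x ** leg_in C X s ** v" if "fst X x = Some a" for x a
    using assms(7)[OF that] that assms by (simp add: port_comp)
  show ?thesis
    by (rule hat_eqI[OF span_typed_sets(1)[OF assms(1)] _ _ _ _ _ *]) (use assms(1-6) in simp_all)
qed

text \<open>The interface is a product of two products of ports, so a map of apexes is one over the
  interface as soon as it respects each port.\<close>

lemma span_mapI:
  assumes "span X s" "span X t" "arr h" "src h = src s" "tgt h = src t"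
    and i: "\<And>j a. fst X j = Some a \<Longrightarrow> port_in X t j ** h = port_in X s j"
    and o: "\<And>j a. snd X j = Some a \<Longrightarrow> port_out X t j ** h = port_out X s j"
  shows "span_map X s t h"
proof -
  note b = span_typed_sets[OF assms(1)]
  have 1: "leg_in C X t ** h = leg_in C X s"
  proof (rule hat_eqI[OF b(1)])
    fix x a assume "fst X x = Some a"
    then show "hat_pr C (fst X) x ** leg_in C X t ** h = hat_pr C (fst X) x ** leg_in C X s"
      using i[of x a] port_comp(1)[OF assms(2,3,5)] by (simp add: port_in_def)
  qed (use assms in simp_all)
  have 2: "leg_out C X t ** h = leg_out C X s"
  proof (rule hat_eqI[OF b(2)])
    fix x a assume "snd X x = Some a"
    then show "hat_pr C (snd X) x ** leg_out C X t ** h = hat_pr C (snd X) x ** leg_out C X s"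
      using o[of x a] port_comp(2)[OF assms(2,3,5)] by (simp add: port_out_def)
  qed (use assms in simp_all)
  have "t ** h = s"
    by (rule bprod_eqI[of _ _ "hat C (fst X)" "hat C (snd X)"])
      (use assms(1-5) b leg_comp[OF assms(2,3,5)] 1 2 in \<open>simp_all add: interface_def leg_in_def leg_out_def\<close>)
  then show ?thesis using assms by (simp add: span_map_def)
qed

lemma span_map_elemI:
  assumes "span X s" "span X t" "arr h" "src h = src s" "tgt h = src t"
    and i: "\<And>j a x. \<lbrakk>fst X j = Some a; arr x; tgt x = src s\<rbrakk> \<Longrightarrow> port_in X t j ** h ** x = port_in X s j ** x"
    and o: "\<And>j a x. \<lbrakk>snd X j = Some a; arr x; tgt x = src s\<rbrakk> \<Longrightarrow> port_out X t j ** h ** x = port_out X s j ** x"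
  shows "span_map X s t h"
proof (rule span_mapI[OF assms(1-5)])
  note S = Dom_Obj[OF span_simps(1)[OF assms(1)]]
  show "port_in X t j ** h = port_in X s j" if "fst X j = Some a" for j a
    using i[OF that, of "Ident C (src s)"] S assms(1-5) that by simp
  show "port_out X t j ** h = port_out X s j" if "snd X j = Some a" for j a
    using o[OF that, of "Ident C (src s)"] S assms(1-5) that by simp
qed

lemma span_mapD:
  assumes "span_map X s t h"
  shows "span X s" "span X t" "arr h" "src h = src s" "tgt h = src t" "t ** h = s"
  using assms by (auto simp: span_map_def)

lemma span_map_leg:
  assumes "span_map X s t h" "arr x" "tgt x = src s"
  shows "leg_in C X t ** h ** x = leg_in C X s ** x" "leg_out C X t ** h ** x = leg_out C X s ** x"
proof -
  note m = span_mapD[OF assms(1)]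
  have "(t ** h) ** x = t ** h ** x" by (rule comp_assoc) (use m(1-5) assms in simp_all)
  then have e: "t ** h ** x = s ** x" by (simp only: m(6))
  have hx: "arr (h ** x)" "tgt (h ** x) = src t" using m(1-5) assms(2,3) by simp_all
  show "leg_in C X t ** h ** x = leg_in C X s ** x" "leg_out C X t ** h ** x = leg_out C X s ** x"
    unfolding leg_comp[OF m(2) hx] leg_comp[OF m(1) assms(2,3)] e by simp_all
qed

lemma span_map_port:
  assumes "span_map X s t h" "arr x" "tgt x = src s"
  shows "fst X j \<noteq> None \<Longrightarrow> port_in X t j ** h ** x = port_in X s j ** x"
    "snd X j \<noteq> None \<Longrightarrow> port_out X t j ** h ** x = port_out X s j ** x"
proof -
  note m = span_mapD[OF assms(1)]
  have hx: "arr (h ** x)" "tgt (h ** x) = src t" using m(1-5) assms(2,3) by simp_all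
  show "fst X j \<noteq> None \<Longrightarrow> port_in X t j ** h ** x = port_in X s j ** x"
    "snd X j \<noteq> None \<Longrightarrow> port_out X t j ** h ** x = port_out X s j ** x"
    using port_comp[OF m(2) hx] port_comp[OF m(1) assms(2,3)] span_map_leg[OF assms] by auto
qed

lemma span_map_slice:
  assumes "is_box X"
  shows "(s, t, h) \<in> Arr (Sp X) \<longleftrightarrow> span_map X s t h"
  unfolding span_map_def span_iff[OF assms] slice_simps Hom_iff by auto

lemma span_slice:
  assumes "is_box X"
  shows "s \<in> Obj (Sp X) \<longleftrightarrow> span X s"
  unfolding span_iff[OF assms] slice_simps ..

lemma span_map_Ident: "span X s \<Longrightarrow> span_map X s s (Ident C (src s))"
  by (auto simp: span_map_def)

lemma span_map_comp:
  assumes "span_map X s t h" "span_map X t u k"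
  shows "span_map X s u (k ** h)"
proof -
  note m = span_mapD[OF assms(1)] span_mapD[OF assms(2)]
  have "u ** k ** h = (u ** k) ** h" by (rule comp_assoc[symmetric]) (use m(1-5,7-11) in simp_all)
  then have "u ** k ** h = s" by (simp only: m(6,12))
  then show ?thesis using m(1-5,7-11) by (simp add: span_map_def)
qed

definition span_inv :: "('l, 'o) box \<Rightarrow> 'm \<Rightarrow> 'm \<Rightarrow> 'm \<Rightarrow> 'm" where
  "span_inv X s t h = underlying (inv_arr (Sp X) (s, t, h))"

text \<open>A right inverse \<open>g\<close> gives \<open>h ** g ** h = h\<close>, and injectivity
  on generalised elements cancels \<open>h\<close> on the left. Surjectivity is asked only at the
  generic element, the identity of the target.\<close>

lemma span_isoI:
  assumes m: "span_map X s t h"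
    and surj: "\<exists>g. g \<in> Arr C \<and> tgt g = src s \<and> src g = src t \<and> h ** g = Ident C (src t)"
    and inj: "\<And>x y. \<lbrakk>arr x; arr y; src x = src y; tgt x = src s; tgt y = src s;
       h ** x = h ** y\<rbrakk> \<Longrightarrow> x = y"
  shows "is_iso (Sp X) (s, t, h)"
proof -
  obtain g where g: "arr g" "tgt g = src s" "src g = src t" "h ** g = Ident C (src t)"
    using surj by blast
  note m' = span_mapD[OF m]
  have "h ** g ** h = (h ** g) ** h" using g(1-3) m' by simp
  also have "\<dots> = h ** Ident C (src s)" using m' by (simp only: g(4) Ident_comp comp_Ident)
  finally have e: "h ** g ** h = h ** Ident C (src s)" .
  have gh: "g ** h = Ident C (src s)" by (rule inj[OF _ _ _ _ _ e]) (use g(1-3) m'(1-5) in simp_all)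
  have "s ** g = (t ** h) ** g" by (simp only: m'(6))
  also have "\<dots> = t ** h ** g" using g m'(1-5) by (intro comp_assoc) auto
  also have "\<dots> = t" using span_simps(1)[OF m'(2)] by (simp only: g(4) comp_Ident)
  finally have "span_map X t s g" using g(1-3) m'(1-5) by (simp add: span_map_def)
  then have "inverse_arrows (Sp X) (s, t, h) (t, s, g)"
    using m m' g gh by (auto simp: inverse_arrows_def Hom_def[of "Sp X"] span_map_slice[OF span_box[OF m'(1)]] simp del: slice_simps(1,2))
  then show ?thesis unfolding is_iso_def by blast
qed

lemma span_inv:
  assumes m: "span_map X s t h" and iso: "is_iso (Sp X) (s, t, h)"
  shows "inv_arr (Sp X) (s, t, h) = (t, s, span_inv X s t h)"
    "span_map X t s (span_inv X s t h)"
    "\<lbrakk>arr x; tgt x = src t\<rbrakk> \<Longrightarrow> h ** span_inv X s t h ** x = x"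
    "\<lbrakk>arr x; tgt x = src s\<rbrakk> \<Longrightarrow> span_inv X s t h ** h ** x = x"
proof -
  interpret S: cat "Sp X" by unfold_locales (rule slice_category)
  note m' = span_mapD[OF m]
  have I: "inverse_arrows (Sp X) (s, t, h) (inv_arr (Sp X) (s, t, h))"
    by (rule S.inv_arr[OF iso])
  obtain a b c where abc: "inv_arr (Sp X) (s, t, h) = (a, b, c)" by (cases "inv_arr (Sp X) (s, t, h)")
  have a: "a = t" "b = s" using I unfolding abc inverse_arrows_def by (auto simp: Hom_def)
  show e: "inv_arr (Sp X) (s, t, h) = (t, s, span_inv X s t h)"
    using abc a by (simp add: span_inv_def underlying_def)
  note I' = I[unfolded e inverse_arrows_def Hom_def[of "Sp X"]]
  show k: "span_map X t s (span_inv X s t h)"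
    using I' span_map_slice[OF span_box[OF m'(1)]] by (simp del: slice_simps(2))
  note k' = span_mapD[OF k]
  have h: "h ** span_inv X s t h = Ident C (src t)" "span_inv X s t h ** h = Ident C (src s)"
    using I' by simp_all
  show "h ** span_inv X s t h ** x = x" if x: "arr x" "tgt x = src t"
  proof -
    have "h ** span_inv X s t h ** x = (h ** span_inv X s t h) ** x" using x m'(1-5) k'(1-5) by simp
    then show ?thesis using x by (simp only: h(1) Ident_comp)
  qed
  show "span_inv X s t h ** h ** x = x" if x: "arr x" "tgt x = src s"
  proof -
    have "span_inv X s t h ** h ** x = (span_inv X s t h ** h) ** x" using x m'(1-5) k'(1-5) by simp
    then show ?thesis using x by (simp only: h(2) Ident_comp)
  qed
qed

section \<open>The pullback that defines the action\<close>

abbreviation act :: "('l, 'o) wiring_diagram \<Rightarrow> 'm \<Rightarrow> 'm" where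
  "act d s \<equiv> OM (span_act C d) s"

definition act_base :: "('l, 'o) wiring_diagram \<Rightarrow> 'm" where
  "act_base d = pairing C (hat_in C d) (pr2 C (hat C (fst (wcod d))) (hat C (snd (wdom d))))"

text \<open>The projection from the states of \<open>act d s\<close> to those of \<open>s\<close>.
  Together with the outer input leg it comes to replace the two pullback legs.\<close>

definition act_pr :: "('l, 'o) wiring_diagram \<Rightarrow> 'm \<Rightarrow> 'm" where
  "act_pr d s = pb2 C (act_base d) s"

definition act_arr :: "('l, 'o) wiring_diagram \<Rightarrow> 'm \<Rightarrow> 'm \<Rightarrow> 'm \<Rightarrow> 'm" where
  "act_arr d s t h = pb_pair C (act_base d) t (pb1 C (act_base d) s) (h ** pb2 C (act_base d) s)"

lemma act_eq:
  "act d s = par C (Ident C (hat C (fst (wcod d)))) (hat_out C d) ** pb1 C (act_base d) s"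
  by (simp add: span_act_def Let_def comp_functor_def postcompose_def base_change_def act_base_def)

lemma AM_span_act: "AM (span_act C d) (s, t, h) = (act d s, act d t, act_arr d s t h)"
  by (simp add: span_act_def Let_def comp_functor_def postcompose_def base_change_def act_base_def act_arr_def)

context
  fixes d :: "('l, 'o) wiring_diagram"
  assumes wd: "diagram d"
begin

private lemmas wdD = wiring_diagramD[OF wd]

lemma hat_in:
  "arr (hat_in C d)" "src (hat_in C d) = bprod C (hat C (fst (wcod d))) (hat C (snd (wdom d)))"
  "tgt (hat_in C d) = hat C (fst (wdom d))"
  "\<lbrakk>win d j = Some (InL k); arr u; tgt u = bprod C (hat C (fst (wcod d))) (hat C (snd (wdom d)))\<rbrakk> \<Longrightarrow>
     hat_pr C (fst (wdom d)) j ** hat_in C d ** u =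
     hat_pr C (snd (wdom d)) k ** pr2 C (hat C (fst (wcod d))) (hat C (snd (wdom d))) ** u"
  "\<lbrakk>win d j = Some (InR k); arr u; tgt u = bprod C (hat C (fst (wcod d))) (hat C (snd (wdom d)))\<rbrakk> \<Longrightarrow>
     hat_pr C (fst (wdom d)) j ** hat_in C d ** u =
     hat_pr C (fst (wcod d)) k ** pr1 C (hat C (fst (wcod d))) (hat C (snd (wdom d))) ** u"
proof -
  obtain X Y i out where eq: "d = (X, Y, i, out)" by (cases d)
  note d = wdD[unfolded eq fst_conv snd_conv]
  have S: "typed_sum (snd X) (fst Y) \<in> typed_sets C" using d by simp
  have o: "hat C (fst X) \<in> Obj C" "hat C (snd X) \<in> Obj C" "hat C (fst Y) \<in> Obj C" "hat C (snd Y) \<in> Obj C"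
    using d by auto
  note j = hat_join[OF d(2,3)] and m = hat_map[OF d(1) S d(5)]
  show "arr (hat_in C d)" "src (hat_in C d) = bprod C (hat C (fst (wcod d))) (hat C (snd (wdom d)))"
    "tgt (hat_in C d) = hat C (fst (wdom d))"
    using o j(1-3) m(1-3) by (simp_all add: hat_in_def eq)
  { fix j k u assume k: "win d j = Some (InL k)" and u: "arr u" "tgt u = bprod C (hat C (fst (wcod d))) (hat C (snd (wdom d)))"
    obtain a b where a: "snd X k = Some a" "fst X j = Some b" using typed_in_cases[OF d(5), of j] k by (auto simp: eq)
    show "hat_pr C (fst (wdom d)) j ** hat_in C d ** u =
     hat_pr C (snd (wdom d)) k ** pr2 C (hat C (fst (wcod d))) (hat C (snd (wdom d))) ** u"
      using u k o a \<open>hat C (fst X) \<in> Obj C\<close> by (simp add: hat_in_def eq hat_join[OF d(2,3)] m hat_pr_simps[OF d(1)] hat_pr_simps[OF d(2)]) }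
  { fix j k u assume k: "win d j = Some (InR k)" and u: "arr u" "tgt u = bprod C (hat C (fst (wcod d))) (hat C (snd (wdom d)))"
    obtain a b where a: "fst Y k = Some a" "fst X j = Some b" using typed_in_cases[OF d(5), of j] k by (auto simp: eq)
    show "hat_pr C (fst (wdom d)) j ** hat_in C d ** u =
     hat_pr C (fst (wcod d)) k ** pr1 C (hat C (fst (wcod d))) (hat C (snd (wdom d))) ** u"
      using u k o a by (simp add: hat_in_def eq hat_join[OF d(2,3)] m hat_pr_simps[OF d(1)] hat_pr_simps[OF d(3)]) }
qed

lemma hat_out:
  "arr (hat_out C d)" "src (hat_out C d) = hat C (snd (wdom d))" "tgt (hat_out C d) = hat C (snd (wcod d))"
  "\<lbrakk>wout d j = Some k; arr u; tgt u = hat C (snd (wdom d))\<rbrakk> \<Longrightarrow>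
    hat_pr C (snd (wcod d)) j ** hat_out C d ** u = hat_pr C (snd (wdom d)) k ** u"
  using hat_map[OF wdD(4) wdD(2) wdD(6)] unfolding hat_out_def by (cases d; simp)+

context
  fixes s
  assumes s: "span (wdom d) s"
begin

private lemma o: "hat C (fst (wdom d)) \<in> Obj C" "hat C (snd (wdom d)) \<in> Obj C"
    "hat C (fst (wcod d)) \<in> Obj C" "hat C (snd (wcod d)) \<in> Obj C"
  using wdD by simp_all

private lemma base: "arr (act_base d)" "src (act_base d) = bprod C (hat C (fst (wcod d))) (hat C (snd (wdom d)))"
   "tgt (act_base d) = tgt s"
  using hat_in o s by (simp_all add: act_base_def interface_def)

private lemmas pb = pb_simps[OF base(1) span_simps(1)[OF s] base(3)]

lemma act_Arr: "arr (act d s)" "src (act d s) = src (pb1 C (act_base d) s)" "tgt (act d s) = interface C (wcod d)"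
  using hat_out(1-3) base pb o by (simp_all add: act_eq interface_def del: par_simps(4))

lemma span_act0: "span (wcod d) (act d s)"
  unfolding span_def using act_Arr wdD by (simp add: is_box_def)

lemma act_pr_simps [simp]:
  "arr (act_pr d s)" "src (act_pr d s) = src (act d s)" "tgt (act_pr d s) = src s"
  using pb by (simp_all add: act_pr_def act_Arr)

text \<open>The pullback square split along the two projections of the interface: the first leg of
  the pullback has as components the outer input and the output of \<open>s\<close>, and
  \<open>hat_in\<close> turns this pair into the input of \<open>s\<close>.\<close>

lemma act_legs:
  assumes "arr x" "tgt x = src (act d s)"
  shows "leg_out C (wdom d) s ** act_pr d s ** x =
      pr2 C (hat C (fst (wcod d))) (hat C (snd (wdom d))) ** pb1 C (act_base d) s ** x"
    "leg_in C (wdom d) s ** act_pr d s ** x = hat_in C d ** pb1 C (act_base d) s ** x"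
    "leg_in C (wcod d) (act d s) ** x = pr1 C (hat C (fst (wcod d))) (hat C (snd (wdom d))) ** pb1 C (act_base d) s ** x"
    "leg_out C (wcod d) (act d s) ** x = hat_out C d ** leg_out C (wdom d) s ** act_pr d s ** x"
proof -
  have x: "arr x" "tgt x = src (pb1 C (act_base d) s)" using assms act_Arr by simp_all
  have c: "s ** act_pr d s ** x = act_base d ** pb1 C (act_base d) s ** x"
    unfolding act_pr_def using pb_commute[OF base(1) span_simps(1)[OF s] base(3) x] by simp
  have px: "arr (act_pr d s ** x)" "tgt (act_pr d s ** x) = src s" using assms by simp_all
  show 1: "leg_out C (wdom d) s ** act_pr d s ** x =
      pr2 C (hat C (fst (wcod d))) (hat C (snd (wdom d))) ** pb1 C (act_base d) s ** x"
    "leg_in C (wdom d) s ** act_pr d s ** x = hat_in C d ** pb1 C (act_base d) s ** x"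
    using x pb o hat_in(1-3) base unfolding leg_comp[OF s px] c by (simp_all add: act_base_def)
  show "leg_in C (wcod d) (act d s) ** x = pr1 C (hat C (fst (wcod d))) (hat C (snd (wdom d))) ** pb1 C (act_base d) s ** x"
    "leg_out C (wcod d) (act d s) ** x = hat_out C d ** leg_out C (wdom d) s ** act_pr d s ** x"
    unfolding leg_comp[OF span_act0 assms] 1 unfolding act_eq using x pb o hat_out(1-3) base by simp_all
qed

lemma act_ports0:
  assumes x: "arr x" "tgt x = src (act d s)"
  shows "win d j = Some (InL k) \<Longrightarrow> port_in (wdom d) s j ** act_pr d s ** x = port_out (wdom d) s k ** act_pr d s ** x"
    "win d j = Some (InR k) \<Longrightarrow> port_in (wdom d) s j ** act_pr d s ** x = port_in (wcod d) (act d s) k ** x"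
    "wout d j = Some k \<Longrightarrow> port_out (wcod d) (act d s) j ** x = port_out (wdom d) s k ** act_pr d s ** x"
proof -
  have px: "arr (act_pr d s ** x)" "tgt (act_pr d s ** x) = src s" using x by simp_all
  have u: "arr (pb1 C (act_base d) s ** x)"
    "tgt (pb1 C (act_base d) s ** x) = bprod C (hat C (fst (wcod d))) (hat C (snd (wdom d)))"
    using x pb act_Arr base by simp_all
  { assume j: "win d j = Some (InL k)"
    obtain a where a: "fst (wdom d) j = Some a" "snd (wdom d) k = Some a" using typed_in_cases[OF wdD(5), of j] j by auto
    show "port_in (wdom d) s j ** act_pr d s ** x = port_out (wdom d) s k ** act_pr d s ** x"
      unfolding port_comp(1)[OF s px a(1)] port_comp(2)[OF s px a(2)] act_legs[OF x]
      by (rule hat_in(4)[OF j u]) }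
  { assume j: "win d j = Some (InR k)"
    obtain a where a: "fst (wdom d) j = Some a" "fst (wcod d) k = Some a" using typed_in_cases[OF wdD(5), of j] j by auto
    show "port_in (wdom d) s j ** act_pr d s ** x = port_in (wcod d) (act d s) k ** x"
      unfolding port_comp(1)[OF s px a(1)] port_comp(1)[OF span_act0 x a(2)] act_legs[OF x]
      by (rule hat_in(5)[OF j u]) }
  { assume j: "wout d j = Some k"
    obtain a where a: "snd (wcod d) j = Some a" "snd (wdom d) k = Some a" using typed_out_cases[OF wdD(6), of j] j by auto
    show "port_out (wcod d) (act d s) j ** x = port_out (wdom d) s k ** act_pr d s ** x"
      unfolding port_comp(2)[OF s px a(2)] port_comp(2)[OF span_act0 x a(1)] act_legs(4)[OF x]
      by (rule hat_out(4)[OF j]) (use px s in simp_all) }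
qed

text \<open>The first pullback leg is determined by its two components: the outer input, equal by
  assumption, and the output of \<open>s\<close>, a function of \<open>act_pr\<close>.\<close>

lemma act_leg_eqI:
  assumes "arr x" "arr y" "tgt x = src (act d s)" "tgt y = src (act d s)" "src x = src y"
    and "act_pr d s ** x = act_pr d s ** y"
    and "leg_in C (wcod d) (act d s) ** x = leg_in C (wcod d) (act d s) ** y"
  shows "x = y"
proof (rule pb_eqI[OF base(1) span_simps(1)[OF s] base(3)])
  show "pb1 C (act_base d) s ** x = pb1 C (act_base d) s ** y"
    by (rule bprod_eqI[of _ _ "hat C (fst (wcod d))" "hat C (snd (wdom d))"])
      (use assms pb act_Arr base o act_legs[OF assms(1,3)] act_legs[OF assms(2,4)] in simp_all)
qed (use assms act_Arr in \<open>simp_all add: act_pr_def\<close>)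

lemma act_eqI:
  assumes "arr x" "arr y" "tgt x = src (act d s)" "tgt y = src (act d s)" "src x = src y"
    and "act_pr d s ** x = act_pr d s ** y"
    and "\<And>j a. fst (wcod d) j = Some a \<Longrightarrow> port_in (wcod d) (act d s) j ** x = port_in (wcod d) (act d s) j ** y"
  shows "x = y"
  by (rule act_leg_eqI[OF assms(1-6)]) (rule leg_eqI[OF span_act0 assms(1-5) assms(7)])

text \<open>The point of the base is the pair of the outer input \<open>y\<close> and the output of
  \<sigma>; the hypothesis on \<open>leg_in\<close> says exactly that its image in the interface
  agrees with that of \<sigma>.\<close>

lemma act_leg_elem:
  assumes "arr \<sigma>" "tgt \<sigma> = src s" "arr y" "tgt y = hat C (fst (wcod d))" "src y = src \<sigma>"
    and "leg_in C (wdom d) s ** \<sigma> = hat_in C d ** pairing C y (leg_out C (wdom d) s ** \<sigma>)"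
  obtains x where "arr x" "src x = src \<sigma>" "tgt x = src (act d s)" "act_pr d s ** x = \<sigma>"
    "leg_in C (wcod d) (act d s) ** x = y"
proof -
  let ?u = "pairing C y (leg_out C (wdom d) s ** \<sigma>)"
  have c: "act_base d ** ?u = s ** \<sigma>"
    by (rule bprod_eqI[of _ _ "hat C (fst (wdom d))" "hat C (snd (wdom d))"])
      (use assms s o base hat_in(1-3) leg_comp[OF s assms(1,2)] in \<open>simp_all add: interface_def act_base_def\<close>)
  have u: "arr ?u" "arr \<sigma>" "src ?u = src \<sigma>" "tgt ?u = src (act_base d)" "tgt \<sigma> = src s"
    using assms s base by simp_all
  note p = pb_pair[OF base(1) span_simps(1)[OF s] base(3) u c]
  let ?x = "pb_pair C (act_base d) s ?u \<sigma>"
  show thesis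
  proof (rule that[of ?x])
    show x: "arr ?x" "src ?x = src \<sigma>" "tgt ?x = src (act d s)" "act_pr d s ** ?x = \<sigma>"
      using p act_Arr by (simp_all add: act_pr_def)
    show "leg_in C (wcod d) (act d s) ** ?x = y"
      unfolding act_legs(3)[OF x(1,3)] p(4) using assms s by simp
  qed
qed

text \<open>On ports the closing of the loop becomes two families of equations: inputs with feedback
  read outputs of the same state, and the remaining ones read \<open>y\<close>.\<close>

lemma act_elem:
  assumes "arr \<sigma>" "tgt \<sigma> = src s" "arr y" "tgt y = hat C (fst (wcod d))" "src y = src \<sigma>"
    and "\<And>j k. win d j = Some (InL k) \<Longrightarrow> port_in (wdom d) s j ** \<sigma> = port_out (wdom d) s k ** \<sigma>"
    and "\<And>j k. win d j = Some (InR k) \<Longrightarrow> port_in (wdom d) s j ** \<sigma> = hat_pr C (fst (wcod d)) k ** y"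
  obtains x where "arr x" "src x = src \<sigma>" "tgt x = src (act d s)" "act_pr d s ** x = \<sigma>"
    "leg_in C (wcod d) (act d s) ** x = y"
proof -
  let ?u = "pairing C y (leg_out C (wdom d) s ** \<sigma>)"
  have u: "arr ?u" "tgt ?u = bprod C (hat C (fst (wcod d))) (hat C (snd (wdom d)))"
    using assms(1-5) s by simp_all
  have "leg_in C (wdom d) s ** \<sigma> = hat_in C d ** ?u"
  proof (rule hat_eqI[OF wdD(1)])
    fix j a assume j: "fst (wdom d) j = Some a"
    consider (l) k where "win d j = Some (InL k)" "snd (wdom d) k = Some a" | (r) k where "win d j = Some (InR k)" "fst (wcod d) k = Some a"
      using typed_in_cases[OF wdD(5), of j] j by auto
    then show "hat_pr C (fst (wdom d)) j ** leg_in C (wdom d) s ** \<sigma> = hat_pr C (fst (wdom d)) j ** hat_in C d ** ?u"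
    proof cases
      case l
      show ?thesis unfolding hat_in(4)[OF l(1) u] port_comp(1)[OF s assms(1,2) j, symmetric] assms(6)[OF l(1)]
          port_comp(2)[OF s assms(1,2) l(2)]
        using assms(1-5) s by simp
    next
      case r
      show ?thesis unfolding hat_in(5)[OF r(1) u] port_comp(1)[OF s assms(1,2) j, symmetric] assms(7)[OF r(1)]
        using assms(1-5) s by simp
    qed
  qed (use assms(1-5) s u hat_in(1-3) in simp_all)
  from act_leg_elem[OF assms(1-5) this] that show thesis by blast
qed

end

end

lemma span_act [simp]:
  "\<lbrakk>diagram d; span (wdom d) s; Y = wcod d\<rbrakk> \<Longrightarrow> span Y (act d s)"
  by (simp add: span_act0)

lemma act_port_out [simp]:
  assumes "diagram d" "span (wdom d) s" "Y = wcod d" "arr x" "tgt x = src (act d s)" "snd Y j \<noteq> None"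
  shows "port_out Y (act d s) j ** x = port_out (wdom d) s (the (wout d j)) ** act_pr d s ** x"
  using act_ports0(3)[OF assms(1,2,4,5)] typed_out_cases[OF wiring_diagramD(6)[OF assms(1)], of j] assms(3,6) by auto

text \<open>The universal property of an action inside its fibre. A map of apexes suffices, provided
  it closes the loops and matches the ports; the outer input is then forced to be the input leg of
  \<open>A\<close>.\<close>

lemma into_act:
  assumes wd: "diagram d" and s: "span (wdom d) s" and A: "span (wcod d) A"
    and \<sigma>: "arr \<sigma>" "src \<sigma> = src A" "tgt \<sigma> = src s"
    and 1: "\<And>j k. win d j = Some (InL k) \<Longrightarrow> port_in (wdom d) s j ** \<sigma> = port_out (wdom d) s k ** \<sigma>"
    and 2: "\<And>j k. win d j = Some (InR k) \<Longrightarrow> port_in (wdom d) s j ** \<sigma> = port_in (wcod d) A k"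
    and 3: "\<And>j k. wout d j = Some k \<Longrightarrow> port_out (wcod d) A j = port_out (wdom d) s k ** \<sigma>"
  shows "\<exists>h. span_map (wcod d) A (act d s) h \<and> act_pr d s ** h = \<sigma>"
proof -
  have y: "arr (leg_in C (wcod d) A)" "tgt (leg_in C (wcod d) A) = hat C (fst (wcod d))"
    "src (leg_in C (wcod d) A) = src \<sigma>" using A \<sigma> by simp_all
  obtain h where h: "arr h" "src h = src \<sigma>" "tgt h = src (act d s)" "act_pr d s ** h = \<sigma>"
    "leg_in C (wcod d) (act d s) ** h = leg_in C (wcod d) A"
    by (rule act_elem[OF wd s \<sigma>(1,3) y 1]) (use 2 in \<open>simp_all add: port_in_def\<close>)
  have "span_map (wcod d) A (act d s) h"
  proof (rule span_mapI)
    fix j a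
    { assume "fst (wcod d) j = Some a"
      then show "port_in (wcod d) (act d s) j ** h = port_in (wcod d) A j"
        using port_comp(1)[OF span_act0[OF wd s] h(1,3)] h(5) by (simp add: port_in_def) }
    { assume j: "snd (wcod d) j = Some a"
      then obtain k where k: "wout d j = Some k" using typed_out_cases[OF wiring_diagramD(6)[OF wd], of j] by auto
      show "port_out (wcod d) (act d s) j ** h = port_out (wcod d) A j"
        using wd s h j k 3[OF k] by simp }
  qed (use A h \<sigma> wd s in simp_all)
  then show ?thesis using h(4) by blast
qed

text \<open>The two defining properties determine this map, because a map of spans fixes the outer
  inputs and \<open>act_pr\<close> fixes the state.\<close>

definition to_act :: "('l, 'o) wiring_diagram \<Rightarrow> 'm \<Rightarrow> 'm \<Rightarrow> 'm \<Rightarrow> 'm" where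
  "to_act d s A \<sigma> = (SOME h. span_map (wcod d) A (act d s) h \<and> act_pr d s ** h = \<sigma>)"

lemma to_act:
  assumes "diagram d" "span (wdom d) s" "span (wcod d) A"
    and "arr \<sigma>" "src \<sigma> = src A" "tgt \<sigma> = src s"
    and "\<And>j k. win d j = Some (InL k) \<Longrightarrow> port_in (wdom d) s j ** \<sigma> = port_out (wdom d) s k ** \<sigma>"
    and "\<And>j k. win d j = Some (InR k) \<Longrightarrow> port_in (wdom d) s j ** \<sigma> = port_in (wcod d) A k"
    and "\<And>j k. wout d j = Some k \<Longrightarrow> port_out (wcod d) A j = port_out (wdom d) s k ** \<sigma>"
  shows "span_map (wcod d) A (act d s) (to_act d s A \<sigma>)"
    "\<lbrakk>arr x; tgt x = src A\<rbrakk> \<Longrightarrow> act_pr d s ** to_act d s A \<sigma> ** x = \<sigma> ** x"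
proof -
  have *: "span_map (wcod d) A (act d s) (to_act d s A \<sigma>)" "act_pr d s ** to_act d s A \<sigma> = \<sigma>"
    using someI_ex[OF into_act[OF assms]] unfolding to_act_def by auto
  show "span_map (wcod d) A (act d s) (to_act d s A \<sigma>)" by (rule *)
  show "act_pr d s ** to_act d s A \<sigma> ** x = \<sigma> ** x" if "arr x" "tgt x = src A"
  proof -
    have "act_pr d s ** to_act d s A \<sigma> ** x = (act_pr d s ** to_act d s A \<sigma>) ** x"
      using that span_mapD[OF *(1)] assms(1,2) by simp
    then show ?thesis by (simp only: *(2))
  qed
qed

lemma act_arr:
  assumes wd: "diagram d" and h: "span_map (wdom d) s t h"
  shows "span_map (wcod d) (act d s) (act d t) (act_arr d s t h)"
    "\<lbrakk>arr x; tgt x = src (act d s)\<rbrakk> \<Longrightarrow> act_pr d t ** act_arr d s t h ** x = h ** act_pr d s ** x"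
proof -
  note h' = span_mapD[OF h]
  have o: "hat C (fst (wdom d)) \<in> Obj C" "hat C (snd (wdom d)) \<in> Obj C"
    "hat C (fst (wcod d)) \<in> Obj C" "hat C (snd (wcod d)) \<in> Obj C"
    using wiring_diagramD[OF wd] by simp_all
  have base: "arr (act_base d)" "src (act_base d) = bprod C (hat C (fst (wcod d))) (hat C (snd (wdom d)))"
    "tgt (act_base d) = tgt s" "tgt (act_base d) = tgt t"
    using hat_in[OF wd] o h' by (simp_all add: act_base_def interface_def)
  note pbs = pb_simps[OF base(1) span_simps(1)[OF h'(1)] base(3)] and pbt = pb_simps[OF base(1) span_simps(1)[OF h'(2)] base(4)]
  have c: "act_base d ** pb1 C (act_base d) s = t ** h ** pb2 C (act_base d) s"
  proof -
    have "act_base d ** pb1 C (act_base d) s = s ** pb2 C (act_base d) s"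
      using pb_cone[OF base(1) span_simps(1)[OF h'(1)] base(3)] unfolding is_pullback_def by blast
    also have "\<dots> = (t ** h) ** pb2 C (act_base d) s" using h' by simp
    also have "\<dots> = t ** h ** pb2 C (act_base d) s" using h'(1-5) pbs by (intro comp_assoc) auto
    finally show ?thesis .
  qed
  note p = pb_pair[OF base(1) span_simps(1)[OF h'(2)] base(4) _ _ _ _ _ c, folded act_arr_def]
  have q: "arr (act_arr d s t h)" "src (act_arr d s t h) = src (act d s)" "tgt (act_arr d s t h) = src (act d t)"
    "pb1 C (act_base d) t ** act_arr d s t h = pb1 C (act_base d) s"
    "act_pr d t ** act_arr d s t h = h ** act_pr d s"
    using p pbs pbt h'(1-5) wd by (simp_all add: act_Arr act_pr_def)
  have "act d t ** act_arr d s t h = act d s"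
    unfolding act_eq using q(1-4) pbt o hat_out[OF wd] base h' wd by (simp add: act_Arr del: par_simps(4))
  then show "span_map (wcod d) (act d s) (act d t) (act_arr d s t h)"
    using q wd h' by (simp add: span_map_def)
  show "act_pr d t ** act_arr d s t h ** x = h ** act_pr d s ** x" if "arr x" "tgt x = src (act d s)"
  proof -
    have "act_pr d t ** act_arr d s t h ** x = (act_pr d t ** act_arr d s t h) ** x" using that q(1-3) h' wd by simp
    also have "\<dots> = h ** act_pr d s ** x" unfolding q(5) using that h'(1-5) wd by simp
    finally show ?thesis .
  qed
qed

section \<open>Products of spans\<close>

abbreviation mul :: "('l, 'o) box \<Rightarrow> ('l, 'o) box \<Rightarrow> 'm \<Rightarrow> 'm \<Rightarrow> 'm" where
  "mul X Y s t \<equiv> span_mul_ob C X Y s t"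

abbreviation p1 :: "'m \<Rightarrow> 'm \<Rightarrow> 'm" where "p1 s t \<equiv> pr1 C (src s) (src t)"
abbreviation p2 :: "'m \<Rightarrow> 'm \<Rightarrow> 'm" where "p2 s t \<equiv> pr2 C (src s) (src t)"

lemma mul_legs:
  assumes "span X s" "span Y t" "arr z" "tgt z = src (mul X Y s t)"
  shows "leg_in C (box_sum X Y) (mul X Y s t) ** z = hat_join C (fst X) (fst Y) ** pairing C (leg_in C X s ** p1 s t ** z) (leg_in C Y t ** p2 s t ** z)"
    "leg_out C (box_sum X Y) (mul X Y s t) ** z = hat_join C (snd X) (snd Y) ** pairing C (leg_out C X s ** p1 s t ** z) (leg_out C Y t ** p2 s t ** z)"
    and "span (box_sum X Y) (mul X Y s t)" "src (mul X Y s t) = bprod C (src s) (src t)"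
proof -
  have b: "fst X \<in> typed_sets C" "snd X \<in> typed_sets C" "fst Y \<in> typed_sets C" "snd Y \<in> typed_sets C"
    using span_typed_sets assms(1,2) by blast+
  note j = hat_join[OF b(1,3)] hat_join[OF b(2,4)]
  show s: "span (box_sum X Y) (mul X Y s t)" and d: "src (mul X Y s t) = bprod C (src s) (src t)"
    unfolding span_def using assms(1,2) b j by (simp_all add: span_mul_ob_def interface_def is_box_def del: par_simps(4))
  have z: "arr z" "tgt z = bprod C (src s) (src t)" using assms d by simp_all
  show "leg_in C (box_sum X Y) (mul X Y s t) ** z = hat_join C (fst X) (fst Y) ** pairing C (leg_in C X s ** p1 s t ** z) (leg_in C Y t ** p2 s t ** z)"
    "leg_out C (box_sum X Y) (mul X Y s t) ** z = hat_join C (snd X) (snd Y) ** pairing C (leg_out C X s ** p1 s t ** z) (leg_out C Y t ** p2 s t ** z)"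
    unfolding leg_comp[OF s assms(3,4)] using z assms(1,2) b j(1-3) j(6-8) by (simp_all add: span_mul_ob_def)
qed

lemma mul_simps [simp]:
  assumes "span X s" "span Y t"
  shows "Z = box_sum X Y \<Longrightarrow> span Z (mul X Y s t)" "src (mul X Y s t) = bprod C (src s) (src t)"
proof -
  have "src (mul X Y s t) \<in> Obj C"
  proof -
    have b: "fst X \<in> typed_sets C" "snd X \<in> typed_sets C" "fst Y \<in> typed_sets C" "snd Y \<in> typed_sets C"
      using span_typed_sets assms(1,2) by blast+
    show ?thesis using assms b hat_join[OF b(1,3)] hat_join[OF b(2,4)] by (simp add: span_mul_ob_def del: par_simps(4))
  qed
  then show "Z = box_sum X Y \<Longrightarrow> span Z (mul X Y s t)" "src (mul X Y s t) = bprod C (src s) (src t)"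
    using mul_legs(3,4)[OF assms, of "Ident C (src (mul X Y s t))"] by simp_all
qed

lemma mul_ports [simp]:
  assumes "span X s" "span Y t" "arr z" "tgt z = bprod C (src s) (src t)" "Z = box_sum X Y"
  shows "fst X j \<noteq> None \<Longrightarrow> port_in Z (mul X Y s t) (InL j) ** z = port_in X s j ** p1 s t ** z"
    "fst Y j \<noteq> None \<Longrightarrow> port_in Z (mul X Y s t) (InR j) ** z = port_in Y t j ** p2 s t ** z"
    "snd X j \<noteq> None \<Longrightarrow> port_out Z (mul X Y s t) (InL j) ** z = port_out X s j ** p1 s t ** z"
    "snd Y j \<noteq> None \<Longrightarrow> port_out Z (mul X Y s t) (InR j) ** z = port_out Y t j ** p2 s t ** z"
proof -
  have z: "tgt z = src (mul X Y s t)" using assms by simp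
  have S: "span (box_sum X Y) (mul X Y s t)" using assms by simp
  have b: "fst X \<in> typed_sets C" "snd X \<in> typed_sets C" "fst Y \<in> typed_sets C" "snd Y \<in> typed_sets C"
    using span_typed_sets assms(1,2) by blast+
  note j = hat_join[OF b(1,3)] hat_join[OF b(2,4)]
  have q: "arr (p1 s t ** z)" "tgt (p1 s t ** z) = src s" "arr (p2 s t ** z)" "tgt (p2 s t ** z) = src t" using assms by simp_all
  note pc = port_comp[OF S assms(3) z] mul_legs(1,2)[OF assms(1-3) z] port_comp[OF assms(1) q(1,2)] port_comp[OF assms(2) q(3,4)]
  show "fst X j \<noteq> None \<Longrightarrow> port_in Z (mul X Y s t) (InL j) ** z = port_in X s j ** p1 s t ** z"
    "fst Y j \<noteq> None \<Longrightarrow> port_in Z (mul X Y s t) (InR j) ** z = port_in Y t j ** p2 s t ** z"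
    "snd X j \<noteq> None \<Longrightarrow> port_out Z (mul X Y s t) (InL j) ** z = port_out X s j ** p1 s t ** z"
    "snd Y j \<noteq> None \<Longrightarrow> port_out Z (mul X Y s t) (InR j) ** z = port_out Y t j ** p2 s t ** z"
    using assms by (auto simp: pc j)
qed

lemma mul_arr:
  assumes "span_map X s s' h" "span_map Y t t' k"
  shows "span_map (box_sum X Y) (mul X Y s t) (mul X Y s' t') (par C h k)"
  by (rule span_map_elemI)
    (use span_mapD(1-5)[OF assms(1)] span_mapD(1-5)[OF assms(2)] in
      \<open>auto simp: typed_sum_eq_Some span_map_port[OF assms(1)] span_map_port[OF assms(2)]\<close>)

text \<open>The conditions of \<open>to_act\<close> in the form that simp can prove, after an
  arbitrary \<open>x\<close>; the identity recovers the originals.\<close>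

lemma to_act_elem:
  assumes wd: "diagram d" and s: "span (wdom d) s" and A: "span (wcod d) A"
    and \<sigma>: "arr \<sigma>" "src \<sigma> = src A" "tgt \<sigma> = src s"
    and 1: "\<And>j k x. \<lbrakk>win d j = Some (InL k); arr x; tgt x = src A\<rbrakk> \<Longrightarrow>
      port_in (wdom d) s j ** \<sigma> ** x = port_out (wdom d) s k ** \<sigma> ** x"
    and 2: "\<And>j k x. \<lbrakk>win d j = Some (InR k); arr x; tgt x = src A\<rbrakk> \<Longrightarrow>
      port_in (wdom d) s j ** \<sigma> ** x = port_in (wcod d) A k ** x"
    and 3: "\<And>j k x. \<lbrakk>wout d j = Some k; arr x; tgt x = src A\<rbrakk> \<Longrightarrow>
      port_out (wcod d) A j ** x = port_out (wdom d) s k ** \<sigma> ** x"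
  shows "span_map (wcod d) A (act d s) (to_act d s A \<sigma>)"
    "\<lbrakk>arr x; tgt x = src A\<rbrakk> \<Longrightarrow> act_pr d s ** to_act d s A \<sigma> ** x = \<sigma> ** x"
proof -
  note S = Dom_Obj[OF span_simps(1)[OF A]]
  let ?I = "Ident C (src A)"
  have 1: "port_in (wdom d) s j ** \<sigma> = port_out (wdom d) s k ** \<sigma>" if "win d j = Some (InL k)" for j k
    using 1[OF that, of ?I] S \<sigma> by simp
  have 2: "port_in (wdom d) s j ** \<sigma> = port_in (wcod d) A k" if "win d j = Some (InR k)" for j k
    using 2[OF that, of ?I] S \<sigma> A typed_in_cases[OF wiring_diagramD(5)[OF wd], of j] that by auto
  have 3: "port_out (wcod d) A j = port_out (wdom d) s k ** \<sigma>" if "wout d j = Some k" for j k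
    using 3[OF that, of ?I] S \<sigma> A typed_out_cases[OF wiring_diagramD(6)[OF wd], of j] that by auto
  note t = to_act[OF wd s A \<sigma> 1 2 3]
  show "span_map (wcod d) A (act d s) (to_act d s A \<sigma>)" by (rule t(1))
  show "\<lbrakk>arr x; tgt x = src A\<rbrakk> \<Longrightarrow> act_pr d s ** to_act d s A \<sigma> ** x = \<sigma> ** x" by (rule t(2))
qed

end

section \<open>Coherence isomorphisms\<close>

lemma plain_win [simp]: "fst X j \<noteq> None \<Longrightarrow> win (plain_wiring X Y f g) j = map_option InR (f j)"
  by (auto simp: plain_wiring_def restrict_map_def)

lemma plain_win_None [simp]: "fst X j = None \<Longrightarrow> win (plain_wiring X Y f g) j = None"
  by (auto simp: plain_wiring_def restrict_map_def)

lemma plain_wout [simp]: "snd Y j \<noteq> None \<Longrightarrow> wout (plain_wiring X Y f g) j = g j"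
  by (auto simp: plain_wiring_def restrict_map_def)

lemma win_sum [simp]:
  "win (wiring_sum d e) (InL j) = (case win d j of None \<Rightarrow> None | Some z \<Rightarrow> sum_map inl inl z)"
  "win (wiring_sum d e) (InR j) = (case win e j of None \<Rightarrow> None | Some z \<Rightarrow> sum_map inr inr z)"
  "win (wiring_sum d e) (Port p) = None"
  by (auto simp: wiring_sum_def map_comp_def split: prod.split option.split)

lemma wout_sum [simp]: "wout (wiring_sum d e) = sum_map (wout d) (wout e)"
  by (simp add: wiring_sum_def split: prod.split)

lemma wiring_comp_maps:
  "win (wiring_comp e d) = plug (wout d) (win e) \<circ>\<^sub>m win d" "wout (wiring_comp e d) = wout d \<circ>\<^sub>m wout e"
  by (cases d; cases e; simp add: wiring_comp_eq)+

text \<open>Feedback in a composite either is already feedback of \<open>d\<close>, or runs through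
  an input of the middle box that \<open>e\<close> feeds from an output \<open>u\<close>, which
  \<open>d\<close> takes from \<open>k\<close>. An outer input must pass through the middle
  box.\<close>

lemma win_comp_cases:
  "win (wiring_comp e d) j = Some (InL k) \<Longrightarrow> win d j = Some (InL k) \<or>
     (\<exists>y u. win d j = Some (InR y) \<and> win e y = Some (InL u) \<and> wout d u = Some k)"
  "win (wiring_comp e d) j = Some (InR k) \<Longrightarrow> \<exists>y. win d j = Some (InR y) \<and> win e y = Some (InR k)"
  by (auto simp: wiring_comp_maps map_comp_Some_iff plug_def copair_def inl_def inr_def sum_map_def
      map_comp_def split: label.splits option.splits)

abbreviation idw :: "('l, 'o) box \<Rightarrow> ('l, 'o) wiring_diagram" where
  "idw X \<equiv> plain_wiring X X Some Some"

context fincomplete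
begin

lemma is_box_iff: "is_box X \<longleftrightarrow> X \<in> typed_sets C \<times> typed_sets C"
  by (auto simp: is_box_def mem_Times_iff)

lemma plain_diagram:
  "\<lbrakk>is_box X; is_box Y; respects_types (fst X) (fst Y) f; respects_types (snd Y) (snd X) g\<rbrakk> \<Longrightarrow>
     plain_wiring X Y f g \<in> wiring_diagrams C"
  by (rule plain_wiring_diagram) (auto simp: is_box_iff)

lemma idw_diagram [simp]: "is_box X \<Longrightarrow> idw X \<in> wiring_diagrams C"
  by (rule plain_diagram) (simp_all add: respects_types_intros)

lemma sum_diagram [simp]:
  "\<lbrakk>diagram d; diagram e\<rbrakk> \<Longrightarrow> wiring_sum d e \<in> wiring_diagrams C"
  by (rule wiring_sum_diagram)

lemma comp_diagram [simp]:
  "\<lbrakk>diagram d; diagram e; wdom e = wcod d\<rbrakk> \<Longrightarrow> wiring_comp e d \<in> wiring_diagrams C"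
  by (rule wiring_comp_diagram)

lemma act_pr_simps' [simp]:
  assumes "diagram d" "span (wdom d) s"
  shows "arr (act_pr d s)" "src (act_pr d s) = src (act d s)" "tgt (act_pr d s) = src s"
  using assms by simp_all

lemma act_Arr_simps [simp]:
  assumes "diagram d" "span (wdom d) s"
  shows "arr (act d s)" "tgt (act d s) = interface C (wcod d)"
  using assms by (simp_all add: act_Arr)

lemma mul_Arr_simps [simp]:
  assumes "span X s" "span Y t"
  shows "arr (mul X Y s t)" "tgt (mul X Y s t) = interface C (box_sum X Y)"
  using span_simps(1,2)[OF mul_simps(1)[OF assms refl]] .

lemma act_plain_in [simp]:
  assumes "diagram (plain_wiring X Y f g)" "span X s" "arr x" "tgt x = src (act (plain_wiring X Y f g) s)"
    "fst X j \<noteq> None"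
  shows "port_in X s j ** act_pr (plain_wiring X Y f g) s ** x = port_in Y (act (plain_wiring X Y f g) s) (the (f j)) ** x"
proof -
  obtain k where "f j = Some k"
    using typed_in_cases[OF wiring_diagramD(5)[OF assms(1)], of j] assms(5) by auto
  then show ?thesis using act_ports0(2)[OF assms(1), of s x j k] assms by simp
qed

lemma act_port_in:
  assumes "diagram d" "span X s" "X = wdom d" "arr x" "tgt x = src (act d s)"
  shows "win d j = Some (InL k) \<Longrightarrow> port_in X s j ** act_pr d s ** x = port_out X s k ** act_pr d s ** x"
    "\<lbrakk>win d j = Some (InR k); Y = wcod d\<rbrakk> \<Longrightarrow> port_in X s j ** act_pr d s ** x = port_in Y (act d s) k ** x"
  using act_ports0[OF assms(1), of s x j k] assms by auto

lemma act_arr_simps [simp]: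
  assumes "diagram d" "span_map (wdom d) s t h"
  shows "arr (act_arr d s t h)" "src (act_arr d s t h) = src (act d s)" "tgt (act_arr d s t h) = src (act d t)"
    "\<lbrakk>arr x; tgt x = src (act d s)\<rbrakk> \<Longrightarrow> act_pr d t ** act_arr d s t h ** x = h ** act_pr d s ** x"
    "\<lbrakk>arr x; tgt x = src (act d s); Y = wcod d; fst Y j \<noteq> None\<rbrakk> \<Longrightarrow>
       port_in Y (act d t) j ** act_arr d s t h ** x = port_in Y (act d s) j ** x"
  using act_arr[OF assms] span_mapD[OF act_arr(1)[OF assms]] span_map_port(1)[OF act_arr(1)[OF assms]] by auto

section \<open>The comparison maps for identities, composites and sums\<close>

definition co_id :: "('l, 'o) box \<Rightarrow> 'm \<Rightarrow> 'm" where
  "co_id X s = to_act (idw X) s s (Ident C (src s))"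

definition co_comp :: "('l, 'o) wiring_diagram \<Rightarrow> ('l, 'o) wiring_diagram \<Rightarrow> 'm \<Rightarrow> 'm" where
  "co_comp e d s = to_act (wiring_comp e d) s (act e (act d s)) (act_pr d s ** act_pr e (act d s))"

definition co_mul :: "('l, 'o) wiring_diagram \<Rightarrow> ('l, 'o) wiring_diagram \<Rightarrow> 'm \<Rightarrow> 'm \<Rightarrow> 'm" where
  "co_mul d e s t = to_act (wiring_sum d e) (mul (wdom d) (wdom e) s t)
     (mul (wcod d) (wcod e) (act d s) (act e t)) (par C (act_pr d s) (act_pr e t))"

lemma co_id:
  assumes "span X s"
  shows "span_map X s (act (idw X) s) (co_id X s)"
    "\<lbrakk>arr x; tgt x = src s\<rbrakk> \<Longrightarrow> act_pr (idw X) s ** co_id X s ** x = x"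
proof -
  note b = span_box[OF assms]
  have S: "src s \<in> Obj C" using assms by simp
  have *: "fst X j \<noteq> None \<and> z = InR j" if "win (idw X) j = Some z" for j z
    using that by (cases "fst X j") auto
  have **: "snd X j \<noteq> None \<and> z = j" if "wout (idw X) j = Some z" for j z
    using that by (cases "snd X j") (auto simp: plain_wiring_def restrict_map_def split: if_splits)
  note t = to_act_elem[of "idw X" s s "Ident C (src s)", folded co_id_def]
  show "span_map X s (act (idw X) s) (co_id X s)"
    using t(1) S assms b by (auto dest!: * **)
  show "act_pr (idw X) s ** co_id X s ** x = x" if "arr x" "tgt x = src s"
    using t(2)[of x] S assms b that by (auto dest!: * **)
qed

text \<open>The two projections in succession send a state of the iterated action to a state of
  \<open>s\<close>, and this composite closes the loops of the composite diagram: a loop through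
  \<open>e\<close> is closed by the feedback equation for \<open>e\<close> followed by the output
  equation for \<open>d\<close>.\<close>

lemma co_comp:
  assumes "diagram d" "diagram e" "wdom e = wcod d" "span (wdom d) s"
  shows "span_map (wcod e) (act e (act d s)) (act (wiring_comp e d) s) (co_comp e d s)"
    "\<lbrakk>arr x; tgt x = src (act e (act d s))\<rbrakk> \<Longrightarrow>
      act_pr (wiring_comp e d) s ** co_comp e d s ** x = act_pr d s ** act_pr e (act d s) ** x"
proof -
  let ?\<omega> = "wiring_comp e d" and ?\<sigma> = "act_pr d s ** act_pr e (act d s)"
  have 1: "port_in (wdom ?\<omega>) s j ** ?\<sigma> ** x = port_out (wdom ?\<omega>) s k ** ?\<sigma> ** x"
    if h: "win ?\<omega> j = Some (InL k)" "arr x" "tgt x = src (act e (act d s))" for j k x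
    using win_comp_cases(1)[OF h(1)]
  proof (elim disjE exE conjE)
    assume "win d j = Some (InL k)"
    then show ?thesis using h(2,3) assms by (simp add: act_port_in)
  next
    fix y u assume u: "win d j = Some (InR y)" "win e y = Some (InL u)" "wout d u = Some k"
    then have "snd (wcod d) u \<noteq> None" using typed_out_cases[OF wiring_diagramD(6)[OF assms(1)], of u] by auto
    then show ?thesis using h(2,3) u assms by (simp add: act_port_in)
  qed
  have 2: "port_in (wdom ?\<omega>) s j ** ?\<sigma> ** x = port_in (wcod ?\<omega>) (act e (act d s)) k ** x"
    if h: "win ?\<omega> j = Some (InR k)" "arr x" "tgt x = src (act e (act d s))" for j k x
  proof -
    obtain y where "win d j = Some (InR y)" "win e y = Some (InR k)" using win_comp_cases(2)[OF h(1)] by blast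
    then show ?thesis using h(2,3) assms by (simp add: act_port_in)
  qed
  have 3: "port_out (wcod ?\<omega>) (act e (act d s)) j ** x = port_out (wdom ?\<omega>) s k ** ?\<sigma> ** x"
    if h: "wout ?\<omega> j = Some k" "arr x" "tgt x = src (act e (act d s))" for j k x
  proof -
    obtain y where y: "wout e j = Some y" "wout d y = Some k" using h(1) by (auto simp: wiring_comp_maps map_comp_Some_iff)
    then have "snd (wcod e) j \<noteq> None" "snd (wcod d) y \<noteq> None"
      using typed_out_cases[OF wiring_diagramD(6)[OF assms(2)], of j] typed_out_cases[OF wiring_diagramD(6)[OF assms(1)], of y] by auto
    then show ?thesis using h(2,3) assms y by simp
  qed
  have A: "diagram ?\<omega>" "span (wdom ?\<omega>) s" "span (wcod ?\<omega>) (act e (act d s))"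
    "arr ?\<sigma>" "src ?\<sigma> = src (act e (act d s))" "tgt ?\<sigma> = src s"
    using assms by simp_all
  have M: "span_map (wcod ?\<omega>) (act e (act d s)) (act ?\<omega> s) (to_act ?\<omega> s (act e (act d s)) ?\<sigma>)"
    by (rule to_act_elem(1)[OF A 1 2 3])
  have E: "act_pr ?\<omega> s ** to_act ?\<omega> s (act e (act d s)) ?\<sigma> ** x = ?\<sigma> ** x" if "arr x" "tgt x = src (act e (act d s))" for x
    by (rule to_act_elem(2)[OF A 1 2 3 that])
  show "span_map (wcod e) (act e (act d s)) (act (wiring_comp e d) s) (co_comp e d s)"
    using M by (simp add: co_comp_def)
  show "act_pr (wiring_comp e d) s ** co_comp e d s ** x = act_pr d s ** act_pr e (act d s) ** x"
    if "arr x" "tgt x = src (act e (act d s))"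
    using E[OF that] that assms by (simp add: co_comp_def)
qed

text \<open>Every loop and every wire of the sum lies in one summand, so the pair of projections
  satisfies the equations of the sum separately in each component.\<close>

lemma co_mul:
  assumes "diagram d" "diagram e" "span (wdom d) s" "span (wdom e) t"
  shows "span_map (box_sum (wcod d) (wcod e)) (mul (wcod d) (wcod e) (act d s) (act e t))
      (act (wiring_sum d e) (mul (wdom d) (wdom e) s t)) (co_mul d e s t)"
    "\<lbrakk>arr x; tgt x = bprod C (src (act d s)) (src (act e t))\<rbrakk> \<Longrightarrow>
      act_pr (wiring_sum d e) (mul (wdom d) (wdom e) s t) ** co_mul d e s t ** x =
      pairing C (act_pr d s ** p1 (act d s) (act e t) ** x) (act_pr e t ** p2 (act d s) (act e t) ** x)"
proof -
  let ?\<omega> = "wiring_sum d e" and ?\<sigma> = "par C (act_pr d s) (act_pr e t)"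
  let ?m = "mul (wdom d) (wdom e) s t" and ?n = "mul (wcod d) (wcod e) (act d s) (act e t)"
  note T = typed_in_cases[OF wiring_diagramD(5)[OF assms(1)]] typed_in_cases[OF wiring_diagramD(5)[OF assms(2)]]
  note O = typed_out_cases[OF wiring_diagramD(6)[OF assms(1)]] typed_out_cases[OF wiring_diagramD(6)[OF assms(2)]]
  have 1: "port_in (wdom ?\<omega>) ?m j ** ?\<sigma> ** x = port_out (wdom ?\<omega>) ?m k ** ?\<sigma> ** x"
    if h: "win ?\<omega> j = Some (InL k)" "arr x" "tgt x = src ?n" for j k x
  proof (cases j)
    case (InL i)
    then obtain l where l: "win d i = Some (InL l)" "k = InL l"
      using h(1) T(1)[of i] by (auto simp: inl_app)
    moreover have "fst (wdom d) i \<noteq> None" "snd (wdom d) l \<noteq> None" using l(1) T(1)[of i] by auto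
    ultimately show ?thesis using h(2,3) InL assms by (simp add: act_port_in)
  next
    case (InR i)
    then obtain l where l: "win e i = Some (InL l)" "k = InR l"
      using h(1) T(2)[of i] by (auto simp: inr_def)
    moreover have "fst (wdom e) i \<noteq> None" "snd (wdom e) l \<noteq> None" using l(1) T(2)[of i] by auto
    ultimately show ?thesis using h(2,3) InR assms by (simp add: act_port_in)
  qed (use h in simp)
  have 2: "port_in (wdom ?\<omega>) ?m j ** ?\<sigma> ** x = port_in (wcod ?\<omega>) ?n k ** x"
    if h: "win ?\<omega> j = Some (InR k)" "arr x" "tgt x = src ?n" for j k x
  proof (cases j)
    case (InL i)
    then obtain l where l: "win d i = Some (InR l)" "k = InL l"
      using h(1) T(1)[of i] by (auto simp: inl_app)
    moreover have "fst (wdom d) i \<noteq> None" "fst (wcod d) l \<noteq> None" using l(1) T(1)[of i] by auto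
    ultimately show ?thesis using h(2,3) InL assms by (simp add: act_port_in)
  next
    case (InR i)
    then obtain l where l: "win e i = Some (InR l)" "k = InR l"
      using h(1) T(2)[of i] by (auto simp: inr_def)
    moreover have "fst (wdom e) i \<noteq> None" "fst (wcod e) l \<noteq> None" using l(1) T(2)[of i] by auto
    ultimately show ?thesis using h(2,3) InR assms by (simp add: act_port_in)
  qed (use h in simp)
  have 3: "port_out (wcod ?\<omega>) ?n j ** x = port_out (wdom ?\<omega>) ?m k ** ?\<sigma> ** x"
    if h: "wout ?\<omega> j = Some k" "arr x" "tgt x = src ?n" for j k x
  proof (cases j)
    case (InL i)
    then obtain l where l: "wout d i = Some l" "k = InL l" using h(1) by auto
    moreover have "snd (wcod d) i \<noteq> None" "snd (wdom d) l \<noteq> None" using l(1) O(1)[of i] by auto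
    ultimately show ?thesis using h(2,3) InL assms by simp
  next
    case (InR i)
    then obtain l where l: "wout e i = Some l" "k = InR l" using h(1) by auto
    moreover have "snd (wcod e) i \<noteq> None" "snd (wdom e) l \<noteq> None" using l(1) O(2)[of i] by auto
    ultimately show ?thesis using h(2,3) InR assms by simp
  qed (use h in simp)
  have A: "diagram ?\<omega>" "span (wdom ?\<omega>) ?m" "span (wcod ?\<omega>) (?n)"
    "arr ?\<sigma>" "src ?\<sigma> = src (?n)" "tgt ?\<sigma> = src ?m"
    using assms by simp_all
  have M: "span_map (wcod ?\<omega>) (?n) (act ?\<omega> ?m) (to_act ?\<omega> ?m (?n) ?\<sigma>)"
    by (rule to_act_elem(1)[OF A 1 2 3])
  have E: "act_pr ?\<omega> ?m ** to_act ?\<omega> ?m (?n) ?\<sigma> ** x = ?\<sigma> ** x" if "arr x" "tgt x = src (?n)" for x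
    by (rule to_act_elem(2)[OF A 1 2 3 that])
  show "span_map (box_sum (wcod d) (wcod e)) ?n (act ?\<omega> ?m) (co_mul d e s t)"
    using M by (simp add: co_mul_def)
  show "act_pr ?\<omega> ?m ** co_mul d e s t ** x =
      pairing C (act_pr d s ** p1 (act d s) (act e t) ** x) (act_pr e t ** p2 (act d s) (act e t) ** x)"
    if "arr x" "tgt x = bprod C (src (act d s)) (src (act e t))"
    using E[of x] that assms by (simp add: co_mul_def)
qed

section \<open>Invertibility of the comparison maps\<close>

lemma port_in_leg_in:
  assumes "span X s" "arr u" "tgt u = src s" "leg_in C X s ** u = y" "fst X j \<noteq> None"
  shows "port_in X s j ** u = hat_pr C (fst X) j ** y"
  using assms port_comp(1)[OF assms(1-3)] by auto

text \<open>Here the outer input is prescribed port by port and assembled by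
  \<open>hat_tuple\<close>; the inputs of a middle box arise in this way, from several
  sources.\<close>

lemma act_elem_ports:
  assumes wd: "diagram d" and s: "span (wdom d) s" and \<sigma>: "arr \<sigma>" "tgt \<sigma> = src s"
    and r: "\<And>k a. fst (wcod d) k = Some a \<Longrightarrow> r k \<in> Arr C \<and> src (r k) = src \<sigma> \<and> tgt (r k) = a"
    and L: "\<And>j k. win d j = Some (InL k) \<Longrightarrow> port_in (wdom d) s j ** \<sigma> = port_out (wdom d) s k ** \<sigma>"
    and R: "\<And>j k. win d j = Some (InR k) \<Longrightarrow> port_in (wdom d) s j ** \<sigma> = r k"
  obtains x where "arr x" "src x = src \<sigma>" "tgt x = src (act d s)" "act_pr d s ** x = \<sigma>"
    "\<And>k a. fst (wcod d) k = Some a \<Longrightarrow> port_in (wcod d) (act d s) k ** x = r k"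
proof -
  have r': "r k \<in> Hom C (src \<sigma>) a" if "fst (wcod d) k = Some a" for k a using r[OF that] by (simp add: Hom_iff)
  note h = hat_tuple[OF wiring_diagramD(3)[OF wd] Dom_Obj[OF \<sigma>(1)] r']
  have R': "port_in (wdom d) s j ** \<sigma> = hat_pr C (fst (wcod d)) k ** hat_tuple C (fst (wcod d)) (src \<sigma>) r"
    if k: "win d j = Some (InR k)" for j k
  proof -
    obtain a where "fst (wcod d) k = Some a" using typed_in_cases[OF wiring_diagramD(5)[OF wd], of j] k by auto
    then show ?thesis using R[OF k] h(4) by simp
  qed
  obtain x where x: "arr x" "src x = src \<sigma>" "tgt x = src (act d s)" "act_pr d s ** x = \<sigma>"
    "leg_in C (wcod d) (act d s) ** x = hat_tuple C (fst (wcod d)) (src \<sigma>) r"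
    by (rule act_elem[OF wd s \<sigma> h(1,3,2) L R'])
  show thesis
    by (rule that[OF x(1-4)]) (use h(4) port_in_leg_in[OF span_act0[OF wd s] x(1,3,5)] in simp)
qed

text \<open>An input of the middle box is either fed back, hence a function of the state of
  \<open>s\<close>, or an outer input, where equality is assumed; so joint monicity passes from one
  action to two.\<close>

lemma act_act_eqI:
  assumes "diagram d" "diagram e" "wdom e = wcod d" "span (wdom d) s"
    and x: "arr x" "tgt x = src (act e (act d s))" and y: "arr y" "tgt y = src (act e (act d s))"
    and "src x = src y"
    and e: "act_pr d s ** act_pr e (act d s) ** x = act_pr d s ** act_pr e (act d s) ** y"
    and p: "\<And>j a. fst (wcod e) j = Some a \<Longrightarrow> port_in (wcod e) (act e (act d s)) j ** x = port_in (wcod e) (act e (act d s)) j ** y"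
  shows "x = y"
proof (rule act_eqI[OF assms(2), of "act d s"])
  show "act_pr e (act d s) ** x = act_pr e (act d s) ** y"
  proof (rule act_eqI[OF assms(1,4)])
    fix j a assume j: "fst (wcod d) j = Some a"
    consider (l) k where "win e j = Some (InL k)" "snd (wcod d) k = Some a" | (r) k where "win e j = Some (InR k)" "fst (wcod e) k = Some a"
      using typed_in_cases[OF wiring_diagramD(5)[OF assms(2)], of j] assms(3) j by auto
    then show "port_in (wcod d) (act d s) j ** act_pr e (act d s) ** x = port_in (wcod d) (act d s) j ** act_pr e (act d s) ** y"
    proof cases
      case l then show ?thesis using assms(1-9) e by (simp add: act_port_in)
    next
      case r then show ?thesis using assms(1-9) p[of k a] by (simp add: act_port_in)
    qed
  qed (use assms in simp_all)
qed (use assms in simp_all)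

lemma mul_eqI:
  assumes "span X s" "span Y t" "arr u" "arr v" "tgt u = bprod C (src s) (src t)"
    "tgt v = bprod C (src s) (src t)" "src u = src v"
    "p1 s t ** u = p1 s t ** v" "p2 s t ** u = p2 s t ** v"
  shows "u = v"
  by (rule bprod_eqI[of _ _ "src s" "src t"]) (use assms in simp_all)

text \<open>If every outer input reaches some inner input, it can be read off the state, and
  \<open>act_pr\<close> alone is monic.\<close>

lemma act_plain_eqI:
  assumes wd: "diagram (plain_wiring X Y f g)" and s: "span X s"
    and f: "\<And>k a. fst Y k = Some a \<Longrightarrow> \<exists>j. fst X j \<noteq> None \<and> f j = Some k"
    and x: "arr x" "arr y" "tgt x = src (act (plain_wiring X Y f g) s)" "tgt y = src (act (plain_wiring X Y f g) s)" "src x = src y"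
    and e: "act_pr (plain_wiring X Y f g) s ** x = act_pr (plain_wiring X Y f g) s ** y"
  shows "x = y"
proof (rule act_eqI[OF wd _ x e])
  fix k a assume "fst (wcod (plain_wiring X Y f g)) k = Some a"
  then have "fst Y k = Some a" by simp
  from f[OF this] obtain j where j: "fst X j \<noteq> None" "f j = Some k" by blast
  have "port_in X s j ** act_pr (plain_wiring X Y f g) s ** x = port_in X s j ** act_pr (plain_wiring X Y f g) s ** y" by (simp only: e)
  then show "port_in (wcod (plain_wiring X Y f g)) (act (plain_wiring X Y f g) s) k ** x =
      port_in (wcod (plain_wiring X Y f g)) (act (plain_wiring X Y f g) s) k ** y"
    using act_plain_in[OF wd s x(1,3) j(1)] act_plain_in[OF wd s x(2,4) j(1)] j(2) by simp
qed (use s in simp)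

text \<open>No loops have to be closed, so every state of \<open>s\<close> lifts: the outer input at
  \<open>k\<close> is taken to be what the state receives at \<open>f' k\<close>. Since
  \<open>f'\<close> undoes \<open>f\<close>, this is consistent.\<close>

lemma act_plain_elem:
  assumes wd: "diagram (plain_wiring X Y f g)" and s: "span X s"
    and f': "respects_types (fst Y) (fst X) f'" "\<And>j a. fst X j = Some a \<Longrightarrow> \<exists>k. f j = Some k \<and> f' k = Some j"
    and \<sigma>: "arr \<sigma>" "tgt \<sigma> = src s"
  obtains x where "arr x" "src x = src \<sigma>" "tgt x = src (act (plain_wiring X Y f g) s)"
    "act_pr (plain_wiring X Y f g) s ** x = \<sigma>"
proof -
  let ?r = "\<lambda>k. port_in X s (the (f' k)) ** \<sigma>"
  have r: "?r k \<in> Arr C \<and> src (?r k) = src \<sigma> \<and> tgt (?r k) = a" if k: "fst Y k = Some a" for k a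
    using respects_typesD[OF f'(1) k] s \<sigma> by auto
  show thesis
  proof (rule act_elem_ports[OF wd, of s \<sigma> ?r])
    fix j k assume j: "win (plain_wiring X Y f g) j = Some (InR k)"
    then obtain a where a: "fst X j = Some a" by (cases "fst X j") auto
    then show "port_in (wdom (plain_wiring X Y f g)) s j ** \<sigma> = ?r k" using f'(2)[OF a] j by auto
  next
    fix j k assume "win (plain_wiring X Y f g) j = Some (InL k)"
    then show "port_in (wdom (plain_wiring X Y f g)) s j ** \<sigma> = port_out (wdom (plain_wiring X Y f g)) s k ** \<sigma>"
      by (cases "fst X j") auto
  qed (use r s \<sigma> that in simp_all)
qed

text \<open>The common pattern of associator, unitors and braiding: ports are reindexed along a
  bijection, which makes \<open>act_pr\<close> invertible, and the apexes are reindexed by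
  \<open>k\<close>.\<close>

lemma plain_iso:
  assumes wd: "diagram (plain_wiring X Y f g)" and s: "span X s" and t: "span Y t"
    and f: "\<And>k a. fst Y k = Some a \<Longrightarrow> \<exists>j. fst X j \<noteq> None \<and> f j = Some k"
    and f': "respects_types (fst Y) (fst X) f'" "\<And>j a. fst X j = Some a \<Longrightarrow> \<exists>k. f j = Some k \<and> f' k = Some j"
    and k: "arr k" "src k = src s" "tgt k = src t"
    and k': "arr k'" "src k' = src t" "tgt k' = src s"
    and kk': "\<And>x. \<lbrakk>arr x; tgt x = src t\<rbrakk> \<Longrightarrow> k ** k' ** x = x"
    and k'k: "\<And>x. \<lbrakk>arr x; tgt x = src s\<rbrakk> \<Longrightarrow> k' ** k ** x = x"
    and i: "\<And>j x. \<lbrakk>fst X j \<noteq> None; arr x; tgt x = src s\<rbrakk> \<Longrightarrow> port_in Y t (the (f j)) ** k ** x = port_in X s j ** x"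
    and o: "\<And>j x. \<lbrakk>snd Y j \<noteq> None; arr x; tgt x = src s\<rbrakk> \<Longrightarrow> port_out Y t j ** k ** x = port_out X s (the (g j)) ** x"
  shows "span_map Y (act (plain_wiring X Y f g) s) t (k ** act_pr (plain_wiring X Y f g) s)"
    "is_iso (Sp Y) (act (plain_wiring X Y f g) s, t, k ** act_pr (plain_wiring X Y f g) s)"
proof -
  let ?\<theta> = "plain_wiring X Y f g"
  show m: "span_map Y (act ?\<theta> s) t (k ** act_pr ?\<theta> s)"
  proof (rule span_map_elemI)
    fix j a x assume h: "fst Y j = Some a" "arr x" "tgt x = src (act ?\<theta> s)"
    obtain l where l: "fst X l \<noteq> None" "f l = Some j" using f[OF h(1)] by blast
    show "port_in Y t j ** (k ** act_pr ?\<theta> s) ** x = port_in Y (act ?\<theta> s) j ** x"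
      using i[OF l(1), of "act_pr ?\<theta> s ** x"] act_plain_in[OF wd s h(2,3) l(1)] l h(2,3) wd s k by simp
  next
    fix j a x assume h: "snd Y j = Some a" "arr x" "tgt x = src (act ?\<theta> s)"
    then show "port_out Y t j ** (k ** act_pr ?\<theta> s) ** x = port_out Y (act ?\<theta> s) j ** x"
      using o[of j "act_pr ?\<theta> s ** x"] wd s k by simp
  qed (use wd s t k in simp_all)
  show "is_iso (Sp Y) (act ?\<theta> s, t, k ** act_pr ?\<theta> s)"
  proof (rule span_isoI[OF m])
    have S: "src t \<in> Obj C" using t by simp
    have \<sigma>: "arr k'" "tgt k' = src s" by (rule k' k')+
    obtain x where x: "arr x" "src x = src k'" "tgt x = src (act ?\<theta> s)" "act_pr ?\<theta> s ** x = k'"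
      by (rule act_plain_elem[OF wd s f' \<sigma>])
    have "(k ** act_pr ?\<theta> s) ** x = Ident C (src t)"
      using kk'[of "Ident C (src t)"] x wd s k k' S by simp
    then show "\<exists>u. u \<in> Arr C \<and> tgt u = src (act ?\<theta> s) \<and> src u = src t \<and> (k ** act_pr ?\<theta> s) ** u = Ident C (src t)"
      using x k' by auto
  next
    fix x y assume x: "arr x" "arr y" "src x = src y" "tgt x = src (act ?\<theta> s)" "tgt y = src (act ?\<theta> s)"
      and e: "(k ** act_pr ?\<theta> s) ** x = (k ** act_pr ?\<theta> s) ** y"
    have "k' ** k ** act_pr ?\<theta> s ** x = k' ** k ** act_pr ?\<theta> s ** y"
      using e x wd s k by simp
    then have e': "act_pr ?\<theta> s ** x = act_pr ?\<theta> s ** y" using x wd s by (simp add: k'k)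
    show "x = y" by (rule act_plain_eqI[OF wd s f x(1,2,4,5,3) e'])
  qed
qed

lemma co_id_iso:
  assumes s: "span X s"
  shows "is_iso (Sp X) (s, act (idw X) s, co_id X s)"
proof (rule span_isoI[OF co_id(1)[OF s]])
  note b = span_box[OF s] and c = co_id[OF s]
  note c1 = span_mapD[OF c(1)]
  have S: "src (act (idw X) s) \<in> Obj C" using c1 by simp
  have "co_id X s ** act_pr (idw X) s = Ident C (src (act (idw X) s))"
  proof (rule act_plain_eqI[OF idw_diagram[OF b] s])
    show "act_pr (idw X) s ** co_id X s ** act_pr (idw X) s = act_pr (idw X) s ** Ident C (src (act (idw X) s))"
      using c(2)[of "act_pr (idw X) s"] b s by simp
  qed (use b s c1(3-5) S in auto)
  then show "\<exists>g. g \<in> Arr C \<and> tgt g = src s \<and> src g = src (act (idw X) s) \<and> co_id X s ** g = Ident C (src (act (idw X) s))"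
    using b s by (intro exI[of _ "act_pr (idw X) s"]) simp
  show "x = y" if h: "arr x" "arr y" "src x = src y" "tgt x = src s" "tgt y = src s" "co_id X s ** x = co_id X s ** y" for x y
    by (metis c(2)[OF h(1,4)] c(2)[OF h(2,5)] h(6))
qed

text \<open>Injectivity is \<open>act_act_eqI\<close>. For surjectivity the generic element of the
  composite action is lifted first along \<open>d\<close> and then along \<open>e\<close>; the
  composite action does not record the inputs of the middle box, so these have to be
  reconstructed.\<close>

lemma co_comp_iso:
  assumes "diagram d" "diagram e" "wdom e = wcod d" "span (wdom d) s"
  shows "is_iso (Sp (wcod e)) (act e (act d s), act (wiring_comp e d) s, co_comp e d s)"
proof (rule span_isoI[OF co_comp(1)[OF assms]])
  let ?\<omega> = "wiring_comp e d"
  note c = co_comp[OF assms]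
  note c1 = span_mapD[OF c(1)]
  show "x = y" if h: "arr x" "arr y" "src x = src y" "tgt x = src (act e (act d s))" "tgt y = src (act e (act d s))"
    and e: "co_comp e d s ** x = co_comp e d s ** y" for x y
  proof (rule act_act_eqI[OF assms h(1,4) h(2,5,3)])
    show "act_pr d s ** act_pr e (act d s) ** x = act_pr d s ** act_pr e (act d s) ** y"
      by (metis c(2)[OF h(1,4)] c(2)[OF h(2,5)] e)
    fix j a assume "fst (wcod e) j = Some a"
    then show "port_in (wcod e) (act e (act d s)) j ** x = port_in (wcod e) (act e (act d s)) j ** y"
      using span_map_port(1)[OF c(1) h(1,4), of j] span_map_port(1)[OF c(1) h(2,5), of j] by (metis e option.distinct(1))
  qed
  let ?w = "Ident C (src (act ?\<omega> s))"
  let ?\<sigma> = "act_pr ?\<omega> s"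
  have S: "src (act ?\<omega> s) \<in> Obj C" using c1 by simp
  have w: "arr ?w" "tgt ?w = src (act ?\<omega> s)" "src ?w = src (act ?\<omega> s)" using S by simp_all
  have wd: "diagram ?\<omega>" and sw: "span (wdom ?\<omega>) s" using assms by simp_all
  have \<sigma>: "arr ?\<sigma>" "tgt ?\<sigma> = src s" "src ?\<sigma> = src (act ?\<omega> s)" using assms by simp_all
  have P: "port_in (wdom d) s j ** ?\<sigma> = port_out (wdom d) s k ** ?\<sigma>" if "win ?\<omega> j = Some (InL k)" for j k
    using act_port_in(1)[OF wd sw refl w(1,2) that] \<sigma> by simp
  have Q: "port_in (wdom d) s j ** ?\<sigma> = port_in (wcod e) (act ?\<omega> s) k" if "win ?\<omega> j = Some (InR k)" for j k
  proof -
    have "fst (wcod e) k \<noteq> None" using typed_in_cases[OF wiring_diagramD(5)[OF wd], of j] that by auto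
    then have "port_in (wcod e) (act ?\<omega> s) k ** ?w = port_in (wcod e) (act ?\<omega> s) k" using assms S by auto
    then show ?thesis using act_port_in(2)[OF wd sw refl w(1,2) that refl] \<sigma> by simp
  qed
  \<comment> \<open>The input of the middle box at \<open>j\<close>, reconstructed from its source
    in \<open>e\<close>: an output of the middle box, which \<open>d\<close> takes from an output of
    \<open>s\<close>, or an outer input.\<close>
  define r where "r j = (case win e j of Some (InL u) \<Rightarrow> port_out (wdom d) s (the (wout d u)) ** ?\<sigma> | Some (InR k) \<Rightarrow> port_in (wcod e) (act ?\<omega> s) k)" for j
  have r: "r j \<in> Arr C \<and> src (r j) = src ?\<sigma> \<and> tgt (r j) = a" if j: "fst (wcod d) j = Some a" for j a
  proof -
    consider (l) k l where "win e j = Some (InL k)" "wout d k = Some l" "snd (wdom d) l = Some a"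
      | (r) k where "win e j = Some (InR k)" "fst (wcod e) k = Some a"
      using typed_in_cases[OF wiring_diagramD(5)[OF assms(2)], of j] typed_out_cases[OF wiring_diagramD(6)[OF assms(1)]] assms(3) j by (metis option.distinct(1) option.inject)
    then show ?thesis using assms \<sigma> by cases (simp_all add: r_def)
  qed
  obtain x where x: "arr x" "src x = src ?\<sigma>" "tgt x = src (act d s)" "act_pr d s ** x = ?\<sigma>"
    "\<And>k a. fst (wcod d) k = Some a \<Longrightarrow> port_in (wcod d) (act d s) k ** x = r k"
  proof (rule act_elem_ports[OF assms(1,4) \<sigma>(1,2), of r])
    show "port_in (wdom d) s j ** ?\<sigma> = port_out (wdom d) s k ** ?\<sigma>" if "win d j = Some (InL k)" for j k
      using that by (intro P) (simp add: wiring_comp_maps)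
    show "port_in (wdom d) s j ** ?\<sigma> = r k" if j: "win d j = Some (InR k)" for j k
    proof -
      have "fst (wcod d) k \<noteq> None" using typed_in_cases[OF wiring_diagramD(5)[OF assms(1)], of j] j by auto
      then consider (l) u l where "win e k = Some (InL u)" "wout d u = Some l"
      | (r) u where "win e k = Some (InR u)"
        using typed_in_cases[OF wiring_diagramD(5)[OF assms(2)], of k] typed_out_cases[OF wiring_diagramD(6)[OF assms(1)]] assms(3) by (metis option.distinct(1))
      then show ?thesis
      proof cases
        case l then show ?thesis using P[of j l] j by (simp add: r_def wiring_comp_maps)
      next
        case r then show ?thesis using Q[of j u] j by (simp add: r_def wiring_comp_maps)
      qed
    qed
  qed (use r that in blast)+
  have sa: "span (wdom e) (act d s)" using assms by simp
  obtain y where y: "arr y" "src y = src x" "tgt y = src (act e (act d s))" "act_pr e (act d s) ** y = x"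
    "\<And>k a. fst (wcod e) k = Some a \<Longrightarrow> port_in (wcod e) (act e (act d s)) k ** y = port_in (wcod e) (act ?\<omega> s) k"
  proof (rule act_elem_ports[OF assms(2) sa x(1,3), of "port_in (wcod e) (act ?\<omega> s)"])
    show "port_in (wcod e) (act ?\<omega> s) k \<in> Arr C \<and> src (port_in (wcod e) (act ?\<omega> s) k) = src x \<and> tgt (port_in (wcod e) (act ?\<omega> s) k) = a"
      if "fst (wcod e) k = Some a" for k a using that assms x \<sigma> by simp
    show "port_in (wdom e) (act d s) j ** x = port_out (wdom e) (act d s) k ** x" if j: "win e j = Some (InL k)" for j k
    proof -
      have n: "fst (wcod d) j \<noteq> None" "snd (wcod d) k \<noteq> None" using typed_in_cases[OF wiring_diagramD(5)[OF assms(2)], of j] j assms(3) by auto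
      then show ?thesis using x(5)[of j] x(1-4) j assms by (auto simp: r_def)
    qed
    show "port_in (wdom e) (act d s) j ** x = port_in (wcod e) (act ?\<omega> s) k" if j: "win e j = Some (InR k)" for j k
    proof -
      have n: "fst (wcod d) j \<noteq> None" using typed_in_cases[OF wiring_diagramD(5)[OF assms(2)], of j] j assms(3) by auto
      then show ?thesis using x(5)[of j] j assms by (auto simp: r_def)
    qed
  qed (use that in blast)+
  have "co_comp e d s ** y = ?w"
  proof (rule act_eqI[OF wd sw])
    show "act_pr ?\<omega> s ** co_comp e d s ** y = act_pr ?\<omega> s ** ?w"
      using c(2)[OF y(1,3)] y(4) x(4) \<sigma> by simp
    fix j a assume j: "fst (wcod ?\<omega>) j = Some a"
    then have "port_in (wcod e) (act ?\<omega> s) j ** ?w = port_in (wcod e) (act ?\<omega> s) j" using assms S by auto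
    then show "port_in (wcod ?\<omega>) (act ?\<omega> s) j ** co_comp e d s ** y = port_in (wcod ?\<omega>) (act ?\<omega> s) j ** ?w"
      using span_map_port(1)[OF c(1) y(1,3), of j] y(5) j by simp
  qed (use y x \<sigma> w c1 in simp_all)
  then show "\<exists>g. g \<in> Arr C \<and> tgt g = src (act e (act d s)) \<and> src g = src (act ?\<omega> s) \<and> co_comp e d s ** g = ?w"
    using y x \<sigma> by auto
qed

text \<open>Both directions split into components: the generic element of the action of the sum is
  projected to the two factors, each projection is lifted along its own diagram, and the two lifts
  are paired.\<close>

lemma co_mul_iso:
  assumes "diagram d" "diagram e" "span (wdom d) s" "span (wdom e) t"
  shows "is_iso (Sp (box_sum (wcod d) (wcod e))) (mul (wcod d) (wcod e) (act d s) (act e t),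
      act (wiring_sum d e) (mul (wdom d) (wdom e) s t), co_mul d e s t)"
proof (rule span_isoI[OF co_mul(1)[OF assms]])
  let ?\<omega> = "wiring_sum d e"
  let ?m = "mul (wdom d) (wdom e) s t" and ?n = "mul (wcod d) (wcod e) (act d s) (act e t)"
  note c = co_mul[OF assms]
  note c1 = span_mapD[OF c(1)]
  have S: "src s \<in> Obj C" "src t \<in> Obj C" "src (act ?\<omega> ?m) \<in> Obj C" using c1 assms by simp_all
  have N: "src ?n = bprod C (src (act d s)) (src (act e t))" using assms by simp
  show "x = y" if h: "arr x" "arr y" "src x = src y" "tgt x = src ?n" "tgt y = src ?n"
    and e: "co_mul d e s t ** x = co_mul d e s t ** y" for x y
  proof -
    have h': "tgt x = bprod C (src (act d s)) (src (act e t))" "tgt y = bprod C (src (act d s)) (src (act e t))" using h N by simp_all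
    have "pairing C (act_pr d s ** p1 (act d s) (act e t) ** x) (act_pr e t ** p2 (act d s) (act e t) ** x) =
      pairing C (act_pr d s ** p1 (act d s) (act e t) ** y) (act_pr e t ** p2 (act d s) (act e t) ** y)" (is "pairing C ?a ?b = pairing C ?a' ?b'")
      by (metis c(2)[OF h(1) h'(1)] c(2)[OF h(2) h'(2)] e)
    then have "p1 s t ** pairing C ?a ?b = p1 s t ** pairing C ?a' ?b'" "p2 s t ** pairing C ?a ?b = p2 s t ** pairing C ?a' ?b'" by simp_all
    then have q: "?a = ?a'" "?b = ?b'" using h(1-3) h' assms by simp_all
    have pn: "port_in (box_sum (wcod d) (wcod e)) ?n j ** x = port_in (box_sum (wcod d) (wcod e)) ?n j ** y" if "fst (box_sum (wcod d) (wcod e)) j \<noteq> None" for j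
      by (metis span_map_port(1)[OF c(1) h(1,4) that] span_map_port(1)[OF c(1) h(2,5) that] e)
    show "x = y"
    proof (rule mul_eqI[OF span_act0[OF assms(1,3)] span_act0[OF assms(2,4)]])
      show "p1 (act d s) (act e t) ** x = p1 (act d s) (act e t) ** y"
      proof (rule act_eqI[OF assms(1,3) _ _ _ _ _ q(1)])
        fix j a assume "fst (wcod d) j = Some a"
        then show "port_in (wcod d) (act d s) j ** p1 (act d s) (act e t) ** x = port_in (wcod d) (act d s) j ** p1 (act d s) (act e t) ** y"
          using pn[of "InL j"] h(1-3) h' assms by simp
      qed (use h h' assms in simp_all)
      show "p2 (act d s) (act e t) ** x = p2 (act d s) (act e t) ** y"
      proof (rule act_eqI[OF assms(2,4) _ _ _ _ _ q(2)])
        fix j a assume "fst (wcod e) j = Some a"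
        then show "port_in (wcod e) (act e t) j ** p2 (act d s) (act e t) ** x = port_in (wcod e) (act e t) j ** p2 (act d s) (act e t) ** y"
          using pn[of "InR j"] h(1-3) h' assms by simp
      qed (use h h' assms in simp_all)
    qed (use h h' in simp_all)
  qed
  let ?w = "Ident C (src (act ?\<omega> ?m))"
  let ?\<sigma> = "act_pr ?\<omega> ?m"
  let ?W = "box_sum (wcod d) (wcod e)"
  have w: "arr ?w" "tgt ?w = src (act ?\<omega> ?m)" "src ?w = src (act ?\<omega> ?m)" using S by simp_all
  have wd: "diagram ?\<omega>" and sw: "span (wdom ?\<omega>) ?m" using assms by simp_all
  have \<sigma>: "arr ?\<sigma>" "tgt ?\<sigma> = bprod C (src s) (src t)" "src ?\<sigma> = src (act ?\<omega> ?m)" using assms by simp_all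
  have P: "port_in (wdom ?\<omega>) ?m j ** ?\<sigma> = port_out (wdom ?\<omega>) ?m k ** ?\<sigma>" if "win ?\<omega> j = Some (InL k)" for j k
    using act_port_in(1)[OF wd sw refl w(1,2) that] \<sigma> by simp
  have PW: "port_in ?W (act ?\<omega> ?m) k ** ?w = port_in ?W (act ?\<omega> ?m) k" if "fst ?W k \<noteq> None" for k
    using that assms S by auto
  have Q: "port_in (wdom ?\<omega>) ?m j ** ?\<sigma> = port_in ?W (act ?\<omega> ?m) k" if "win ?\<omega> j = Some (InR k)" for j k
  proof -
    have "fst ?W k \<noteq> None" using typed_in_cases[OF wiring_diagramD(5)[OF wd], of j] that by auto
    then show ?thesis using act_port_in(2)[OF wd sw refl w(1,2) that refl] \<sigma> PW by simp
  qed
  obtain x where x: "arr x" "src x = src (p1 s t ** ?\<sigma>)" "tgt x = src (act d s)" "act_pr d s ** x = p1 s t ** ?\<sigma>"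
    "\<And>k a. fst (wcod d) k = Some a \<Longrightarrow> port_in (wcod d) (act d s) k ** x = port_in ?W (act ?\<omega> ?m) (InL k)"
  proof (rule act_elem_ports[OF assms(1,3), of "p1 s t ** ?\<sigma>" "\<lambda>k. port_in ?W (act ?\<omega> ?m) (InL k)"])
    fix j k assume j: "win d j = Some (InL k)"
    then have "fst (wdom d) j \<noteq> None" "snd (wdom d) k \<noteq> None" using typed_in_cases[OF wiring_diagramD(5)[OF assms(1)], of j] by auto
    then show "port_in (wdom d) s j ** p1 s t ** ?\<sigma> = port_out (wdom d) s k ** p1 s t ** ?\<sigma>"
      using P[of "InL j" "InL k"] j assms \<sigma> by (simp add: inl_app)
  next
    fix j k assume j: "win d j = Some (InR k)"
    then have "fst (wdom d) j \<noteq> None" using typed_in_cases[OF wiring_diagramD(5)[OF assms(1)], of j] by auto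
    then show "port_in (wdom d) s j ** p1 s t ** ?\<sigma> = port_in ?W (act ?\<omega> ?m) (InL k)"
      using Q[of "InL j" "InL k"] j assms \<sigma> by (simp add: inl_app)
  qed (use assms \<sigma> S that in simp_all)
  obtain y where y: "arr y" "src y = src (p2 s t ** ?\<sigma>)" "tgt y = src (act e t)" "act_pr e t ** y = p2 s t ** ?\<sigma>"
    "\<And>k a. fst (wcod e) k = Some a \<Longrightarrow> port_in (wcod e) (act e t) k ** y = port_in ?W (act ?\<omega> ?m) (InR k)"
  proof (rule act_elem_ports[OF assms(2,4), of "p2 s t ** ?\<sigma>" "\<lambda>k. port_in ?W (act ?\<omega> ?m) (InR k)"])
    fix j k assume j: "win e j = Some (InL k)"
    then have "fst (wdom e) j \<noteq> None" "snd (wdom e) k \<noteq> None" using typed_in_cases[OF wiring_diagramD(5)[OF assms(2)], of j] by auto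
    then show "port_in (wdom e) t j ** p2 s t ** ?\<sigma> = port_out (wdom e) t k ** p2 s t ** ?\<sigma>"
      using P[of "InR j" "InR k"] j assms \<sigma> by (simp add: inr_def)
  next
    fix j k assume j: "win e j = Some (InR k)"
    then have "fst (wdom e) j \<noteq> None" using typed_in_cases[OF wiring_diagramD(5)[OF assms(2)], of j] by auto
    then show "port_in (wdom e) t j ** p2 s t ** ?\<sigma> = port_in ?W (act ?\<omega> ?m) (InR k)"
      using Q[of "InR j" "InR k"] j assms \<sigma> by (simp add: inr_def)
  qed (use assms \<sigma> S that in simp_all)
  have D: "src x = src y" "src x = src (act ?\<omega> ?m)" using x(2) y(2) \<sigma> S by simp_all
  have z: "arr (pairing C x y)" "tgt (pairing C x y) = bprod C (src (act d s)) (src (act e t))" "src (pairing C x y) = src (act ?\<omega> ?m)"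
    using x(1,3) y(1,3) D by simp_all
  have "co_mul d e s t ** pairing C x y = ?w"
  proof (rule act_eqI[OF wd sw])
    have "pairing C (p1 s t ** ?\<sigma>) (p2 s t ** ?\<sigma>) = ?\<sigma>"
      by (rule mul_eqI[OF assms(3,4)]) (use \<sigma> S in simp_all)
    then show "act_pr ?\<omega> ?m ** co_mul d e s t ** pairing C x y = act_pr ?\<omega> ?m ** ?w"
      using c(2)[OF z(1,2)] x(1,3,4) y(1,3,4) D \<sigma> by simp
    fix j a assume j: "fst (wcod ?\<omega>) j = Some a"
    have "port_in ?W ?n j ** pairing C x y = port_in ?W (act ?\<omega> ?m) j"
      using j x(1,3,5) y(1,3,5) D(1) z assms by (auto simp: typed_sum_eq_Some)
    then show "port_in (wcod ?\<omega>) (act ?\<omega> ?m) j ** co_mul d e s t ** pairing C x y = port_in (wcod ?\<omega>) (act ?\<omega> ?m) j ** ?w"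
      using span_map_port(1)[OF c(1) z(1), of j] z(2) N PW[of j] j by simp
  qed (use z w c1 N in simp_all)
  then show "\<exists>g. g \<in> Arr C \<and> tgt g = src ?n \<and> src g = src (act ?\<omega> ?m) \<and> co_mul d e s t ** g = ?w"
    using z N by (intro exI[of _ "pairing C x y"]) simp
qed

end

lemma is_functor_id: "is_category A \<Longrightarrow> is_functor A A id_functor"
  by (auto simp: is_functor_def id_functor_def is_category_def Hom_def)

lemma is_functor_comp: "\<lbrakk>is_functor A B F; is_functor B D G\<rbrakk> \<Longrightarrow> is_functor A D (G \<circ>\<^sub>F F)"
  by (auto simp: is_functor_def comp_functor_def Hom_def)

lemma is_functor_prod: "\<lbrakk>is_functor A B F; is_functor A' B' G\<rbrakk> \<Longrightarrow> is_functor (A \<times>\<^sub>C A') (B \<times>\<^sub>C B') (F \<times>\<^sub>F G)"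
  by (auto simp: is_functor_def prod_functor_def prod_category_def Hom_def)

section \<open>Inverse comparison maps and the functors between fibres\<close>

context fincomplete
begin

text \<open>Pasting of cells goes along the inverses of \<open>CoComp\<close> and
  \<open>CoMul\<close>, so these need evaluation rules of their own; they satisfy the equations of
  the comparison maps read backwards.\<close>

definition icomp :: "('l, 'o) wiring_diagram \<Rightarrow> ('l, 'o) wiring_diagram \<Rightarrow> 'm \<Rightarrow> 'm" where
  "icomp e d s = span_inv (wcod e) (act e (act d s)) (act (wiring_comp e d) s) (co_comp e d s)"

definition imul :: "('l, 'o) wiring_diagram \<Rightarrow> ('l, 'o) wiring_diagram \<Rightarrow> 'm \<Rightarrow> 'm \<Rightarrow> 'm" where
  "imul d e s t = span_inv (box_sum (wcod d) (wcod e)) (mul (wcod d) (wcod e) (act d s) (act e t))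
      (act (wiring_sum d e) (mul (wdom d) (wdom e) s t)) (co_mul d e s t)"

lemma span_map_arr:
  assumes "span_map X s t h"
  shows "arr h" "src h = src s" "tgt h = src t"
  using span_mapD[OF assms] by simp_all

lemma icomp:
  assumes "diagram d" "diagram e" "wdom e = wcod d" "span (wdom d) s"
  shows "inv_arr (Sp (wcod e)) (act e (act d s), act (wiring_comp e d) s, co_comp e d s) =
      (act (wiring_comp e d) s, act e (act d s), icomp e d s)"
    "span_map (wcod e) (act (wiring_comp e d) s) (act e (act d s)) (icomp e d s)"
    "\<lbrakk>arr x; tgt x = src (act (wiring_comp e d) s)\<rbrakk> \<Longrightarrow>
      act_pr d s ** act_pr e (act d s) ** icomp e d s ** x = act_pr (wiring_comp e d) s ** x"
proof -
  note i = span_inv[OF co_comp(1)[OF assms] co_comp_iso[OF assms], folded icomp_def]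
  show "inv_arr (Sp (wcod e)) (act e (act d s), act (wiring_comp e d) s, co_comp e d s) =
      (act (wiring_comp e d) s, act e (act d s), icomp e d s)"
    "span_map (wcod e) (act (wiring_comp e d) s) (act e (act d s)) (icomp e d s)" by (rule i)+
  show "act_pr d s ** act_pr e (act d s) ** icomp e d s ** x = act_pr (wiring_comp e d) s ** x"
    if x: "arr x" "tgt x = src (act (wiring_comp e d) s)"
    using co_comp(2)[OF assms, of "icomp e d s ** x"] i(3)[OF x] span_mapD(3-5)[OF i(2)] x by simp
qed

lemma icomp_simps [simp]:
  assumes "diagram d" "diagram e" "wdom e = wcod d" "span (wdom d) s"
  shows "arr (icomp e d s)" "src (icomp e d s) = src (act (wiring_comp e d) s)"
    "tgt (icomp e d s) = src (act e (act d s))"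
    "\<lbrakk>arr x; tgt x = src (act (wiring_comp e d) s)\<rbrakk> \<Longrightarrow>
      act_pr d s ** act_pr e (act d s) ** icomp e d s ** x = act_pr (wiring_comp e d) s ** x"
    "\<lbrakk>arr x; tgt x = src (act (wiring_comp e d) s); Z = wcod e; fst Z j \<noteq> None\<rbrakk> \<Longrightarrow>
      port_in Z (act e (act d s)) j ** icomp e d s ** x = port_in Z (act (wiring_comp e d) s) j ** x"
proof -
  note i = icomp[OF assms]
  show "arr (icomp e d s)" "src (icomp e d s) = src (act (wiring_comp e d) s)"
    "tgt (icomp e d s) = src (act e (act d s))"
    by (rule span_map_arr[OF i(2)])+
  { assume x: "arr x" "tgt x = src (act (wiring_comp e d) s)"
    show "act_pr d s ** act_pr e (act d s) ** icomp e d s ** x = act_pr (wiring_comp e d) s ** x"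
      by (rule i(3)[OF x])
    assume "Z = wcod e" "fst Z j \<noteq> None"
    then show "port_in Z (act e (act d s)) j ** icomp e d s ** x = port_in Z (act (wiring_comp e d) s) j ** x"
      using span_map_port(1)[OF i(2) x, of j] by simp }
qed

lemma co_comp_simps [simp]:
  assumes "diagram d" "diagram e" "wdom e = wcod d" "span (wdom d) s"
  shows "arr (co_comp e d s)" "src (co_comp e d s) = src (act e (act d s))"
    "tgt (co_comp e d s) = src (act (wiring_comp e d) s)"
    "\<lbrakk>arr x; tgt x = src (act e (act d s))\<rbrakk> \<Longrightarrow>
      act_pr (wiring_comp e d) s ** co_comp e d s ** x = act_pr d s ** act_pr e (act d s) ** x"
  using span_map_arr[OF co_comp(1)[OF assms]] co_comp(2)[OF assms] by simp_all

lemma imul: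
  assumes "diagram d" "diagram e" "span (wdom d) s" "span (wdom e) t"
  defines "m \<equiv> mul (wdom d) (wdom e) s t" and "n \<equiv> mul (wcod d) (wcod e) (act d s) (act e t)"
  shows "inv_arr (Sp (box_sum (wcod d) (wcod e))) (n, act (wiring_sum d e) m, co_mul d e s t) =
      (act (wiring_sum d e) m, n, imul d e s t)"
    "span_map (box_sum (wcod d) (wcod e)) (act (wiring_sum d e) m) n (imul d e s t)"
    "\<lbrakk>arr x; tgt x = src (act (wiring_sum d e) m)\<rbrakk> \<Longrightarrow>
      pairing C (act_pr d s ** p1 (act d s) (act e t) ** imul d e s t ** x) (act_pr e t ** p2 (act d s) (act e t) ** imul d e s t ** x) =
      act_pr (wiring_sum d e) m ** x"
proof -
  note i = span_inv[OF co_mul(1)[OF assms(1-4)] co_mul_iso[OF assms(1-4)], folded imul_def, folded m_def n_def]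
  show "inv_arr (Sp (box_sum (wcod d) (wcod e))) (n, act (wiring_sum d e) m, co_mul d e s t) =
      (act (wiring_sum d e) m, n, imul d e s t)"
    "span_map (box_sum (wcod d) (wcod e)) (act (wiring_sum d e) m) n (imul d e s t)" by (rule i)+
  have N: "src n = bprod C (src (act d s)) (src (act e t))" using assms by simp
  show "pairing C (act_pr d s ** p1 (act d s) (act e t) ** imul d e s t ** x) (act_pr e t ** p2 (act d s) (act e t) ** imul d e s t ** x) =
      act_pr (wiring_sum d e) m ** x"
    if x: "arr x" "tgt x = src (act (wiring_sum d e) m)"
    using co_mul(2)[OF assms(1-4), of "imul d e s t ** x"] i(3)[OF x] span_map_arr[OF i(2)] x N by (simp add: m_def)
qed

lemma imul_simps [simp]:
  assumes "diagram d" "diagram e" "span (wdom d) s" "span (wdom e) t"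
  shows "arr (imul d e s t)" "src (imul d e s t) = src (act (wiring_sum d e) (mul (wdom d) (wdom e) s t))"
    "tgt (imul d e s t) = bprod C (src (act d s)) (src (act e t))"
    "\<lbrakk>arr x; tgt x = src (act (wiring_sum d e) (mul (wdom d) (wdom e) s t))\<rbrakk> \<Longrightarrow>
      act_pr d s ** p1 (act d s) (act e t) ** imul d e s t ** x = p1 s t ** act_pr (wiring_sum d e) (mul (wdom d) (wdom e) s t) ** x"
    "\<lbrakk>arr x; tgt x = src (act (wiring_sum d e) (mul (wdom d) (wdom e) s t))\<rbrakk> \<Longrightarrow>
      act_pr e t ** p2 (act d s) (act e t) ** imul d e s t ** x = p2 s t ** act_pr (wiring_sum d e) (mul (wdom d) (wdom e) s t) ** x"
    "\<lbrakk>arr x; tgt x = src (act (wiring_sum d e) (mul (wdom d) (wdom e) s t)); Z = wcod d; fst Z j \<noteq> None\<rbrakk> \<Longrightarrow>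
      port_in Z (act d s) j ** p1 (act d s) (act e t) ** imul d e s t ** x =
      port_in (box_sum Z (wcod e)) (act (wiring_sum d e) (mul (wdom d) (wdom e) s t)) (InL j) ** x"
    "\<lbrakk>arr x; tgt x = src (act (wiring_sum d e) (mul (wdom d) (wdom e) s t)); Z = wcod e; fst Z j \<noteq> None\<rbrakk> \<Longrightarrow>
      port_in Z (act e t) j ** p2 (act d s) (act e t) ** imul d e s t ** x =
      port_in (box_sum (wcod d) Z) (act (wiring_sum d e) (mul (wdom d) (wdom e) s t)) (InR j) ** x"
proof -
  let ?m = "mul (wdom d) (wdom e) s t" and ?n = "mul (wcod d) (wcod e) (act d s) (act e t)"
  note i = imul[OF assms(1-4)]
  have N: "src ?n = bprod C (src (act d s)) (src (act e t))" using assms by simp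
  show a: "arr (imul d e s t)" "src (imul d e s t) = src (act (wiring_sum d e) ?m)"
    "tgt (imul d e s t) = bprod C (src (act d s)) (src (act e t))"
    using span_map_arr[OF i(2)] N by simp_all
  { assume x: "arr x" "tgt x = src (act (wiring_sum d e) ?m)"
    let ?a = "act_pr d s ** p1 (act d s) (act e t) ** imul d e s t ** x"
    let ?b = "act_pr e t ** p2 (act d s) (act e t) ** imul d e s t ** x"
    have ab: "arr ?a" "arr ?b" "src ?a = src ?b" "tgt ?a = src s" "tgt ?b = src t"
      using x a assms by simp_all
    have "p1 s t ** pairing C ?a ?b = ?a" "p2 s t ** pairing C ?a ?b = ?b" using ab by simp_all
    then show "?a = p1 s t ** act_pr (wiring_sum d e) ?m ** x" "?b = p2 s t ** act_pr (wiring_sum d e) ?m ** x"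
      by (simp_all only: i(3)[OF x])
    { assume Z: "Z = wcod d" "fst Z j \<noteq> None"
      show "port_in Z (act d s) j ** p1 (act d s) (act e t) ** imul d e s t ** x =
        port_in (box_sum Z (wcod e)) (act (wiring_sum d e) ?m) (InL j) ** x"
        using span_map_port(1)[OF i(2) x, of "InL j"] Z x a assms by simp }
    { assume Z: "Z = wcod e" "fst Z j \<noteq> None"
      show "port_in Z (act e t) j ** p2 (act d s) (act e t) ** imul d e s t ** x =
        port_in (box_sum (wcod d) Z) (act (wiring_sum d e) ?m) (InR j) ** x"
        using span_map_port(1)[OF i(2) x, of "InR j"] Z x a assms by simp } }
qed

lemma co_mul_simps [simp]:
  assumes "diagram d" "diagram e" "span (wdom d) s" "span (wdom e) t"
  shows "arr (co_mul d e s t)" "src (co_mul d e s t) = bprod C (src (act d s)) (src (act e t))"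
    "tgt (co_mul d e s t) = src (act (wiring_sum d e) (mul (wdom d) (wdom e) s t))"
    "\<lbrakk>arr x; tgt x = bprod C (src (act d s)) (src (act e t)); X = wdom d; Y = wdom e\<rbrakk> \<Longrightarrow>
      act_pr (wiring_sum d e) (mul X Y s t) ** co_mul d e s t ** x =
      pairing C (act_pr d s ** p1 (act d s) (act e t) ** x) (act_pr e t ** p2 (act d s) (act e t) ** x)"
  using span_map_arr[OF co_mul(1)[OF assms]] co_mul(2)[OF assms] assms by simp_all

lemma co_id_simps [simp]:
  assumes "span X s"
  shows "arr (co_id X s)" "src (co_id X s) = src s" "tgt (co_id X s) = src (act (idw X) s)"
    "\<lbrakk>arr x; tgt x = src s\<rbrakk> \<Longrightarrow> act_pr (idw X) s ** co_id X s ** x = x"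
  using span_map_arr[OF co_id(1)[OF assms]] co_id(2)[OF assms] by simp_all

text \<open>\<open>act_pr\<close> undoes \<open>co_id\<close> by construction, so it has to be the
  two-sided inverse.\<close>

lemma co_id_inv:
  assumes "span X s"
  shows "inv_arr (Sp X) (s, act (idw X) s, co_id X s) = (act (idw X) s, s, act_pr (idw X) s)"
    "span_map X (act (idw X) s) s (act_pr (idw X) s)"
proof -
  note i = span_inv[OF co_id(1)[OF assms] co_id_iso[OF assms]]
  note m = span_map_arr[OF i(2)]
  note b = span_box[OF assms]
  have "span_inv X s (act (idw X) s) (co_id X s) = act_pr (idw X) s"
  proof (rule arr_eqI)
    fix x assume x: "arr x" "tgt x = src (span_inv X s (act (idw X) s) (co_id X s))"
    have x': "tgt x = src (act (idw X) s)" using x m by simp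
    have y: "arr (span_inv X s (act (idw X) s) (co_id X s) ** x)" "tgt (span_inv X s (act (idw X) s) (co_id X s) ** x) = src s"
      using x m by simp_all
    show "span_inv X s (act (idw X) s) (co_id X s) ** x = act_pr (idw X) s ** x"
      using co_id(2)[OF assms y] i(3)[OF x(1) x'] by simp
  qed (use m b assms in simp_all)
  then show "inv_arr (Sp X) (s, act (idw X) s, co_id X s) = (act (idw X) s, s, act_pr (idw X) s)"
    "span_map X (act (idw X) s) s (act_pr (idw X) s)"
    using i(1,2) by simp_all
qed

text \<open>Maps of spans agree on the outer inputs by definition, so \<open>act_pr\<close> decides.
  The equations of the pseudofunctor and of the laxator have an action as their target and are
  settled in this way.\<close>

lemma span_map_eqI:
  assumes "diagram d" "span (wdom d) s"
    and h: "span_map (wcod d) A (act d s) h" and k: "span_map (wcod d) A (act d s) k"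
    and e: "\<And>x. \<lbrakk>arr x; tgt x = src A\<rbrakk> \<Longrightarrow> act_pr d s ** h ** x = act_pr d s ** k ** x"
  shows "h = k"
proof (rule arr_eqI)
  fix x assume x: "arr x" "tgt x = src h"
  have x': "tgt x = src A" using x span_map_arr[OF h] by simp
  show "h ** x = k ** x"
  proof (rule act_eqI[OF assms(1,2) _ _ _ _ _ e[OF x(1) x']])
    show "port_in (wcod d) (act d s) j ** h ** x = port_in (wcod d) (act d s) j ** k ** x" if "fst (wcod d) j = Some a" for j a
      using span_map_port(1)[OF h x(1) x', of j] span_map_port(1)[OF k x(1) x', of j] that by simp
  qed (use x x' span_map_arr[OF h] span_map_arr[OF k] in simp_all)
qed (use span_map_arr[OF h] span_map_arr[OF k] in simp_all)

lemma act_arr_Ident: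
  assumes "diagram d" "span (wdom d) s"
  shows "act_arr d s s (Ident C (src s)) = Ident C (src (act d s))"
proof (rule span_map_eqI[OF assms act_arr(1)[OF assms(1) span_map_Ident[OF assms(2)]] span_map_Ident[OF span_act0[OF assms]]])
  fix x assume x: "arr x" "tgt x = src (act d s)"
  have "src s \<in> Obj C" using assms by simp
  then show "act_pr d s ** act_arr d s s (Ident C (src s)) ** x = act_pr d s ** Ident C (src (act d s)) ** x"
    using act_arr(2)[OF assms(1) span_map_Ident[OF assms(2)] x] x assms by simp
qed

lemma act_arr_comp:
  assumes wd: "diagram d" and h: "span_map (wdom d) s t h" and k: "span_map (wdom d) t u k"
  shows "act_arr d s u (k ** h) = act_arr d t u k ** act_arr d s t h"
proof (rule span_map_eqI[OF wd span_mapD(2)[OF k] act_arr(1)[OF wd span_map_comp[OF h k]]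
      span_map_comp[OF act_arr(1)[OF wd h] act_arr(1)[OF wd k]]])
  fix x assume x: "arr x" "tgt x = src (act d s)"
  show "act_pr d u ** act_arr d s u (k ** h) ** x = act_pr d u ** (act_arr d t u k ** act_arr d s t h) ** x"
    unfolding act_arr(2)[OF wd span_map_comp[OF h k] x]
    using x wd h k span_mapD(1-5)[OF h] span_mapD(1-5)[OF k] by simp
qed

abbreviation "W \<equiv> wiring C"
abbreviation "F \<equiv> span_systems C"

lemma span_systems_simps [simp]:
  "Fib (span_systems C :: ('l, 'o, 'm) span_algebra) X = Sp X"
  "Act (span_systems C :: ('l, 'o, 'm) span_algebra) = span_act C"
  "OM (Mul (span_systems C :: ('l, 'o, 'm) span_algebra) X Y) (s, t) = mul X Y s t"
  "AM (Mul (span_systems C :: ('l, 'o, 'm) span_algebra) X Y) ((s, s', h), (t, t', k)) = (mul X Y s t, mul X Y s' t', par C h k)"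
  by (simp_all add: span_systems_def span_mul_def)

lemma span_act_functor:
  assumes wd: "diagram d"
  shows "is_functor (Sp (wdom d)) (Sp (wcod d)) (span_act C d)"
  unfolding is_functor_def
proof (intro conjI ballI impI)
  note b = is_box_ends[OF wd]
  note S = span_slice[OF b(1)] span_slice[OF b(2)] span_map_slice[OF b(1)] span_map_slice[OF b(2)]
  show "act d s \<in> Obj (Sp (wcod d))" if "s \<in> Obj (Sp (wdom d))" for s
    using that wd unfolding S by simp
  fix f assume f: "f \<in> Arr (Sp (wdom d))"
  obtain s t h where f': "f = (s, t, h)" by (cases f)
  have h: "span_map (wdom d) s t h" using f unfolding f' S .
  show "AM (span_act C d) f \<in> Hom (Sp (wcod d)) (act d (Dom (Sp (wdom d)) f)) (act d (Cod (Sp (wdom d)) f))"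
    unfolding f' AM_span_act Hom_def using act_arr(1)[OF wd h] by (simp add: S del: slice_simps(2))
  fix g assume g: "g \<in> Arr (Sp (wdom d))" "Dom (Sp (wdom d)) g = Cod (Sp (wdom d)) f"
  obtain u k where g': "g = (t, u, k)" using g(2) by (cases g) (simp add: f')
  have k: "span_map (wdom d) t u k" using g(1) unfolding g' S .
  show "AM (span_act C d) (g \<cdot>\<^bsub>Sp (wdom d)\<^esub> f) = AM (span_act C d) g \<cdot>\<^bsub>Sp (wcod d)\<^esub> AM (span_act C d) f"
    by (simp add: f' g' AM_span_act act_arr_comp[OF wd h k])
next
  note b = is_box_ends[OF wd]
  fix s assume "s \<in> Obj (Sp (wdom d))"
  then have s: "span (wdom d) s" unfolding span_slice[OF b(1)] .
  show "AM (span_act C d) (Ident (Sp (wdom d)) s) = Ident (Sp (wcod d)) (act d s)"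
    by (simp add: AM_span_act act_arr_Ident[OF wd s])
qed

section \<open>Associator, braiding and unitors of the span algebra\<close>

definition kassoc :: "('l, 'o) box \<Rightarrow> ('l, 'o) box \<Rightarrow> 'm \<Rightarrow> 'm \<Rightarrow> 'm \<Rightarrow> 'm" where
  "kassoc X Y s t u = pairing C (p1 s t ** p1 (mul X Y s t) u)
     (pairing C (p2 s t ** p1 (mul X Y s t) u) (p2 (mul X Y s t) u))"

definition kassoc' :: "('l, 'o) box \<Rightarrow> ('l, 'o) box \<Rightarrow> 'm \<Rightarrow> 'm \<Rightarrow> 'm \<Rightarrow> 'm" where
  "kassoc' Y Z s t u = pairing C (pairing C (p1 s (mul Y Z t u)) (p1 t u ** p2 s (mul Y Z t u)))
     (p2 t u ** p2 s (mul Y Z t u))"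

abbreviation assocw :: "('l, 'o) box \<Rightarrow> ('l, 'o) box \<Rightarrow> ('l, 'o) box \<Rightarrow> ('l, 'o) wiring_diagram" where
  "assocw X Y Z \<equiv> plain_wiring (box_sum (box_sum X Y) Z) (box_sum X (box_sum Y Z)) reassoc unassoc"
abbreviation lunitw :: "('l, 'o) box \<Rightarrow> ('l, 'o) wiring_diagram" where
  "lunitw X \<equiv> plain_wiring (box_sum empty_box X) X (copair Map.empty Some) inr"
abbreviation runitw :: "('l, 'o) box \<Rightarrow> ('l, 'o) wiring_diagram" where
  "runitw X \<equiv> plain_wiring (box_sum X empty_box) X (copair Some Map.empty) inl"
abbreviation braidw :: "('l, 'o) box \<Rightarrow> ('l, 'o) box \<Rightarrow> ('l, 'o) wiring_diagram" where
  "braidw X Y \<equiv> plain_wiring (box_sum X Y) (box_sum Y X) (copair inr inl) (copair inr inl)"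

lemma structural_diagrams [simp]:
  "\<lbrakk>is_box X; is_box Y; is_box Z\<rbrakk> \<Longrightarrow> assocw X Y Z \<in> wiring_diagrams C"
  "is_box X \<Longrightarrow> lunitw X \<in> wiring_diagrams C" "is_box X \<Longrightarrow> runitw X \<in> wiring_diagrams C"
  "\<lbrakk>is_box X; is_box Y\<rbrakk> \<Longrightarrow> braidw X Y \<in> wiring_diagrams C"
  by (rule plain_diagram; simp add: respects_reassoc respects_types_intros)+

definition co_assoc :: "('l, 'o) box \<Rightarrow> ('l, 'o) box \<Rightarrow> ('l, 'o) box \<Rightarrow> 'm \<Rightarrow> 'm \<Rightarrow> 'm \<Rightarrow> 'm" where
  "co_assoc X Y Z s t u = kassoc X Y s t u ** act_pr (assocw X Y Z) (mul (box_sum X Y) Z (mul X Y s t) u)"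

lemma co_assoc:
  assumes "span X s" "span Y t" "span Z u"
  defines "m \<equiv> mul (box_sum X Y) Z (mul X Y s t) u" and "n \<equiv> mul X (box_sum Y Z) s (mul Y Z t u)"
  shows "span_map (box_sum X (box_sum Y Z)) (act (assocw X Y Z) m) n (co_assoc X Y Z s t u)"
    "is_iso (Sp (box_sum X (box_sum Y Z))) (act (assocw X Y Z) m, n, co_assoc X Y Z s t u)"
proof -
  note b = span_box[OF assms(1)] span_box[OF assms(2)] span_box[OF assms(3)]
  have O: "src s \<in> Obj C" "src t \<in> Obj C" "src u \<in> Obj C" using assms by simp_all
  have sp: "span (box_sum (box_sum X Y) Z) m" "span (box_sum X (box_sum Y Z)) n" using assms by simp_all
  have *: "kassoc X Y s t u ** kassoc' Y Z s t u ** x = x" if "arr x" "tgt x = src n" for x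
  proof (rule bprod_eqI[of _ _ "src s" "bprod C (src t) (src u)"])
    show "pr2 C (src s) (bprod C (src t) (src u)) ** kassoc X Y s t u ** kassoc' Y Z s t u ** x = pr2 C (src s) (bprod C (src t) (src u)) ** x"
      by (rule bprod_eqI[of _ _ "src t" "src u"]) (use that assms O in \<open>simp_all add: kassoc_def kassoc'_def\<close>)
  qed (use that assms O in \<open>simp_all add: kassoc_def kassoc'_def\<close>)
  have **: "kassoc' Y Z s t u ** kassoc X Y s t u ** x = x" if "arr x" "tgt x = src m" for x
  proof (rule bprod_eqI[of _ _ "bprod C (src s) (src t)" "src u"])
    show "pr1 C (bprod C (src s) (src t)) (src u) ** kassoc' Y Z s t u ** kassoc X Y s t u ** x = pr1 C (bprod C (src s) (src t)) (src u) ** x"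
      by (rule bprod_eqI[of _ _ "src s" "src t"]) (use that assms O in \<open>simp_all add: kassoc_def kassoc'_def\<close>)
  qed (use that assms O in \<open>simp_all add: kassoc_def kassoc'_def\<close>)
  have f: "\<exists>j. fst (box_sum (box_sum X Y) Z) j \<noteq> None \<and> reassoc j = Some k" if "fst (box_sum X (box_sum Y Z)) k = Some a" for k a
    using respects_typesD[OF respects_reassoc(2), of "fst X" "fst Y" "fst Z" k a] that
    by (auto simp: typed_sum_eq_Some inl_app intro!: exI[of _ "the (unassoc k)"])
  have f': "\<exists>k. reassoc j = Some k \<and> unassoc k = Some j" if "fst (box_sum (box_sum X Y) Z) j = Some a" for j a
    using that by (auto simp: typed_sum_eq_Some inl_app)
  have r: "respects_types (fst (box_sum X (box_sum Y Z))) (fst (box_sum (box_sum X Y) Z)) unassoc"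
    by (simp add: respects_reassoc)
  have k: "arr (kassoc X Y s t u)" "src (kassoc X Y s t u) = src m" "tgt (kassoc X Y s t u) = src n"
    "arr (kassoc' Y Z s t u)" "src (kassoc' Y Z s t u) = src n" "tgt (kassoc' Y Z s t u) = src m"
    using assms O by (simp_all add: kassoc_def kassoc'_def)
  have i: "port_in (box_sum X (box_sum Y Z)) n (the (reassoc j)) ** kassoc X Y s t u ** x = port_in (box_sum (box_sum X Y) Z) m j ** x"
    if "fst (box_sum (box_sum X Y) Z) j \<noteq> None" "arr x" "tgt x = src m" for j x
    using that assms O by (auto simp: typed_sum_eq_Some inl_app kassoc_def)
  have o: "port_out (box_sum X (box_sum Y Z)) n j ** kassoc X Y s t u ** x = port_out (box_sum (box_sum X Y) Z) m (the (unassoc j)) ** x"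
    if "snd (box_sum X (box_sum Y Z)) j \<noteq> None" "arr x" "tgt x = src m" for j x
    using that assms O by (auto simp: typed_sum_eq_Some inl_app kassoc_def)
  have wd: "diagram (assocw X Y Z)" using b by simp
  show "span_map (box_sum X (box_sum Y Z)) (act (assocw X Y Z) m) n (co_assoc X Y Z s t u)"
    unfolding co_assoc_def m_def[symmetric] by (rule plain_iso(1)[OF wd sp f r f' k * ** i o])
  show "is_iso (Sp (box_sum X (box_sum Y Z))) (act (assocw X Y Z) m, n, co_assoc X Y Z s t u)"
    unfolding co_assoc_def m_def[symmetric] by (rule plain_iso(2)[OF wd sp f r f' k * ** i o])
qed

definition co_braid :: "('l, 'o) box \<Rightarrow> ('l, 'o) box \<Rightarrow> 'm \<Rightarrow> 'm \<Rightarrow> 'm" where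
  "co_braid X Y s t = pairing C (p2 s t) (p1 s t) ** act_pr (braidw X Y) (mul X Y s t)"

lemma co_braid:
  assumes "span X s" "span Y t"
  shows "span_map (box_sum Y X) (act (braidw X Y) (mul X Y s t)) (mul Y X t s) (co_braid X Y s t)"
    "is_iso (Sp (box_sum Y X)) (act (braidw X Y) (mul X Y s t), mul Y X t s, co_braid X Y s t)"
proof -
  note b = span_box[OF assms(1)] span_box[OF assms(2)]
  have O: "src s \<in> Obj C" "src t \<in> Obj C" using assms by simp_all
  have sp: "span (box_sum X Y) (mul X Y s t)" "span (box_sum Y X) (mul Y X t s)" using assms by simp_all
  let ?k = "pairing C (p2 s t) (p1 s t)" and ?k' = "pairing C (p2 t s) (p1 t s)"
  have *: "?k ** ?k' ** x = x" if "arr x" "tgt x = src (mul Y X t s)" for x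
    by (rule bprod_eqI[of _ _ "src t" "src s"]) (use that assms O in simp_all)
  have **: "?k' ** ?k ** x = x" if "arr x" "tgt x = src (mul X Y s t)" for x
    by (rule bprod_eqI[of _ _ "src s" "src t"]) (use that assms O in simp_all)
  have f: "\<exists>j. fst (box_sum X Y) j \<noteq> None \<and> copair inr inl j = Some k" if "fst (box_sum Y X) k = Some a" for k a
    using that by (auto simp: typed_sum_eq_Some inl_app intro!: exI[of _ "the (copair inr inl k)"])
  have f': "\<exists>k. copair inr inl j = Some k \<and> copair inr inl k = Some j" if "fst (box_sum X Y) j = Some a" for j a
    using that by (auto simp: typed_sum_eq_Some inl_app)
  have r: "respects_types (fst (box_sum Y X)) (fst (box_sum X Y)) (copair inr inl)"
    by (simp add: respects_types_intros)
  have k: "arr ?k" "src ?k = src (mul X Y s t)" "tgt ?k = src (mul Y X t s)"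
    "arr ?k'" "src ?k' = src (mul Y X t s)" "tgt ?k' = src (mul X Y s t)"
    using assms O by simp_all
  have i: "port_in (box_sum Y X) (mul Y X t s) (the (copair inr inl j)) ** ?k ** x = port_in (box_sum X Y) (mul X Y s t) j ** x"
    if "fst (box_sum X Y) j \<noteq> None" "arr x" "tgt x = src (mul X Y s t)" for j x
    using that assms O by (auto simp: typed_sum_eq_Some inl_app)
  have o: "port_out (box_sum Y X) (mul Y X t s) j ** ?k ** x = port_out (box_sum X Y) (mul X Y s t) (the (copair inr inl j)) ** x"
    if "snd (box_sum Y X) j \<noteq> None" "arr x" "tgt x = src (mul X Y s t)" for j x
    using that assms O by (auto simp: typed_sum_eq_Some inl_app)
  have wd: "diagram (braidw X Y)" using b by simp
  show "span_map (box_sum Y X) (act (braidw X Y) (mul X Y s t)) (mul Y X t s) (co_braid X Y s t)"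
    unfolding co_braid_def by (rule plain_iso(1)[OF wd sp f r f' k * ** i o])
  show "is_iso (Sp (box_sum Y X)) (act (braidw X Y) (mul X Y s t), mul Y X t s, co_braid X Y s t)"
    unfolding co_braid_def by (rule plain_iso(2)[OF wd sp f r f' k * ** i o])
qed

definition eta :: "'l itself \<Rightarrow> 'm" where
  "eta _ = Eta (span_systems C :: ('l, 'o, 'm) span_algebra)"

lemma span_eta [simp]:
  "span (empty_box :: ('l, 'o) box) (eta TYPE('l))" "src (eta TYPE('l)) = hat C (Map.empty :: ('l, 'o) typed_set)"
proof -
  have O: "hat C (Map.empty :: ('l, 'o) typed_set) \<in> Obj C" by simp
  have e: "eta TYPE('l) = pairing C (Ident C (hat C (Map.empty :: ('l, 'o) typed_set))) (Ident C (hat C (Map.empty :: ('l, 'o) typed_set)))"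
    by (simp add: eta_def span_systems_def Let_def)
  show "src (eta TYPE('l)) = hat C (Map.empty :: ('l, 'o) typed_set)" using O by (simp add: e)
  show "span (empty_box :: ('l, 'o) box) (eta TYPE('l))" unfolding span_iff[OF is_box_empty]
    using O by (simp add: e interface_def)
qed

lemma eta_eqI:
  assumes "arr u" "arr v" "tgt u = hat C (Map.empty :: ('l, 'o) typed_set)" "tgt v = hat C (Map.empty :: ('l, 'o) typed_set)" "src u = src v"
  shows "u = v"
  by (rule hat_eqI[OF empty_typed_sets assms]) simp

definition co_lunit :: "('l, 'o) box \<Rightarrow> 'm \<Rightarrow> 'm" where
  "co_lunit X s = p2 (eta TYPE('l)) s ** act_pr (lunitw X) (mul empty_box X (eta TYPE('l)) s)"

definition co_runit :: "('l, 'o) box \<Rightarrow> 'm \<Rightarrow> 'm" where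
  "co_runit X s = p1 s (eta TYPE('l)) ** act_pr (runitw X) (mul X empty_box s (eta TYPE('l)))"

lemma co_unit:
  fixes X :: "('l, 'o) box"
  assumes "span X s"
  shows "span_map X (act (lunitw X) (mul empty_box X (eta TYPE('l)) s)) s (co_lunit X s)"
    "is_iso (Sp X) (act (lunitw X) (mul empty_box X (eta TYPE('l)) s), s, co_lunit X s)"
    "span_map X (act (runitw X) (mul X empty_box s (eta TYPE('l)))) s (co_runit X s)"
    "is_iso (Sp X) (act (runitw X) (mul X empty_box s (eta TYPE('l))), s, co_runit X s)"
proof -
  let ?e = "eta TYPE('l)" and ?h = "hat C (Map.empty :: ('l, 'o) typed_set)"
  note b = span_box[OF assms]
  have O: "src s \<in> Obj C" "?h \<in> Obj C" using assms by simp_all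
  \<comment> \<open>The unique map to the empty product; the family of components is indexed by no
    port, so a dummy stands for it.\<close>
  let ?b = "hat_tuple C (Map.empty :: ('l, 'o) typed_set) (src s) (\<lambda>_. undefined)"
  have bang: "arr ?b" "src ?b = src s" "tgt ?b = ?h"
    using hat_tuple(1-3)[OF empty_typed_sets O(1), of "\<lambda>_. undefined"] by simp_all
  have bx: "?b ** x = y" if "arr x" "tgt x = src s" "arr y" "src y = src x" "tgt y = ?h" for x y
    by (rule eta_eqI[where 'l='l]) (use that bang in simp_all)
  { let ?m = "mul empty_box X ?e s"
    have sp: "span (box_sum empty_box X) ?m" using assms by simp
    let ?k = "p2 ?e s" and ?k' = "pairing C ?b (Ident C (src s))"
    have *: "?k ** ?k' ** x = x" if "arr x" "tgt x = src s" for x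
      using that assms O bang by simp
    have **: "?k' ** ?k ** x = x" if "arr x" "tgt x = src ?m" for x
      by (rule bprod_eqI[of _ _ "src ?e" "src s"]) (use that assms O bang in \<open>simp_all add: bx\<close>)
    have f: "\<exists>j. fst (box_sum empty_box X) j \<noteq> None \<and> copair Map.empty Some j = Some k" if "fst X k = Some a" for k a
      using that by (auto simp: typed_sum_eq_Some inl_app intro!: exI[of _ "InR k"])
    have f': "\<exists>k. copair Map.empty Some j = Some k \<and> inr k = Some j" if "fst (box_sum empty_box X) j = Some a" for j a
      using that by (auto simp: typed_sum_eq_Some inl_app)
    have r: "respects_types (fst X) (fst (box_sum empty_box X)) inr" by (simp add: respects_types_intros)
    have k: "arr ?k" "src ?k = src ?m" "tgt ?k = src s" "arr ?k'" "src ?k' = src s" "tgt ?k' = src ?m"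
      using assms O bang by simp_all
    have i: "port_in X s (the (copair Map.empty Some j)) ** ?k ** x = port_in (box_sum empty_box X) ?m j ** x"
      if "fst (box_sum empty_box X) j \<noteq> None" "arr x" "tgt x = src ?m" for j x
      using that assms O by (auto simp: typed_sum_eq_Some inl_app)
    have o: "port_out X s j ** ?k ** x = port_out (box_sum empty_box X) ?m (the (inr j)) ** x"
      if "snd X j \<noteq> None" "arr x" "tgt x = src ?m" for j x
      using that assms O by (auto simp: typed_sum_eq_Some inl_app)
    have wd: "diagram (lunitw X)" using b by simp
    show "span_map X (act (lunitw X) ?m) s (co_lunit X s)"
      unfolding co_lunit_def by (rule plain_iso(1)[OF wd sp assms f r f' k * ** i o])
    show "is_iso (Sp X) (act (lunitw X) ?m, s, co_lunit X s)"
      unfolding co_lunit_def by (rule plain_iso(2)[OF wd sp assms f r f' k * ** i o]) }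
  { let ?m = "mul X empty_box s ?e"
    have sp: "span (box_sum X empty_box) ?m" using assms by simp
    let ?k = "p1 s ?e" and ?k' = "pairing C (Ident C (src s)) ?b"
    have *: "?k ** ?k' ** x = x" if "arr x" "tgt x = src s" for x
      using that assms O bang by simp
    have **: "?k' ** ?k ** x = x" if "arr x" "tgt x = src ?m" for x
      by (rule bprod_eqI[of _ _ "src s" "src ?e"]) (use that assms O bang in \<open>simp_all add: bx\<close>)
    have f: "\<exists>j. fst (box_sum X empty_box) j \<noteq> None \<and> copair Some Map.empty j = Some k" if "fst X k = Some a" for k a
      using that by (auto simp: typed_sum_eq_Some inl_app intro!: exI[of _ "InL k"])
    have f': "\<exists>k. copair Some Map.empty j = Some k \<and> inl k = Some j" if "fst (box_sum X empty_box) j = Some a" for j a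
      using that by (auto simp: typed_sum_eq_Some inl_app)
    have r: "respects_types (fst X) (fst (box_sum X empty_box)) inl" by (simp add: respects_types_intros)
    have k: "arr ?k" "src ?k = src ?m" "tgt ?k = src s" "arr ?k'" "src ?k' = src s" "tgt ?k' = src ?m"
      using assms O bang by simp_all
    have i: "port_in X s (the (copair Some Map.empty j)) ** ?k ** x = port_in (box_sum X empty_box) ?m j ** x"
      if "fst (box_sum X empty_box) j \<noteq> None" "arr x" "tgt x = src ?m" for j x
      using that assms O by (auto simp: typed_sum_eq_Some inl_app)
    have o: "port_out X s j ** ?k ** x = port_out (box_sum X empty_box) ?m (the (inl j)) ** x"
      if "snd X j \<noteq> None" "arr x" "tgt x = src ?m" for j x
      using that assms O by (auto simp: typed_sum_eq_Some inl_app)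
    have wd: "diagram (runitw X)" using b by simp
    show "span_map X (act (runitw X) ?m) s (co_runit X s)"
      unfolding co_runit_def by (rule plain_iso(1)[OF wd sp assms f r f' k * ** i o])
    show "is_iso (Sp X) (act (runitw X) ?m, s, co_runit X s)"
      unfolding co_runit_def by (rule plain_iso(2)[OF wd sp assms f r f' k * ** i o]) }
qed

definition coh :: "(('l, 'o) box, ('l, 'o) wiring_diagram, 'm, 'm \<times> 'm \<times> 'm) coherence_data" where
  "coh = \<lparr>
     CoId = (\<lambda>X s. (s, act (idw X) s, co_id X s)),
     CoComp = (\<lambda>e d s. (act e (act d s), act (wiring_comp e d) s, co_comp e d s)),
     CoMul = (\<lambda>d e (s, t). (mul (wcod d) (wcod e) (act d s) (act e t),
        act (wiring_sum d e) (mul (wdom d) (wdom e) s t), co_mul d e s t)),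
     CoAssoc = (\<lambda>X Y Z s t u. (act (assocw X Y Z) (mul (box_sum X Y) Z (mul X Y s t) u),
        mul X (box_sum Y Z) s (mul Y Z t u), co_assoc X Y Z s t u)),
     CoLUnit = (\<lambda>X s. (act (lunitw X) (mul empty_box X (eta TYPE('l)) s), s, co_lunit X s)),
     CoRUnit = (\<lambda>X s. (act (runitw X) (mul X empty_box s (eta TYPE('l))), s, co_runit X s)),
     CoBraid = (\<lambda>X Y s t. (act (braidw X Y) (mul X Y s t), mul Y X t s, co_braid X Y s t))\<rparr>"

lemma coh_simps [simp]:
  "CoId coh X s = (s, act (idw X) s, co_id X s)"
  "CoComp coh e d s = (act e (act d s), act (wiring_comp e d) s, co_comp e d s)"
  "CoMul coh d e (s, t) = (mul (wcod d) (wcod e) (act d s) (act e t),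
        act (wiring_sum d e) (mul (wdom d) (wdom e) s t), co_mul d e s t)"
  "CoAssoc coh X Y Z s t u = (act (assocw X Y Z) (mul (box_sum X Y) Z (mul X Y s t) u),
        mul X (box_sum Y Z) s (mul Y Z t u), co_assoc X Y Z s t u)"
  "CoLUnit (coh :: (('l, 'o) box, ('l, 'o) wiring_diagram, 'm, 'm \<times> 'm \<times> 'm) coherence_data) X s =
     (act (lunitw X) (mul empty_box X (eta TYPE('l)) s), s, co_lunit X s)"
  "CoRUnit (coh :: (('l, 'o) box, ('l, 'o) wiring_diagram, 'm, 'm \<times> 'm \<times> 'm) coherence_data) X s =
     (act (runitw X) (mul X empty_box s (eta TYPE('l))), s, co_runit X s)"
  "CoBraid coh X Y s t = (act (braidw X Y) (mul X Y s t), mul Y X t s, co_braid X Y s t)"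
  by (simp_all add: coh_def)

end

section \<open>The lax monoidal pseudofunctor of span systems\<close>

context fincomplete
begin

lemma wiring_assoc:
  assumes "diagram d" "diagram e" "diagram \<chi>" "wdom e = wcod d" "wdom \<chi> = wcod e"
  shows "wiring_comp (wiring_comp \<chi> e) d = wiring_comp \<chi> (wiring_comp e d)"
  using wiring_category[of C] assms unfolding is_category_def wiring_simps by blast

lemma wiring_idw:
  assumes "diagram d" "X = wdom d" "Y = wcod d"
  shows "wiring_comp d (idw X) = d" "wiring_comp (idw Y) d = d"
  using wiring_category[of C] assms unfolding is_category_def wiring_simps by blast+

lemma wiring_sum_comp:
  assumes "diagram d" "diagram e" "diagram d'" "diagram e'"
    "wdom d' = wcod d" "wdom e' = wcod e"
  shows "wiring_sum (wiring_comp d' d) (wiring_comp e' e) = wiring_comp (wiring_sum d' e') (wiring_sum d e)"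
proof -
  have "is_functor (W \<times>\<^sub>C W) W (Tensor W)" using wiring_symmetric_monoidal[of C] unfolding symmetric_monoidal_def by blast
  then have "\<forall>f\<in>Arr (W \<times>\<^sub>C W). \<forall>g\<in>Arr (W \<times>\<^sub>C W). Dom (W \<times>\<^sub>C W) g = Cod (W \<times>\<^sub>C W) f \<longrightarrow>
      AM (Tensor W) (g \<cdot>\<^bsub>W \<times>\<^sub>C W\<^esub> f) = AM (Tensor W) g \<cdot>\<^bsub>W\<^esub> AM (Tensor W) f" unfolding is_functor_def by blast
  from bspec[OF bspec[OF this, of "(d, e)"], of "(d', e')"] show ?thesis
    using assms by (simp add: prod_category_def)
qed

lemma wiring_sum_idw: "wiring_sum (idw X) (idw Y) = idw (box_sum X Y)"
  unfolding plain_wiring_sum by (rule plain_wiring_cong) (auto simp: typed_sum_eq_Some)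

lemma wiring_natural:
  assumes "diagram d" "diagram e" "diagram \<chi>"
  shows "wiring_comp (assocw (wcod d) (wcod e) (wcod \<chi>)) (wiring_sum (wiring_sum d e) \<chi>) =
      wiring_comp (wiring_sum d (wiring_sum e \<chi>)) (assocw (wdom d) (wdom e) (wdom \<chi>))"
    "wiring_comp (lunitw (wcod d)) (wiring_sum (idw empty_box) d) = wiring_comp d (lunitw (wdom d))"
    "wiring_comp (runitw (wcod d)) (wiring_sum d (idw empty_box)) = wiring_comp d (runitw (wdom d))"
    "wiring_comp (braidw (wcod d) (wcod e)) (wiring_sum d e) = wiring_comp (wiring_sum e d) (braidw (wdom d) (wdom e))"
  using wiring_symmetric_monoidal[of C] assms unfolding symmetric_monoidal_def wiring_simps by blast+

lemma wiring_coherence: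
  assumes "is_box w" "is_box x" "is_box y" "is_box z"
  shows "wiring_comp (assocw w x (box_sum y z)) (assocw (box_sum w x) y z) =
      wiring_comp (wiring_sum (idw w) (assocw x y z)) (wiring_comp (assocw w (box_sum x y) z) (wiring_sum (assocw w x y) (idw z)))"
    "wiring_comp (wiring_sum (idw x) (lunitw y)) (assocw x empty_box y) = wiring_sum (runitw x) (idw y)"
    "wiring_comp (assocw y z x) (wiring_comp (braidw x (box_sum y z)) (assocw x y z)) =
      wiring_comp (wiring_sum (idw y) (braidw x z)) (wiring_comp (assocw y x z) (wiring_sum (braidw x y) (idw z)))"
    "wiring_comp (braidw y x) (braidw x y) = idw (box_sum x y)"
  using wiring_symmetric_monoidal[of C] assms unfolding symmetric_monoidal_def wiring_simps is_box_iff by blast+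

lemma in_slice:
  "is_box X \<Longrightarrow> f \<in> Arr (Sp X) \<longleftrightarrow> (\<exists>s t h. f = (s, t, h) \<and> span_map X s t h)"
  by (cases f) (simp add: span_map_slice del: slice_simps(2))

theorem span_pseudofunctor: "pseudofunctor (W :: (('l, 'o) box, ('l, 'o) wiring_diagram) monoidal_category) F coh"
  unfolding pseudofunctor_def wiring_simps span_systems_simps Let_def coh_simps
proof (intro conjI ballI impI)
  show "is_category (Sp X)" for X :: "('l, 'o) box" by (rule slice_category)
  show "is_functor (Sp (wdom d)) (Sp (wcod d)) (span_act C d)"
    if "diagram d" for d :: "('l, 'o) wiring_diagram" by (rule span_act_functor[OF that])
next
  fix X :: "('l, 'o) box" assume "X \<in> typed_sets C \<times> typed_sets C"
  then have b: "is_box X" by (simp add: is_box_iff)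
  let ?\<theta> = "\<lambda>s. (s, act (idw X) s, co_id X s)"
  show "nat_iso (Sp X) (Sp X) id_functor (span_act C (idw X)) (\<lambda>s. (s, act (idw X) s, co_id X s))"
    unfolding nat_iso_def
  proof (intro conjI ballI)
    show "is_functor (Sp X) (Sp X) id_functor" by (rule is_functor_id[OF slice_category])
    show "is_functor (Sp X) (Sp X) (span_act C (idw X))"
      using span_act_functor[OF idw_diagram[OF b]] by simp
    fix s assume "s \<in> Obj (Sp X)"
    then have s: "span X s" by (simp add: span_slice[OF b] del: slice_simps(1))
    show "?\<theta> s \<in> Hom (Sp X) (OM id_functor s) (act (idw X) s)" "is_iso (Sp X) (?\<theta> s)"
      using co_id(1)[OF s] co_id_iso[OF s] by (simp_all add: id_functor_def Hom_def[of "Sp X"] span_map_slice[OF b] del: slice_simps(2))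
  next
    fix f assume "f \<in> Arr (Sp X)"
    then obtain s t h where f: "f = (s, t, h)" and h: "span_map X s t h" by (auto simp: in_slice[OF b])
    note h' = span_mapD(1-5)[OF h]
    have "co_id X t ** h = act_arr (idw X) s t h ** co_id X s"
    proof (rule span_map_eqI[of "idw X" t s])
      show "span_map (wcod (idw X)) s (act (idw X) t) (co_id X t ** h)"
        using span_map_comp[OF h co_id(1)[OF h'(2)]] by simp
      show "span_map (wcod (idw X)) s (act (idw X) t) (act_arr (idw X) s t h ** co_id X s)"
        using span_map_comp[OF co_id(1)[OF h'(1)]] act_arr(1)[of "idw X" s t h] h b by simp
      fix x assume "arr x" "tgt x = src s"
      then show "act_pr (idw X) t ** (co_id X t ** h) ** x = act_pr (idw X) t ** (act_arr (idw X) s t h ** co_id X s) ** x"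
        using h h' b by simp
    qed (use b h' in simp_all)
    then show "?\<theta> (Cod (Sp X) f) \<cdot>\<^bsub>Sp X\<^esub> AM id_functor f =
      AM (span_act C (idw X)) f \<cdot>\<^bsub>Sp X\<^esub> ?\<theta> (Dom (Sp X) f)"
      by (simp add: f id_functor_def AM_span_act)
  qed
next
  fix d e :: "('l, 'o) wiring_diagram"
  assume w: "diagram d" "diagram e" and e: "wdom e = wcod d"
  note b = is_box_ends[OF w(1)] is_box_ends[OF w(2)]
  let ?\<theta> = "\<lambda>s. (act e (act d s), act (wiring_comp e d) s, co_comp e d s)"
  show "nat_iso (Sp (wdom d)) (Sp (wcod e)) (span_act C e \<circ>\<^sub>F span_act C d)
      (span_act C (wiring_comp e d)) (\<lambda>s. (act e (act d s), act (wiring_comp e d) s, co_comp e d s))"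
    unfolding nat_iso_def
  proof (intro conjI ballI)
    show "is_functor (Sp (wdom d)) (Sp (wcod e)) (span_act C e \<circ>\<^sub>F span_act C d)"
      by (rule is_functor_comp[OF span_act_functor[OF w(1)]]) (use span_act_functor[OF w(2)] e in simp)
    show "is_functor (Sp (wdom d)) (Sp (wcod e)) (span_act C (wiring_comp e d))"
      using span_act_functor[OF comp_diagram[OF w e]] by simp
    fix s assume "s \<in> Obj (Sp (wdom d))"
    then have s: "span (wdom d) s" by (simp add: span_slice[OF b(1)] del: slice_simps(1))
    show "?\<theta> s \<in> Hom (Sp (wcod e)) (OM (span_act C e \<circ>\<^sub>F span_act C d) s) (act (wiring_comp e d) s)"
      "is_iso (Sp (wcod e)) (?\<theta> s)"
      using co_comp(1)[OF w e s] co_comp_iso[OF w e s]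
      by (simp_all add: comp_functor_def Hom_def[of "Sp (wcod e)"] span_map_slice[OF b(4)] del: slice_simps(2))
  next
    fix f assume "f \<in> Arr (Sp (wdom d))"
    then obtain s t h where f: "f = (s, t, h)" and h: "span_map (wdom d) s t h" by (auto simp: in_slice[OF b(1)])
    note h' = span_mapD(1-5)[OF h]
    let ?\<omega> = "wiring_comp e d"
    have a: "span_map (wdom e) (act d s) (act d t) (act_arr d s t h)" using act_arr(1)[OF w(1) h] e by simp
    have "co_comp e d t ** act_arr e (act d s) (act d t) (act_arr d s t h) = act_arr ?\<omega> s t h ** co_comp e d s"
    proof (rule span_map_eqI[of "?\<omega>" t "act e (act d s)"])
      show "span_map (wcod ?\<omega>) (act e (act d s)) (act ?\<omega> t) (co_comp e d t ** act_arr e (act d s) (act d t) (act_arr d s t h))"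
        using span_map_comp[OF act_arr(1)[OF w(2) a] co_comp(1)[OF w e h'(2)]] by simp
      show "span_map (wcod ?\<omega>) (act e (act d s)) (act ?\<omega> t) (act_arr ?\<omega> s t h ** co_comp e d s)"
        using span_map_comp[OF co_comp(1)[OF w e h'(1)]] act_arr(1)[of ?\<omega> s t h] h w e by simp
      fix x assume "arr x" "tgt x = src (act e (act d s))"
      then show "act_pr ?\<omega> t ** (co_comp e d t ** act_arr e (act d s) (act d t) (act_arr d s t h)) ** x =
          act_pr ?\<omega> t ** (act_arr ?\<omega> s t h ** co_comp e d s) ** x"
        using h h' w e a by simp
    qed (use w e h' in simp_all)
    then show "?\<theta> (Cod (Sp (wdom d)) f) \<cdot>\<^bsub>Sp (wcod e)\<^esub> AM (span_act C e \<circ>\<^sub>F span_act C d) f =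
      AM (span_act C ?\<omega>) f \<cdot>\<^bsub>Sp (wcod e)\<^esub> ?\<theta> (Dom (Sp (wdom d)) f)"
      by (simp add: f comp_functor_def AM_span_act)
  qed
next
  fix d e \<chi> :: "('l, 'o) wiring_diagram" and s
  assume w: "diagram d" "diagram e" "diagram \<chi>"
    and s: "s \<in> Obj (Sp (wdom d))" and e: "wdom e = wcod d" "wdom \<chi> = wcod e"
  have s: "span (wdom d) s" using s by (simp add: span_slice[OF is_box_ends(1)[OF w(1)]] del: slice_simps(1))
  note A = wiring_assoc[OF w e]
  let ?L = "wiring_comp \<chi> (wiring_comp e d)" and ?A = "act \<chi> (act e (act d s))"
  have c: "span_map (wdom \<chi>) (act e (act d s)) (act (wiring_comp e d) s) (co_comp e d s)"
    using co_comp(1)[OF w(1,2) e(1) s] e by simp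
  have sa: "span (wdom e) (act d s)" using w s e by simp
  have wc: "diagram (wiring_comp e d)" "diagram (wiring_comp \<chi> e)" using w e by simp_all
  have "co_comp \<chi> (wiring_comp e d) s ** act_arr \<chi> (act e (act d s)) (act (wiring_comp e d) s) (co_comp e d s) =
     co_comp (wiring_comp \<chi> e) d s ** co_comp \<chi> e (act d s)"
  proof (rule span_map_eqI[of ?L s ?A])
    show "span_map (wcod ?L) ?A (act ?L s) (co_comp \<chi> (wiring_comp e d) s ** act_arr \<chi> (act e (act d s)) (act (wiring_comp e d) s) (co_comp e d s))"
      using span_map_comp[OF act_arr(1)[OF w(3) c] co_comp(1)[OF wc(1) w(3), of s]] w e s by simp
    show "span_map (wcod ?L) ?A (act ?L s) (co_comp (wiring_comp \<chi> e) d s ** co_comp \<chi> e (act d s))"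
      using span_map_comp[OF co_comp(1)[OF w(2,3) e(2) sa]] co_comp(1)[OF w(1) wc(2), of s] w e s A by simp
    fix x assume "arr x" "tgt x = src ?A"
    then show "act_pr ?L s ** (co_comp \<chi> (wiring_comp e d) s ** act_arr \<chi> (act e (act d s)) (act (wiring_comp e d) s) (co_comp e d s)) ** x =
        act_pr ?L s ** (co_comp (wiring_comp \<chi> e) d s ** co_comp \<chi> e (act d s)) ** x"
      using w e s sa c co_comp_simps[OF w(1) wc(2), of s] unfolding A by simp
  qed (use w e s in simp_all)
  then show "(act \<chi> (act (wiring_comp e d) s), act ?L s, co_comp \<chi> (wiring_comp e d) s) \<cdot>\<^bsub>Sp (wcod \<chi>)\<^esub>
       AM (span_act C \<chi>) (act e (act d s), act (wiring_comp e d) s, co_comp e d s) =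
      (act (wiring_comp \<chi> e) (act d s), act (wiring_comp (wiring_comp \<chi> e) d) s, co_comp (wiring_comp \<chi> e) d s) \<cdot>\<^bsub>Sp (wcod \<chi>)\<^esub>
       (act \<chi> (act e (act d s)), act (wiring_comp \<chi> e) (act d s), co_comp \<chi> e (act d s))"
    by (simp add: AM_span_act A)
next
  fix d :: "('l, 'o) wiring_diagram" and s
  assume w: "diagram d" and s: "s \<in> Obj (Sp (wdom d))"
  have s: "span (wdom d) s" using s by (simp add: span_slice[OF is_box_ends(1)[OF w]] del: slice_simps(1))
  note b = is_box_ends[OF w]
  note I = wiring_idw[OF w refl refl]
  have sa: "span (wcod d) (act d s)" using w s by simp
  have c: "span_map (wdom d) s (act (idw (wdom d)) s) (co_id (wdom d) s)" using co_id(1)[OF s] .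
  have O: "src (act d s) \<in> Obj C" using w s by simp
  have "co_comp d (idw (wdom d)) s ** act_arr d s (act (idw (wdom d)) s) (co_id (wdom d) s) = Ident C (src (act d s))"
  proof (rule span_map_eqI[OF w s])
    show "span_map (wcod d) (act d s) (act d s) (co_comp d (idw (wdom d)) s ** act_arr d s (act (idw (wdom d)) s) (co_id (wdom d) s))"
      using span_map_comp[OF act_arr(1)[OF w c]] co_comp(1)[OF idw_diagram[OF b(1)] w, of s] s I by simp
    show "span_map (wcod d) (act d s) (act d s) (Ident C (src (act d s)))" by (rule span_map_Ident[OF sa])
    fix x assume "arr x" "tgt x = src (act d s)"
    then show "act_pr d s ** (co_comp d (idw (wdom d)) s ** act_arr d s (act (idw (wdom d)) s) (co_id (wdom d) s)) ** x =
        act_pr d s ** Ident C (src (act d s)) ** x"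
      using w s c b O co_comp_simps[OF idw_diagram[OF b(1)] w, of s] unfolding I by simp
  qed
  then show "(act d (act (idw (wdom d)) s), act (wiring_comp d (idw (wdom d))) s, co_comp d (idw (wdom d)) s) \<cdot>\<^bsub>Sp (wcod d)\<^esub>
       AM (span_act C d) (s, act (idw (wdom d)) s, co_id (wdom d) s) = Ident (Sp (wcod d)) (act d s)"
    by (simp add: AM_span_act I)
  have "co_comp (idw (wcod d)) d s ** co_id (wcod d) (act d s) = Ident C (src (act d s))"
  proof (rule span_map_eqI[OF w s])
    show "span_map (wcod d) (act d s) (act d s) (co_comp (idw (wcod d)) d s ** co_id (wcod d) (act d s))"
      using span_map_comp[OF co_id(1)[OF sa]] co_comp(1)[OF w idw_diagram[OF b(2)], of s] s I by simp
    show "span_map (wcod d) (act d s) (act d s) (Ident C (src (act d s)))" by (rule span_map_Ident[OF sa])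
    fix x assume "arr x" "tgt x = src (act d s)"
    then show "act_pr d s ** (co_comp (idw (wcod d)) d s ** co_id (wcod d) (act d s)) ** x =
        act_pr d s ** Ident C (src (act d s)) ** x"
      using w s sa b O co_comp_simps[OF w idw_diagram[OF b(2)], of s] unfolding I by simp
  qed
  then show "(act (idw (wcod d)) (act d s), act (wiring_comp (idw (wcod d)) d) s, co_comp (idw (wcod d)) d s) \<cdot>\<^bsub>Sp (wcod d)\<^esub>
       (act d s, act (idw (wcod d)) (act d s), co_id (wcod d) (act d s)) = Ident (Sp (wcod d)) (act d s)"
    by (simp add: I)
qed

lemma span_mul_functor:
  fixes X Y :: "('l, 'o) box"
  assumes b: "is_box X" "is_box Y"
  shows "is_functor (Sp X \<times>\<^sub>C Sp Y) (Sp (box_sum X Y)) (Mul (F :: ('l, 'o, 'm) span_algebra) X Y)"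
  unfolding is_functor_def
proof (intro conjI ballI impI)
  note b' = b is_box_sum[OF b]
  let ?A = "Sp X \<times>\<^sub>C Sp Y" and ?B = "Sp (box_sum X Y)"
  let ?M = "Mul (F :: ('l, 'o, 'm) span_algebra) X Y"
  fix p assume "p \<in> Obj ?A"
  then obtain s t where p: "p = (s, t)" and st: "span X s" "span Y t"
    by (auto simp: prod_category_def span_slice b simp del: slice_simps(1))
  show "OM ?M p \<in> Obj ?B" using st by (simp add: p span_slice b' del: slice_simps(1))
  have O: "src s \<in> Obj C" "src t \<in> Obj C" using st by simp_all
  have "par C (Ident C (src s)) (Ident C (src t)) = Ident C (bprod C (src s) (src t))"
    by (rule bprod_eqI[of _ _ "src s" "src t"]) (use O in \<open>simp_all add: par_def\<close>)
  then show "AM ?M (Ident ?A p) = Ident ?B (OM ?M p)" using st by (simp add: p prod_category_def)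
next
  note b' = b is_box_sum[OF b]
  let ?A = "Sp X \<times>\<^sub>C Sp Y" and ?B = "Sp (box_sum X Y)"
  let ?M = "Mul (F :: ('l, 'o, 'm) span_algebra) X Y"
  fix f assume "f \<in> Arr ?A"
  then obtain s s' h t t' k where f: "f = ((s, s', h), (t, t', k))" and hk: "span_map X s s' h" "span_map Y t t' k"
    by (auto simp: prod_category_def in_slice b simp del: slice_simps(2))
  show "AM ?M f \<in> Hom ?B (OM ?M (Dom ?A f)) (OM ?M (Cod ?A f))"
    using mul_arr[OF hk] by (simp add: f prod_category_def Hom_def[of ?B] span_map_slice b' del: slice_simps(2))
  fix g assume "g \<in> Arr ?A" "Dom ?A g = Cod ?A f"
  then obtain s'' h' t'' k' where g: "g = ((s', s'', h'), (t', t'', k'))" and hk': "span_map X s' s'' h'" "span_map Y t' t'' k'"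
    by (auto simp: f prod_category_def in_slice b simp del: slice_simps(2))
  have "par C (h' ** h) (k' ** k) = par C h' k' ** par C h k"
    by (rule arr_eqI)
      (use span_map_arr[OF hk(1)] span_map_arr[OF hk(2)] span_map_arr[OF hk'(1)] span_map_arr[OF hk'(2)]
        span_mapD(1,2)[OF hk(1)] span_mapD(1,2)[OF hk(2)] in simp_all)
  then show "AM ?M (g \<cdot>\<^bsub>?A\<^esub> f) = AM ?M g \<cdot>\<^bsub>?B\<^esub> AM ?M f" by (simp add: f g prod_category_def)
qed

theorem span_laxator: "pseudonatural_laxator (W :: (('l, 'o) box, ('l, 'o) wiring_diagram) monoidal_category) F coh"
  unfolding pseudonatural_laxator_def wiring_simps Let_def span_systems_simps(1,2) coh_simps
proof (intro conjI ballI impI)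
  fix X Y :: "('l, 'o) box" assume "X \<in> typed_sets C \<times> typed_sets C" "Y \<in> typed_sets C \<times> typed_sets C"
  then have b: "is_box X" "is_box Y" by (simp_all add: is_box_iff)
  show "is_functor (Sp X \<times>\<^sub>C Sp Y) (Sp (box_sum X Y)) (Mul (F :: ('l, 'o, 'm) span_algebra) X Y)"
    by (rule span_mul_functor[OF b])
  fix s t assume "s \<in> Obj (Sp X)" "t \<in> Obj (Sp Y)"
  then have s: "span X s" and t: "span Y t" by (simp_all add: span_slice b del: slice_simps(1))
  let ?I = "wiring_sum (idw X) (idw Y)" and ?m = "mul X Y s t"
  note e = wiring_sum_idw[of X Y]
  have iw: "diagram ?I" using b by simp
  have m: "span (box_sum X Y) ?m" using s t by simp
  have "co_mul (idw X) (idw Y) s t ** par C (co_id X s) (co_id Y t) = co_id (box_sum X Y) ?m"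
  proof (rule span_map_eqI[OF iw, of ?m ?m])
    show "span_map (wcod ?I) ?m (act ?I ?m) (co_mul (idw X) (idw Y) s t ** par C (co_id X s) (co_id Y t))"
      using span_map_comp[OF mul_arr[OF co_id(1)[OF s] co_id(1)[OF t]]] co_mul(1)[OF idw_diagram[OF b(1)] idw_diagram[OF b(2)], of s t] s t by simp
    show "span_map (wcod ?I) ?m (act ?I ?m) (co_id (box_sum X Y) ?m)" using co_id(1)[OF m] by (simp add: e)
    fix x assume x: "arr x" "tgt x = src ?m"
    \<comment> \<open>Surjective pairing restores the element from the components that the rule for
      \<open>co_mul\<close> produces.\<close>
    have "pairing C (p1 s t ** x) (p2 s t ** x) = x" by (rule mul_eqI[OF s t]) (use x s t in simp_all)
    then show "act_pr ?I ?m ** (co_mul (idw X) (idw Y) s t ** par C (co_id X s) (co_id Y t)) ** x = act_pr ?I ?m ** co_id (box_sum X Y) ?m ** x"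
      using x s t m b co_id(2)[OF m x] by (simp add: e) (simp add: e[symmetric])
  qed (use s t in simp)
  then show "(mul (wcod (idw X)) (wcod (idw Y)) (act (idw X) s) (act (idw Y) t), act ?I (mul (wdom (idw X)) (wdom (idw Y)) s t), co_mul (idw X) (idw Y) s t)
      \<cdot>\<^bsub>Sp (box_sum X Y)\<^esub> AM (Mul (F :: ('l, 'o, 'm) span_algebra) X Y) ((s, act (idw X) s, co_id X s), (t, act (idw Y) t, co_id Y t)) =
      (OM (Mul (F :: ('l, 'o, 'm) span_algebra) X Y) (s, t), act (idw (box_sum X Y)) (OM (Mul (F :: ('l, 'o, 'm) span_algebra) X Y) (s, t)), co_id (box_sum X Y) (OM (Mul (F :: ('l, 'o, 'm) span_algebra) X Y) (s, t)))"
    by (simp add: e)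
next
  fix d e :: "('l, 'o) wiring_diagram"
  assume w: "diagram d" "diagram e"
  note b = is_box_ends[OF w(1)] is_box_ends[OF w(2)]
  let ?A = "Sp (wdom d) \<times>\<^sub>C Sp (wdom e)" and ?B = "Sp (box_sum (wcod d) (wcod e))"
  let ?\<omega> = "wiring_sum d e"
  let ?G = "Mul (F :: ('l, 'o, 'm) span_algebra) (wcod d) (wcod e) \<circ>\<^sub>F (span_act C d \<times>\<^sub>F span_act C e)"
  let ?H = "span_act C ?\<omega> \<circ>\<^sub>F Mul (F :: ('l, 'o, 'm) span_algebra) (wdom d) (wdom e)"
  show "nat_iso ?A ?B ?G ?H (CoMul coh d e)"
    unfolding nat_iso_def
  proof (intro conjI ballI)
    show "is_functor ?A ?B ?G"
      by (rule is_functor_comp[OF is_functor_prod[OF span_act_functor[OF w(1)] span_act_functor[OF w(2)]] span_mul_functor[OF b(2,4)]])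
    show "is_functor ?A ?B ?H"
      by (rule is_functor_comp[OF span_mul_functor[OF b(1,3)]]) (use span_act_functor[OF sum_diagram[OF w]] in simp)
    fix p assume "p \<in> Obj ?A"
    then obtain s t where p: "p = (s, t)" and st: "span (wdom d) s" "span (wdom e) t"
      by (auto simp: prod_category_def span_slice b simp del: slice_simps(1))
    show "CoMul coh d e p \<in> Hom ?B (OM ?G p) (OM ?H p)" "is_iso ?B (CoMul coh d e p)"
      using co_mul(1)[OF w st] co_mul_iso[OF w st] b
      by (simp_all add: p comp_functor_def prod_functor_def Hom_def[of ?B] span_map_slice del: slice_simps(2))
  next
    fix f assume "f \<in> Arr ?A"
    then obtain s s' h t t' k where f: "f = ((s, s', h), (t, t', k))" and hk: "span_map (wdom d) s s' h" "span_map (wdom e) t t' k"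
      by (auto simp: prod_category_def in_slice b simp del: slice_simps(2))
    note h' = span_mapD(1-5)[OF hk(1)] and k' = span_mapD(1-5)[OF hk(2)]
    let ?m = "mul (wdom d) (wdom e) s t" and ?m' = "mul (wdom d) (wdom e) s' t'" and ?n = "mul (wcod d) (wcod e) (act d s) (act e t)"
    have mh: "span_map (wdom ?\<omega>) ?m ?m' (par C h k)" using mul_arr[OF hk] by simp
    note wo = sum_diagram[OF w]
    have "co_mul d e s' t' ** par C (act_arr d s s' h) (act_arr e t t' k) = act_arr ?\<omega> ?m ?m' (par C h k) ** co_mul d e s t"
    proof (rule span_map_eqI[OF wo, of ?m' ?n])
      show "span_map (wcod ?\<omega>) ?n (act ?\<omega> ?m') (co_mul d e s' t' ** par C (act_arr d s s' h) (act_arr e t t' k))"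
        using span_map_comp[OF mul_arr[OF act_arr(1)[OF w(1) hk(1)] act_arr(1)[OF w(2) hk(2)]] co_mul(1)[OF w h'(2) k'(2)]] by simp
      show "span_map (wcod ?\<omega>) ?n (act ?\<omega> ?m') (act_arr ?\<omega> ?m ?m' (par C h k) ** co_mul d e s t)"
        using span_map_comp[OF co_mul(1)[OF w h'(1) k'(1)]] act_arr(1)[OF wo mh] by simp
      fix x assume x: "arr x" "tgt x = src ?n"
      show "act_pr ?\<omega> ?m' ** (co_mul d e s' t' ** par C (act_arr d s s' h) (act_arr e t t' k)) ** x =
          act_pr ?\<omega> ?m' ** (act_arr ?\<omega> ?m ?m' (par C h k) ** co_mul d e s t) ** x"
        using x w hk h' k' mh act_arr_simps[OF wo mh] by simp
    qed (use h' k' in simp)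
    then show "CoMul coh d e (Cod ?A f) \<cdot>\<^bsub>?B\<^esub> AM ?G f = AM ?H f \<cdot>\<^bsub>?B\<^esub> CoMul coh d e (Dom ?A f)"
      by (simp add: f prod_category_def comp_functor_def prod_functor_def AM_span_act)
  qed
next
  fix d d' e e' :: "('l, 'o) wiring_diagram" and s t
  assume w: "diagram d" "diagram d'" "diagram e" "diagram e'"
    and e: "wdom d' = wcod d" "wdom e' = wcod e"
    and st: "s \<in> Obj (Sp (wdom d))" "t \<in> Obj (Sp (wdom e))"
  note b = is_box_ends[OF w(1)] is_box_ends[OF w(3)]
  have s: "span (wdom d) s" and t: "span (wdom e) t" using st by (simp_all add: span_slice b del: slice_simps(1))
  let ?p = "wiring_comp d' d" and ?q = "wiring_comp e' e" and ?\<omega> = "wiring_sum d e" and ?\<omega>' = "wiring_sum d' e'"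
  let ?m = "mul (wdom d) (wdom e) s t" and ?n = "mul (wcod d) (wcod e) (act d s) (act e t)"
  let ?k = "mul (wcod d') (wcod e') (act d' (act d s)) (act e' (act e t))"
  have wc: "diagram ?p" "diagram ?q" using w e by simp_all
  have wo: "diagram ?\<omega>" "diagram ?\<omega>'" using w by simp_all
  have eo: "wdom ?\<omega>' = wcod ?\<omega>" using e by simp
  have sa: "span (wdom d') (act d s)" "span (wdom e') (act e t)" using w e s t by simp_all
  have sm: "span (wdom ?\<omega>) ?m" using s t by simp
  note E = wiring_sum_comp[OF w(1,3,2,4) e]
  have cm: "span_map (wdom ?\<omega>') ?n (act ?\<omega> ?m) (co_mul d e s t)" using co_mul(1)[OF w(1,3) s t] e by simp
  have c1: "span_map (wcod ?\<omega>') ?k (act ?\<omega>' ?n) (co_mul d' e' (act d s) (act e t))"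
    using co_mul(1)[OF w(2,4) sa] e by simp
  have c2: "span_map (wcod ?\<omega>') (act ?\<omega>' ?n) (act ?\<omega>' (act ?\<omega> ?m)) (act_arr ?\<omega>' ?n (act ?\<omega> ?m) (co_mul d e s t))"
    by (rule act_arr(1)[OF wo(2) cm])
  have c3: "span_map (wcod ?\<omega>') (act ?\<omega>' (act ?\<omega> ?m)) (act (wiring_comp ?\<omega>' ?\<omega>) ?m) (co_comp ?\<omega>' ?\<omega> ?m)"
    by (rule co_comp(1)[OF wo eo sm])
  note c4 = span_map_arr[OF c1] span_map_arr[OF c2] span_map_arr[OF c3]
  have "co_mul ?p ?q s t ** par C (co_comp d' d s) (co_comp e' e t) =
     co_comp ?\<omega>' ?\<omega> ?m ** act_arr ?\<omega>' ?n (act ?\<omega> ?m) (co_mul d e s t) ** co_mul d' e' (act d s) (act e t)"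
  proof (rule span_map_eqI[of "wiring_comp ?\<omega>' ?\<omega>" ?m ?k])
    show "span_map (wcod (wiring_comp ?\<omega>' ?\<omega>)) ?k (act (wiring_comp ?\<omega>' ?\<omega>) ?m) (co_mul ?p ?q s t ** par C (co_comp d' d s) (co_comp e' e t))"
      using span_map_comp[OF mul_arr[OF co_comp(1)[OF w(1,2) e(1) s] co_comp(1)[OF w(3,4) e(2) t]]] co_mul(1)[OF wc, of s t] s t by (simp add: E)
    show "span_map (wcod (wiring_comp ?\<omega>' ?\<omega>)) ?k (act (wiring_comp ?\<omega>' ?\<omega>) ?m)
        (co_comp ?\<omega>' ?\<omega> ?m ** act_arr ?\<omega>' ?n (act ?\<omega> ?m) (co_mul d e s t) ** co_mul d' e' (act d s) (act e t))"
      using span_map_comp[OF span_map_comp[OF c1 c2] c3] by simp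
    fix x assume x: "arr x" "tgt x = src ?k"
    \<comment> \<open>The composite of sums is turned back into the sum of composites on this side
      only: the rule for the outermost \<open>co_mul\<close> matches a sum, while the rules on the
      other side match a composite.\<close>
    have 1: "act_pr (wiring_comp ?\<omega>' ?\<omega>) ?m ** (co_mul ?p ?q s t ** par C (co_comp d' d s) (co_comp e' e t)) ** x =
       act_pr (wiring_sum ?p ?q) ?m ** co_mul ?p ?q s t ** par C (co_comp d' d s) (co_comp e' e t) ** x"
      using x w e s t sa by (simp add: E[symmetric])
    show "act_pr (wiring_comp ?\<omega>' ?\<omega>) ?m ** (co_mul ?p ?q s t ** par C (co_comp d' d s) (co_comp e' e t)) ** x =
      act_pr (wiring_comp ?\<omega>' ?\<omega>) ?m ** (co_comp ?\<omega>' ?\<omega> ?m ** act_arr ?\<omega>' ?n (act ?\<omega> ?m) (co_mul d e s t) ** co_mul d' e' (act d s) (act e t)) ** x"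
      unfolding 1 using x w e s t sa wo wc sm cm by simp
  qed (use w e s t in simp_all)
  then show "(mul (wcod ?p) (wcod ?q) (act ?p s) (act ?q t), act (wiring_sum ?p ?q) (mul (wdom ?p) (wdom ?q) s t), co_mul ?p ?q s t)
     \<cdot>\<^bsub>Sp (box_sum (wcod d') (wcod e'))\<^esub> AM (Mul (F :: ('l, 'o, 'm) span_algebra) (wcod d') (wcod e'))
       ((act d' (act d s), act ?p s, co_comp d' d s), (act e' (act e t), act ?q t, co_comp e' e t)) =
     (act ?\<omega>' (act ?\<omega> (OM (Mul (F :: ('l, 'o, 'm) span_algebra) (wdom d) (wdom e)) (s, t))), act (wiring_comp ?\<omega>' ?\<omega>) (OM (Mul (F :: ('l, 'o, 'm) span_algebra) (wdom d) (wdom e)) (s, t)),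
       co_comp ?\<omega>' ?\<omega> (OM (Mul (F :: ('l, 'o, 'm) span_algebra) (wdom d) (wdom e)) (s, t))) \<cdot>\<^bsub>Sp (box_sum (wcod d') (wcod e'))\<^esub>
      (AM (span_act C ?\<omega>') (mul (wcod d) (wcod e) (act d s) (act e t), act ?\<omega> (mul (wdom d) (wdom e) s t), co_mul d e s t) \<cdot>\<^bsub>Sp (box_sum (wcod d') (wcod e'))\<^esub>
       (mul (wcod d') (wcod e') (act d' (act d s)) (act e' (act e t)), act ?\<omega>' (mul (wdom d') (wdom e') (act d s) (act e t)), co_mul d' e' (act d s) (act e t)))"
    using e by (simp add: AM_span_act E)
qed

end

section \<open>Cells over wiring diagrams and their pasting\<close>

context fincomplete
begin

abbreviation "ccmp \<equiv> cell_comp W F coh"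
abbreviation "cmul \<equiv> cell_mul W F coh"
abbreviation "cid \<equiv> cell_id W F coh"
abbreviation "assocc \<equiv> assoc_cell W F coh"
abbreviation "lunitc \<equiv> lunit_cell W F coh"
abbreviation "runitc \<equiv> runit_cell W F coh"
abbreviation "braidc \<equiv> braid_cell W F coh"

lemma Eta_span_systems [simp]: "Eta (F :: ('l, 'o, 'm) span_algebra) = eta TYPE('l)"
  by (simp add: eta_def)

lemma is_cell_iff:
  "is_cell W F (s, d, f) \<longleftrightarrow> d \<in> wiring_diagrams C \<and> span (wdom d) s \<and>
     (\<exists>t h. f = (act d s, t, h) \<and> span_map (wcod d) (act d s) t h)"
proof (cases "diagram d")
  case True
  note b = is_box_ends[OF True]
  show ?thesis using True
    by (cases f) (auto simp: is_cell_def span_slice b span_map_slice simp del: slice_simps(1,2))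
qed (simp add: is_cell_def)

text \<open>The arrow part of a pasted cell, and likewise \<open>mcell\<close> below. In the
  coherence proofs both stay folded and are evaluated on elements only, through \<open>csnd\<close>
  and \<open>m12\<close>.\<close>

definition ccell :: "('l, 'o) wiring_diagram \<Rightarrow> ('l, 'o) wiring_diagram \<Rightarrow> 'm \<Rightarrow> 'm \<Rightarrow> 'm \<Rightarrow> 'm \<Rightarrow> 'm" where
  "ccell e d s t g f = g ** act_arr e (act d s) t f ** icomp e d s"

definition mcell :: "('l, 'o) wiring_diagram \<Rightarrow> ('l, 'o) wiring_diagram \<Rightarrow> 'm \<Rightarrow> 'm \<Rightarrow> 'm \<Rightarrow> 'm \<Rightarrow> 'm" where
  "mcell d e s t f g = par C f g ** imul d e s t"

lemma cell_comp_eq: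
  assumes "diagram d" "diagram e" "wdom e = wcod d" "span (wdom d) s"
  shows "ccmp (t, e, (act e t, r, g)) (s, d, (act d s, t, f)) =
    (s, wiring_comp e d, (act (wiring_comp e d) s, r, ccell e d s t g f))"
  by (simp add: ccell_def cell_comp_def Let_def AM_span_act icomp(1)[OF assms])

lemma cell_mul_eq:
  assumes "diagram d" "diagram e" "span (wdom d) s" "span (wdom e) t"
  shows "cmul (s, d, (act d s, s', f)) (t, e, (act e t, t', g)) =
    (mul (wdom d) (wdom e) s t, wiring_sum d e,
      (act (wiring_sum d e) (mul (wdom d) (wdom e) s t), mul (wcod d) (wcod e) s' t', mcell d e s t f g))"
  by (simp add: mcell_def cell_mul_def Let_def imul(1)[OF assms])

lemma cell_id_eq:
  assumes "span X s"
  shows "cid X s = (s, idw X, (act (idw X) s, s, act_pr (idw X) s))"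
  by (simp add: cell_id_def co_id_inv(1)[OF assms])

lemma structural_cells:
  "assocc X Y Z s t u = (mul (box_sum X Y) Z (mul X Y s t) u, assocw X Y Z,
     (act (assocw X Y Z) (mul (box_sum X Y) Z (mul X Y s t) u), mul X (box_sum Y Z) s (mul Y Z t u), co_assoc X Y Z s t u))"
  "lunit_cell W (F :: ('l, 'o, 'm) span_algebra) coh X s = (mul empty_box X (eta TYPE('l)) s, lunitw X,
     (act (lunitw X) (mul empty_box X (eta TYPE('l)) s), s, co_lunit X s))"
  "runit_cell W (F :: ('l, 'o, 'm) span_algebra) coh X s = (mul X empty_box s (eta TYPE('l)), runitw X,
     (act (runitw X) (mul X empty_box s (eta TYPE('l))), s, co_runit X s))"
  "braidc X Y s t = (mul X Y s t, braidw X Y, (act (braidw X Y) (mul X Y s t), mul Y X t s, co_braid X Y s t))"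
  by (simp_all add: assoc_cell_def lunit_cell_def runit_cell_def braid_cell_def)

lemma cell_comp_map [simp]:
  assumes "diagram d" "diagram e" "wdom e = wcod d" "span (wdom d) s"
    and "span_map (wcod d) (act d s) t f" "span_map (wcod e) (act e t) r g" "Z = wcod e"
  shows "span_map Z (act (wiring_comp e d) s) r (ccell e d s t g f)"
proof -
  have f: "span_map (wdom e) (act d s) t f" using assms by simp
  note m = icomp(2)[OF assms(1-4)] act_arr(1)[OF assms(2) f]
  show ?thesis using span_map_comp[OF span_map_comp[OF m(1) m(2)] assms(6)] assms(7) by (simp add: ccell_def)
qed

lemma cell_mul_map [simp]:
  assumes "diagram d" "diagram e" "span (wdom d) s" "span (wdom e) t"
    and "span_map (wcod d) (act d s) s' f" "span_map (wcod e) (act e t) t' g"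
    and "X = wdom d" "Y = wdom e" "X' = wcod d" "Y' = wcod e" "Z = box_sum X' Y'"
  shows "span_map Z (act (wiring_sum d e) (mul X Y s t)) (mul X' Y' s' t') (mcell d e s t f g)"
  using span_map_comp[OF imul(2)[OF assms(1-4)] mul_arr[OF assms(5,6)]] assms(7-11) by (simp add: mcell_def)

lemma ccell_simps [simp]:
  assumes "diagram d" "diagram e" "wdom e = wcod d" "span (wdom d) s"
    and "span_map (wdom e) (act d s) t f" "arr g" "src g = src (act e t)"
  shows "arr (ccell e d s t g f)" "src (ccell e d s t g f) = src (act (wiring_comp e d) s)"
    "tgt (ccell e d s t g f) = tgt g"
    "\<lbrakk>arr x; tgt x = src (act (wiring_comp e d) s)\<rbrakk> \<Longrightarrow>
      ccell e d s t g f ** x = g ** act_arr e (act d s) t f ** icomp e d s ** x"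
  unfolding ccell_def using assms by simp_all

lemma mcell_simps [simp]:
  assumes "diagram d" "diagram e" "span (wdom d) s" "span (wdom e) t"
    and "arr f" "src f = src (act d s)" "arr g" "src g = src (act e t)"
  shows "arr (mcell d e s t f g)"
    "src (mcell d e s t f g) = src (act (wiring_sum d e) (mul (wdom d) (wdom e) s t))"
    "tgt (mcell d e s t f g) = bprod C (tgt f) (tgt g)"
    "\<lbrakk>arr x; tgt x = src (act (wiring_sum d e) (mul (wdom d) (wdom e) s t))\<rbrakk> \<Longrightarrow>
      mcell d e s t f g ** x = pairing C (f ** p1 (act d s) (act e t) ** imul d e s t ** x) (g ** p2 (act d s) (act e t) ** imul d e s t ** x)"
proof -
  have o: "src (act d s) \<in> Obj C" "src (act e t) \<in> Obj C" using assms by simp_all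
  note i = imul_simps(1-3)[OF assms(1-4)]
  have d: "src (par C f g) = bprod C (src (act d s)) (src (act e t))" "arr (par C f g)"
    "tgt (par C f g) = bprod C (tgt f) (tgt g)" using assms by simp_all
  show "arr (mcell d e s t f g)"
    "src (mcell d e s t f g) = src (act (wiring_sum d e) (mul (wdom d) (wdom e) s t))"
    "tgt (mcell d e s t f g) = bprod C (tgt f) (tgt g)"
    unfolding mcell_def using i d by (simp_all del: par_simps)
  show "mcell d e s t f g ** x = pairing C (f ** p1 (act d s) (act e t) ** imul d e s t ** x) (g ** p2 (act d s) (act e t) ** imul d e s t ** x)"
    if x: "arr x" "tgt x = src (act (wiring_sum d e) (mul (wdom d) (wdom e) s t))"
  proof -
    have "mcell d e s t f g ** x = par C f g ** imul d e s t ** x"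
      unfolding mcell_def by (rule comp_assoc) (use i d x in simp_all)
    then show ?thesis using assms i x by simp
  qed
qed

lemma cell_id_map [simp]: "span X s \<Longrightarrow> span_map X (act (idw X) s) s (act_pr (idw X) s)"
  by (rule co_id_inv(2))

lemma co_assoc_map [simp]:
  "\<lbrakk>span X s; span Y t; span Z u; V = box_sum X (box_sum Y Z); U = box_sum X Y; U' = box_sum Y Z\<rbrakk> \<Longrightarrow>
    span_map V (act (assocw X Y Z) (mul U Z (mul X Y s t) u)) (mul X U' s (mul Y Z t u)) (co_assoc X Y Z s t u)"
  using co_assoc(1) by blast

lemma co_braid_map [simp]:
  "\<lbrakk>span X s; span Y t; V = box_sum Y X\<rbrakk> \<Longrightarrow>
    span_map V (act (braidw X Y) (mul X Y s t)) (mul Y X t s) (co_braid X Y s t)"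
  using co_braid(1) by blast

lemma co_unit_map [simp]:
  fixes X :: "('l, 'o) box"
  shows "span X s \<Longrightarrow> span_map X (act (lunitw X) (mul empty_box X (eta TYPE('l)) s)) s (co_lunit X s)"
    "span X s \<Longrightarrow> span_map X (act (runitw X) (mul X empty_box s (eta TYPE('l)))) s (co_runit X s)"
  by (rule co_unit; assumption)+

lemma co_assoc_app [simp]:
  assumes "span X s" "span Y t" "span Z u" "arr x" "tgt x = src (act (assocw X Y Z) (mul (box_sum X Y) Z (mul X Y s t) u))"
  shows "co_assoc X Y Z s t u ** x = pairing C (p1 s t ** p1 (mul X Y s t) u ** act_pr (assocw X Y Z) (mul (box_sum X Y) Z (mul X Y s t) u) ** x)
     (pairing C (p2 s t ** p1 (mul X Y s t) u ** act_pr (assocw X Y Z) (mul (box_sum X Y) Z (mul X Y s t) u) ** x)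
       (p2 (mul X Y s t) u ** act_pr (assocw X Y Z) (mul (box_sum X Y) Z (mul X Y s t) u) ** x))"
proof -
  note b = span_box[OF assms(1)] span_box[OF assms(2)] span_box[OF assms(3)]
  have "src s \<in> Obj C" "src t \<in> Obj C" "src u \<in> Obj C" using assms by simp_all
  then show ?thesis unfolding co_assoc_def kassoc_def using assms b by simp
qed

lemma co_braid_app [simp]:
  assumes "span X s" "span Y t" "arr x" "tgt x = src (act (braidw X Y) (mul X Y s t))"
  shows "co_braid X Y s t ** x = pairing C (p2 s t ** act_pr (braidw X Y) (mul X Y s t) ** x) (p1 s t ** act_pr (braidw X Y) (mul X Y s t) ** x)"
proof -
  note b = span_box[OF assms(1)] span_box[OF assms(2)]
  have "src s \<in> Obj C" "src t \<in> Obj C" using assms by simp_all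
  then show ?thesis unfolding co_braid_def using assms b by simp
qed

lemma co_unit_app [simp]:
  fixes X :: "('l, 'o) box"
  assumes "span X s" "arr x"
  shows "tgt x = src (act (lunitw X) (mul empty_box X (eta TYPE('l)) s)) \<Longrightarrow>
      co_lunit X s ** x = p2 (eta TYPE('l)) s ** act_pr (lunitw X) (mul empty_box X (eta TYPE('l)) s) ** x"
    "tgt x = src (act (runitw X) (mul X empty_box s (eta TYPE('l)))) \<Longrightarrow>
      co_runit X s ** x = p1 s (eta TYPE('l)) ** act_pr (runitw X) (mul X empty_box s (eta TYPE('l))) ** x"
proof -
  note b = span_box[OF assms(1)]
  have "src s \<in> Obj C" using assms by simp
  then show "tgt x = src (act (lunitw X) (mul empty_box X (eta TYPE('l)) s)) \<Longrightarrow>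
      co_lunit X s ** x = p2 (eta TYPE('l)) s ** act_pr (lunitw X) (mul empty_box X (eta TYPE('l)) s) ** x"
    "tgt x = src (act (runitw X) (mul X empty_box s (eta TYPE('l)))) \<Longrightarrow>
      co_runit X s ** x = p1 s (eta TYPE('l)) ** act_pr (runitw X) (mul X empty_box s (eta TYPE('l))) ** x"
    unfolding co_lunit_def co_runit_def using assms b by simp_all
qed

lemma structural_arr [simp]:
  fixes X :: "('l, 'o) box"
  shows "\<lbrakk>span X s; span Y t; span Z u\<rbrakk> \<Longrightarrow> co_assoc X Y Z s t u \<in> Arr C"
    "\<lbrakk>span X s; span Y t; span Z u\<rbrakk> \<Longrightarrow> src (co_assoc X Y Z s t u) = src (act (assocw X Y Z) (mul (box_sum X Y) Z (mul X Y s t) u))"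
    "\<lbrakk>span X s; span Y t; span Z u\<rbrakk> \<Longrightarrow> tgt (co_assoc X Y Z s t u) = bprod C (src s) (bprod C (src t) (src u))"
    "\<lbrakk>span X s; span Y t\<rbrakk> \<Longrightarrow> co_braid X Y s t \<in> Arr C"
    "\<lbrakk>span X s; span Y t\<rbrakk> \<Longrightarrow> src (co_braid X Y s t) = src (act (braidw X Y) (mul X Y s t))"
    "\<lbrakk>span X s; span Y t\<rbrakk> \<Longrightarrow> tgt (co_braid X Y s t) = bprod C (src t) (src s)"
    "span X s \<Longrightarrow> co_lunit X s \<in> Arr C"
    "span X s \<Longrightarrow> src (co_lunit X s) = src (act (lunitw X) (mul empty_box X (eta TYPE('l)) s))"
    "span X s \<Longrightarrow> tgt (co_lunit X s) = src s"
    "span X s \<Longrightarrow> co_runit X s \<in> Arr C"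
    "span X s \<Longrightarrow> src (co_runit X s) = src (act (runitw X) (mul X empty_box s (eta TYPE('l))))"
    "span X s \<Longrightarrow> tgt (co_runit X s) = src s"
  using span_map_arr[OF co_assoc(1)[of X s Y t Z u]] span_map_arr[OF co_braid(1)[of X s Y t]]
    span_map_arr[OF co_unit(1)[of X s]] span_map_arr[OF co_unit(3)[of X s]] by simp_all

text \<open>A single membership fact replaces the two premises on arrow and target, and the
  constructions below preserve it; this carries simp through nested pastings.\<close>

definition el :: "'o \<Rightarrow> 'm set" where
  "el A = {x \<in> Arr C. tgt x = A}"

lemma elD: "x \<in> el A \<Longrightarrow> x \<in> Arr C" "x \<in> el A \<Longrightarrow> tgt x = A"
  by (simp_all add: el_def)

text \<open>An element of the action of a composite diagram as seen in the inner action
  \<open>act d s\<close>; \<open>csnd\<close> is the same element as seen in the outer action on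
  \<open>t\<close>, after the inner cell \<open>f\<close> has been applied.\<close>

definition cfst :: "('l, 'o) wiring_diagram \<Rightarrow> ('l, 'o) wiring_diagram \<Rightarrow> 'm \<Rightarrow> 'm \<Rightarrow> 'm" where
  "cfst e d s x = act_pr e (act d s) ** icomp e d s ** x"

definition csnd :: "('l, 'o) wiring_diagram \<Rightarrow> ('l, 'o) wiring_diagram \<Rightarrow> 'm \<Rightarrow> 'm \<Rightarrow> 'm \<Rightarrow> 'm \<Rightarrow> 'm" where
  "csnd e d s t f x = act_arr e (act d s) t f ** icomp e d s ** x"

text \<open>With \<open>m2\<close>, the two components of an element of the action of a sum, as
  elements of the separate actions.\<close>

definition m1 :: "('l, 'o) wiring_diagram \<Rightarrow> ('l, 'o) wiring_diagram \<Rightarrow> 'm \<Rightarrow> 'm \<Rightarrow> 'm \<Rightarrow> 'm" where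
  "m1 d e s t x = p1 (act d s) (act e t) ** imul d e s t ** x"

definition m2 :: "('l, 'o) wiring_diagram \<Rightarrow> ('l, 'o) wiring_diagram \<Rightarrow> 'm \<Rightarrow> 'm \<Rightarrow> 'm \<Rightarrow> 'm" where
  "m2 d e s t x = p2 (act d s) (act e t) ** imul d e s t ** x"

lemma cfst:
  assumes "diagram d" "diagram e" "wdom e = wcod d" "span (wdom d) s"
    and x: "x \<in> el (src (act (wiring_comp e d) s))"
  shows "cfst e d s x \<in> el (src (act d s))" "src (cfst e d s x) = src x"
    "act_pr d s ** cfst e d s x = act_pr (wiring_comp e d) s ** x"
    "\<lbrakk>win e j = Some (InR k); Y = wcod d\<rbrakk> \<Longrightarrow> port_in Y (act d s) j ** cfst e d s x = port_in (wcod e) (act (wiring_comp e d) s) k ** x"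
    "\<lbrakk>win e j = Some (InL k); Y = wcod d\<rbrakk> \<Longrightarrow> port_in Y (act d s) j ** cfst e d s x = port_out Y (act d s) k ** cfst e d s x"
proof -
  note x = elD[OF x]
  have u: "arr (icomp e d s ** x)" "tgt (icomp e d s ** x) = src (act e (act d s))" "src (icomp e d s ** x) = src x"
    using x assms(1-4) by simp_all
  have sa: "span (wdom e) (act d s)" using assms by simp
  show "cfst e d s x \<in> el (src (act d s))" "src (cfst e d s x) = src x"
    using u sa assms(1-4) by (simp_all add: cfst_def el_def)
  show "act_pr d s ** cfst e d s x = act_pr (wiring_comp e d) s ** x"
    unfolding cfst_def by (rule icomp_simps(4)[OF assms(1-4) x])
  { assume j: "win e j = Some (InR k)" "Y = wcod d"
    have "fst (wcod e) k \<noteq> None" using typed_in_cases[OF wiring_diagramD(5)[OF assms(2)], of j] j by auto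
    then show "port_in Y (act d s) j ** cfst e d s x = port_in (wcod e) (act (wiring_comp e d) s) k ** x"
      using act_port_in(2)[OF assms(2) sa refl u(1,2) j(1) refl] icomp_simps(5)[OF assms(1-4) x refl, of k] j assms(3)
      by (simp add: cfst_def) }
  { assume j: "win e j = Some (InL k)" "Y = wcod d"
    then show "port_in Y (act d s) j ** cfst e d s x = port_out Y (act d s) k ** cfst e d s x"
      using act_port_in(1)[OF assms(2) sa refl u(1,2) j(1)] assms(3) by (simp add: cfst_def) }
qed

lemma csnd:
  assumes "diagram d" "diagram e" "wdom e = wcod d" "span (wdom d) s"
    and f: "span_map (wdom e) (act d s) t f" and x: "x \<in> el (src (act (wiring_comp e d) s))"
  shows "csnd e d s t f x \<in> el (src (act e t))" "src (csnd e d s t f x) = src x"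
    "act_pr e t ** csnd e d s t f x = f ** cfst e d s x"
    "\<lbrakk>Z = wcod e; fst Z j \<noteq> None\<rbrakk> \<Longrightarrow> port_in Z (act e t) j ** csnd e d s t f x = port_in Z (act (wiring_comp e d) s) j ** x"
    "\<lbrakk>arr g; src g = src (act e t)\<rbrakk> \<Longrightarrow> ccell e d s t g f ** x = g ** csnd e d s t f x"
proof -
  note x = elD[OF x]
  have u: "arr (icomp e d s ** x)" "tgt (icomp e d s ** x) = src (act e (act d s))" "src (icomp e d s ** x) = src x"
    using x assms(1-4) by simp_all
  note a = act_arr_simps[OF assms(2) f]
  show "csnd e d s t f x \<in> el (src (act e t))" "src (csnd e d s t f x) = src x"
    using u a by (simp_all add: csnd_def el_def)
  show "act_pr e t ** csnd e d s t f x = f ** cfst e d s x"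
    unfolding csnd_def cfst_def by (rule a(4)[OF u(1,2)])
  show "port_in Z (act e t) j ** csnd e d s t f x = port_in Z (act (wiring_comp e d) s) j ** x" if "Z = wcod e" "fst Z j \<noteq> None"
    unfolding csnd_def using a(5)[OF u(1,2) that] icomp_simps(5)[OF assms(1-4) x that] by simp
  show "ccell e d s t g f ** x = g ** csnd e d s t f x" if "arr g" "src g = src (act e t)"
    unfolding csnd_def by (rule ccell_simps(4)[OF assms(1-5) that x])
qed

lemma m12:
  assumes "diagram d" "diagram e" "span (wdom d) s" "span (wdom e) t"
    and X: "x \<in> el (src (act (wiring_sum d e) (mul (wdom d) (wdom e) s t)))"
  shows "m1 d e s t x \<in> el (src (act d s))" "src (m1 d e s t x) = src x"
    "m2 d e s t x \<in> el (src (act e t))" "src (m2 d e s t x) = src x"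
    "act_pr d s ** m1 d e s t x = p1 s t ** act_pr (wiring_sum d e) (mul (wdom d) (wdom e) s t) ** x"
    "act_pr e t ** m2 d e s t x = p2 s t ** act_pr (wiring_sum d e) (mul (wdom d) (wdom e) s t) ** x"
    "\<lbrakk>Z = wcod d; fst Z j \<noteq> None\<rbrakk> \<Longrightarrow> port_in Z (act d s) j ** m1 d e s t x =
      port_in (box_sum Z (wcod e)) (act (wiring_sum d e) (mul (wdom d) (wdom e) s t)) (InL j) ** x"
    "\<lbrakk>Z = wcod e; fst Z j \<noteq> None\<rbrakk> \<Longrightarrow> port_in Z (act e t) j ** m2 d e s t x =
      port_in (box_sum (wcod d) Z) (act (wiring_sum d e) (mul (wdom d) (wdom e) s t)) (InR j) ** x"
    "\<lbrakk>arr f; src f = src (act d s); arr g; src g = src (act e t)\<rbrakk> \<Longrightarrow>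
      mcell d e s t f g ** x = pairing C (f ** m1 d e s t x) (g ** m2 d e s t x)"
    "\<lbrakk>arr f; src f = src (act d s); arr g; src g = src (act e t); a = tgt f; b = tgt g\<rbrakk> \<Longrightarrow>
      pr1 C a b ** mcell d e s t f g ** x = f ** m1 d e s t x"
    "\<lbrakk>arr f; src f = src (act d s); arr g; src g = src (act e t); a = tgt f; b = tgt g\<rbrakk> \<Longrightarrow>
      pr2 C a b ** mcell d e s t f g ** x = g ** m2 d e s t x"
proof -
  note x = elD[OF X]
  note i = imul_simps[OF assms(1-4)]
  have u: "arr (imul d e s t ** x)" "tgt (imul d e s t ** x) = bprod C (src (act d s)) (src (act e t))"
    "src (imul d e s t ** x) = src x"
    using x i(1-3) by simp_all
  show m: "m1 d e s t x \<in> el (src (act d s))" "src (m1 d e s t x) = src x"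
    "m2 d e s t x \<in> el (src (act e t))" "src (m2 d e s t x) = src x"
    using u assms(1-4) by (simp_all add: m1_def m2_def el_def)
  show "act_pr d s ** m1 d e s t x = p1 s t ** act_pr (wiring_sum d e) (mul (wdom d) (wdom e) s t) ** x"
    "act_pr e t ** m2 d e s t x = p2 s t ** act_pr (wiring_sum d e) (mul (wdom d) (wdom e) s t) ** x"
    unfolding m1_def m2_def by (rule i(4)[OF x], rule i(5)[OF x])
  show "port_in Z (act d s) j ** m1 d e s t x =
      port_in (box_sum Z (wcod e)) (act (wiring_sum d e) (mul (wdom d) (wdom e) s t)) (InL j) ** x" if "Z = wcod d" "fst Z j \<noteq> None"
    unfolding m1_def by (rule i(6)[OF x that])
  show "port_in Z (act e t) j ** m2 d e s t x =
      port_in (box_sum (wcod d) Z) (act (wiring_sum d e) (mul (wdom d) (wdom e) s t)) (InR j) ** x" if "Z = wcod e" "fst Z j \<noteq> None"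
    unfolding m2_def by (rule i(7)[OF x that])
  assume f: "arr f" "src f = src (act d s)" "arr g" "src g = src (act e t)"
  show e: "mcell d e s t f g ** x = pairing C (f ** m1 d e s t x) (g ** m2 d e s t x)"
    unfolding m1_def m2_def by (rule mcell_simps(4)[OF assms(1-4) f x])
  have v: "arr (f ** m1 d e s t x)" "tgt (f ** m1 d e s t x) = tgt f" "src (f ** m1 d e s t x) = src x"
    "arr (g ** m2 d e s t x)" "tgt (g ** m2 d e s t x) = tgt g" "src (g ** m2 d e s t x) = src x"
    using f m elD[OF m(1)] elD[OF m(3)] by simp_all
  assume ab: "a = tgt f" "b = tgt g"
  show "pr1 C a b ** mcell d e s t f g ** x = f ** m1 d e s t x"
    "pr2 C a b ** mcell d e s t f g ** x = g ** m2 d e s t x"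
    unfolding e ab using v by simp_all
qed

lemma co_assoc_el:
  assumes "span X s" "span Y t" "span Z u" "x \<in> el (src (act (assocw X Y Z) (mul (box_sum X Y) Z (mul X Y s t) u)))"
  defines "y \<equiv> act_pr (assocw X Y Z) (mul (box_sum X Y) Z (mul X Y s t) u) ** x"
  shows "co_assoc X Y Z s t u ** x = pairing C (p1 s t ** pr1 C (bprod C (src s) (src t)) (src u) ** y)
     (pairing C (p2 s t ** pr1 C (bprod C (src s) (src t)) (src u) ** y) (pr2 C (bprod C (src s) (src t)) (src u) ** y))"
    "\<lbrakk>a = src s; b = src t; c = src u\<rbrakk> \<Longrightarrow> pr1 C a (bprod C b c) ** co_assoc X Y Z s t u ** x = pr1 C a b ** pr1 C (bprod C a b) c ** y"
    "\<lbrakk>a = src s; b = src t; c = src u\<rbrakk> \<Longrightarrow> pr1 C b c ** pr2 C a (bprod C b c) ** co_assoc X Y Z s t u ** x = pr2 C a b ** pr1 C (bprod C a b) c ** y"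
    "\<lbrakk>a = src s; b = src t; c = src u\<rbrakk> \<Longrightarrow> pr2 C b c ** pr2 C a (bprod C b c) ** co_assoc X Y Z s t u ** x = pr2 C (bprod C a b) c ** y"
    "\<lbrakk>a = src s; b = src t; c = src u\<rbrakk> \<Longrightarrow> pr2 C a (bprod C b c) ** co_assoc X Y Z s t u ** x =
       pairing C (pr2 C a b ** pr1 C (bprod C a b) c ** y) (pr2 C (bprod C a b) c ** y)"
proof -
  note x = elD[OF assms(4)]
  have O: "src s \<in> Obj C" "src t \<in> Obj C" "src u \<in> Obj C" using assms by simp_all
  have y: "arr y" "tgt y = bprod C (bprod C (src s) (src t)) (src u)"
    using x assms(1-3) span_box[OF assms(1)] span_box[OF assms(2)] span_box[OF assms(3)] by (simp_all add: y_def)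
  show e: "co_assoc X Y Z s t u ** x = pairing C (p1 s t ** pr1 C (bprod C (src s) (src t)) (src u) ** y)
     (pairing C (p2 s t ** pr1 C (bprod C (src s) (src t)) (src u) ** y) (pr2 C (bprod C (src s) (src t)) (src u) ** y))"
    using co_assoc_app[OF assms(1-3) x(1)] x(2) assms(1-3) by (simp add: y_def)
  assume abc: "a = src s" "b = src t" "c = src u"
  show "pr1 C a (bprod C b c) ** co_assoc X Y Z s t u ** x = pr1 C a b ** pr1 C (bprod C a b) c ** y"
    "pr1 C b c ** pr2 C a (bprod C b c) ** co_assoc X Y Z s t u ** x = pr2 C a b ** pr1 C (bprod C a b) c ** y"
    "pr2 C b c ** pr2 C a (bprod C b c) ** co_assoc X Y Z s t u ** x = pr2 C (bprod C a b) c ** y"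
    "pr2 C a (bprod C b c) ** co_assoc X Y Z s t u ** x =
       pairing C (pr2 C a b ** pr1 C (bprod C a b) c ** y) (pr2 C (bprod C a b) c ** y)"
    unfolding e abc using y O by simp_all
qed

lemma co_braid_el:
  assumes "span X s" "span Y t" "x \<in> el (src (act (braidw X Y) (mul X Y s t)))"
  defines "y \<equiv> act_pr (braidw X Y) (mul X Y s t) ** x"
  shows "co_braid X Y s t ** x = pairing C (p2 s t ** y) (p1 s t ** y)"
    "\<lbrakk>a = src t; b = src s\<rbrakk> \<Longrightarrow> pr1 C a b ** co_braid X Y s t ** x = pr2 C b a ** y"
    "\<lbrakk>a = src t; b = src s\<rbrakk> \<Longrightarrow> pr2 C a b ** co_braid X Y s t ** x = pr1 C b a ** y"
proof -
  note x = elD[OF assms(3)]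
  have O: "src s \<in> Obj C" "src t \<in> Obj C" using assms by simp_all
  have y: "arr y" "tgt y = bprod C (src s) (src t)"
    using x assms(1,2) span_box[OF assms(1)] span_box[OF assms(2)] by (simp_all add: y_def)
  show e: "co_braid X Y s t ** x = pairing C (p2 s t ** y) (p1 s t ** y)"
    using co_braid_app[OF assms(1,2) x] by (simp add: y_def)
  assume ab: "a = src t" "b = src s"
  show "pr1 C a b ** co_braid X Y s t ** x = pr2 C b a ** y" "pr2 C a b ** co_braid X Y s t ** x = pr1 C b a ** y"
    unfolding e ab using y O by simp_all
qed

lemma co_unit_el:
  fixes X :: "('l, 'o) box"
  assumes "span X s"
  shows "x \<in> el (src (act (lunitw X) (mul empty_box X (eta TYPE('l)) s))) \<Longrightarrow>
      co_lunit X s ** x = p2 (eta TYPE('l)) s ** act_pr (lunitw X) (mul empty_box X (eta TYPE('l)) s) ** x"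
    "x \<in> el (src (act (runitw X) (mul X empty_box s (eta TYPE('l))))) \<Longrightarrow>
      co_runit X s ** x = p1 s (eta TYPE('l)) ** act_pr (runitw X) (mul X empty_box s (eta TYPE('l))) ** x"
  using co_unit_app[OF assms] by (auto dest: elD)

text \<open>\<open>el_pr_rules\<close> omits the rules that produce pairings, for comparisons made
  one component at a time; \<open>el_rules\<close> evaluates structural arrows in full.\<close>

lemmas el_pr_rules = cfst csnd m12(1-8,10,11) co_assoc_el(2-4) co_braid_el(2,3) co_unit_el
lemmas el_rules = cfst csnd m12 co_assoc_el co_braid_el co_unit_el

lemma act_el_eqI:
  assumes "diagram d" "span (wdom d) s" "x \<in> el (src (act d s))" "y \<in> el (src (act d s))" "src x = src y"
    and "act_pr d s ** x = act_pr d s ** y"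
    and "\<And>j a. fst (wcod d) j = Some a \<Longrightarrow> port_in (wcod d) (act d s) j ** x = port_in (wcod d) (act d s) j ** y"
  shows "x = y"
  by (rule act_eqI[OF assms(1,2) _ _ _ _ assms(5-7)]) (use assms(3,4) in \<open>auto simp: el_def\<close>)

lemma cell_eqI:
  assumes "\<omega> = \<omega>'" "span_map Z (act \<omega> m) n H" "span_map Z (act \<omega>' m) n H'"
    "\<And>x. x \<in> el (src (act \<omega> m)) \<Longrightarrow> H ** x = H' ** x"
  shows "(m, \<omega>, (act \<omega> m, n, H)) = (m, \<omega>', (act \<omega>' m, n, H'))"
  using arr_eqI[OF span_map_arr(1)[OF assms(2)] span_map_arr(1)[OF assms(3)]] span_map_arr[OF assms(2)] span_map_arr[OF assms(3)] assms(1,4)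
  by (simp add: el_def)

lemmas cell_eqs = structural_cells cell_mul_eq cell_comp_eq cell_id_eq sum_diagram comp_diagram structural_diagrams idw_diagram
  wiring_sum_ends plain_wiring_ends wiring_comp_ends mul_simps(1) is_box_sum is_box_empty span_eta(1)

declare co_assoc_app [simp del] co_braid_app [simp del] co_unit_app [simp del] mcell_simps(4) [simp del] ccell_simps(4) [simp del]

text \<open>Both sides apply \<open>f\<close>, \<open>g\<close> and \<open>h\<close> to three
  elements of the separate actions. That these elements agree is \<open>E\<close>, tested by
  \<open>act_pr\<close> and the outer ports; the cells are arbitrary and enter only
  afterwards.\<close>

lemma assoc_natural:
  assumes w: "diagram d" "diagram e" "diagram \<chi>"
    and st: "span (wdom d) s" "span (wdom e) t" "span (wdom \<chi>) u"
    and f: "span_map (wcod d) (act d s) s' f" and g: "span_map (wcod e) (act e t) t' g" and h: "span_map (wcod \<chi>) (act \<chi> u) u' h"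
  shows "ccmp (assocc (wcod d) (wcod e) (wcod \<chi>) s' t' u')
      (cmul (cmul (s, d, (act d s, s', f)) (t, e, (act e t, t', g))) (u, \<chi>, (act \<chi> u, u', h))) =
    ccmp (cmul (s, d, (act d s, s', f)) (cmul (t, e, (act e t, t', g)) (u, \<chi>, (act \<chi> u, u', h))))
      (assocc (wdom d) (wdom e) (wdom \<chi>) s t u)"
proof -
  note b = is_box_ends[OF w(1)] is_box_ends[OF w(2)] is_box_ends[OF w(3)]
  note fgh = span_map_arr[OF f] span_map_arr[OF g] span_map_arr[OF h] span_mapD(2)[OF f] span_mapD(2)[OF g] span_mapD(2)[OF h]
  note N = wiring_natural(1)[OF w]
  let ?m = "mul (box_sum (wdom d) (wdom e)) (wdom \<chi>) (mul (wdom d) (wdom e) s t) u"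
  note hyps = w st f g h b fgh
  let ?a = "assocw (wcod d) (wcod e) (wcod \<chi>)" and ?b = "assocw (wdom d) (wdom e) (wdom \<chi>)"
  let ?L = "wiring_sum (wiring_sum d e) \<chi>" and ?R = "wiring_sum d (wiring_sum e \<chi>)"
  let ?n = "mul (wdom d) (box_sum (wdom e) (wdom \<chi>)) s (mul (wdom e) (wdom \<chi>) t u)"
  have E: "m1 d e s t (m1 (wiring_sum d e) \<chi> (mul (wdom d) (wdom e) s t) u (cfst ?a ?L ?m x)) =
      m1 d (wiring_sum e \<chi>) s (mul (wdom e) (wdom \<chi>) t u) (csnd ?R ?b ?m ?n (co_assoc (wdom d) (wdom e) (wdom \<chi>) s t u) x)"
    "m2 d e s t (m1 (wiring_sum d e) \<chi> (mul (wdom d) (wdom e) s t) u (cfst ?a ?L ?m x)) =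
      m1 e \<chi> t u (m2 d (wiring_sum e \<chi>) s (mul (wdom e) (wdom \<chi>) t u) (csnd ?R ?b ?m ?n (co_assoc (wdom d) (wdom e) (wdom \<chi>) s t u) x))"
    "m2 (wiring_sum d e) \<chi> (mul (wdom d) (wdom e) s t) u (cfst ?a ?L ?m x) =
      m2 e \<chi> t u (m2 d (wiring_sum e \<chi>) s (mul (wdom e) (wdom \<chi>) t u) (csnd ?R ?b ?m ?n (co_assoc (wdom d) (wdom e) (wdom \<chi>) s t u) x))"
    if x: "x \<in> el (src (act (wiring_comp ?R ?b) ?m))" for x
    by (rule act_el_eqI[OF w(1) st(1)] act_el_eqI[OF w(2) st(2)] act_el_eqI[OF w(3) st(3)];
        simp add: el_pr_rules hyps x N inl_app)+
  show ?thesis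
    by (simp only: cell_eqs w st b fgh, rule cell_eqI[OF N, of "box_sum (wcod d) (box_sum (wcod e) (wcod \<chi>))"],
        simp add: hyps, simp add: hyps, simp add: hyps el_pr_rules co_assoc_el(1) N E, simp add: hyps csnd m12)
qed

lemma lunit_natural:
  fixes d :: "('l, 'o) wiring_diagram"
  assumes w: "diagram d" and s: "span (wdom d) s" and f: "span_map (wcod d) (act d s) s' f"
  shows "cell_comp W (F :: ('l, 'o, 'm) span_algebra) coh (lunitc (wcod d) s')
       (cmul (cid empty_box (eta TYPE('l))) (s, d, (act d s, s', f))) =
     ccmp (s, d, (act d s, s', f)) (lunitc (wdom d) s)"
proof -
  note b = is_box_ends[OF w]
  note f' = span_map_arr[OF f] span_mapD(2)[OF f]
  note N = wiring_natural(2)[OF w w w]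
  note hyps = w s f b f'
  let ?e = "eta TYPE('l)" and ?I = "idw empty_box :: ('l, 'o) wiring_diagram"
  have E: "m2 ?I d ?e s (cfst (lunitw (wcod d)) (wiring_sum ?I d) (mul empty_box (wdom d) ?e s) x) =
      csnd d (lunitw (wdom d)) (mul empty_box (wdom d) ?e s) s (co_lunit (wdom d) s) x"
    if x: "x \<in> el (src (act (wiring_comp d (lunitw (wdom d))) (mul empty_box (wdom d) ?e s)))" for x
    by (rule act_el_eqI[OF w s]) (simp_all add: el_pr_rules hyps x N inl_app)
  show ?thesis
    by (simp only: cell_eqs w s b f', rule cell_eqI[OF N, of "wcod d"],
        simp add: hyps, simp add: hyps, simp add: hyps el_pr_rules N E)
qed

lemma runit_natural:
  fixes d :: "('l, 'o) wiring_diagram"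
  assumes w: "diagram d" and s: "span (wdom d) s" and f: "span_map (wcod d) (act d s) s' f"
  shows "cell_comp W (F :: ('l, 'o, 'm) span_algebra) coh (runitc (wcod d) s')
       (cmul (s, d, (act d s, s', f)) (cid empty_box (eta TYPE('l)))) =
     ccmp (s, d, (act d s, s', f)) (runitc (wdom d) s)"
proof -
  note b = is_box_ends[OF w]
  note f' = span_map_arr[OF f] span_mapD(2)[OF f]
  note N = wiring_natural(3)[OF w w w]
  note hyps = w s f b f'
  let ?e = "eta TYPE('l)" and ?I = "idw empty_box :: ('l, 'o) wiring_diagram"
  have E: "m1 d ?I s ?e (cfst (runitw (wcod d)) (wiring_sum d ?I) (mul (wdom d) empty_box s ?e) x) =
      csnd d (runitw (wdom d)) (mul (wdom d) empty_box s ?e) s (co_runit (wdom d) s) x"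
    if x: "x \<in> el (src (act (wiring_comp d (runitw (wdom d))) (mul (wdom d) empty_box s ?e)))" for x
    by (rule act_el_eqI[OF w s]) (simp_all add: el_pr_rules hyps x N inl_app)
  show ?thesis
    by (simp only: cell_eqs w s b f', rule cell_eqI[OF N, of "wcod d"],
        simp add: hyps, simp add: hyps, simp add: hyps el_pr_rules N E)
qed

lemma braid_natural:
  assumes w: "diagram d" "diagram e"
    and st: "span (wdom d) s" "span (wdom e) t"
    and f: "span_map (wcod d) (act d s) s' f" and g: "span_map (wcod e) (act e t) t' g"
  shows "ccmp (braidc (wcod d) (wcod e) s' t')
      (cmul (s, d, (act d s, s', f)) (t, e, (act e t, t', g))) =
    ccmp (cmul (t, e, (act e t, t', g)) (s, d, (act d s, s', f)))
      (braidc (wdom d) (wdom e) s t)"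
proof -
  note b = is_box_ends[OF w(1)] is_box_ends[OF w(2)]
  note fg = span_map_arr[OF f] span_map_arr[OF g] span_mapD(2)[OF f] span_mapD(2)[OF g]
  note N = wiring_natural(4)[OF w w(1)]
  note hyps = w st f g b fg
  let ?m = "mul (wdom d) (wdom e) s t" and ?a = "braidw (wcod d) (wcod e)" and ?b = "braidw (wdom d) (wdom e)"
  have E: "m1 d e s t (cfst ?a (wiring_sum d e) ?m x) =
      m2 e d t s (csnd (wiring_sum e d) ?b ?m (mul (wdom e) (wdom d) t s) (co_braid (wdom d) (wdom e) s t) x)"
    "m2 d e s t (cfst ?a (wiring_sum d e) ?m x) =
      m1 e d t s (csnd (wiring_sum e d) ?b ?m (mul (wdom e) (wdom d) t s) (co_braid (wdom d) (wdom e) s t) x)"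
    if x: "x \<in> el (src (act (wiring_comp (wiring_sum e d) ?b) ?m))" for x
    by (rule act_el_eqI[OF w(1) st(1)] act_el_eqI[OF w(2) st(2)]; simp add: el_pr_rules hyps x N inl_app)+
  show ?thesis
    by (simp only: cell_eqs w st b fg, rule cell_eqI[OF N, of "box_sum (wcod e) (wcod d)"],
        simp add: hyps, simp add: hyps, simp add: hyps el_pr_rules co_braid_el(1) N E, simp add: hyps csnd m12)
qed

theorem span_modifications: "modifications (W :: (('l, 'o) box, ('l, 'o) wiring_diagram) monoidal_category) F coh"
  unfolding modifications_def Let_def
proof (intro conjI ballI allI impI)
  fix x y z :: "('l, 'o) box" and s t u
  assume o: "x \<in> Obj W" "y \<in> Obj W" "z \<in> Obj W" "s \<in> Obj (Fib F x)" "t \<in> Obj (Fib F y)" "u \<in> Obj (Fib F z)"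
  have b: "is_box x" "is_box y" "is_box z" using o by (simp_all add: is_box_iff)
  have s: "span x s" "span y t" "span z u" using o b by (simp_all add: span_slice del: slice_simps(1))
  note a = co_assoc[OF s]
  show "is_iso (Fib F (x \<oplus>\<^bsub>W\<^esub> (y \<oplus>\<^bsub>W\<^esub> z))) (CoAssoc coh x y z s t u)"
    "CoAssoc coh x y z s t u \<in> Hom (Fib F (x \<oplus>\<^bsub>W\<^esub> (y \<oplus>\<^bsub>W\<^esub> z)))
       (OM (Act F (Assoc W x y z)) (OM (Mul F (x \<oplus>\<^bsub>W\<^esub> y) z) (OM (Mul F x y) (s, t), u)))
       (OM (Mul F x (y \<oplus>\<^bsub>W\<^esub> z)) (s, OM (Mul F y z) (t, u)))"
    using a b by (simp_all add: Hom_def[of "Sp (box_sum x (box_sum y z))"] span_map_slice del: slice_simps(2))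
next
  fix x :: "('l, 'o) box" and s
  assume o: "x \<in> Obj W" "s \<in> Obj (Fib F x)"
  have b: "is_box x" using o by (simp add: is_box_iff)
  have s: "span x s" using o b by (simp add: span_slice del: slice_simps(1))
  note a = co_unit[OF s]
  show "is_iso (Fib (F :: ('l, 'o, 'm) span_algebra) x) (CoLUnit coh x s)"
    "CoLUnit coh x s \<in> Hom (Fib (F :: ('l, 'o, 'm) span_algebra) x) (OM (Act (F :: ('l, 'o, 'm) span_algebra) (LUnit W x)) (OM (Mul (F :: ('l, 'o, 'm) span_algebra) (Unit W) x) (Eta (F :: ('l, 'o, 'm) span_algebra), s))) s"
    "is_iso (Fib (F :: ('l, 'o, 'm) span_algebra) x) (CoRUnit coh x s)"
    "CoRUnit coh x s \<in> Hom (Fib (F :: ('l, 'o, 'm) span_algebra) x) (OM (Act (F :: ('l, 'o, 'm) span_algebra) (RUnit W x)) (OM (Mul (F :: ('l, 'o, 'm) span_algebra) x (Unit W)) (s, Eta (F :: ('l, 'o, 'm) span_algebra)))) s"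
    using a b by (simp_all add: Hom_def[of "Sp x"] span_map_slice del: slice_simps(2))
next
  fix x y :: "('l, 'o) box" and s t
  assume o: "x \<in> Obj W" "y \<in> Obj W" "s \<in> Obj (Fib F x)" "t \<in> Obj (Fib F y)"
  have b: "is_box x" "is_box y" using o by (simp_all add: is_box_iff)
  have s: "span x s" "span y t" using o b by (simp_all add: span_slice del: slice_simps(1))
  note a = co_braid[OF s]
  show "is_iso (Fib F (y \<oplus>\<^bsub>W\<^esub> x)) (CoBraid coh x y s t)"
    "CoBraid coh x y s t \<in> Hom (Fib F (y \<oplus>\<^bsub>W\<^esub> x)) (OM (Act F (Braid W x y)) (OM (Mul F x y) (s, t))) (OM (Mul F y x) (t, s))"
    using a b by (simp_all add: Hom_def[of "Sp (box_sum y x)"] span_map_slice del: slice_simps(2))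
next
  fix a b c :: "('m, ('l, 'o) wiring_diagram, 'm \<times> 'm \<times> 'm) cell"
  assume cells: "is_cell W F a" "is_cell W F b" "is_cell W F c"
  obtain s d s' f t e t' g u \<chi> u' h where eq: "a = (s, d, (act d s, s', f))" "b = (t, e, (act e t, t', g))" "c = (u, \<chi>, (act \<chi> u, u', h))"
    and w: "diagram d" "diagram e" "diagram \<chi>" "span (wdom d) s" "span (wdom e) t" "span (wdom \<chi>) u"
      "span_map (wcod d) (act d s) s' f" "span_map (wcod e) (act e t) t' g" "span_map (wcod \<chi>) (act \<chi> u) u' h"
    using cells by (cases a, cases b, cases c) (auto simp: is_cell_iff)
  show "ccmp (assocc (cell_base_cod W a) (cell_base_cod W b) (cell_base_cod W c) (cell_target W F a) (cell_target W F b) (cell_target W F c))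
          (cmul (cmul a b) c) =
        ccmp (cmul a (cmul b c))
          (assocc (cell_base_dom W a) (cell_base_dom W b) (cell_base_dom W c) (cell_source a) (cell_source b) (cell_source c))"
    using assoc_natural[OF w] by (simp add: eq cell_base_cod_def cell_base_dom_def cell_target_def cell_source_def)
next
  fix a :: "('m, ('l, 'o) wiring_diagram, 'm \<times> 'm \<times> 'm) cell"
  assume cells: "is_cell W F a"
  obtain s d s' f where eq: "a = (s, d, (act d s, s', f))"
    and w: "diagram d" "span (wdom d) s" "span_map (wcod d) (act d s) s' f"
    using cells by (cases a) (auto simp: is_cell_iff)
  show "cell_comp W (F :: ('l, 'o, 'm) span_algebra) coh (lunitc (cell_base_cod W a) (cell_target W (F :: ('l, 'o, 'm) span_algebra) a))
          (cmul (cid (Unit W) (Eta (F :: ('l, 'o, 'm) span_algebra))) a) =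
        ccmp a (lunitc (cell_base_dom W a) (cell_source a))"
    "cell_comp W (F :: ('l, 'o, 'm) span_algebra) coh (runitc (cell_base_cod W a) (cell_target W (F :: ('l, 'o, 'm) span_algebra) a))
          (cmul a (cid (Unit W) (Eta (F :: ('l, 'o, 'm) span_algebra)))) =
        ccmp a (runitc (cell_base_dom W a) (cell_source a))"
    using lunit_natural[OF w] runit_natural[OF w] by (simp_all add: eq cell_base_cod_def cell_base_dom_def cell_target_def cell_source_def)
next
  fix a b :: "('m, ('l, 'o) wiring_diagram, 'm \<times> 'm \<times> 'm) cell"
  assume cells: "is_cell W F a" "is_cell W F b"
  obtain s d s' f t e t' g where eq: "a = (s, d, (act d s, s', f))" "b = (t, e, (act e t, t', g))"
    and w: "diagram d" "diagram e" "span (wdom d) s" "span (wdom e) t"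
      "span_map (wcod d) (act d s) s' f" "span_map (wcod e) (act e t) t' g"
    using cells by (cases a, cases b) (auto simp: is_cell_iff)
  show "ccmp (braidc (cell_base_cod W a) (cell_base_cod W b) (cell_target W F a) (cell_target W F b)) (cmul a b) =
        ccmp (cmul b a) (braidc (cell_base_dom W a) (cell_base_dom W b) (cell_source a) (cell_source b))"
    using braid_natural[OF w] by (simp add: eq cell_base_cod_def cell_base_dom_def cell_target_def cell_source_def)
qed

section \<open>Pentagon, triangle, hexagon and symmetry\<close>

lemma cell_eqI':
  assumes "\<omega> = \<omega>'" "span_map Z (act \<omega> m) n H" "span_map Z (act \<omega>' m) n H'"
    "\<And>x. \<lbrakk>x \<in> el (src (act \<omega> m)); arr x; tgt x = src (act \<omega> m)\<rbrakk> \<Longrightarrow> H ** x = H' ** x"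
  shows "(m, \<omega>, (act \<omega> m, n, H)) = (m, \<omega>', (act \<omega>' m, n, H'))"
  by (rule cell_eqI[OF assms(1-3)]) (use assms(4) in \<open>auto dest: elD\<close>)

text \<open>The target of the pentagon is a fourfold product; comparing the four components
  separately avoids equations between nested pairings.\<close>

lemma cell_eqI_mul4:
  assumes "\<omega> = \<omega>'" and H: "span_map Z (act \<omega> m) n H" "span_map Z (act \<omega>' m) n H'"
    and n: "src n = bprod C a (bprod C b (bprod C c d))" and o: "a \<in> Obj C" "b \<in> Obj C" "c \<in> Obj C" "d \<in> Obj C"
    and e: "\<And>x. x \<in> el (src (act \<omega> m)) \<Longrightarrow> pr1 C a (bprod C b (bprod C c d)) ** H ** x = pr1 C a (bprod C b (bprod C c d)) ** H' ** x"
      "\<And>x. x \<in> el (src (act \<omega> m)) \<Longrightarrow> pr1 C b (bprod C c d) ** pr2 C a (bprod C b (bprod C c d)) ** H ** x =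
         pr1 C b (bprod C c d) ** pr2 C a (bprod C b (bprod C c d)) ** H' ** x"
      "\<And>x. x \<in> el (src (act \<omega> m)) \<Longrightarrow> pr1 C c d ** pr2 C b (bprod C c d) ** pr2 C a (bprod C b (bprod C c d)) ** H ** x =
         pr1 C c d ** pr2 C b (bprod C c d) ** pr2 C a (bprod C b (bprod C c d)) ** H' ** x"
      "\<And>x. x \<in> el (src (act \<omega> m)) \<Longrightarrow> pr2 C c d ** pr2 C b (bprod C c d) ** pr2 C a (bprod C b (bprod C c d)) ** H ** x =
         pr2 C c d ** pr2 C b (bprod C c d) ** pr2 C a (bprod C b (bprod C c d)) ** H' ** x"
  shows "(m, \<omega>, (act \<omega> m, n, H)) = (m, \<omega>', (act \<omega>' m, n, H'))"
proof (rule cell_eqI[OF assms(1-3)])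
  fix x assume x: "x \<in> el (src (act \<omega> m))"
  have h: "arr (H ** x)" "tgt (H ** x) = bprod C a (bprod C b (bprod C c d))" "src (H ** x) = src x"
    "arr (H' ** x)" "tgt (H' ** x) = bprod C a (bprod C b (bprod C c d))" "src (H' ** x) = src x"
    using elD[OF x] span_map_arr[OF H(1)] span_map_arr[OF H(2)] n assms(1) by simp_all
  show "H ** x = H' ** x"
    by (rule bprod_eqI[OF _ _ _ _ _ _ _ e(1)[OF x] bprod_eqI[OF _ _ _ _ _ _ _ e(2)[OF x] bprod_eqI[OF _ _ _ _ _ _ _ e(3)[OF x] e(4)[OF x]]]])
      (use h o in simp_all)
qed

lemma span_pentagon:
  assumes "span w r" "span x s" "span y t" "span z u"
  shows "ccmp (assocc w x (box_sum y z) r s (mul y z t u))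
      (assocc (box_sum w x) y z (mul w x r s) t u) =
    ccmp (cmul (cid w r) (assocc x y z s t u))
      (ccmp (assocc w (box_sum x y) z r (mul x y s t) u)
        (cmul (assocc w x y r s t) (cid z u)))"
proof -
  note b = span_box[OF assms(1)] span_box[OF assms(2)] span_box[OF assms(3)] span_box[OF assms(4)]
  note N = wiring_coherence(1)[OF b]
  note o = span_simps(1)[OF assms(1)] span_simps(1)[OF assms(2)] span_simps(1)[OF assms(3)] span_simps(1)[OF assms(4)]
  show ?thesis
    apply (simp only: cell_eqs assms b)
    apply (rule cell_eqI_mul4[OF N, where Z = "box_sum w (box_sum x (box_sum y z))" and a = "src r" and b = "src s" and c = "src t" and d = "src u"])
    apply (simp add: assms b)
    apply (simp add: assms b)
    apply (simp_all add: assms b o)[5]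
    by (simp_all add: assms b o el_pr_rules N)
qed

lemma span_triangle:
  fixes x y :: "('l, 'o) box"
  assumes "span x s" "span y t"
  shows "cell_comp W (F :: ('l, 'o, 'm) span_algebra) coh (cmul (cid x s) (lunitc y t))
      (assocc x empty_box y s (eta TYPE('l)) t) =
    cmul (runitc x s) (cid y t)"
proof -
  note b = span_box[OF assms(1)] span_box[OF assms(2)]
  note N = wiring_coherence(2)[OF b(1) b(1) b(2) b(1)]
  note o = span_simps(1)[OF assms(1)] span_simps(1)[OF assms(2)]
  show ?thesis
    apply (simp only: cell_eqs assms b)
    apply (rule cell_eqI'[OF N, of "box_sum x y"])
    apply (simp add: assms b)
    apply (simp add: assms b)
    by (simp add: assms b o el_rules N)
qed

lemma span_hexagon:
  assumes "span x s" "span y t" "span z u"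
  shows "ccmp (assocc y z x t u s)
      (ccmp (braidc x (box_sum y z) s (mul y z t u)) (assocc x y z s t u)) =
    ccmp (cmul (cid y t) (braidc x z s u))
      (ccmp (assocc y x z t s u)
        (cmul (braidc x y s t) (cid z u)))"
proof -
  note b = span_box[OF assms(1)] span_box[OF assms(2)] span_box[OF assms(3)]
  note N = wiring_coherence(3)[OF b(1) b]
  note o = span_simps(1)[OF assms(1)] span_simps(1)[OF assms(2)] span_simps(1)[OF assms(3)]
  show ?thesis
    apply (simp only: cell_eqs assms b)
    apply (rule cell_eqI'[OF N, of "box_sum y (box_sum z x)"])
    apply (simp add: assms b)
    apply (simp add: assms b)
    by (simp add: assms b o el_rules N)
qed

lemma span_symmetry:
  assumes "span x s" "span y t"
  shows "ccmp (braidc y x t s) (braidc x y s t) = cid (box_sum x y) (mul x y s t)"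
proof -
  note b = span_box[OF assms(1)] span_box[OF assms(2)]
  note N = wiring_coherence(4)[OF b(1) b b(1)]
  note o = span_simps(1)[OF assms(1)] span_simps(1)[OF assms(2)]
  show ?thesis
    apply (simp only: cell_eqs assms b)
    apply (rule cell_eqI'[OF N, of "box_sum x y"])
    apply (simp add: assms b)
    apply (simp add: assms b)
    \<comment> \<open>The right-hand side is the bare projection \<open>act_pr\<close> and no
      pairing, so the components are compared one by one.\<close>
    apply (rule mul_eqI[OF assms])
    by (simp_all add: assms b o el_rules N)
qed

theorem span_coherence: "monoidal_coherence (W :: (('l, 'o) box, ('l, 'o) wiring_diagram) monoidal_category) F coh"
  unfolding monoidal_coherence_def
proof (intro conjI ballI)
  fix w x y z :: "('l, 'o) box" and r s t u
  assume "w \<in> Obj W" "x \<in> Obj W" "y \<in> Obj W" "z \<in> Obj W" "r \<in> Obj (Fib F w)" "s \<in> Obj (Fib F x)" "t \<in> Obj (Fib F y)" "u \<in> Obj (Fib F z)"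
  then have "span w r" "span x s" "span y t" "span z u"
    by (simp_all add: is_box_iff[symmetric] span_slice del: slice_simps(1) mem_Sigma_iff)
  from span_pentagon[OF this] show "ccmp (assocc w x (y \<oplus>\<^bsub>W\<^esub> z) r s (OM (Mul F y z) (t, u)))
      (assocc (w \<oplus>\<^bsub>W\<^esub> x) y z (OM (Mul F w x) (r, s)) t u) =
    ccmp (cmul (cid w r) (assocc x y z s t u))
      (ccmp (assocc w (x \<oplus>\<^bsub>W\<^esub> y) z r (OM (Mul F x y) (s, t)) u)
        (cmul (assocc w x y r s t) (cid z u)))" by simp
next
  fix x y :: "('l, 'o) box" and s t
  assume "x \<in> Obj W" "y \<in> Obj W" "s \<in> Obj (Fib F x)" "t \<in> Obj (Fib F y)"
  then have st: "span x s" "span y t"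
    by (simp_all add: is_box_iff[symmetric] span_slice del: slice_simps(1) mem_Sigma_iff)
  show "cell_comp W (F :: ('l, 'o, 'm) span_algebra) coh (cmul (cid x s) (lunitc y t))
      (assocc x (Unit W) y s (Eta (F :: ('l, 'o, 'm) span_algebra)) t) =
    cmul (runitc x s) (cid y t)"
    "ccmp (braidc y x t s) (braidc x y s t) = cid (x \<oplus>\<^bsub>W\<^esub> y) (OM (Mul F x y) (s, t))"
    using span_triangle[OF st] span_symmetry[OF st] by simp_all
next
  fix x y z :: "('l, 'o) box" and s t u
  assume "x \<in> Obj W" "y \<in> Obj W" "z \<in> Obj W" "s \<in> Obj (Fib F x)" "t \<in> Obj (Fib F y)" "u \<in> Obj (Fib F z)"
  then have "span x s" "span y t" "span z u"
    by (simp_all add: is_box_iff[symmetric] span_slice del: slice_simps(1) mem_Sigma_iff)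
  from span_hexagon[OF this] show "ccmp (assocc y z x t u s)
      (ccmp (braidc x (y \<oplus>\<^bsub>W\<^esub> z) s (OM (Mul F y z) (t, u))) (assocc x y z s t u)) =
    ccmp (cmul (cid y t) (braidc x z s u))
      (ccmp (assocc y x z t s u)
        (cmul (braidc x y s t) (cid z u)))" by simp
qed

theorem span_systems_algebra: "is_algebra (W :: (('l, 'o) box, ('l, 'o) wiring_diagram) monoidal_category) F"
proof -
  have "Eta (F :: ('l, 'o, 'm) span_algebra) \<in> Obj (Fib (F :: ('l, 'o, 'm) span_algebra) (Unit W))"
    using span_eta(1)[where 'l='l] by (simp add: span_slice del: slice_simps(1))
  then have "symmetric_lax_monoidal_pseudofunctor (W :: (('l, 'o) box, ('l, 'o) wiring_diagram) monoidal_category) F coh"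
    unfolding symmetric_lax_monoidal_pseudofunctor_def
    using wiring_symmetric_monoidal span_pseudofunctor span_laxator span_modifications span_coherence by blast
  then show ?thesis unfolding is_algebra_def by blast
qed

end

section \<open>Interval sheaves\<close>

lemma presheafD:
  assumes "is_presheaf X"
  shows "x \<in> sec X l \<Longrightarrow> 0 \<le> l"
    "\<lbrakk>int_arr l l' p; x \<in> sec X l\<rbrakk> \<Longrightarrow> res X l l' p x \<in> sec X l'"
    "x \<in> sec X l \<Longrightarrow> res X l l 0 x = x"
    "\<lbrakk>int_arr l l' p; int_arr l' l'' p'; x \<in> sec X l\<rbrakk> \<Longrightarrow> res X l' l'' p' (res X l l' p x) = res X l l'' (p + p') x"
proof -
  show n: "x \<in> sec X l \<Longrightarrow> 0 \<le> l" for x l using assms unfolding is_presheaf_def by (metis empty_iff not_le)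
  show "\<lbrakk>int_arr l l' p; x \<in> sec X l\<rbrakk> \<Longrightarrow> res X l l' p x \<in> sec X l'" using assms unfolding is_presheaf_def by blast
  show "x \<in> sec X l \<Longrightarrow> res X l l 0 x = x" using assms n unfolding is_presheaf_def by blast
  show "\<lbrakk>int_arr l l' p; int_arr l' l'' p'; x \<in> sec X l\<rbrakk> \<Longrightarrow> res X l' l'' p' (res X l l' p x) = res X l l'' (p + p') x"
    using assms unfolding is_presheaf_def by blast
qed

lemma sheaf_presheaf: "is_sheaf X \<Longrightarrow> is_presheaf X"
  by (simp add: is_sheaf_def)

lemmas sheafD = presheafD[OF sheaf_presheaf]

lemma sheaf_glue:
  assumes "is_sheaf X" "x1 \<in> sec X l1" "x2 \<in> sec X l2" "res X l1 0 l1 x1 = res X l2 0 0 x2"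
  obtains x where "x \<in> sec X (l1 + l2)" "res X (l1 + l2) l1 0 x = x1" "res X (l1 + l2) l2 l1 x = x2"
  using assms sheafD(1)[OF assms(1,2)] sheafD(1)[OF assms(1,3)] unfolding is_sheaf_def by blast

text \<open>Both sections glue the same two pieces, and these are compatible because they are
  restrictions of one section.\<close>

lemma sheaf_eqI:
  assumes "is_sheaf X" "x \<in> sec X (l1 + l2)" "y \<in> sec X (l1 + l2)" "0 \<le> l1" "0 \<le> l2"
    and "res X (l1 + l2) l1 0 x = res X (l1 + l2) l1 0 y" "res X (l1 + l2) l2 l1 x = res X (l1 + l2) l2 l1 y"
  shows "x = y"
proof -
  have i: "int_arr (l1 + l2) l1 0" "int_arr (l1 + l2) l2 l1" "int_arr l1 0 l1" "int_arr l2 0 0"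
    using assms by (simp_all add: int_arr_def)
  have m: "res X (l1 + l2) l1 0 x \<in> sec X l1" "res X (l1 + l2) l2 l1 x \<in> sec X l2"
    using sheafD(2)[OF assms(1)] i assms by blast+
  have "res X l1 0 l1 (res X (l1 + l2) l1 0 x) = res X l2 0 0 (res X (l1 + l2) l2 l1 x)"
    using sheafD(4)[OF assms(1) i(1,3) assms(2)] sheafD(4)[OF assms(1) i(2,4) assms(2)] by simp
  then have "\<exists>!z. z \<in> sec X (l1 + l2) \<and> res X (l1 + l2) l1 0 z = res X (l1 + l2) l1 0 x \<and> res X (l1 + l2) l2 l1 z = res X (l1 + l2) l2 l1 x"
    using assms(1,4,5) m unfolding is_sheaf_def by blast
  then show ?thesis using assms by metis
qed

text \<open>Carries a presheaf with sections in any type \<open>'v\<close> into the universe. For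
  the result to be a sheaf the coding need only be injective on the sections of each length
  separately, which is what makes a code for up-sets possible.\<close>

definition encode :: "('v \<Rightarrow> 'u) \<Rightarrow> (real \<Rightarrow> 'v set) \<Rightarrow> (real \<Rightarrow> real \<Rightarrow> real \<Rightarrow> 'v \<Rightarrow> 'v) \<Rightarrow> 'u presheaf" where
  "encode e S r = \<lparr>
     sec = (\<lambda>l. e ` S l),
     res = (\<lambda>l l' p. if int_arr l l' p then restrict (\<lambda>x. e (r l l' p (inv_into (S l) e x))) (e ` S l) else (\<lambda>_. undefined))\<rparr>"

lemma sec_encode [simp]: "sec (encode e S r) l = e ` S l"
  by (simp add: encode_def)

lemma res_encode:
  assumes "inj_on e (S l)" "int_arr l l' p" "x \<in> S l"
  shows "res (encode e S r) l l' p (e x) = e (r l l' p x)"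
  using assms by (simp add: encode_def)

lemma encode_sheaf:
  assumes inj: "\<And>l. inj_on e (S l)" and neg: "\<And>l. l < 0 \<Longrightarrow> S l = {}"
    and r: "\<And>l l' p x. \<lbrakk>int_arr l l' p; x \<in> S l\<rbrakk> \<Longrightarrow> r l l' p x \<in> S l'"
    and id: "\<And>l x. x \<in> S l \<Longrightarrow> r l l 0 x = x"
    and comp: "\<And>l l' l'' p p' x. \<lbrakk>int_arr l l' p; int_arr l' l'' p'; x \<in> S l\<rbrakk> \<Longrightarrow> r l' l'' p' (r l l' p x) = r l l'' (p + p') x"
    and glue: "\<And>l1 l2 x1 x2. \<lbrakk>0 \<le> l1; 0 \<le> l2; x1 \<in> S l1; x2 \<in> S l2; r l1 0 l1 x1 = r l2 0 0 x2\<rbrakk> \<Longrightarrow>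
      \<exists>x\<in>S (l1 + l2). r (l1 + l2) l1 0 x = x1 \<and> r (l1 + l2) l2 l1 x = x2"
    and sep: "\<And>l1 l2 x y. \<lbrakk>0 \<le> l1; 0 \<le> l2; x \<in> S (l1 + l2); y \<in> S (l1 + l2); r (l1 + l2) l1 0 x = r (l1 + l2) l1 0 y;
      r (l1 + l2) l2 l1 x = r (l1 + l2) l2 l1 y\<rbrakk> \<Longrightarrow> x = y"
  shows "is_sheaf (encode e S r)"
proof -
  have re: "res (encode e S r) l l' p (e x) = e (r l l' p x)" if "int_arr l l' p" "x \<in> S l" for l l' p x
    by (rule res_encode) (use inj that in auto)
  have eq: "e x = e y \<longleftrightarrow> x = y" if "x \<in> S l" "y \<in> S l" for x y l using inj that by (meson inj_on_eq_iff)
  have P: "is_presheaf (encode e S r)"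
    unfolding is_presheaf_def
  proof (intro conjI allI impI)
    show "sec (encode e S r) l = {}" if "l < 0" for l using neg that by simp
    show "res (encode e S r) l l' p = (\<lambda>_. undefined)" if "\<not> int_arr l l' p" for l l' p using that by (simp add: encode_def)
    show "res (encode e S r) l l' p \<in> sec (encode e S r) l \<rightarrow>\<^sub>E sec (encode e S r) l'" if i: "int_arr l l' p" for l l' p
    proof (rule PiE_I)
      show "res (encode e S r) l l' p x \<in> sec (encode e S r) l'" if "x \<in> sec (encode e S r) l" for x
        using that r[OF i] re[OF i] by auto
      show "res (encode e S r) l l' p x = undefined" if "x \<notin> sec (encode e S r) l" for x
        using that i by (simp add: encode_def)
    qed
    show "\<forall>x\<in>sec (encode e S r) l. res (encode e S r) l l 0 x = x" if "0 \<le> l" for l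
      using id re[of l l 0] that by (auto simp: int_arr_def)
    fix l l' l'' p p' assume i: "int_arr l l' p" "int_arr l' l'' p'"
    then have i': "int_arr l l'' (p + p')" by (simp add: int_arr_def)
    show "\<forall>x\<in>sec (encode e S r) l. res (encode e S r) l' l'' p' (res (encode e S r) l l' p x) = res (encode e S r) l l'' (p + p') x"
      using re[OF i(1)] re[OF i(2)] re[OF i'] r[OF i(1)] comp[OF i] by auto
  qed
  show ?thesis unfolding is_sheaf_def
  proof (intro conjI P allI impI ballI)
    fix l1 l2 x1 x2 assume l: "0 \<le> (l1::real)" "0 \<le> (l2::real)" and x: "x1 \<in> sec (encode e S r) l1" "x2 \<in> sec (encode e S r) l2"
      and c: "res (encode e S r) l1 0 l1 x1 = res (encode e S r) l2 0 0 x2"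
    have i: "int_arr (l1 + l2) l1 0" "int_arr (l1 + l2) l2 l1" "int_arr l1 0 l1" "int_arr l2 0 0"
      using l by (simp_all add: int_arr_def)
    obtain y1 y2 where y: "y1 \<in> S l1" "x1 = e y1" "y2 \<in> S l2" "x2 = e y2" using x by auto
    have c': "r l1 0 l1 y1 = r l2 0 0 y2"
      using c re[OF i(3) y(1)] re[OF i(4) y(3)] eq[OF r[OF i(3) y(1)] r[OF i(4) y(3)]] y by simp
    obtain z where z: "z \<in> S (l1 + l2)" "r (l1 + l2) l1 0 z = y1" "r (l1 + l2) l2 l1 z = y2"
      using glue[OF l y(1,3) c'] by blast
    show "\<exists>!x. x \<in> sec (encode e S r) (l1 + l2) \<and> res (encode e S r) (l1 + l2) l1 0 x = x1 \<and> res (encode e S r) (l1 + l2) l2 l1 x = x2"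
    proof (rule ex1I[of _ "e z"])
      show "e z \<in> sec (encode e S r) (l1 + l2) \<and> res (encode e S r) (l1 + l2) l1 0 (e z) = x1 \<and> res (encode e S r) (l1 + l2) l2 l1 (e z) = x2"
        using z re[OF i(1) z(1)] re[OF i(2) z(1)] y by simp
      fix x assume x: "x \<in> sec (encode e S r) (l1 + l2) \<and> res (encode e S r) (l1 + l2) l1 0 x = x1 \<and> res (encode e S r) (l1 + l2) l2 l1 x = x2"
      then obtain w where w: "w \<in> S (l1 + l2)" "x = e w" by auto
      have "r (l1 + l2) l1 0 w = y1" "r (l1 + l2) l2 l1 w = y2"
        using x w re[OF i(1) w(1)] re[OF i(2) w(1)] y eq[OF r[OF i(1) w(1)] y(1)] eq[OF r[OF i(2) w(1)] y(3)] by simp_all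
      then have "w = z" using sep[OF l w(1) z(1)] z by simp
      then show "x = e z" using w by simp
    qed
  qed
qed

section \<open>The category of interval sheaves\<close>

abbreviation IS :: "('u presheaf, 'u sheaf_map) category" where "IS \<equiv> Int_sheaves"

abbreviation IS_comp (infixr "\<odot>" 55) where "g \<odot> f \<equiv> Comp IS g f"

abbreviation "tg h \<equiv> fst (snd h)"

definition ap :: "'u sheaf_map \<Rightarrow> real \<Rightarrow> 'u \<Rightarrow> 'u" where
  "ap h = snd (snd h)"

text \<open>Restriction to the sections makes the components extensional, as
  \<open>sheaf_maps\<close> demands, so that equality of sheaf maps is equality on sections.\<close>

definition mkmap :: "'u presheaf \<Rightarrow> 'u presheaf \<Rightarrow> (real \<Rightarrow> 'u \<Rightarrow> 'u) \<Rightarrow> 'u sheaf_map" where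
  "mkmap X Y f = (X, Y, \<lambda>l. restrict (f l) (sec X l))"

lemma IS_simps [simp]:
  "X \<in> Obj IS \<longleftrightarrow> is_sheaf X" "Arr IS = sheaf_maps" "Dom IS h = fst h" "Cod IS h = tg h"
  "Ident IS X = mkmap X X (\<lambda>l x. x)"
  by (simp_all add: Int_sheaves_def mkmap_def id_def split: prod.split)

lemma ap_mkmap [simp]: "x \<in> sec X l \<Longrightarrow> ap (mkmap X Y f) l x = f l x"
  by (simp add: ap_def mkmap_def)

lemma mkmap_ends [simp]: "fst (mkmap X Y f) = X" "fst (snd (mkmap X Y f)) = Y"
  by (simp_all add: mkmap_def)

lemma sheaf_maps_iff:
  "h \<in> sheaf_maps \<longleftrightarrow> is_sheaf (fst h) \<and> is_sheaf (tg h) \<and> (\<forall>l. ap h l \<in> sec (fst h) l \<rightarrow>\<^sub>E sec (tg h) l) \<and>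
     (\<forall>l l' p. int_arr l l' p \<longrightarrow> (\<forall>x\<in>sec (fst h) l. ap h l' (res (fst h) l l' p x) = res (tg h) l l' p (ap h l x)))"
  by (cases h) (simp add: sheaf_maps_def ap_def)

lemma mkmap:
  assumes "is_sheaf X" "is_sheaf Y" "\<And>l x. x \<in> sec X l \<Longrightarrow> f l x \<in> sec Y l"
    and "\<And>l l' p x. \<lbrakk>int_arr l l' p; x \<in> sec X l\<rbrakk> \<Longrightarrow> f l' (res X l l' p x) = res Y l l' p (f l x)"
  shows "mkmap X Y f \<in> sheaf_maps"
  using assms sheafD(2)[OF assms(1)] unfolding sheaf_maps_iff by (auto simp: mkmap_def ap_def)

lemma sheaf_mapD:
  assumes "h \<in> sheaf_maps"
  shows "is_sheaf (fst h)" "is_sheaf (tg h)" "x \<in> sec (fst h) l \<Longrightarrow> ap h l x \<in> sec (tg h) l"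
    "\<lbrakk>int_arr l l' p; x \<in> sec (fst h) l\<rbrakk> \<Longrightarrow> ap h l' (res (fst h) l l' p x) = res (tg h) l l' p (ap h l x)"
  using assms unfolding sheaf_maps_iff by auto

lemma sheaf_map_eqI:
  assumes "f \<in> sheaf_maps" "g \<in> sheaf_maps" "fst f = fst g" "tg f = tg g"
    and "\<And>l x. x \<in> sec (fst f) l \<Longrightarrow> ap f l x = ap g l x"
  shows "f = g"
proof -
  have "ap f l = ap g l" for l
    using assms unfolding sheaf_maps_iff by (intro extensionalityI[of _ "sec (fst f) l"]) (auto simp: PiE_def)
  then have "ap f = ap g" by auto
  then show ?thesis using assms by (simp add: ap_def prod_eq_iff)
qed

lemma IS_comp_eq: "h \<in> sheaf_maps \<Longrightarrow> g \<odot> h = mkmap (fst h) (tg g) (\<lambda>l x. ap g l (ap h l x))"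
  by (cases h; cases g) (simp add: Int_sheaves_def mkmap_def ap_def compose_def)

lemma IS_comp_arr:
  assumes "h \<in> sheaf_maps" "g \<in> sheaf_maps" "fst g = tg h"
  shows "g \<odot> h \<in> sheaf_maps"
  unfolding IS_comp_eq[OF assms(1)]
  by (rule mkmap) (use sheaf_mapD[OF assms(1)] sheaf_mapD[OF assms(2)] assms(3) in auto)

lemma ap_comp [simp]: "\<lbrakk>h \<in> sheaf_maps; x \<in> sec (fst h) l\<rbrakk> \<Longrightarrow> ap (g \<odot> h) l x = ap g l (ap h l x)"
  by (simp add: IS_comp_eq)

lemma IS_comp_ends [simp]: "h \<in> sheaf_maps \<Longrightarrow> fst (g \<odot> h) = fst h" "h \<in> sheaf_maps \<Longrightarrow> fst (snd (g \<odot> h)) = tg g"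
  by (simp_all add: IS_comp_eq)

lemma IS_category: "is_category (IS :: ('u presheaf, 'u sheaf_map) category)"
  unfolding is_category_def
proof (intro conjI ballI impI)
  fix f :: "'u sheaf_map" assume "f \<in> Arr IS"
  then have f: "f \<in> sheaf_maps" by simp
  note f' = sheaf_mapD[OF f]
  show "Dom IS f \<in> Obj IS" "Cod IS f \<in> Obj IS" using f' by simp_all
  have I: "mkmap X X (\<lambda>l x. x) \<in> sheaf_maps" if "is_sheaf X" for X :: "'u presheaf" by (rule mkmap) (use that in auto)
  show "f \<odot> Ident IS (Dom IS f) = f" "Ident IS (Cod IS f) \<odot> f = f"
    by (rule sheaf_map_eqI; use f f' I[OF f'(1)] I[OF f'(2)] in \<open>simp add: IS_comp_arr\<close>)+
  fix g assume "g \<in> Arr IS" "Dom IS g = Cod IS f"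
  then have g: "g \<in> sheaf_maps" "fst g = tg f" by simp_all
  note g' = sheaf_mapD[OF g(1)]
  show "g \<odot> f \<in> Hom IS (Dom IS f) (Cod IS g)" using IS_comp_arr[OF f g] f by (simp add: Hom_def)
  fix h assume "h \<in> Arr IS" "Dom IS h = Cod IS g"
  then have h: "h \<in> sheaf_maps" "fst h = tg g" by simp_all
  show "(h \<odot> g) \<odot> f = h \<odot> (g \<odot> f)"
    by (rule sheaf_map_eqI) (use f f' g g' h IS_comp_arr[OF f g] IS_comp_arr[OF g(1) h] in \<open>simp_all add: IS_comp_arr\<close>)
next
  fix X :: "'u presheaf" assume "X \<in> Obj IS"
  then show "Ident IS X \<in> Hom IS X X" by (auto simp: Hom_def intro!: mkmap)
qed

lemma infinite_pair_injection:
  assumes "infinite (UNIV :: 'u set)"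
  shows "\<exists>e :: 'u \<times> 'u \<Rightarrow> 'u. inj e"
proof -
  obtain e :: "'u \<times> 'u \<Rightarrow> 'u" where "bij_betw e (UNIV \<times> UNIV) UNIV"
    using card_of_Times_same_infinite[OF assms] card_of_ordIso by blast
  then show ?thesis unfolding bij_betw_def UNIV_Times_UNIV by blast
qed

text \<open>The pullback is computed sectionwise and coded into the universe by an injection of
  pairs, available since an infinite set is equipotent with its square.\<close>

lemma IS_pullback:
  fixes f g :: "'u sheaf_map"
  assumes inf: "infinite (UNIV :: 'u set)" and f: "f \<in> sheaf_maps" and g: "g \<in> sheaf_maps" and fg: "tg f = tg g"
  shows "\<exists>p q. is_pullback IS f g p q"
proof -
  obtain e :: "'u \<times> 'u \<Rightarrow> 'u" where e: "inj e" using infinite_pair_injection[OF inf] by blast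
  note f' = sheaf_mapD[OF f] and g' = sheaf_mapD[OF g]
  let ?X = "fst f" and ?Y = "fst g"
  define S where "S l = {(x, y). x \<in> sec ?X l \<and> y \<in> sec ?Y l \<and> ap f l x = ap g l y}" for l
  define r where "r l l' p = map_prod (res ?X l l' p) (res ?Y l l' p)" for l l' p
  have ie: "inj_on e (S l)" for l using e by (meson inj_on_subset subset_UNIV)
  let ?P = "encode e S r"
  note X = sheafD[OF f'(1)] and Y = sheafD[OF g'(1)]
  have P: "is_sheaf ?P"
  proof (rule encode_sheaf[OF ie])
    show "S l = {}" if "l < 0" for l using X(1) that by (force simp: S_def)
    show "r l l' p x \<in> S l'" if "int_arr l l' p" "x \<in> S l" for l l' p x
      using that X(2)[of l l' p] Y(2)[of l l' p] f'(4)[of l l' p] g'(4)[of l l' p] fg by (auto simp: S_def r_def)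
    show "r l l 0 x = x" if "x \<in> S l" for l x using that X(3) Y(3) by (auto simp: S_def r_def)
    show "r l' l'' p' (r l l' p x) = r l l'' (p + p') x" if "int_arr l l' p" "int_arr l' l'' p'" "x \<in> S l" for l l' l'' p p' x
      using that X(4) Y(4) by (auto simp: S_def r_def)
    show "\<exists>x\<in>S (l1 + l2). r (l1 + l2) l1 0 x = x1 \<and> r (l1 + l2) l2 l1 x = x2"
      if l: "0 \<le> l1" "0 \<le> l2" and x: "x1 \<in> S l1" "x2 \<in> S l2" and c: "r l1 0 l1 x1 = r l2 0 0 x2" for l1 l2 x1 x2
    proof -
      obtain a1 b1 a2 b2 where ab: "x1 = (a1, b1)" "x2 = (a2, b2)" by (cases x1, cases x2)
      have i: "int_arr (l1 + l2) l1 0" "int_arr (l1 + l2) l2 l1" using l by (simp_all add: int_arr_def)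
      obtain a where a: "a \<in> sec ?X (l1 + l2)" "res ?X (l1 + l2) l1 0 a = a1" "res ?X (l1 + l2) l2 l1 a = a2"
        by (rule sheaf_glue[OF f'(1), of a1 l1 a2 l2]) (use x c ab in \<open>auto simp: S_def r_def\<close>)
      obtain b where b: "b \<in> sec ?Y (l1 + l2)" "res ?Y (l1 + l2) l1 0 b = b1" "res ?Y (l1 + l2) l2 l1 b = b2"
        by (rule sheaf_glue[OF g'(1), of b1 l1 b2 l2]) (use x c ab in \<open>auto simp: S_def r_def\<close>)
      \<comment> \<open>The glued components lie over the same section because they do so on both
        pieces.\<close>
      have "ap f (l1 + l2) a = ap g (l1 + l2) b"
      proof (rule sheaf_eqI[OF f'(2) _ _ l])
        show "res (tg f) (l1 + l2) l1 0 (ap f (l1 + l2) a) = res (tg f) (l1 + l2) l1 0 (ap g (l1 + l2) b)"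
          using f'(4)[OF i(1) a(1)] g'(4)[OF i(1) b(1)] a b x ab fg by (simp add: S_def)
        show "res (tg f) (l1 + l2) l2 l1 (ap f (l1 + l2) a) = res (tg f) (l1 + l2) l2 l1 (ap g (l1 + l2) b)"
          using f'(4)[OF i(2) a(1)] g'(4)[OF i(2) b(1)] a b x ab fg by (simp add: S_def)
      qed (use f'(3)[OF a(1)] g'(3)[OF b(1)] fg in auto)
      then show ?thesis using a b ab by (intro bexI[of _ "(a, b)"]) (auto simp: S_def r_def)
    qed
    show "x = y" if "0 \<le> l1" "0 \<le> l2" "x \<in> S (l1 + l2)" "y \<in> S (l1 + l2)" "r (l1 + l2) l1 0 x = r (l1 + l2) l1 0 y"
      "r (l1 + l2) l2 l1 x = r (l1 + l2) l2 l1 y" for l1 l2 x y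
      using that sheaf_eqI[OF f'(1), of "fst x" l1 l2 "fst y"] sheaf_eqI[OF g'(1), of "snd x" l1 l2 "snd y"]
      by (cases x; cases y) (auto simp: S_def r_def)
  qed
  have re: "res ?P l l' p (e x) = e (r l l' p x)" if "int_arr l l' p" "x \<in> S l" for l l' p x
    by (rule res_encode) (use ie that in auto)
  let ?p = "mkmap ?P ?X (\<lambda>l z. fst (inv e z))" and ?q = "mkmap ?P ?Y (\<lambda>l z. snd (inv e z))"
  have p: "?p \<in> sheaf_maps" by (rule mkmap[OF P f'(1)]) (auto simp: re e S_def r_def)
  have q: "?q \<in> sheaf_maps" by (rule mkmap[OF P g'(1)]) (auto simp: re e S_def r_def)
  have "is_pullback IS f g ?p ?q"
    unfolding is_pullback_def
  proof (intro conjI ballI impI)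
    show "f \<odot> ?p = g \<odot> ?q"
      by (rule sheaf_map_eqI) (use p q f g fg e in \<open>auto simp: IS_comp_arr S_def\<close>)
    fix u v :: "'u sheaf_map"
    assume "u \<in> Arr IS" "v \<in> Arr IS" "Dom IS u = Dom IS v" "Cod IS u = Dom IS f" "Cod IS v = Dom IS g" and c: "f \<odot> u = g \<odot> v"
    then have uv: "u \<in> sheaf_maps" "v \<in> sheaf_maps" "fst u = fst v" "tg u = ?X" "tg v = ?Y" by simp_all
    note u' = sheaf_mapD[OF uv(1)] and v' = sheaf_mapD[OF uv(2)]
    have uvS: "(ap u l x, ap v l x) \<in> S l" if x: "x \<in> sec (fst u) l" for l x
    proof -
      have "ap (f \<odot> u) l x = ap (g \<odot> v) l x" by (simp only: c)
      then show ?thesis using x uv u'(3)[OF x] v'(3)[of x l] by (simp add: S_def)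
    qed
    let ?w = "mkmap (fst u) ?P (\<lambda>l x. e (ap u l x, ap v l x))"
    have w: "?w \<in> sheaf_maps"
    proof (rule mkmap[OF u'(1) P])
      show "e (ap u l x, ap v l x) \<in> sec ?P l" if "x \<in> sec (fst u) l" for l x using uvS[OF that] by simp
      show "e (ap u l' (res (fst u) l l' p x), ap v l' (res (fst u) l l' p x)) = res ?P l l' p (e (ap u l x, ap v l x))"
        if i: "int_arr l l' p" and x: "x \<in> sec (fst u) l" for l l' p x
        using re[OF i uvS[OF x]] u'(4)[OF i x] v'(4)[OF i] x uv by (simp add: r_def)
    qed
    show "\<exists>!w. w \<in> Hom IS (Dom IS u) (Dom IS ?p) \<and> ?p \<odot> w = u \<and> ?q \<odot> w = v"
    proof (rule ex1I[of _ ?w])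
      have "?p \<odot> ?w = u"
        by (rule sheaf_map_eqI) (use w p uv e uvS in \<open>auto simp: IS_comp_arr\<close>)
      moreover have "?q \<odot> ?w = v"
        by (rule sheaf_map_eqI) (use w q uv e uvS in \<open>auto simp: IS_comp_arr\<close>)
      ultimately show "?w \<in> Hom IS (Dom IS u) (Dom IS ?p) \<and> ?p \<odot> ?w = u \<and> ?q \<odot> ?w = v"
        using w by (simp add: Hom_def)
      fix w' assume "w' \<in> Hom IS (Dom IS u) (Dom IS ?p) \<and> ?p \<odot> w' = u \<and> ?q \<odot> w' = v"
      then have w': "w' \<in> sheaf_maps" "fst w' = fst u" "fst (snd w') = ?P" "?p \<odot> w' = u" "?q \<odot> w' = v" by (auto simp: Hom_def)
      show "w' = ?w"
      proof (rule sheaf_map_eqI[OF w'(1) w])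
        fix l x assume x: "x \<in> sec (fst w') l"
        have y: "ap w' l x \<in> sec ?P l" using sheaf_mapD(3)[OF w'(1) x] w' by simp
        then obtain a b where ab: "ap w' l x = e (a, b)" "(a, b) \<in> S l" by auto
        have "ap ?p l (ap w' l x) = ap u l x" "ap ?q l (ap w' l x) = ap v l x"
          using w' x ap_comp[OF w'(1) x, of ?p] ap_comp[OF w'(1) x, of ?q] by simp_all
        then have "a = ap u l x" "b = ap v l x" using y ab e by simp_all
        then show "ap w' l x = ap ?w l x" using ab x w' by simp
      qed (use w' in simp_all)
    qed
  qed (use p q in simp_all)
  then show ?thesis by blast
qed

section \<open>Extensions of sections\<close>

lemma sheaf_res_res:
  assumes "is_sheaf X" "x \<in> sec X l" "0 \<le> l''" "0 \<le> p" "0 \<le> p'" "p' + l'' \<le> l'" "p + l' \<le> l" "q = p + p'"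
  shows "res X l' l'' p' (res X l l' p x) = res X l l'' q x"
  using sheafD(4)[OF assms(1), of l l' p l'' p' x] assms by (simp add: int_arr_def)

lemma sheaf_res_sec:
  assumes "is_sheaf X" "x \<in> sec X l" "0 \<le> l'" "0 \<le> p" "p + l' \<le> l"
  shows "res X l l' p x \<in> sec X l'"
  using sheafD(2)[OF assms(1), of l l' p x] assms by (simp add: int_arr_def)

lemma sheaf_map_res:
  assumes "h \<in> sheaf_maps" "X = fst h" "Y = tg h" "x \<in> sec X l" "0 \<le> l'" "0 \<le> p" "p + l' \<le> l"
  shows "ap h l' (res X l l' p x) = res Y l l' p (ap h l x)"
  using sheaf_mapD(4)[OF assms(1), of l l' p x] assms by (simp add: int_arr_def)

lemma Ext_sec [simp]: "sec (Ext \<epsilon> A) l = (if 0 \<le> l then sec A (l + \<epsilon>) else {})"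
  by (simp add: Ext_def)

lemma Ext_res: "int_arr l l' p \<Longrightarrow> res (Ext \<epsilon> A) l l' p = res A (l + \<epsilon>) (l' + \<epsilon>) p"
  by (simp add: Ext_def)

text \<open>Matching sections of lengths \<open>l1\<close> and \<open>l2\<close> in
  \<open>Ext \<epsilon> A\<close> are sections of \<open>A\<close> that overlap in an interval of
  length \<epsilon>, whereas \<open>A\<close> glues at a point. So \<open>x1\<close> is cut back to
  length \<open>l1\<close> before gluing, and the lost end is recovered from
  \<open>x2\<close>.\<close>

lemma Ext_sheaf:
  assumes A: "is_sheaf A" and e: "0 \<le> \<epsilon>"
  shows "is_sheaf (Ext \<epsilon> A)"
proof -
  have P: "is_presheaf A" using A by (rule sheaf_presheaf)
  have i: "int_arr l l' p \<Longrightarrow> int_arr (l + \<epsilon>) (l' + \<epsilon>) p" for l l' p using e by (simp add: int_arr_def)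
  have "is_presheaf (Ext \<epsilon> A)"
    unfolding is_presheaf_def
  proof (intro conjI allI impI ballI)
    show "res (Ext \<epsilon> A) l l' p \<in> sec (Ext \<epsilon> A) l \<rightarrow>\<^sub>E sec (Ext \<epsilon> A) l'" if "int_arr l l' p" for l l' p
      using that i[OF that] P unfolding is_presheaf_def by (auto simp: Ext_res int_arr_def)
    show "res (Ext \<epsilon> A) l l 0 x = x" if "x \<in> sec (Ext \<epsilon> A) l" for l x
      using that sheafD(3)[OF A] by (auto simp: Ext_res int_arr_def split: if_splits)
    show "res (Ext \<epsilon> A) l' l'' p' (res (Ext \<epsilon> A) l l' p x) = res (Ext \<epsilon> A) l l'' (p + p') x"
      if "int_arr l l' p" "int_arr l' l'' p'" "x \<in> sec (Ext \<epsilon> A) l" for l l' l'' p p' x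
    proof -
      have "int_arr l l'' (p + p')" using that by (simp add: int_arr_def)
      then show ?thesis using that sheafD(4)[OF A i[OF that(1)] i[OF that(2)]] by (auto simp: Ext_res split: if_splits)
    qed
  qed (auto simp: Ext_def)
  moreover have "\<exists>!x. x \<in> sec (Ext \<epsilon> A) (l1 + l2) \<and> res (Ext \<epsilon> A) (l1 + l2) l1 0 x = x1 \<and> res (Ext \<epsilon> A) (l1 + l2) l2 l1 x = x2"
    if l: "0 \<le> l1" "0 \<le> l2" and x: "x1 \<in> sec (Ext \<epsilon> A) l1" "x2 \<in> sec (Ext \<epsilon> A) l2"
      and c: "res (Ext \<epsilon> A) l1 0 l1 x1 = res (Ext \<epsilon> A) l2 0 0 x2" for l1 l2 x1 x2
  proof -
    have x': "x1 \<in> sec A (l1 + \<epsilon>)" "x2 \<in> sec A (l2 + \<epsilon>)" using x l by simp_all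
    have c': "res A (l1 + \<epsilon>) \<epsilon> l1 x1 = res A (l2 + \<epsilon>) \<epsilon> 0 x2" using c l by (simp add: Ext_res int_arr_def)
    note rr = sheaf_res_res[OF A] and rs = sheaf_res_sec[OF A]
    have E: "res (Ext \<epsilon> A) (l1 + l2) l1 0 = res A (l1 + (l2 + \<epsilon>)) (l1 + \<epsilon>) 0"
      "res (Ext \<epsilon> A) (l1 + l2) l2 l1 = res A (l1 + (l2 + \<epsilon>)) (l2 + \<epsilon>) l1"
      "sec (Ext \<epsilon> A) (l1 + l2) = sec A (l1 + (l2 + \<epsilon>))"
      using l by (simp_all add: Ext_res int_arr_def add.assoc)
    have "res A l1 0 l1 (res A (l1 + \<epsilon>) l1 0 x1) = res A \<epsilon> 0 0 (res A (l1 + \<epsilon>) \<epsilon> l1 x1)"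
      using x' l e by (simp add: rr[where q = l1])
    also have "\<dots> = res A (l2 + \<epsilon>) 0 0 x2"
      unfolding c' using x' l e by (simp add: rr[where q = 0])
    finally obtain z where z: "z \<in> sec A (l1 + (l2 + \<epsilon>))" "res A (l1 + (l2 + \<epsilon>)) l1 0 z = res A (l1 + \<epsilon>) l1 0 x1"
      "res A (l1 + (l2 + \<epsilon>)) (l2 + \<epsilon>) l1 z = x2"
      using sheaf_glue[OF A _ x'(2), of "res A (l1 + \<epsilon>) l1 0 x1" l1] rs[OF x'(1), of l1 0] l e by auto
    show ?thesis unfolding E
    proof (rule ex1I[of _ z])
      \<comment> \<open>Beyond \<open>l1\<close> the glued section continues with the first
        \<epsilon> of \<open>x2\<close>, which by compatibility is the end of
        \<open>x1\<close>.\<close>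
      have "res A (l1 + (l2 + \<epsilon>)) (l1 + \<epsilon>) 0 z = x1"
      proof (rule sheaf_eqI[OF A _ x'(1) l(1) e])
        show "res A (l1 + (l2 + \<epsilon>)) (l1 + \<epsilon>) 0 z \<in> sec A (l1 + \<epsilon>)" using rs[OF z(1)] l e by simp
        show "res A (l1 + \<epsilon>) l1 0 (res A (l1 + (l2 + \<epsilon>)) (l1 + \<epsilon>) 0 z) = res A (l1 + \<epsilon>) l1 0 x1"
          using rr[OF z(1), of l1 0 0 "l1 + \<epsilon>"] l e z(2) by simp
        have "res A (l1 + \<epsilon>) \<epsilon> l1 (res A (l1 + (l2 + \<epsilon>)) (l1 + \<epsilon>) 0 z) = res A (l2 + \<epsilon>) \<epsilon> 0 (res A (l1 + (l2 + \<epsilon>)) (l2 + \<epsilon>) l1 z)"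
          using rr[OF z(1), of \<epsilon> 0 l1 "l1 + \<epsilon>" l1] rr[OF z(1), of \<epsilon> l1 0 "l2 + \<epsilon>" l1] l e by simp
        then show "res A (l1 + \<epsilon>) \<epsilon> l1 (res A (l1 + (l2 + \<epsilon>)) (l1 + \<epsilon>) 0 z) = res A (l1 + \<epsilon>) \<epsilon> l1 x1"
          using z(3) c' by simp
      qed
      then show "z \<in> sec A (l1 + (l2 + \<epsilon>)) \<and> res A (l1 + (l2 + \<epsilon>)) (l1 + \<epsilon>) 0 z = x1 \<and> res A (l1 + (l2 + \<epsilon>)) (l2 + \<epsilon>) l1 z = x2"
        using z by simp
      fix w assume w: "w \<in> sec A (l1 + (l2 + \<epsilon>)) \<and> res A (l1 + (l2 + \<epsilon>)) (l1 + \<epsilon>) 0 w = x1 \<and> res A (l1 + (l2 + \<epsilon>)) (l2 + \<epsilon>) l1 w = x2"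
      show "w = z"
      proof (rule sheaf_eqI[OF A _ z(1) l(1)])
        show "res A (l1 + (l2 + \<epsilon>)) l1 0 w = res A (l1 + (l2 + \<epsilon>)) l1 0 z"
          using rr[of w "l1 + (l2 + \<epsilon>)" l1 0 0 "l1 + \<epsilon>" 0] w l e z(2) by simp
      qed (use w z l e in auto)
    qed
  qed
  ultimately show ?thesis unfolding is_sheaf_def by blast
qed

lemma Ext_map_eq: "Ext_map \<epsilon> h = mkmap (Ext \<epsilon> (fst h)) (Ext \<epsilon> (tg h)) (\<lambda>l. ap h (l + \<epsilon>))"
  by (cases h) (simp add: Ext_map_def mkmap_def ap_def)

lemma left_restriction_eq: "left_restriction \<epsilon> A = mkmap (Ext \<epsilon> A) A (\<lambda>l. res A (l + \<epsilon>) l 0)"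
  by (simp add: left_restriction_def mkmap_def)

lemma Ext_map:
  assumes "h \<in> sheaf_maps" "0 \<le> \<epsilon>"
  shows "Ext_map \<epsilon> h \<in> sheaf_maps" "fst (Ext_map \<epsilon> h) = Ext \<epsilon> (fst h)" "fst (snd (Ext_map \<epsilon> h)) = Ext \<epsilon> (tg h)"
    "\<lbrakk>0 \<le> l; x \<in> sec (fst h) (l + \<epsilon>)\<rbrakk> \<Longrightarrow> ap (Ext_map \<epsilon> h) l x = ap h (l + \<epsilon>) x"
  unfolding Ext_map_eq
  by (rule mkmap)
    (use sheaf_mapD[OF assms(1)] assms(2) in \<open>auto simp: Ext_sheaf Ext_res int_arr_def split: if_splits\<close>)

lemma left_restriction:
  assumes "is_sheaf A" "0 \<le> \<epsilon>"
  shows "left_restriction \<epsilon> A \<in> sheaf_maps" "fst (left_restriction \<epsilon> A) = Ext \<epsilon> A" "fst (snd (left_restriction \<epsilon> A)) = A"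
    "\<lbrakk>0 \<le> l; x \<in> sec A (l + \<epsilon>)\<rbrakk> \<Longrightarrow> ap (left_restriction \<epsilon> A) l x = res A (l + \<epsilon>) l 0 x"
proof -
  show "left_restriction \<epsilon> A \<in> sheaf_maps"
    unfolding left_restriction_eq
  proof (rule mkmap[OF Ext_sheaf[OF assms] assms(1)])
    show "res A (l + \<epsilon>) l 0 x \<in> sec A l" if "x \<in> sec (Ext \<epsilon> A) l" for l x
      using that assms by (auto intro: sheaf_res_sec split: if_splits)
    fix l l' p x assume "int_arr l l' p" "x \<in> sec (Ext \<epsilon> A) l"
    then show "res A (l' + \<epsilon>) l' 0 (res (Ext \<epsilon> A) l l' p x) = res A l l' p (res A (l + \<epsilon>) l 0 x)"
      using assms by (auto simp: Ext_res int_arr_def sheaf_res_res[where q = p] split: if_splits)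
  qed
qed (simp_all add: left_restriction_eq)

text \<open>If \<open>g\<close> is the factorisation of \<open>p\<close>, then
  \<open>Ext_map \<epsilon> k\<close> after \<open>g\<close> after \<open>h\<close> is one for the
  composite, because left restriction is natural.\<close>

lemma inertial_comp:
  assumes p: "inertial_map p" and h: "h \<in> sheaf_maps" "tg h = fst p" and k: "k \<in> sheaf_maps" "fst k = tg p"
  shows "inertial_map (k \<odot> (p \<odot> h))"
proof -
  obtain \<epsilon> g where g: "\<epsilon> > 0" "g \<in> sheaf_maps" "fst g = fst p" "tg g = Ext \<epsilon> (tg p)"
      "left_restriction \<epsilon> (tg p) \<odot> g = p"
    using p by (auto simp: inertial_map_def Hom_def)
  have e: "0 \<le> \<epsilon>" using g by simp
  note kd = sheaf_mapD[OF k(1)] and gd = sheaf_mapD[OF g(2)] and hd = sheaf_mapD[OF h(1)]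
  note r = left_restriction[OF kd(1) e] and r' = left_restriction[OF kd(2) e] and ek = Ext_map[OF k(1) e]
  have gh: "g \<odot> h \<in> sheaf_maps" using IS_comp_arr[OF h(1) g(2)] g h by simp
  have G: "Ext_map \<epsilon> k \<odot> (g \<odot> h) \<in> sheaf_maps"
    using IS_comp_arr[OF gh ek(1)] ek h g k by simp
  have pm: "p \<in> sheaf_maps" using IS_comp_arr[OF g(2) r(1)] g k r by simp
  have ph: "p \<odot> h \<in> sheaf_maps" using IS_comp_arr[OF h(1) pm] h by simp
  have kph: "k \<odot> (p \<odot> h) \<in> sheaf_maps" using IS_comp_arr[OF ph k(1)] h k by simp
  have "left_restriction \<epsilon> (tg k) \<odot> (Ext_map \<epsilon> k \<odot> (g \<odot> h)) = k \<odot> (p \<odot> h)"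
  proof (rule sheaf_map_eqI[OF IS_comp_arr[OF G r'(1)] kph])
    fix l x assume "x \<in> sec (fst (left_restriction \<epsilon> (tg k) \<odot> (Ext_map \<epsilon> k \<odot> (g \<odot> h)))) l"
    then have x: "x \<in> sec (fst h) l" using G gh h by simp
    have l: "0 \<le> l" using x sheafD(1)[OF hd(1)] by blast
    have hx: "ap h l x \<in> sec (fst g) l" using hd(3)[OF x] h g by simp
    have y: "ap g l (ap h l x) \<in> sec (fst k) (l + \<epsilon>)" using gd(3)[OF hx] g k l by simp
    have "ap p l (ap h l x) = ap (left_restriction \<epsilon> (fst k) \<odot> g) l (ap h l x)" using g k by simp
    also have "\<dots> = res (fst k) (l + \<epsilon>) l 0 (ap g l (ap h l x))" using ap_comp[OF g(2) hx] r(4)[OF l y] by simp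
    finally have "ap k l (ap p l (ap h l x)) = res (tg k) (l + \<epsilon>) l 0 (ap k (l + \<epsilon>) (ap g l (ap h l x)))"
      using sheaf_map_res[OF k(1) refl refl y, of l 0] l e by simp
    then show "ap (left_restriction \<epsilon> (tg k) \<odot> (Ext_map \<epsilon> k \<odot> (g \<odot> h))) l x = ap (k \<odot> (p \<odot> h)) l x"
      using x h g G gh ph ek(4)[OF l y] r'(4)[OF l] kd(3)[OF y] by simp
  qed (use G gh h ph r' ek in auto)
  moreover have "Ext_map \<epsilon> k \<odot> (g \<odot> h) \<in> Hom IS (fst h) (Ext \<epsilon> (tg k))" using G gh h ek by (simp add: Hom_def)
  moreover have "Dom IS (k \<odot> (p \<odot> h)) = fst h" "Cod IS (k \<odot> (p \<odot> h)) = tg k" using ph h by simp_all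
  ultimately show ?thesis unfolding inertial_map_def using g(1) by metis
qed

section \<open>Inertial maps in terms of sections\<close>

lemma inertial_mapI:
  assumes p: "p \<in> sheaf_maps" and e: "0 < \<epsilon>"
    and g: "\<And>l x. x \<in> sec (fst p) l \<Longrightarrow> g l x \<in> sec (tg p) (l + \<epsilon>)"
    and n: "\<And>l l' q x. \<lbrakk>int_arr l l' q; x \<in> sec (fst p) l\<rbrakk> \<Longrightarrow>
      g l' (res (fst p) l l' q x) = res (tg p) (l + \<epsilon>) (l' + \<epsilon>) q (g l x)"
    and r: "\<And>l x. x \<in> sec (fst p) l \<Longrightarrow> res (tg p) (l + \<epsilon>) l 0 (g l x) = ap p l x"
  shows "inertial_map p"
proof -
  have e': "0 \<le> \<epsilon>" using e by simp
  note pd = sheaf_mapD[OF p] and lr = left_restriction[OF sheaf_mapD(2)[OF p] e']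
  let ?g = "mkmap (fst p) (Ext \<epsilon> (tg p)) g"
  have G: "?g \<in> sheaf_maps"
    by (rule mkmap[OF pd(1) Ext_sheaf[OF pd(2) e']]) (use g n sheafD(1)[OF pd(1)] in \<open>auto simp: Ext_res\<close>)
  have "left_restriction \<epsilon> (tg p) \<odot> ?g = p"
    by (rule sheaf_map_eqI[OF IS_comp_arr[OF G lr(1)] p]) (use G lr g r sheafD(1)[OF pd(1)] in auto)
  moreover have "?g \<in> Hom IS (fst p) (Ext \<epsilon> (tg p))" using G by (simp add: Hom_def)
  ultimately show ?thesis unfolding inertial_map_def using e by (metis IS_simps(3,4))
qed

lemma inertial_mapE:
  assumes "inertial_map p"
  obtains \<epsilon> g where "0 < \<epsilon>" "\<And>l x. x \<in> sec (fst p) l \<Longrightarrow> g l x \<in> sec (tg p) (l + \<epsilon>)"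
    "\<And>l l' q x. \<lbrakk>int_arr l l' q; x \<in> sec (fst p) l\<rbrakk> \<Longrightarrow> g l' (res (fst p) l l' q x) = res (tg p) (l + \<epsilon>) (l' + \<epsilon>) q (g l x)"
    "\<And>l x. x \<in> sec (fst p) l \<Longrightarrow> res (tg p) (l + \<epsilon>) l 0 (g l x) = ap p l x"
proof -
  obtain \<epsilon> g where g: "\<epsilon> > 0" "g \<in> sheaf_maps" "fst g = fst p" "tg g = Ext \<epsilon> (tg p)"
      "left_restriction \<epsilon> (tg p) \<odot> g = p"
    using assms by (auto simp: inertial_map_def Hom_def)
  note gd = sheaf_mapD[OF g(2)]
  have l: "0 \<le> l" if "x \<in> sec (fst p) l" for l x using sheafD(1)[OF gd(1)] that g by metis
  have m: "ap g l x \<in> sec (tg p) (l + \<epsilon>)" if "x \<in> sec (fst p) l" for l x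
    using gd(3)[of x l] that g l[OF that] by simp
  show thesis
  proof (rule that[OF g(1), of "ap g"])
    show "ap g l' (res (fst p) l l' q x) = res (tg p) (l + \<epsilon>) (l' + \<epsilon>) q (ap g l x)"
      if "int_arr l l' q" "x \<in> sec (fst p) l" for l l' q x
      using gd(4)[of l l' q x] that g by (simp add: Ext_res)
    show "res (tg p) (l + \<epsilon>) l 0 (ap g l x) = ap p l x" if x: "x \<in> sec (fst p) l" for l x
    proof -
      have "ap p l x = ap (left_restriction \<epsilon> (tg p) \<odot> g) l x" using g by simp
      also have "\<dots> = res (tg p) (l + \<epsilon>) l 0 (ap g l x)"
        using ap_comp[of g x l "left_restriction \<epsilon> (tg p)"] x g(2-4) m[OF x] l[OF x] by (simp add: left_restriction_eq)
      finally show ?thesis by simp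
    qed
  qed (rule m)
qed

lemma IS_terminal: "\<exists>t\<in>Obj IS. \<forall>a\<in>Obj IS. \<exists>!u. u \<in> Hom IS a (t :: 'u presheaf)"
proof -
  \<comment> \<open>The terminal sheaf has one section of each nonnegative length; any element of
    \<open>'u\<close> can code it.\<close>
  define c :: "unit \<Rightarrow> 'u" where "c = (\<lambda>_. undefined)"
  let ?S = "\<lambda>l :: real. if 0 \<le> l then {()} else {}"
  let ?T = "encode c ?S (\<lambda>_ _ _ _. ())"
  have ie: "inj_on c (?S l)" for l by simp
  have T: "is_sheaf ?T" by (rule encode_sheaf) (auto simp: int_arr_def split: if_splits)
  have re: "res ?T l l' p (c ()) = c ()" if "int_arr l l' p" for l l' p
    by (rule res_encode) (use that in \<open>auto simp: int_arr_def\<close>)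
  show ?thesis
  proof (intro bexI[of _ ?T] ballI)
    fix X :: "'u presheaf" assume "X \<in> Obj IS"
    then have X: "is_sheaf X" by simp
    have m: "mkmap X ?T (\<lambda>_ _. c ()) \<in> sheaf_maps"
      by (rule mkmap[OF X T]) (use sheafD(1)[OF X] re in auto)
    show "\<exists>!u. u \<in> Hom IS X ?T"
    proof (rule ex1I[of _ "mkmap X ?T (\<lambda>_ _. c ())"])
      fix u assume "u \<in> Hom IS X ?T"
      then have u: "u \<in> sheaf_maps" "fst u = X" "tg u = ?T" by (auto simp: Hom_def)
      show "u = mkmap X ?T (\<lambda>_ _. c ())"
      proof (rule sheaf_map_eqI[OF u(1) m])
        fix l x assume x: "x \<in> sec (fst u) l"
        have "ap u l x \<in> sec ?T l" using sheaf_mapD(3)[OF u(1) x] u by simp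
        then show "ap u l x = ap (mkmap X ?T (\<lambda>_ _. c ())) l x" using x u by (auto split: if_splits)
      qed (use u in simp_all)
    qed (use m in \<open>simp add: Hom_def\<close>)
  qed (use T in simp)
qed

lemma IS_fincomplete: "infinite (UNIV :: 'u set) \<Longrightarrow> fincomplete (IS :: ('u presheaf, 'u sheaf_map) category)"
  by (intro fincomplete.intro cat.intro IS_category fincomplete_axioms.intro IS_terminal IS_pullback) simp_all

text \<open>Surjectivity of the comparison map for \<epsilon> on sections, with the pullback spelled
  out as a condition on \<open>s\<close> and \<open>a\<close>; \<open>sep_at\<close> below is its
  injectivity.\<close>

definition lift_at :: "'u sheaf_map \<Rightarrow> real \<Rightarrow> bool" where
  "lift_at p \<epsilon> \<longleftrightarrow> (\<forall>l. \<forall>s\<in>sec (fst p) l. \<forall>a\<in>sec (tg p) (l + \<epsilon>). res (tg p) (l + \<epsilon>) l 0 a = ap p l s \<longrightarrow>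
     (\<exists>s'\<in>sec (fst p) (l + \<epsilon>). res (fst p) (l + \<epsilon>) l 0 s' = s \<and> ap p (l + \<epsilon>) s' = a))"

definition sep_at :: "'u sheaf_map \<Rightarrow> real \<Rightarrow> bool" where
  "sep_at p \<epsilon> \<longleftrightarrow> (\<forall>l\<ge>0. \<forall>x\<in>sec (fst p) (l + \<epsilon>). \<forall>y\<in>sec (fst p) (l + \<epsilon>).
     res (fst p) (l + \<epsilon>) l 0 x = res (fst p) (l + \<epsilon>) l 0 y \<longrightarrow> ap p (l + \<epsilon>) x = ap p (l + \<epsilon>) y \<longrightarrow> x = y)"

text \<open>A long extension is a step of length \<delta> followed by one that is shorter by
  \<delta>, and the input is cut accordingly. The induction is on a number \<open>n\<close> of steps
  that cover \<epsilon>, supplied by the Archimedean property.\<close>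

lemma lift_at_stepwise:
  assumes p: "p \<in> sheaf_maps" and d: "0 < \<delta>" and step: "\<And>\<epsilon>. \<lbrakk>0 < \<epsilon>; \<epsilon> \<le> \<delta>\<rbrakk> \<Longrightarrow> lift_at p \<epsilon>" and e: "0 < \<epsilon>"
  shows "lift_at p \<epsilon>"
proof -
  note pd = sheaf_mapD[OF p] and rr = sheaf_res_res[OF sheaf_mapD(1)[OF p]] and rr' = sheaf_res_res[OF sheaf_mapD(2)[OF p]]
  obtain n where "\<epsilon> \<le> real n * \<delta>" using reals_Archimedean3[OF d] by (meson less_imp_le)
  then show ?thesis using e
  proof (induction n arbitrary: \<epsilon>)
    case (Suc n)
    show ?case
    proof (cases "\<epsilon> \<le> \<delta>")
      case False
      let ?\<eta> = "\<epsilon> - \<delta>"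
      have n: "lift_at p ?\<eta>" using Suc False by (simp add: distrib_right)
      show ?thesis unfolding lift_at_def
      proof (intro allI ballI impI)
        fix l s a assume s: "s \<in> sec (fst p) l" and a: "a \<in> sec (tg p) (l + \<epsilon>)" and c: "res (tg p) (l + \<epsilon>) l 0 a = ap p l s"
        have l: "0 \<le> l" using sheafD(1)[OF pd(1) s] .
        let ?a = "res (tg p) (l + \<epsilon>) (l + \<delta>) 0 a"
        have a': "?a \<in> sec (tg p) (l + \<delta>)" using sheaf_res_sec[OF pd(2) a] l d False by simp
        have "res (tg p) (l + \<delta>) l 0 ?a = ap p l s" using rr'[OF a, of l 0 0 "l + \<delta>" 0] l d False c by simp
        then obtain t where t: "t \<in> sec (fst p) (l + \<delta>)" "res (fst p) (l + \<delta>) l 0 t = s" "ap p (l + \<delta>) t = ?a"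
          using step[of \<delta>] s a' d unfolding lift_at_def by blast
        have "res (tg p) (l + \<delta> + ?\<eta>) (l + \<delta>) 0 a = ap p (l + \<delta>) t" using t by simp
        moreover have "a \<in> sec (tg p) (l + \<delta> + ?\<eta>)" using a by simp
        ultimately obtain r where r: "r \<in> sec (fst p) (l + \<delta> + ?\<eta>)" "res (fst p) (l + \<delta> + ?\<eta>) (l + \<delta>) 0 r = t" "ap p (l + \<delta> + ?\<eta>) r = a"
          using n t(1) unfolding lift_at_def by blast
        have "res (fst p) (l + \<epsilon>) l 0 r = s" using rr[of r "l + \<epsilon>" l 0 0 "l + \<delta>" 0] r t l d False by simp
        then show "\<exists>s'\<in>sec (fst p) (l + \<epsilon>). res (fst p) (l + \<epsilon>) l 0 s' = s \<and> ap p (l + \<epsilon>) s' = a"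
          using r by (intro bexI[of _ r]) simp_all
      qed
    qed (use step Suc in blast)
  qed simp
qed

text \<open>The two sections agree up to \<open>l + \<delta>\<close> by the basic step, and then on
  their whole length by induction on the number of steps.\<close>

lemma sep_at_stepwise:
  assumes p: "p \<in> sheaf_maps" and d: "0 < \<delta>" and step: "\<And>\<epsilon>. \<lbrakk>0 < \<epsilon>; \<epsilon> \<le> \<delta>\<rbrakk> \<Longrightarrow> sep_at p \<epsilon>" and e: "0 < \<epsilon>"
  shows "sep_at p \<epsilon>"
proof -
  note pd = sheaf_mapD[OF p] and rr = sheaf_res_res[OF sheaf_mapD(1)[OF p]]
  obtain n where "\<epsilon> \<le> real n * \<delta>" using reals_Archimedean3[OF d] by (meson less_imp_le)
  then show ?thesis using e
  proof (induction n arbitrary: \<epsilon>)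
    case (Suc n)
    show ?case
    proof (cases "\<epsilon> \<le> \<delta>")
      case False
      let ?\<eta> = "\<epsilon> - \<delta>"
      have n: "sep_at p ?\<eta>" using Suc False by (simp add: distrib_right)
      show ?thesis unfolding sep_at_def
      proof (intro allI ballI impI)
        fix l x y assume l: "0 \<le> l" and x: "x \<in> sec (fst p) (l + \<epsilon>)" and y: "y \<in> sec (fst p) (l + \<epsilon>)"
          and c: "res (fst p) (l + \<epsilon>) l 0 x = res (fst p) (l + \<epsilon>) l 0 y" and f: "ap p (l + \<epsilon>) x = ap p (l + \<epsilon>) y"
        let ?x = "res (fst p) (l + \<epsilon>) (l + \<delta>) 0 x" and ?y = "res (fst p) (l + \<epsilon>) (l + \<delta>) 0 y"
        have m: "?x \<in> sec (fst p) (l + \<delta>)" "?y \<in> sec (fst p) (l + \<delta>)"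
          using sheaf_res_sec[OF pd(1) x] sheaf_res_sec[OF pd(1) y] l d False by simp_all
        have "res (fst p) (l + \<delta>) l 0 ?x = res (fst p) (l + \<delta>) l 0 ?y"
          using rr[OF x, of l 0 0 "l + \<delta>" 0] rr[OF y, of l 0 0 "l + \<delta>" 0] l d False c by simp
        moreover have "ap p (l + \<delta>) ?x = ap p (l + \<delta>) ?y"
          using sheaf_map_res[OF p refl refl x, of "l + \<delta>" 0] sheaf_map_res[OF p refl refl y, of "l + \<delta>" 0] l d False f by simp
        ultimately have "?x = ?y" using step[of \<delta>] m l d unfolding sep_at_def by blast
        moreover have "0 \<le> l + \<delta>" "x \<in> sec (fst p) (l + \<delta> + ?\<eta>)" "y \<in> sec (fst p) (l + \<delta> + ?\<eta>)" using l d x y by simp_all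
        ultimately show "x = y" using n[unfolded sep_at_def, rule_format, of "l + \<delta>" x y] f by simp
      qed
    qed (use step Suc in blast)
  qed simp
qed

section \<open>Representables, and tests for monomorphisms and epimorphisms\<close>

locale continuum =
  fixes c :: "real \<Rightarrow> 'u"
  assumes inj_c: "inj c"
begin

lemma infinite_universe: "infinite (UNIV :: 'u set)"
  using inj_c by (metis infinite_UNIV_char_0 finite_imageD finite_subset subset_UNIV)

sublocale I: fincomplete "IS :: ('u presheaf, 'u sheaf_map) category"
  by (rule IS_fincomplete[OF infinite_universe])

text \<open>The representable presheaf: a section of length \<open>l'\<close> is a morphism from
  \<open>l'\<close> to \<open>l\<close>, coded by its translation \<open>p\<close>.\<close>

definition yo :: "real \<Rightarrow> 'u presheaf" where
  "yo l = encode c (\<lambda>l'. {p. 0 \<le> l' \<and> 0 \<le> p \<and> p + l' \<le> l}) (\<lambda>_ _ q p. p + q)"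

text \<open>The map that corresponds to the section \<open>x\<close> under the Yoneda lemma; the
  identity of \<open>l\<close>, coded as \<open>c 0\<close>, is sent to \<open>x\<close>.\<close>

definition pt :: "'u presheaf \<Rightarrow> real \<Rightarrow> 'u \<Rightarrow> 'u sheaf_map" where
  "pt X l x = mkmap (yo l) X (\<lambda>l' z. res X l l' (inv c z) x)"

lemma inv_c [simp]: "inv c (c x) = x"
  using inj_c by simp

lemma yo_sec: "sec (yo l) l' = c ` {p. 0 \<le> l' \<and> 0 \<le> p \<and> p + l' \<le> l}"
  by (simp add: yo_def)

lemma yo_top: "0 \<le> l \<Longrightarrow> c 0 \<in> sec (yo l) l"
  by (simp add: yo_sec)

lemma yo_res: "\<lbrakk>int_arr l1 l2 q; 0 \<le> p; p + l1 \<le> l\<rbrakk> \<Longrightarrow> res (yo l) l1 l2 q (c p) = c (p + q)"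
  unfolding yo_def by (rule res_encode) (auto simp: int_arr_def intro: inj_on_subset[OF inj_c])

text \<open>Compatibility at the cut point reads \<open>x2 = x1 + l1\<close>, so the first piece
  already carries the translation of the glued section.\<close>

lemma yo_sheaf: "is_sheaf (yo l)"
  unfolding yo_def
proof (rule encode_sheaf)
  show "inj_on c {p. 0 \<le> l' \<and> 0 \<le> p \<and> p + l' \<le> l}" for l' by (rule inj_on_subset[OF inj_c]) simp
  show "\<exists>x\<in>{p. 0 \<le> l1 + l2 \<and> 0 \<le> p \<and> p + (l1 + l2) \<le> l}. x + 0 = x1 \<and> x + l1 = x2"
    if "0 \<le> l1" "0 \<le> l2" "x1 \<in> {p. 0 \<le> l1 \<and> 0 \<le> p \<and> p + l1 \<le> l}" "x2 \<in> {p. 0 \<le> l2 \<and> 0 \<le> p \<and> p + l2 \<le> l}" "x1 + l1 = x2 + 0"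
    for l1 l2 x1 x2 using that by (intro bexI[of _ x1]) auto
qed (auto simp: int_arr_def)

lemma pt:
  assumes X: "is_sheaf X" and x: "x \<in> sec X l"
  shows "pt X l x \<in> sheaf_maps" "ap (pt X l x) l (c 0) = x"
proof -
  have l: "0 \<le> l" using sheafD(1)[OF X x] .
  show "pt X l x \<in> sheaf_maps"
    unfolding pt_def
  proof (rule mkmap[OF yo_sheaf X])
    show "res X l l' (inv c z) x \<in> sec X l'" if "z \<in> sec (yo l) l'" for l' z
      using that sheaf_res_sec[OF X x, of l'] by (auto simp: yo_sec)
    fix l1 l2 q z assume i: "int_arr l1 l2 q" and "z \<in> sec (yo l) l1"
    then obtain p where p: "z = c p" "0 \<le> l1" "0 \<le> p" "p + l1 \<le> l" by (auto simp: yo_sec)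
    then have "res (yo l) l1 l2 q z = c (p + q)" using yo_res[OF i, of p l] by simp
    then show "res X l l2 (inv c (res (yo l) l1 l2 q z)) x = res X l1 l2 q (res X l l1 (inv c z) x)"
      using p i sheaf_res_res[OF X x, of l2 p q l1 "p + q"] by (simp add: int_arr_def)
  qed
  show "ap (pt X l x) l (c 0) = x" using sheafD(3)[OF X x] yo_top[OF l] by (simp add: pt_def)
qed

lemma pt_ends [simp]: "fst (pt X l x) = yo l" "fst (snd (pt X l x)) = X"
  by (simp_all add: pt_def)

lemma pt_comp:
  assumes h: "h \<in> sheaf_maps" "X = fst h" and x: "x \<in> sec X l"
  shows "h \<odot> pt X l x = pt (tg h) l (ap h l x)"
proof -
  note hd = sheaf_mapD[OF h(1)]
  have x': "x \<in> sec (fst h) l" using x h by simp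
  have X: "is_sheaf X" using hd h by simp
  note a = pt(1)[OF X x] and b = pt(1)[OF hd(2) hd(3)[OF x']]
  show ?thesis
  proof (rule sheaf_map_eqI[OF IS_comp_arr[OF a h(1)] b])
    fix l' z assume "z \<in> sec (fst (h \<odot> pt X l x)) l'"
    then have z: "z \<in> sec (yo l) l'" using a by simp
    then obtain p where p: "z = c p" "0 \<le> l'" "0 \<le> p" "p + l' \<le> l" by (auto simp: yo_sec)
    have "ap (h \<odot> pt X l x) l' z = ap h l' (res X l l' p x)" using a z p by (simp add: pt_def)
    also have "\<dots> = ap (pt (tg h) l (ap h l x)) l' z" using sheaf_map_res[OF h(1,2) refl x p(2-4)] z p by (simp add: pt_def)
    finally show "ap (h \<odot> pt X l x) l' z = ap (pt (tg h) l (ap h l x)) l' z" .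
  qed (use a h in simp_all)
qed

lemma pt_surj:
  assumes h: "h \<in> sheaf_maps" "fst h = yo l" and l: "0 \<le> l"
  shows "h = pt (tg h) l (ap h l (c 0))"
proof -
  note hd = sheaf_mapD[OF h(1)]
  have "ap h l (c 0) \<in> sec (tg h) l" using hd(3)[of "c 0" l] h yo_top[OF l] by simp
  note b = pt(1)[OF hd(2) this]
  show ?thesis
  proof (rule sheaf_map_eqI[OF h(1) b])
    fix l' z assume "z \<in> sec (fst h) l'"
    then have z: "z \<in> sec (yo l) l'" using h by simp
    then obtain p where p: "z = c p" "0 \<le> l'" "0 \<le> p" "p + l' \<le> l" by (auto simp: yo_sec)
    have i: "int_arr l l' p" using p by (simp add: int_arr_def)
    have "z = res (yo l) l l' p (c 0)" using yo_res[OF i, of 0 l] p by simp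
    then have "ap h l' z = res (tg h) l l' p (ap h l (c 0))" using hd(4)[OF i, of "c 0"] h yo_top[OF l] by simp
    then show "ap h l' z = ap (pt (tg h) l (ap h l (c 0))) l' z" using z p by (simp add: pt_def)
  qed (use h in simp_all)
qed

lemma pt_inj: "\<lbrakk>is_sheaf X; x \<in> sec X l; y \<in> sec X l; pt X l x = pt X l y\<rbrakk> \<Longrightarrow> x = y"
  using pt(2) by metis

lemma mono_iff:
  fixes h :: "'u sheaf_map"
  assumes h: "h \<in> sheaf_maps"
  shows "is_mono IS h \<longleftrightarrow> (\<forall>l. inj_on (ap h l) (sec (fst h) l))"
proof
  note hd = sheaf_mapD[OF h]
  assume m: "is_mono IS h"
  show "\<forall>l. inj_on (ap h l) (sec (fst h) l)"
  proof (intro allI inj_onI)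
    fix l x y assume x: "x \<in> sec (fst h) l" and y: "y \<in> sec (fst h) l" and e: "ap h l x = ap h l y"
    have "h \<odot> pt (fst h) l x = h \<odot> pt (fst h) l y" using pt_comp[OF h refl x] pt_comp[OF h refl y] e by simp
    then have "pt (fst h) l x = pt (fst h) l y" using m pt(1)[OF hd(1) x] pt(1)[OF hd(1) y] unfolding is_mono_def by simp
    then show "x = y" by (rule pt_inj[OF hd(1) x y])
  qed
next
  assume i: "\<forall>l. inj_on (ap h l) (sec (fst h) l)"
  show "is_mono IS h" unfolding is_mono_def
  proof (intro conjI ballI impI)
    fix f g :: "'u sheaf_map" assume "f \<in> Arr IS" "g \<in> Arr IS" "Cod IS f = Dom IS h" "Cod IS g = Dom IS h" "Dom IS f = Dom IS g"
      and e: "h \<odot> f = h \<odot> g"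
    then have fg: "f \<in> sheaf_maps" "g \<in> sheaf_maps" "tg f = fst h" "tg g = fst h" "fst f = fst g" by simp_all
    show "f = g"
    proof (rule sheaf_map_eqI[OF fg(1,2,5)])
      fix l x assume x: "x \<in> sec (fst f) l"
      have "ap h l (ap f l x) = ap h l (ap g l x)" using ap_comp[OF fg(1) x, of h] ap_comp[OF fg(2), of x l h] x fg(5) e by simp
      then show "ap f l x = ap g l x" using i sheaf_mapD(3)[OF fg(1) x] sheaf_mapD(3)[OF fg(2), of x l] x fg by (auto dest: inj_onD)
    qed (use fg in simp)
  qed (use h in simp)
qed

definition upsets :: "real \<Rightarrow> real set set" where
  "upsets l = {A. 0 \<le> l \<and> A \<subseteq> {0..l} \<and> (\<forall>s\<in>A. \<forall>t. s \<le> t \<longrightarrow> t \<le> l \<longrightarrow> t \<in> A)}"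

text \<open>An up-set of \<open>[0, l]\<close> is determined by its infimum and by whether the
  infimum is attained. Attained infima are coded by themselves and are at least 0, the others by
  \<open>- 2 - Inf A\<close>, which is at most -2, and the empty set by -1; so the three kinds
  cannot collide.\<close>

definition upset_code :: "real set \<Rightarrow> 'u" where
  "upset_code A = c (if A = {} then -1 else if Inf A \<in> A then Inf A else - 2 - Inf A)"

definition shift_set :: "real \<Rightarrow> real \<Rightarrow> real \<Rightarrow> real set \<Rightarrow> real set" where
  "shift_set l l' p A = {t. 0 \<le> t \<and> t \<le> l' \<and> t + p \<in> A}"

lemma upset_code_inj: "inj_on upset_code (upsets l)"
proof -
  have char: "t \<in> A \<longleftrightarrow> t \<le> l \<and> (if Inf A \<in> A then Inf A \<le> t else Inf A < t)" and pos: "0 \<le> Inf A"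
    if A: "A \<in> upsets l" "A \<noteq> {}" for A t
  proof -
    have b: "bdd_below A" using A unfolding upsets_def by (intro bdd_belowI[of _ 0]) auto
    show "0 \<le> Inf A" using A by (intro cInf_greatest) (auto simp: upsets_def)
    have "\<exists>s\<in>A. s < t" if "Inf A < t" using cInf_lessD[OF A(2) that] .
    then show "t \<in> A \<longleftrightarrow> t \<le> l \<and> (if Inf A \<in> A then Inf A \<le> t else Inf A < t)"
      using A cInf_lower[OF _ b, of t] unfolding upsets_def by (auto simp: less_le)
  qed
  show ?thesis
  proof (rule inj_onI)
    fix A B assume A: "A \<in> upsets l" and B: "B \<in> upsets l" and "upset_code A = upset_code B"
    then have e: "(if A = {} then -1 else if Inf A \<in> A then Inf A else - 2 - Inf A) = (if B = {} then -1 else if Inf B \<in> B then Inf B else - 2 - Inf B)"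
      unfolding upset_code_def using inj_c by (simp only: inj_eq)
    show "A = B"
    proof (cases "A = {} \<or> B = {}")
      case True
      then show ?thesis using e pos[OF A] pos[OF B] by (auto split: if_splits)
    next
      case False
      then have "0 \<le> Inf A" "0 \<le> Inf B" using pos A B by blast+
      then have "Inf A = Inf B \<and> (Inf A \<in> A \<longleftrightarrow> Inf B \<in> B)"
        using e False by (cases "Inf A \<in> A"; cases "Inf B \<in> B") simp_all
      moreover have "A \<noteq> {}" "B \<noteq> {}" using False by simp_all
      ultimately have "t \<in> A \<longleftrightarrow> t \<in> B" for t
        unfolding char[OF A \<open>A \<noteq> {}\<close>, of t] char[OF B \<open>B \<noteq> {}\<close>, of t] by auto
      then show ?thesis by blast
    qed
  qed
qed

text \<open>Gluing uses that both up-sets say the same about the cut point. If the first has an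
  element, it contains \<open>l1\<close>, hence the second contains 0 and is a whole interval; so
  the union is again upward closed.\<close>

lemma upsets_sheaf: "is_sheaf (encode upset_code upsets shift_set)"
proof (rule encode_sheaf[OF upset_code_inj])
  show "shift_set l l' p A \<in> upsets l'" if "int_arr l l' p" "A \<in> upsets l" for l l' p A
    using that unfolding upsets_def shift_set_def int_arr_def by auto
  show "shift_set l l 0 A = A" if "A \<in> upsets l" for l A
    using that unfolding upsets_def shift_set_def by auto
  show "shift_set l' l'' p' (shift_set l l' p A) = shift_set l l'' (p + p') A" if "int_arr l l' p" "int_arr l' l'' p'" "A \<in> upsets l" for l l' l'' p p' A
    using that unfolding shift_set_def int_arr_def by (auto simp: ac_simps)
  show "\<exists>A\<in>upsets (l1 + l2). shift_set (l1 + l2) l1 0 A = A1 \<and> shift_set (l1 + l2) l2 l1 A = A2"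
    if l: "0 \<le> l1" "0 \<le> l2" and A: "A1 \<in> upsets l1" "A2 \<in> upsets l2" and e: "shift_set l1 0 l1 A1 = shift_set l2 0 0 A2" for l1 l2 A1 A2
  proof -
    have "l1 \<in> A1 \<longleftrightarrow> 0 \<in> shift_set l1 0 l1 A1" "0 \<in> A2 \<longleftrightarrow> 0 \<in> shift_set l2 0 0 A2" by (simp_all add: shift_set_def)
    then have e': "l1 \<in> A1 \<longleftrightarrow> 0 \<in> A2" using e by simp
    define B where "B = {t. t \<le> l1 \<and> t \<in> A1 \<or> l1 \<le> t \<and> t - l1 \<in> A2}"
    have B: "t \<in> B \<longleftrightarrow> (if t \<le> l1 then t \<in> A1 else t - l1 \<in> A2)" for t
      using e' by (cases "t = l1") (auto simp: B_def)
    have "t \<in> B" if "s \<in> B" "s \<le> t" "t \<le> l1 + l2" for s t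
    proof (cases "t \<le> l1")
      case True
      then show ?thesis using that A(1) unfolding B by (auto simp: upsets_def)
    next
      case False
      have "0 \<in> A2" if "s \<le> l1" using that \<open>s \<in> B\<close> e' A(1) l unfolding B by (auto simp: upsets_def)
      then have "\<exists>r\<in>A2. r \<le> t - l1" using False that by (cases "s \<le> l1") (auto simp: B intro: bexI[of _ 0] bexI[of _ "s - l1"])
      then show ?thesis using that A(2) False unfolding B by (auto simp: upsets_def)
    qed
    moreover have "B \<subseteq> {0..l1 + l2}" using A l by (auto simp: B_def upsets_def)
    ultimately have "B \<in> upsets (l1 + l2)" using l by (auto simp: upsets_def)
    moreover have "shift_set (l1 + l2) l1 0 B = A1" using A by (auto simp: shift_set_def B upsets_def)
    moreover have "shift_set (l1 + l2) l2 l1 B = A2" using A e' l by (fastforce simp: shift_set_def B_def upsets_def)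
    ultimately show ?thesis by blast
  qed
  show "A = B" if "0 \<le> l1" "0 \<le> l2" "A \<in> upsets (l1 + l2)" "B \<in> upsets (l1 + l2)"
    and e: "shift_set (l1 + l2) l1 0 A = shift_set (l1 + l2) l1 0 B" "shift_set (l1 + l2) l2 l1 A = shift_set (l1 + l2) l2 l1 B" for l1 l2 A B
  proof (rule set_eqI)
    fix t show "t \<in> A \<longleftrightarrow> t \<in> B"
    proof (cases "0 \<le> t \<and> t \<le> l1 + l2")
      case True
      have "t \<in> shift_set (l1 + l2) l1 0 A \<longleftrightarrow> t \<in> shift_set (l1 + l2) l1 0 B" "t - l1 \<in> shift_set (l1 + l2) l2 l1 A \<longleftrightarrow> t - l1 \<in> shift_set (l1 + l2) l2 l1 B"
        using e by simp_all
      then show ?thesis using True by (cases "t \<le> l1") (simp_all add: shift_set_def)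
    qed (use that in \<open>auto simp: upsets_def\<close>)
  qed
qed (auto simp: upsets_def)

text \<open>\<open>N\<close> and the constant empty up-set are two maps out of the target that agree
  after \<open>h\<close>, since a section in the image lifts at all times; an epimorphism therefore
  makes \<open>N\<close> empty everywhere. The hypothesis \<open>last\<close> enters twice: it makes
  \<open>N\<close> upward closed, and in the end it turns a lift at the last time into a lift of the
  whole section.\<close>

lemma epi_iff:
  fixes h :: "'u sheaf_map"
  assumes h: "h \<in> sheaf_maps"
    and last: "\<And>l q. \<lbrakk>q \<in> sec (tg h) l; res (tg h) l 0 l q \<in> ap h 0 ` sec (fst h) 0\<rbrakk> \<Longrightarrow> q \<in> ap h l ` sec (fst h) l"
  shows "is_epi IS h \<longleftrightarrow> (\<forall>l. sec (tg h) l \<subseteq> ap h l ` sec (fst h) l)"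
proof
  note hd = sheaf_mapD[OF h]
  let ?P = "tg h" and ?Z = "encode upset_code upsets shift_set"
  assume ep: "is_epi IS h"
  define N where "N l q = {t. 0 \<le> t \<and> t \<le> l \<and> res ?P l 0 t q \<notin> ap h 0 ` sec (fst h) 0}" for l q
  note rr = sheaf_res_res[OF hd(2)]
  have re: "res ?Z l l' p (upset_code A) = upset_code (shift_set l l' p A)" if "int_arr l l' p" "A \<in> upsets l" for l l' p A
    by (rule res_encode) (use that upset_code_inj in auto)
  \<comment> \<open>A lift at time \<open>t\<close> gives by \<open>last\<close> a lift on all of
    \<open>[0, t]\<close>, which restricts to every earlier time.\<close>
  have down: "res ?P l 0 s q \<in> ap h 0 ` sec (fst h) 0"
    if q: "q \<in> sec ?P l" and t: "0 \<le> s" "s \<le> t" "t \<le> l" "res ?P l 0 t q \<in> ap h 0 ` sec (fst h) 0" for l q s t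
  proof -
    have "res ?P t 0 t (res ?P l t 0 q) = res ?P l 0 t q" using rr[OF q, of 0 0 t t t] t by simp
    then have "res ?P l t 0 q \<in> ap h t ` sec (fst h) t" using last[of "res ?P l t 0 q" t] sheaf_res_sec[OF hd(2) q, of t 0] t by simp
    then obtain x where x: "x \<in> sec (fst h) t" "res ?P l t 0 q = ap h t x" by blast
    have "res ?P l 0 s q = res ?P t 0 s (res ?P l t 0 q)" using rr[OF q, of 0 0 s t s] t by simp
    also have "\<dots> = ap h 0 (res (fst h) t 0 s x)" using sheaf_map_res[OF h refl refl x(1), of 0 s] x t by simp
    finally show ?thesis using sheaf_res_sec[OF hd(1) x(1), of 0 s] t by simp
  qed
  have N: "N l q \<in> upsets l" if "q \<in> sec ?P l" for l q
    using down[OF that] sheafD(1)[OF hd(2) that] unfolding N_def upsets_def by auto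
  let ?n = "mkmap ?P ?Z (\<lambda>l q. upset_code (N l q))" and ?o = "mkmap ?P ?Z (\<lambda>l q. upset_code {})"
  have n: "?n \<in> sheaf_maps"
  proof (rule mkmap[OF hd(2) upsets_sheaf])
    show "upset_code (N l q) \<in> sec ?Z l" if "q \<in> sec ?P l" for l q using N[OF that] by simp
    fix l l' p q assume i: "int_arr l l' p" and q: "q \<in> sec ?P l"
    \<comment> \<open>Times are measured from the left end of a section, so restriction along a
      translation by \<open>p\<close> shifts the set of bad times by \<open>p\<close>.\<close>
    have "N l' (res ?P l l' p q) = shift_set l l' p (N l q)"
      unfolding N_def shift_set_def using i rr[OF q] by (auto simp: int_arr_def add.commute)
    then show "upset_code (N l' (res ?P l l' p q)) = res ?Z l l' p (upset_code (N l q))" using re[OF i N[OF q]] by simp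
  qed
  have z: "{} \<in> upsets l" if "0 \<le> l" for l using that by (simp add: upsets_def)
  have o: "?o \<in> sheaf_maps"
    by (rule mkmap[OF hd(2) upsets_sheaf]) (use z sheafD(1)[OF hd(2)] re in \<open>auto simp: shift_set_def int_arr_def\<close>)
  have "?n \<odot> h = ?o \<odot> h"
  proof (rule sheaf_map_eqI[OF IS_comp_arr[OF h n] IS_comp_arr[OF h o]])
    fix l x assume "x \<in> sec (fst (?n \<odot> h)) l"
    then have x: "x \<in> sec (fst h) l" using h by simp
    have "res ?P l 0 t (ap h l x) \<in> ap h 0 ` sec (fst h) 0" if "0 \<le> t" "t \<le> l" for t
      using sheaf_map_res[OF h refl refl x, of 0 t] sheaf_res_sec[OF hd(1) x, of 0 t] that by (metis add.right_neutral imageI order_refl)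
    then have "N l (ap h l x) = {}" unfolding N_def by blast
    then show "ap (?n \<odot> h) l x = ap (?o \<odot> h) l x" using h x hd(3)[OF x] by simp
  qed (use h in simp_all)
  then have no: "?n = ?o" using ep n o unfolding is_epi_def by simp
  show "\<forall>l. sec ?P l \<subseteq> ap h l ` sec (fst h) l"
  proof (intro allI subsetI)
    fix l q assume q: "q \<in> sec ?P l"
    have "upset_code (N l q) = upset_code {}" using arg_cong[OF no, of "\<lambda>f. ap f l q"] q by simp
    then have "N l q = {}" using inj_onD[OF upset_code_inj] N[OF q] z sheafD(1)[OF hd(2) q] by blast
    then show "q \<in> ap h l ` sec (fst h) l" using last[OF q] sheafD(1)[OF hd(2) q] unfolding N_def by blast
  qed
next
  note hd = sheaf_mapD[OF h]
  assume s: "\<forall>l. sec (tg h) l \<subseteq> ap h l ` sec (fst h) l"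
  show "is_epi IS h" unfolding is_epi_def
  proof (intro conjI ballI impI)
    fix f g :: "'u sheaf_map" assume "f \<in> Arr IS" "g \<in> Arr IS" "Dom IS f = Cod IS h" "Dom IS g = Cod IS h" "Cod IS f = Cod IS g"
      and e: "f \<odot> h = g \<odot> h"
    then have fg: "f \<in> sheaf_maps" "g \<in> sheaf_maps" "fst f = tg h" "fst g = tg h" "tg f = tg g" by simp_all
    show "f = g"
    proof (rule sheaf_map_eqI[OF fg(1,2) _ fg(5)])
      fix l x assume "x \<in> sec (fst f) l"
      then have "x \<in> sec (tg h) l" unfolding fg(3) .
      then obtain y where y: "y \<in> sec (fst h) l" "x = ap h l y" using s by blast
      then show "ap f l x = ap g l x" using ap_comp[OF h y(1), of f] ap_comp[OF h y(1), of g] e by simp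
    qed (use fg in simp)
  qed (use h in simp)
qed

text \<open>The chosen pullback is known only through its universal property; its sections are found
  by applying that property to maps out of representables.\<close>

lemma pb_sections:
  fixes f g :: "'u sheaf_map"
  assumes f: "f \<in> sheaf_maps" and g: "g \<in> sheaf_maps" and fg: "tg f = tg g"
  shows "\<lbrakk>x \<in> sec (fst f) l; y \<in> sec (fst g) l; ap f l x = ap g l y\<rbrakk> \<Longrightarrow>
      \<exists>z\<in>sec (fst (pb1 IS f g)) l. ap (pb1 IS f g) l z = x \<and> ap (pb2 IS f g) l z = y"
    "\<lbrakk>z \<in> sec (fst (pb1 IS f g)) l; z' \<in> sec (fst (pb1 IS f g)) l; ap (pb1 IS f g) l z = ap (pb1 IS f g) l z';
      ap (pb2 IS f g) l z = ap (pb2 IS f g) l z'\<rbrakk> \<Longrightarrow> z = z'"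
    "z \<in> sec (fst (pb1 IS f g)) l \<Longrightarrow> ap f l (ap (pb1 IS f g) l z) = ap g l (ap (pb2 IS f g) l z)"
proof -
  have A: "f \<in> Arr IS" "g \<in> Arr IS" "Cod IS f = Cod IS g" using assms by simp_all
  note pb = I.pb_simps[OF A, unfolded IS_simps]
  note fd = sheaf_mapD[OF f] and gd = sheaf_mapD[OF g] and pd = sheaf_mapD[OF pb(1)]
  { assume x: "x \<in> sec (fst f) l" and y: "y \<in> sec (fst g) l" and e: "ap f l x = ap g l y"
    have l: "0 \<le> l" using sheafD(1)[OF fd(1) x] .
    note px = pt(1)[OF fd(1) x] and py = pt(1)[OF gd(1) y]
    have "f \<odot> pt (fst f) l x = g \<odot> pt (fst g) l y"
      using pt_comp[OF f refl x] pt_comp[OF g refl y] e fg by simp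
    note w = I.pb_pair[OF A, of "pt (fst f) l x" "pt (fst g) l y", unfolded IS_simps, OF px py _ _ _ this, simplified]
    let ?w = "pb_pair IS f g (pt (fst f) l x) (pt (fst g) l y)"
    have c: "c 0 \<in> sec (fst ?w) l" using w yo_top[OF l] by simp
    have "ap ?w l (c 0) \<in> sec (fst (pb1 IS f g)) l" using sheaf_mapD(3)[OF w(1) c] w by simp
    moreover have "ap (pb1 IS f g) l (ap ?w l (c 0)) = x" using ap_comp[OF w(1) c, of "pb1 IS f g"] w(4) pt(2)[OF fd(1) x] by simp
    moreover have "ap (pb2 IS f g) l (ap ?w l (c 0)) = y" using ap_comp[OF w(1) c, of "pb2 IS f g"] w(5) pt(2)[OF gd(1) y] by simp
    ultimately show "\<exists>z\<in>sec (fst (pb1 IS f g)) l. ap (pb1 IS f g) l z = x \<and> ap (pb2 IS f g) l z = y" by blast }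
  { assume z: "z \<in> sec (fst (pb1 IS f g)) l" "z' \<in> sec (fst (pb1 IS f g)) l"
      and e: "ap (pb1 IS f g) l z = ap (pb1 IS f g) l z'" "ap (pb2 IS f g) l z = ap (pb2 IS f g) l z'"
    have "pt (fst (pb1 IS f g)) l z = pt (fst (pb1 IS f g)) l z'"
    proof (rule I.pb_eqI[OF A])
      show "pb1 IS f g \<odot> pt (fst (pb1 IS f g)) l z = pb1 IS f g \<odot> pt (fst (pb1 IS f g)) l z'"
        using pt_comp[OF pb(1) refl] z e by simp
      show "pb2 IS f g \<odot> pt (fst (pb1 IS f g)) l z = pb2 IS f g \<odot> pt (fst (pb1 IS f g)) l z'"
        using pt_comp[OF pb(2) pb(3)[symmetric]] z e by simp
    qed (use pt(1)[OF pd(1) z(1)] pt(1)[OF pd(1) z(2)] in simp_all)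
    then show "z = z'" by (rule pt_inj[OF pd(1) z]) }
  assume z: "z \<in> sec (fst (pb1 IS f g)) l"
  have "f \<odot> pb1 IS f g = g \<odot> pb2 IS f g" using I.pb_cone[OF A] unfolding is_pullback_def by blast
  then show "ap f l (ap (pb1 IS f g) l z) = ap g l (ap (pb2 IS f g) l z)"
    using ap_comp[OF pb(1) z, of f] ap_comp[OF pb(2), of z l g] z pb(3) by simp
qed

context
  fixes p :: "'u sheaf_map" and \<epsilon> :: real
  assumes p: "p \<in> sheaf_maps" and e: "0 < \<epsilon>"
begin

lemma ext_comparison:
  defines "h \<equiv> ext_comparison \<epsilon> p" and "f \<equiv> left_restriction \<epsilon> (tg p)"
  shows "h \<in> sheaf_maps" "fst h = Ext \<epsilon> (fst p)" "tg h = fst (pb1 IS f p)"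
    "f \<in> sheaf_maps" "tg f = tg p" "fst f = Ext \<epsilon> (tg p)"
    "\<lbrakk>0 \<le> l; x \<in> sec (fst p) (l + \<epsilon>)\<rbrakk> \<Longrightarrow> ap (pb1 IS f p) l (ap h l x) = ap p (l + \<epsilon>) x"
    "\<lbrakk>0 \<le> l; x \<in> sec (fst p) (l + \<epsilon>)\<rbrakk> \<Longrightarrow> ap (pb2 IS f p) l (ap h l x) = res (fst p) (l + \<epsilon>) l 0 x"
    "\<lbrakk>0 \<le> l; a \<in> sec (tg p) (l + \<epsilon>)\<rbrakk> \<Longrightarrow> ap f l a = res (tg p) (l + \<epsilon>) l 0 a"
proof -
  have e': "0 \<le> \<epsilon>" using e by simp
  note pd = sheaf_mapD[OF p]
  note f = left_restriction[OF pd(2) e', folded f_def] and g = left_restriction[OF pd(1) e'] and E = Ext_map[OF p e']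
  show f': "f \<in> sheaf_maps" "tg f = tg p" "fst f = Ext \<epsilon> (tg p)"
    "\<lbrakk>0 \<le> l; a \<in> sec (tg p) (l + \<epsilon>)\<rbrakk> \<Longrightarrow> ap f l a = res (tg p) (l + \<epsilon>) l 0 a"
    using f by simp_all
  have c: "f \<odot> Ext_map \<epsilon> p = p \<odot> left_restriction \<epsilon> (fst p)"
  proof (rule sheaf_map_eqI[OF IS_comp_arr[OF E(1) f(1)] IS_comp_arr[OF g(1) p]])
    fix l x assume "x \<in> sec (fst (f \<odot> Ext_map \<epsilon> p)) l"
    then have x: "x \<in> sec (Ext \<epsilon> (fst p)) l" using E by simp
    then have x': "0 \<le> l" "x \<in> sec (fst p) (l + \<epsilon>)" by (auto split: if_splits)
    show "ap (f \<odot> Ext_map \<epsilon> p) l x = ap (p \<odot> left_restriction \<epsilon> (fst p)) l x"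
      using x x' E g f pd(3)[OF x'(2)] sheaf_map_res[OF p refl refl x'(2), of l 0] e by simp
  qed (use E f g p in simp_all)
  have A: "f \<in> Arr IS" "p \<in> Arr IS" "Cod IS f = Cod IS p" using f p by simp_all
  have B: "Ext_map \<epsilon> p \<in> Arr IS" "left_restriction \<epsilon> (fst p) \<in> Arr IS" "Dom IS (Ext_map \<epsilon> p) = Dom IS (left_restriction \<epsilon> (fst p))"
    "Cod IS (Ext_map \<epsilon> p) = Dom IS f" "Cod IS (left_restriction \<epsilon> (fst p)) = Dom IS p" using E f g p by simp_all
  have hd: "h = pb_pair IS f p (Ext_map \<epsilon> p) (left_restriction \<epsilon> (fst p))" by (simp add: h_def ext_comparison_def f_def)
  note w = I.pb_pair[OF A B c, folded hd, unfolded IS_simps]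
  show h: "h \<in> sheaf_maps" "fst h = Ext \<epsilon> (fst p)" "tg h = fst (pb1 IS f p)" using w g by simp_all
  assume l: "0 \<le> l" and x: "x \<in> sec (fst p) (l + \<epsilon>)"
  then have x': "x \<in> sec (fst h) l" using h by simp
  show "ap (pb1 IS f p) l (ap h l x) = ap p (l + \<epsilon>) x" using ap_comp[OF h(1) x', of "pb1 IS f p"] w(4) E(4)[OF l x] by simp
  show "ap (pb2 IS f p) l (ap h l x) = res (fst p) (l + \<epsilon>) l 0 x" using ap_comp[OF h(1) x', of "pb2 IS f p"] w(5) g(4)[OF l x] by simp
qed

lemma ext_mono_iff: "is_mono IS (ext_comparison \<epsilon> p) \<longleftrightarrow> sep_at p \<epsilon>"
proof -
  note E = ext_comparison
  let ?h = "ext_comparison \<epsilon> p" and ?f = "left_restriction \<epsilon> (tg p)"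
  have "inj_on (ap ?h l) (sec (fst ?h) l) \<longleftrightarrow> (0 \<le> l \<longrightarrow> (\<forall>x\<in>sec (fst p) (l + \<epsilon>). \<forall>y\<in>sec (fst p) (l + \<epsilon>).
     res (fst p) (l + \<epsilon>) l 0 x = res (fst p) (l + \<epsilon>) l 0 y \<longrightarrow> ap p (l + \<epsilon>) x = ap p (l + \<epsilon>) y \<longrightarrow> x = y))" for l
  proof (cases "0 \<le> l")
    case l: True
    have "ap ?h l x = ap ?h l y \<longleftrightarrow> res (fst p) (l + \<epsilon>) l 0 x = res (fst p) (l + \<epsilon>) l 0 y \<and> ap p (l + \<epsilon>) x = ap p (l + \<epsilon>) y"
      if "x \<in> sec (fst p) (l + \<epsilon>)" "y \<in> sec (fst p) (l + \<epsilon>)" for x y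
      using that E(7,8)[OF l that(1)] E(7,8)[OF l that(2)]
        pb_sections(2)[OF E(4) p E(5), of "ap ?h l x" l "ap ?h l y"] sheaf_mapD(3)[OF E(1), of _ l] E(2,3) l by auto
    then show ?thesis using l E(2) by (auto simp: inj_on_def)
  qed (simp add: E(2))
  then show ?thesis unfolding mono_iff[OF E(1)] sep_at_def by blast
qed

text \<open>The hypothesis \<open>last\<close> of \<open>epi_iff\<close> holds for the comparison
  map: over the last point a pair consists of a state of length 0 and an input of length \<epsilon>,
  and a lift of that is all the extension that the original pair needs.\<close>

lemma ext_epi_iff: "is_epi IS (ext_comparison \<epsilon> p) \<longleftrightarrow> lift_at p \<epsilon>"
proof -
  note E = ext_comparison and pd = sheaf_mapD[OF p]
  let ?h = "ext_comparison \<epsilon> p" and ?f = "left_restriction \<epsilon> (tg p)"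
  let ?P = "fst (snd ?h)" and ?a = "pb1 IS ?f p" and ?s = "pb2 IS ?f p" and ?S = "fst p" and ?A = "tg p"
  have A: "?f \<in> Arr IS" "p \<in> Arr IS" "Cod IS ?f = Cod IS p" using E p by simp_all
  note pb = I.pb_simps[OF A, unfolded IS_simps] and ps = pb_sections[OF E(4) p E(5)]
  have q: "0 \<le> l" "ap ?a l q \<in> sec ?A (l + \<epsilon>)" "ap ?s l q \<in> sec ?S l" "res ?A (l + \<epsilon>) l 0 (ap ?a l q) = ap p l (ap ?s l q)"
    if "q \<in> sec ?P l" for l q
  proof -
    have q: "q \<in> sec (fst ?a) l" "q \<in> sec (fst ?s) l" using that E(3) pb(3) by simp_all
    show l: "0 \<le> l" using sheafD(1)[OF sheaf_mapD(2)[OF E(1)] that] .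
    show a: "ap ?a l q \<in> sec ?A (l + \<epsilon>)" using sheaf_mapD(3)[OF pb(1) q(1)] pb E(6) l by simp
    show "ap ?s l q \<in> sec ?S l" using sheaf_mapD(3)[OF pb(2) q(2)] pb by simp
    show "res ?A (l + \<epsilon>) l 0 (ap ?a l q) = ap p l (ap ?s l q)" using ps(3)[OF q(1)] E(9)[OF l a] by simp
  qed
  have im: "q \<in> ap ?h l ` sec (fst ?h) l \<longleftrightarrow> (\<exists>s'\<in>sec ?S (l + \<epsilon>). res ?S (l + \<epsilon>) l 0 s' = ap ?s l q \<and> ap p (l + \<epsilon>) s' = ap ?a l q)"
    if "q \<in> sec ?P l" for l q
  proof -
    note l = q(1)[OF that]
    have "q = ap ?h l s' \<longleftrightarrow> res ?S (l + \<epsilon>) l 0 s' = ap ?s l q \<and> ap p (l + \<epsilon>) s' = ap ?a l q" if s': "s' \<in> sec ?S (l + \<epsilon>)" for s'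
    proof
      assume "q = ap ?h l s'"
      then show "res ?S (l + \<epsilon>) l 0 s' = ap ?s l q \<and> ap p (l + \<epsilon>) s' = ap ?a l q" using E(7,8)[OF l s'] by simp
    next
      assume "res ?S (l + \<epsilon>) l 0 s' = ap ?s l q \<and> ap p (l + \<epsilon>) s' = ap ?a l q"
      moreover have "ap ?h l s' \<in> sec ?P l" using sheaf_mapD(3)[OF E(1), of s' l] s' E(2) l by simp
      ultimately show "q = ap ?h l s'" using ps(2)[of q l "ap ?h l s'"] E(7,8)[OF l s'] E(3) \<open>q \<in> sec ?P l\<close> by simp
    qed
    then show ?thesis using E(2) l by auto
  qed
  have "is_epi IS ?h \<longleftrightarrow> (\<forall>l. sec ?P l \<subseteq> ap ?h l ` sec (fst ?h) l)"
  proof (rule epi_iff[OF E(1)])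
    fix l z assume z: "z \<in> sec ?P l" and last: "res ?P l 0 l z \<in> ap ?h 0 ` sec (fst ?h) 0"
    note Q = q[OF z]
    have z': "z \<in> sec (fst ?a) l" "z \<in> sec (fst ?s) l" using z E(3) pb(3) by simp_all
    have r: "res ?P l 0 l z \<in> sec ?P 0" using sheaf_res_sec[OF sheaf_mapD(2)[OF E(1)] z, of 0 l] Q by simp
    have ra: "ap ?a 0 (res ?P l 0 l z) = res ?A (l + \<epsilon>) \<epsilon> l (ap ?a l z)"
      using sheaf_map_res[OF pb(1) refl refl z'(1), of 0 l] pb E(3,6) Q by (simp add: Ext_res int_arr_def)
    have rs: "ap ?s 0 (res ?P l 0 l z) = res ?S l 0 l (ap ?s l z)"
      using sheaf_map_res[OF pb(2) refl refl z'(2), of 0 l] pb E(3) Q by simp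
    obtain t where t: "t \<in> sec ?S \<epsilon>" "res ?S \<epsilon> 0 0 t = res ?S l 0 l (ap ?s l z)" "ap p \<epsilon> t = res ?A (l + \<epsilon>) \<epsilon> l (ap ?a l z)"
      using last unfolding im[OF r] ra rs by auto
    \<comment> \<open>The extension found over the last point is glued to the end of the given
      state.\<close>
    obtain u where u: "u \<in> sec ?S (l + \<epsilon>)" "res ?S (l + \<epsilon>) l 0 u = ap ?s l z" "res ?S (l + \<epsilon>) \<epsilon> l u = t"
      using sheaf_glue[OF pd(1) Q(3) t(1)] t(2) by auto
    have "ap p (l + \<epsilon>) u = ap ?a l z"
    proof (rule sheaf_eqI[OF pd(2) pd(3)[OF u(1)] Q(2)])
      show "res ?A (l + \<epsilon>) l 0 (ap p (l + \<epsilon>) u) = res ?A (l + \<epsilon>) l 0 (ap ?a l z)"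
        using sheaf_map_res[OF p refl refl u(1), of l 0] u Q e by simp
      show "res ?A (l + \<epsilon>) \<epsilon> l (ap p (l + \<epsilon>) u) = res ?A (l + \<epsilon>) \<epsilon> l (ap ?a l z)"
        using sheaf_map_res[OF p refl refl u(1), of \<epsilon> l] u t Q e by simp
    qed (use Q e in simp_all)
    then show "z \<in> ap ?h l ` sec (fst ?h) l" unfolding im[OF z] using u by blast
  qed
  also have "\<dots> \<longleftrightarrow> lift_at p \<epsilon>"
  proof
    assume sur: "\<forall>l. sec ?P l \<subseteq> ap ?h l ` sec (fst ?h) l"
    show "lift_at p \<epsilon>" unfolding lift_at_def
    proof (intro allI ballI impI)
      fix l s a assume s: "s \<in> sec ?S l" and a: "a \<in> sec ?A (l + \<epsilon>)" and c: "res ?A (l + \<epsilon>) l 0 a = ap p l s"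
      have l: "0 \<le> l" using sheafD(1)[OF pd(1) s] .
      obtain z where z: "z \<in> sec ?P l" "ap ?a l z = a" "ap ?s l z = s"
        using ps(1)[of a l s] s a c l E(6) E(9)[OF l a] E(3) by auto
      then show "\<exists>s'\<in>sec ?S (l + \<epsilon>). res ?S (l + \<epsilon>) l 0 s' = s \<and> ap p (l + \<epsilon>) s' = a"
        using im[OF z(1)] sur by auto
    qed
  next
    assume "lift_at p \<epsilon>"
    then show "\<forall>l. sec ?P l \<subseteq> ap ?h l ` sec (fst ?h) l"
      using q im unfolding lift_at_def by (metis subsetI)
  qed
  finally show ?thesis .
qed

end

lemma total_map_iff: "(p :: 'u sheaf_map) \<in> sheaf_maps \<Longrightarrow> total_map p \<longleftrightarrow> (\<forall>\<epsilon>>0. lift_at p \<epsilon>)"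
  using ext_epi_iff[of p] by (simp add: total_map_def)

lemma deterministic_map_iff: "(p :: 'u sheaf_map) \<in> sheaf_maps \<Longrightarrow> deterministic_map p \<longleftrightarrow> (\<forall>\<epsilon>>0. sep_at p \<epsilon>)"
  using ext_mono_iff[of p] by (simp add: deterministic_map_def)

end

section \<open>Sections over the phase sheaf\<close>

context fincomplete
begin

text \<open>With \<open>hat_join_surj\<close> this expresses on generalised elements that
  \<open>hat_join\<close> is invertible, a form that passes to sections by way of
  representables.\<close>

lemma hat_join_inj:
  assumes XY: "X \<in> typed_sets C" "Y \<in> typed_sets C"
    and uv: "arr u" "arr v" "tgt u = bprod C (hat C X) (hat C Y)" "tgt v = bprod C (hat C X) (hat C Y)" "src u = src v"
    and e: "hat_join C X Y ** u = hat_join C X Y ** v"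
  shows "u = v"
proof -
  have o: "hat C X \<in> Obj C" "hat C Y \<in> Obj C" using XY by simp_all
  note j = hat_join[OF XY]
  show ?thesis
  proof (rule bprod_eqI[OF uv o])
    show "pr1 C (hat C X) (hat C Y) ** u = pr1 C (hat C X) (hat C Y) ** v"
    proof (rule hat_eqI[OF XY(1)])
      show "hat_pr C X x ** pr1 C (hat C X) (hat C Y) ** u = hat_pr C X x ** pr1 C (hat C X) (hat C Y) ** v" if "X x = Some a" for x a
        using j(4)[OF that uv(1,3)] j(4)[OF that uv(2,4)] e by simp
    qed (use uv o in simp_all)
    show "pr2 C (hat C X) (hat C Y) ** u = pr2 C (hat C X) (hat C Y) ** v"
    proof (rule hat_eqI[OF XY(2)])
      show "hat_pr C Y x ** pr2 C (hat C X) (hat C Y) ** u = hat_pr C Y x ** pr2 C (hat C X) (hat C Y) ** v" if "Y x = Some a" for x a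
        using j(5)[OF that uv(1,3)] j(5)[OF that uv(2,4)] e by simp
    qed (use uv o in simp_all)
  qed
qed

lemma hat_join_surj:
  assumes XY: "X \<in> typed_sets C" "Y \<in> typed_sets C" and a: "arr a" "tgt a = hat C (typed_sum X Y)"
  obtains u where "arr u" "src u = src a" "tgt u = bprod C (hat C X) (hat C Y)" "hat_join C X Y ** u = a"
proof -
  have S: "typed_sum X Y \<in> typed_sets C" using XY by simp
  have d: "src a \<in> Obj C" using a by simp
  let ?l = "\<lambda>x. hat_pr C (typed_sum X Y) (InL x) ** a" and ?r = "\<lambda>x. hat_pr C (typed_sum X Y) (InR x) ** a"
  have l: "?l x \<in> Hom C (src a) t" if "X x = Some t" for x t
    using hat_pr_simps[OF S, of "InL x" t] that a by (simp add: Hom_iff)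
  have r: "?r x \<in> Hom C (src a) t" if "Y x = Some t" for x t
    using hat_pr_simps[OF S, of "InR x" t] that a by (simp add: Hom_iff)
  note L = hat_tuple[OF XY(1) d, of ?l, OF l] and R = hat_tuple[OF XY(2) d, of ?r, OF r]
  let ?u = "pairing C (hat_tuple C X (src a) ?l) (hat_tuple C Y (src a) ?r)"
  have u: "arr ?u" "src ?u = src a" "tgt ?u = bprod C (hat C X) (hat C Y)" using L(1-3) R(1-3) by simp_all
  note j = hat_join[OF XY]
  have "hat_join C X Y ** ?u = a"
  proof (rule hat_eqI[OF S])
    fix z t assume z: "typed_sum X Y z = Some t"
    then consider x where "z = InL x" "X x = Some t" | y where "z = InR y" "Y y = Some t" by (auto simp: typed_sum_eq_Some)
    then show "hat_pr C (typed_sum X Y) z ** hat_join C X Y ** ?u = hat_pr C (typed_sum X Y) z ** a"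
    proof cases
      case (1 x)
      show ?thesis unfolding 1(1) using j(4)[OF 1(2) u(1,3)] L(1-3) R(1-3) L(4)[OF _ 1(2)] l by simp
    next
      case (2 x)
      show ?thesis unfolding 2(1) using j(5)[OF 2(2) u(1,3)] L(1-3) R(1-3) R(4)[OF _ 2(2)] r by simp
    qed
  qed (use j(1-3) u a in simp_all)
  then show thesis using that u by blast
qed

lemma act_base_pb1:
  assumes wd: "diagram d" and s: "span (wdom d) s"
  shows "arr (pb1 C (act_base d) s)" "src (pb1 C (act_base d) s) = src (act d s)"
    "tgt (pb1 C (act_base d) s) = bprod C (hat C (fst (wcod d))) (hat C (snd (wdom d)))"
proof -
  have o: "hat C (fst (wcod d)) \<in> Obj C" "hat C (snd (wdom d)) \<in> Obj C" using wiring_diagramD[OF wd] by simp_all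
  have b: "arr (act_base d)" "src (act_base d) = bprod C (hat C (fst (wcod d))) (hat C (snd (wdom d)))" "tgt (act_base d) = tgt s"
    using hat_in[OF wd] o s by (simp_all add: act_base_def interface_def)
  show "arr (pb1 C (act_base d) s)" "src (pb1 C (act_base d) s) = src (act d s)"
    "tgt (pb1 C (act_base d) s) = bprod C (hat C (fst (wcod d))) (hat C (snd (wdom d)))"
    using pb_simps[OF b(1) span_simps(1)[OF s] b(3)] b act_Arr[OF wd s] by simp_all
qed

end

section \<open>The sheaf of phases and the slice over it\<close>

lemma frac_eq_iff: "frac x = frac y \<longleftrightarrow> x - y \<in> \<int>" for x y :: real
proof
  assume "frac x = frac y"
  then have "x - y = of_int (\<lfloor>x\<rfloor> - \<lfloor>y\<rfloor>)" by (simp add: frac_def algebra_simps)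
  then show "x - y \<in> \<int>" by (metis Ints_of_int)
next
  assume "x - y \<in> \<int>"
  then obtain n where "x = y + of_int n" by (metis Ints_cases add.commute diff_add_cancel)
  then show "frac x = frac y" by (simp add: frac_def)
qed

abbreviation SS :: "('u sheaf_map, 'u sync_map) category" where "SS \<equiv> Int_Sync"

definition ev :: "'u sync_map \<Rightarrow> real \<Rightarrow> 'u \<Rightarrow> 'u" where
  "ev F = ap (underlying F)"

context continuum
begin

text \<open>\<open>phase\<close> is defined by a choice, so its property has to be realised once:
  the fractional part classifies reals modulo the integers, and \<open>c\<close> carries it into the
  universe.\<close>

lemma phase_eq_iff: "(phase x :: 'u) = phase y \<longleftrightarrow> x - y \<in> \<int>"
proof -
  have "\<forall>x y. (c \<circ> frac) x = (c \<circ> frac) y \<longleftrightarrow> x - y \<in> \<int>"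
    using inj_c by (simp add: inj_eq frac_eq_iff)
  then have "\<exists>d :: real \<Rightarrow> 'u. \<forall>x y. d x = d y \<longleftrightarrow> x - y \<in> \<int>" by blast
  from someI_ex[OF this] show ?thesis unfolding phase_def by blast
qed

text \<open>The chosen representative differs from \<theta> by an integer, and adding
  \<open>p\<close> does not disturb this.\<close>

lemma phase_some [simp]: "(phase ((SOME \<eta>. phase \<eta> = (phase \<theta> :: 'u)) + p) :: 'u) = phase (\<theta> + p)"
proof -
  have "phase (SOME \<eta>. phase \<eta> = (phase \<theta> :: 'u)) = (phase \<theta> :: 'u)" by (rule someI[of _ \<theta>]) simp
  then show ?thesis by (simp add: phase_eq_iff)
qed

lemma phase_some0 [simp]: "(phase (SOME \<eta>. phase \<eta> = (phase \<theta> :: 'u)) :: 'u) = phase \<theta>"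
  using phase_some[of \<theta> 0] by simp

lemma Sync_sec: "sec (Sync :: 'u presheaf) l = (if 0 \<le> l then range phase else {})"
  by (simp add: Sync_def)

lemma Sync_res: "int_arr l l' p \<Longrightarrow> res (Sync :: 'u presheaf) l l' p (phase \<theta>) = phase (\<theta> + p)"
  by (simp add: Sync_def)

lemma Sync_res_indep:
  assumes "int_arr l l' p" "int_arr m m' p"
  shows "res (Sync :: 'u presheaf) l l' p = res Sync m m' p"
  using assms by (simp add: Sync_def)

text \<open>A section is the phase at its left end, whatever its length, so the left piece of a
  matching pair is already the glued section.\<close>

lemma Sync_sheaf: "is_sheaf (Sync :: 'u presheaf)"
proof -
  let ?S = "\<lambda>l. if 0 \<le> l then range (phase :: real \<Rightarrow> 'u) else {}"
  let ?r = "\<lambda>_ _ p x. phase ((SOME \<theta>. phase \<theta> = x) + p) :: 'u"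
  \<comment> \<open>The phases already lie in the universe, so the identity serves as
    coding.\<close>
  have "is_sheaf (encode id ?S ?r)"
  proof (rule encode_sheaf)
    show "x = y" if l: "0 \<le> l1" "0 \<le> l2" and x: "x \<in> ?S (l1 + l2)" "y \<in> ?S (l1 + l2)" and e: "?r l1 l2 0 x = ?r l1 l2 0 y" for l1 l2 and x y :: 'u
    proof -
      obtain a b where "x = phase a" "y = phase b" using x by (auto split: if_splits)
      then show ?thesis using e by simp
    qed
    show "\<exists>x\<in>?S (l1 + l2). ?r (l1 + l2) l1 0 x = x1 \<and> ?r (l1 + l2) l2 l1 x = x2"
      if "0 \<le> l1" "0 \<le> l2" "x1 \<in> ?S l1" "x2 \<in> ?S l2" "?r l1 0 l1 x1 = ?r l2 0 0 x2" for l1 l2 and x1 x2 :: 'u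
      using that by (intro bexI[of _ x1]) auto
  qed (auto simp: int_arr_def add.assoc split: if_splits)
  moreover have "encode id ?S ?r = Sync"
    by (auto simp: encode_def Sync_def int_arr_def fun_eq_iff inv_into_f_eq)
  ultimately show ?thesis by simp
qed

sublocale M: fincomplete "SS :: ('u sheaf_map, 'u sync_map) category"
  unfolding Int_Sync_def by (rule slice_fincomplete[OF IS_category _ I.pullbacks]) (simp_all add: Sync_sheaf)

abbreviation mcomp (infixr "\<star>" 70) where "G \<star> F \<equiv> Comp (SS :: ('u sheaf_map, 'u sync_map) category) G F"

abbreviation Sec :: "'u sheaf_map \<Rightarrow> real \<Rightarrow> 'u set" where "Sec f \<equiv> sec (fst f)"
abbreviation rs :: "'u sheaf_map \<Rightarrow> real \<Rightarrow> real \<Rightarrow> real \<Rightarrow> 'u \<Rightarrow> 'u" where "rs f \<equiv> res (fst f)"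

lemma SS_Obj: "f \<in> Obj (SS :: ('u sheaf_map, 'u sync_map) category) \<longleftrightarrow> f \<in> sheaf_maps \<and> tg f = Sync"
  by (simp add: Int_Sync_def)

lemma SS_cases:
  assumes "F \<in> Arr (SS :: ('u sheaf_map, 'u sync_map) category)"
  shows "underlying F \<in> sheaf_maps" "fst (underlying F) = fst (Dom SS F)" "fst (snd (underlying F)) = fst (Cod SS F)"
    "Cod SS F \<odot> underlying F = Dom SS F" "F = (Dom SS F, Cod SS F, underlying F)"
  using assms by (cases F; simp add: Int_Sync_def underlying_def Hom_def)+

lemma ev_simps:
  assumes "F \<in> Arr (SS :: ('u sheaf_map, 'u sync_map) category)" "x \<in> Sec (Dom SS F) l"
  shows "ev F l x \<in> Sec (Cod SS F) l" "ap (Cod SS F) l (ev F l x) = ap (Dom SS F) l x"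
    "\<lbrakk>0 \<le> l'; 0 \<le> p; p + l' \<le> l\<rbrakk> \<Longrightarrow> ev F l' (rs (Dom SS F) l l' p x) = rs (Cod SS F) l l' p (ev F l x)"
proof -
  note c = SS_cases[OF assms(1)] and m = sheaf_mapD[OF SS_cases(1)[OF assms(1)]]
  have x: "x \<in> sec (fst (underlying F)) l" using assms c by simp
  show "ev F l x \<in> Sec (Cod SS F) l" using m(3)[OF x] c by (simp add: ev_def)
  show "ap (Cod SS F) l (ev F l x) = ap (Dom SS F) l x" using ap_comp[OF c(1) x, of "Cod SS F"] c(4) by (simp add: ev_def)
  show "ev F l' (rs (Dom SS F) l l' p x) = rs (Cod SS F) l l' p (ev F l x)" if "0 \<le> l'" "0 \<le> p" "p + l' \<le> l"
    using sheaf_map_res[OF c(1) refl refl x that] c by (simp add: ev_def)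
qed

lemma obj_simps:
  assumes f: "f \<in> Obj (SS :: ('u sheaf_map, 'u sync_map) category)" and x: "x \<in> Sec f l"
  shows "0 \<le> l" "is_sheaf (fst f)" "ap f l x \<in> sec Sync l"
    "\<lbrakk>0 \<le> l'; 0 \<le> p; p + l' \<le> l\<rbrakk> \<Longrightarrow> rs f l l' p x \<in> Sec f l'"
    "\<lbrakk>0 \<le> l'; 0 \<le> p; p + l' \<le> l\<rbrakk> \<Longrightarrow> ap f l' (rs f l l' p x) = res Sync l l' p (ap f l x)"
    "\<lbrakk>0 \<le> l'; l' \<le> l\<rbrakk> \<Longrightarrow> ap f l' (rs f l l' 0 x) = ap f l x"
proof -
  have m: "f \<in> sheaf_maps" "tg f = Sync" using f by (simp_all add: SS_Obj)
  note d = sheaf_mapD[OF m(1)]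
  show s: "is_sheaf (fst f)" by (rule d)
  show l: "0 \<le> l" using sheafD(1)[OF s x] .
  show a: "ap f l x \<in> sec Sync l" using d(3)[OF x] m by simp
  show "rs f l l' p x \<in> Sec f l'" if "0 \<le> l'" "0 \<le> p" "p + l' \<le> l" using sheaf_res_sec[OF s x that] .
  show r: "ap f l' (rs f l l' p x) = res Sync l l' p (ap f l x)" if "0 \<le> l'" "0 \<le> p" "p + l' \<le> l" for l' p
    using sheaf_map_res[OF m(1) refl refl x that] m by simp
  show "ap f l' (rs f l l' 0 x) = ap f l x" if l': "0 \<le> l'" "l' \<le> l"
  proof -
    obtain \<theta> where "ap f l x = phase \<theta>" using a l by (auto simp: Sync_sec)
    then show ?thesis using r[of l' 0] Sync_res[of l l' 0 \<theta>] l' l by (simp add: int_arr_def)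
  qed
qed

lemma underlying_comp:
  assumes "F \<in> Arr (SS :: ('u sheaf_map, 'u sync_map) category)" "G \<in> Arr SS" "Cod SS F = Dom SS G"
  shows "underlying (G \<star> F) = underlying G \<odot> underlying F"
  by (cases F; cases G) (simp add: Int_Sync_def underlying_def)

lemma ev_comp [simp]:
  assumes "F \<in> Arr (SS :: ('u sheaf_map, 'u sync_map) category)" "G \<in> Arr SS" "Cod SS F = Dom SS G" "x \<in> Sec (Dom SS F) l"
  shows "ev (G \<star> F) l x = ev G l (ev F l x)"
  using underlying_comp[OF assms(1-3)] SS_cases[OF assms(1)] assms(4) by (simp add: ev_def)

lemma underlying_Ident: "underlying (Ident SS f) = mkmap (fst f) (fst f) (\<lambda>l x. x)"
  by (simp add: Int_Sync_def underlying_def)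

lemma ev_Ident [simp]: "x \<in> Sec f l \<Longrightarrow> ev (Ident SS f) l x = x"
  by (simp add: ev_def underlying_Ident)

text \<open>The section \<open>x\<close> as an arrow of the slice: the representable becomes an
  object over \<open>Sync\<close> through the phase of \<open>x\<close>.\<close>

definition Pt :: "'u sheaf_map \<Rightarrow> real \<Rightarrow> 'u \<Rightarrow> 'u sync_map" where
  "Pt f l x = (pt Sync l (ap f l x), f, pt (fst f) l x)"

lemma Pt_ends [simp]: "Dom SS (Pt f l x) = pt Sync l (ap f l x)" "Cod SS (Pt f l x) = f"
  by (simp_all add: Pt_def Int_Sync_def)

lemma Pt:
  assumes f: "f \<in> Obj (SS :: ('u sheaf_map, 'u sync_map) category)" and x: "x \<in> Sec f l"
  shows "Pt f l x \<in> Arr SS"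
proof -
  note o = obj_simps[OF f x]
  have m: "f \<in> sheaf_maps" "tg f = Sync" using f by (simp_all add: SS_Obj)
  show ?thesis unfolding Pt_def Int_Sync_def
    using pt(1)[OF Sync_sheaf o(3)] pt(1)[OF o(2) x] m pt_comp[OF m(1) refl x] by (simp add: Hom_def)
qed

lemma Pt_inj:
  assumes "f \<in> Obj (SS :: ('u sheaf_map, 'u sync_map) category)" "x \<in> Sec f l" "y \<in> Sec f l" "Pt f l x = Pt f l y"
  shows "x = y"
  using pt_inj[OF obj_simps(2)[OF assms(1,2)] assms(2,3)] assms(4) by (simp add: Pt_def)

lemma Pt_comp:
  assumes F: "F \<in> Arr (SS :: ('u sheaf_map, 'u sync_map) category)" "f = Dom SS F" and x: "x \<in> Sec f l"
  shows "F \<star> Pt f l x = Pt (Cod SS F) l (ev F l x)"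
proof -
  note c = SS_cases[OF F(1)]
  have "F \<star> Pt f l x = (Dom SS F, Cod SS F, underlying F) \<star> Pt f l x" using c(5) by simp
  also have "\<dots> = (pt Sync l (ap f l x), Cod SS F, underlying F \<odot> pt (fst f) l x)"
    by (simp add: Int_Sync_def Pt_def)
  also have "\<dots> = Pt (Cod SS F) l (ev F l x)"
    unfolding Pt_def using pt_comp[OF c(1) _ x] ev_simps(2)[OF F(1), of x l] x c F(2) by (simp add: ev_def)
  finally show ?thesis .
qed

text \<open>The Yoneda lemma in the slice: the underlying map comes from a section, and the
  structure map of the source prescribes its phase.\<close>

lemma Pt_surj:
  assumes A: "A \<in> Arr (SS :: ('u sheaf_map, 'u sync_map) category)" "Dom SS A = pt Sync l \<theta>" and \<theta>: "\<theta> \<in> sec Sync l"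
  obtains x where "x \<in> Sec (Cod SS A) l" "A = Pt (Cod SS A) l x" "ap (Cod SS A) l x = \<theta>"
proof -
  note c' = SS_cases[OF A(1)]
  have l: "0 \<le> l" using \<theta> by (auto simp: Sync_sec split: if_splits)
  have d: "c 0 \<in> Sec (Dom SS A) l" using A yo_top[OF l] by simp
  let ?x = "ev A l (c 0)"
  note e = ev_simps[OF A(1) d]
  have p: "ap (Cod SS A) l ?x = \<theta>" using e(2) A(2) pt(2)[OF Sync_sheaf \<theta>] by simp
  have "underlying A = pt (fst (Cod SS A)) l ?x" using pt_surj[OF c'(1) _ l] c' A by (simp add: ev_def)
  then have "A = Pt (Cod SS A) l ?x" using c'(5) A(2) p by (simp add: Pt_def)
  then show thesis using that e(1) p by blast
qed

lemma bprod_sec_eqI: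
  assumes fg: "f \<in> Obj (SS :: ('u sheaf_map, 'u sync_map) category)" "g \<in> Obj SS"
    and z: "z \<in> Sec (bprod SS f g) l" "z' \<in> Sec (bprod SS f g) l"
    and e: "ev (pr1 SS f g) l z = ev (pr1 SS f g) l z'" "ev (pr2 SS f g) l z = ev (pr2 SS f g) l z'"
  shows "z = z'"
proof -
  note p = M.pr_simps[OF fg] and b = M.bprod_Obj[OF fg]
  have q: "ap (bprod SS f g) l z = ap (bprod SS f g) l z'"
    using ev_simps(2)[OF p(1), of z l] ev_simps(2)[OF p(1), of z' l] z p e(1) by simp
  have "Pt (bprod SS f g) l z = Pt (bprod SS f g) l z'"
  proof (rule M.bprod_eqI[OF Pt[OF b z(1)] Pt[OF b z(2)] _ _ _ fg])
    show "pr1 SS f g \<star> Pt (bprod SS f g) l z = pr1 SS f g \<star> Pt (bprod SS f g) l z'"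
      using Pt_comp[OF p(1) p(2)[symmetric]] z e by simp
    show "pr2 SS f g \<star> Pt (bprod SS f g) l z = pr2 SS f g \<star> Pt (bprod SS f g) l z'"
      using Pt_comp[OF p(4) p(5)[symmetric]] z e by simp
  qed (use q in simp_all)
  then show ?thesis by (rule Pt_inj[OF b z])
qed

text \<open>A product over \<open>Sync\<close> is a fibre product, whence the condition on phases;
  it makes the points of \<open>x\<close> and \<open>y\<close> have a common source, so that they
  can be paired.\<close>

lemma bprod_sec_pair:
  assumes fg: "f \<in> Obj (SS :: ('u sheaf_map, 'u sync_map) category)" "g \<in> Obj SS"
    and x: "x \<in> Sec f l" and y: "y \<in> Sec g l" and e: "ap f l x = ap g l y"
  obtains z where "z \<in> Sec (bprod SS f g) l" "ev (pr1 SS f g) l z = x" "ev (pr2 SS f g) l z = y"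
    "Pt (bprod SS f g) l z = pairing SS (Pt f l x) (Pt g l y)"
proof -
  note p = M.pr_simps[OF fg] and X = Pt[OF fg(1) x] and Y = Pt[OF fg(2) y]
  let ?w = "pairing SS (Pt f l x) (Pt g l y)"
  have d: "Dom SS (Pt f l x) = Dom SS (Pt g l y)" using e by simp
  note w = M.pairing_simps[OF X Y d]
  have c: "Cod SS ?w = bprod SS f g" using w(3) by simp
  have "Dom SS ?w = pt Sync l (ap f l x)" using w(2) d by simp
  from Pt_surj[OF w(1) this obj_simps(3)[OF fg(1) x], unfolded c]
  obtain z where z: "z \<in> Sec (bprod SS f g) l" "?w = Pt (bprod SS f g) l z" by blast
  have "Pt f l (ev (pr1 SS f g) l z) = Pt f l x"
    using Pt_comp[OF p(1) p(2)[symmetric] z(1)] w(4)[of f g] z(2) p by simp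
  then have 1: "ev (pr1 SS f g) l z = x" using Pt_inj[OF fg(1) _ x] ev_simps(1)[OF p(1), of z l] z p by simp
  have "Pt g l (ev (pr2 SS f g) l z) = Pt g l y"
    using Pt_comp[OF p(4) p(5)[symmetric] z(1)] w(5)[of f g] z(2) p by simp
  then have "ev (pr2 SS f g) l z = y" using Pt_inj[OF fg(2) _ y] ev_simps(1)[OF p(4), of z l] z p by simp
  then show thesis using that z 1 by simp
qed

text \<open>Naturality of the prediction \<open>g\<close> is applied to the restriction from
  \<open>l + \<eta>\<close> to \<open>l\<close>: the prediction from the shorter state is a
  restriction of the one from the longer state, whose beginning is the actual output.\<close>

lemma inertial_future:
  assumes p: "p \<in> sheaf_maps" and i: "inertial_map p"
  obtains \<delta> g where "0 < \<delta>" "\<And>l x. x \<in> sec (fst p) l \<Longrightarrow> g l x \<in> sec (tg p) (l + \<delta>)"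
    "\<And>l x. x \<in> sec (fst p) l \<Longrightarrow> res (tg p) (l + \<delta>) l 0 (g l x) = ap p l x"
    "\<And>l \<eta> x. \<lbrakk>0 \<le> l; 0 \<le> \<eta>; \<eta> \<le> \<delta>; x \<in> sec (fst p) (l + \<eta>)\<rbrakk> \<Longrightarrow>
      ap p (l + \<eta>) x = res (tg p) (l + \<delta>) (l + \<eta>) 0 (g l (res (fst p) (l + \<eta>) l 0 x))"
proof -
  obtain \<delta> g where g: "0 < \<delta>" "\<And>l x. x \<in> sec (fst p) l \<Longrightarrow> g l x \<in> sec (tg p) (l + \<delta>)"
    "\<And>l l' q x. \<lbrakk>int_arr l l' q; x \<in> sec (fst p) l\<rbrakk> \<Longrightarrow> g l' (res (fst p) l l' q x) = res (tg p) (l + \<delta>) (l' + \<delta>) q (g l x)"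
    "\<And>l x. x \<in> sec (fst p) l \<Longrightarrow> res (tg p) (l + \<delta>) l 0 (g l x) = ap p l x"
    using inertial_mapE[OF i] by blast
  note pd = sheaf_mapD[OF p] and rr = sheaf_res_res[OF sheaf_mapD(2)[OF p]]
  have "ap p (l + \<eta>) x = res (tg p) (l + \<delta>) (l + \<eta>) 0 (g l (res (fst p) (l + \<eta>) l 0 x))"
    if l: "0 \<le> l" "0 \<le> \<eta>" "\<eta> \<le> \<delta>" and x: "x \<in> sec (fst p) (l + \<eta>)" for l \<eta> x
  proof -
    have "int_arr (l + \<eta>) l 0" using l by (simp add: int_arr_def)
    from g(3)[OF this x] show ?thesis
      using rr[OF g(2)[OF x], of "l + \<eta>" 0 0 "l + \<delta>" 0] g(4)[OF x] l by simp
  qed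
  then show thesis using that[OF g(1,2,4)] by blast
qed

text \<open>A prediction may be cut short. This serves to give two machines in parallel, whose
  delays differ, a common one.\<close>

lemma inertial_map_small:
  assumes p: "p \<in> sheaf_maps" and i: "inertial_map p"
  obtains \<epsilon> where "0 < \<epsilon>" "\<And>\<delta>. \<lbrakk>0 < \<delta>; \<delta> \<le> \<epsilon>\<rbrakk> \<Longrightarrow> \<exists>g.
    (\<forall>l. \<forall>x\<in>sec (fst p) l. g l x \<in> sec (tg p) (l + \<delta>) \<and> res (tg p) (l + \<delta>) l 0 (g l x) = ap p l x \<and>
      (\<forall>l' q. int_arr l l' q \<longrightarrow> g l' (res (fst p) l l' q x) = res (tg p) (l + \<delta>) (l' + \<delta>) q (g l x)))"
proof -
  obtain \<epsilon> g where g: "0 < \<epsilon>" "\<And>l x. x \<in> sec (fst p) l \<Longrightarrow> g l x \<in> sec (tg p) (l + \<epsilon>)"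
    "\<And>l l' q x. \<lbrakk>int_arr l l' q; x \<in> sec (fst p) l\<rbrakk> \<Longrightarrow> g l' (res (fst p) l l' q x) = res (tg p) (l + \<epsilon>) (l' + \<epsilon>) q (g l x)"
    "\<And>l x. x \<in> sec (fst p) l \<Longrightarrow> res (tg p) (l + \<epsilon>) l 0 (g l x) = ap p l x"
    using inertial_mapE[OF i] by blast
  note pd = sheaf_mapD[OF p]
  show thesis
  proof (rule that[OF g(1)])
    fix \<delta> assume d: "0 < \<delta>" "\<delta> \<le> \<epsilon>"
    let ?g = "\<lambda>l x. res (tg p) (l + \<epsilon>) (l + \<delta>) 0 (g l x)"
    have "?g l x \<in> sec (tg p) (l + \<delta>) \<and> res (tg p) (l + \<delta>) l 0 (?g l x) = ap p l x \<and>
      (\<forall>l' q. int_arr l l' q \<longrightarrow> ?g l' (res (fst p) l l' q x) = res (tg p) (l + \<delta>) (l' + \<delta>) q (?g l x))"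
      if x: "x \<in> sec (fst p) l" for l x
    proof (intro conjI allI impI)
      have l: "0 \<le> l" using sheafD(1)[OF pd(1) x] .
      note rr = sheaf_res_res[OF pd(2) g(2)[OF x]]
      show "?g l x \<in> sec (tg p) (l + \<delta>)" using sheaf_res_sec[OF pd(2) g(2)[OF x]] d l by simp
      show "res (tg p) (l + \<delta>) l 0 (?g l x) = ap p l x" using rr[of l 0 0 "l + \<delta>" 0] d l g(4)[OF x] by simp
      fix l' q assume i: "int_arr l l' q"
      show "?g l' (res (fst p) l l' q x) = res (tg p) (l + \<delta>) (l' + \<delta>) q (?g l x)"
        unfolding g(3)[OF i x] using rr[of "l' + \<delta>" q 0 "l' + \<epsilon>" q] rr[of "l' + \<delta>" 0 q "l + \<delta>" q] i d by (simp add: int_arr_def)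
    qed
    then show "\<exists>g. (\<forall>l. \<forall>x\<in>sec (fst p) l. g l x \<in> sec (tg p) (l + \<delta>) \<and> res (tg p) (l + \<delta>) l 0 (g l x) = ap p l x \<and>
      (\<forall>l' q. int_arr l l' q \<longrightarrow> g l' (res (fst p) l l' q x) = res (tg p) (l + \<delta>) (l' + \<delta>) q (g l x)))"
      by (intro exI[of _ ?g]) blast
  qed
qed

end

section \<open>Synchronous machines\<close>

context continuum
begin

lemma sec_lift_atD:
  assumes "lift_at (underlying F) \<epsilon>" "F \<in> Arr (SS :: ('u sheaf_map, 'u sync_map) category)"
    "s \<in> Sec (Dom SS F) l" "a \<in> Sec (Cod SS F) (l + \<epsilon>)" "rs (Cod SS F) (l + \<epsilon>) l 0 a = ev F l s"
  obtains s' where "s' \<in> Sec (Dom SS F) (l + \<epsilon>)" "rs (Dom SS F) (l + \<epsilon>) l 0 s' = s" "ev F (l + \<epsilon>) s' = a"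
  using assms SS_cases[OF assms(2)] unfolding lift_at_def ev_def by metis

lemma sec_lift_atI:
  assumes "F \<in> Arr (SS :: ('u sheaf_map, 'u sync_map) category)"
    and "\<And>l s a. \<lbrakk>0 \<le> l; s \<in> Sec (Dom SS F) l; a \<in> Sec (Cod SS F) (l + \<epsilon>); rs (Cod SS F) (l + \<epsilon>) l 0 a = ev F l s\<rbrakk> \<Longrightarrow>
      \<exists>s'\<in>Sec (Dom SS F) (l + \<epsilon>). rs (Dom SS F) (l + \<epsilon>) l 0 s' = s \<and> ev F (l + \<epsilon>) s' = a"
  shows "lift_at (underlying F) \<epsilon>"
  unfolding lift_at_def SS_cases(2,3)[OF assms(1)]
  using assms(2) obj_simps(1)[OF M.Dom_Obj[OF assms(1)]] unfolding ev_def by blast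

lemma sec_sep_atD:
  assumes "sep_at (underlying F) \<epsilon>" "F \<in> Arr (SS :: ('u sheaf_map, 'u sync_map) category)" "0 \<le> l"
    "x \<in> Sec (Dom SS F) (l + \<epsilon>)" "y \<in> Sec (Dom SS F) (l + \<epsilon>)"
    "rs (Dom SS F) (l + \<epsilon>) l 0 x = rs (Dom SS F) (l + \<epsilon>) l 0 y" "ev F (l + \<epsilon>) x = ev F (l + \<epsilon>) y"
  shows "x = y"
  using assms(1)[unfolded sep_at_def SS_cases(2,3)[OF assms(2)]] assms(3-) unfolding ev_def by blast

lemma sec_sep_atI:
  assumes "F \<in> Arr (SS :: ('u sheaf_map, 'u sync_map) category)"
    and "\<And>l x y. \<lbrakk>0 \<le> l; x \<in> Sec (Dom SS F) (l + \<epsilon>); y \<in> Sec (Dom SS F) (l + \<epsilon>);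
      rs (Dom SS F) (l + \<epsilon>) l 0 x = rs (Dom SS F) (l + \<epsilon>) l 0 y; ev F (l + \<epsilon>) x = ev F (l + \<epsilon>) y\<rbrakk> \<Longrightarrow> x = y"
  shows "sep_at (underlying F) \<epsilon>"
  unfolding sep_at_def SS_cases(2,3)[OF assms(1)] using assms(2) unfolding ev_def by blast

section \<open>Products of machines\<close>

context
  fixes p q J :: "'u sync_map"
  assumes p: "p \<in> Arr SS" and q: "q \<in> Arr SS" and J: "J \<in> Arr SS" "Dom SS J = bprod SS (Cod SS p) (Cod SS q)"
    and J_inj: "\<And>l w w'. \<lbrakk>w \<in> Sec (Dom SS J) l; w' \<in> Sec (Dom SS J) l; ev J l w = ev J l w'\<rbrakk> \<Longrightarrow> w = w'"
    and J_surj: "\<And>l a. a \<in> Sec (Cod SS J) l \<Longrightarrow> \<exists>w\<in>Sec (Dom SS J) l. ev J l w = a"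
begin

private abbreviation "P \<equiv> bprod SS (Dom SS p) (Dom SS q)"
private abbreviation "Q \<equiv> bprod SS (Cod SS p) (Cod SS q)"
private abbreviation "pp1 \<equiv> pr1 SS (Dom SS p) (Dom SS q)"
private abbreviation "pp2 \<equiv> pr2 SS (Dom SS p) (Dom SS q)"
private abbreviation "qq1 \<equiv> pr1 SS (Cod SS p) (Cod SS q)"
private abbreviation "qq2 \<equiv> pr2 SS (Cod SS p) (Cod SS q)"
text \<open>Both legs of a product of spans have this form, with \<open>hat_join\<close> for
  \<open>J\<close>; what matters about \<open>J\<close> is that it is bijective on sections.\<close>

private abbreviation "K \<equiv> J \<star> par SS p q"

private lemma obs: "Dom SS p \<in> Obj SS" "Dom SS q \<in> Obj SS" "Cod SS p \<in> Obj SS" "Cod SS q \<in> Obj SS"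
  "P \<in> Obj SS" "Q \<in> Obj SS" "Cod SS J \<in> Obj SS"
  using p q J by simp_all

private lemmas pp = M.pr_simps[OF obs(1,2)] and qq = M.pr_simps[OF obs(3,4)]
private lemmas parS = M.par_simps(1-3)[OF p q]

private lemma K: "K \<in> Arr SS" "Dom SS K = P" "Cod SS K = Cod SS J"
  using parS J by simp_all

private lemma secs:
  assumes z: "z \<in> Sec P l"
  shows "ev pp1 l z \<in> Sec (Dom SS p) l" "ev pp2 l z \<in> Sec (Dom SS q) l" "ev (par SS p q) l z \<in> Sec Q l"
    "ev qq1 l (ev (par SS p q) l z) = ev p l (ev pp1 l z)" "ev qq2 l (ev (par SS p q) l z) = ev q l (ev pp2 l z)"
    "ev K l z = ev J l (ev (par SS p q) l z)"
proof -
  show a: "ev pp1 l z \<in> Sec (Dom SS p) l" "ev pp2 l z \<in> Sec (Dom SS q) l" "ev (par SS p q) l z \<in> Sec Q l"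
    using ev_simps(1)[OF pp(1), of z l] ev_simps(1)[OF pp(4), of z l] ev_simps(1)[OF parS(1), of z l] pp parS z by simp_all
  show "ev K l z = ev J l (ev (par SS p q) l z)" using parS J z by simp
  have "qq1 \<star> par SS p q = p \<star> pp1" "qq2 \<star> par SS p q = q \<star> pp2"
    unfolding par_def using p q pp by simp_all
  from this[THEN arg_cong[of _ _ "\<lambda>F. ev F l z"]]
  show "ev qq1 l (ev (par SS p q) l z) = ev p l (ev pp1 l z)" "ev qq2 l (ev (par SS p q) l z) = ev q l (ev pp2 l z)"
    using p q pp qq parS z by simp_all
qed

text \<open>The input is decoded by \<open>J\<close> and lifted in each factor. Both lifts inherit
  the phase of the decoded input \<open>w\<close>, so they can be paired over
  \<open>Sync\<close>.\<close>

lemma par_lift_at: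
  assumes "lift_at (underlying p) \<epsilon>" "lift_at (underlying q) \<epsilon>" and e: "0 < \<epsilon>"
  shows "lift_at (underlying K) \<epsilon>"
proof (rule sec_lift_atI[OF K(1)], unfold K(2,3))
  fix l z a assume l: "0 \<le> l" and z: "z \<in> Sec P l" and a: "a \<in> Sec (Cod SS J) (l + \<epsilon>)" and c: "rs (Cod SS J) (l + \<epsilon>) l 0 a = ev K l z"
  obtain w where w: "w \<in> Sec Q (l + \<epsilon>)" "ev J (l + \<epsilon>) w = a" using J_surj[OF a] J by auto
  have r: "0 \<le> l" "(0::real) \<le> 0" "0 + l \<le> l + \<epsilon>" using l e by simp_all
  have "rs Q (l + \<epsilon>) l 0 w = ev (par SS p q) l z"
  proof (rule J_inj, unfold J(2))
    show "rs Q (l + \<epsilon>) l 0 w \<in> Sec Q l" using obj_simps(4)[OF obs(6) w(1) r] .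
    show "ev (par SS p q) l z \<in> Sec Q l" using secs(3)[OF z] .
    show "ev J l (rs Q (l + \<epsilon>) l 0 w) = ev J l (ev (par SS p q) l z)"
      using ev_simps(3)[OF J(1), of w "l + \<epsilon>", unfolded J(2), OF w(1) r] c w(2) secs(6)[OF z] by simp
  qed
  then have x: "rs (Cod SS p) (l + \<epsilon>) l 0 (ev qq1 (l + \<epsilon>) w) = ev p l (ev pp1 l z)" "rs (Cod SS q) (l + \<epsilon>) l 0 (ev qq2 (l + \<epsilon>) w) = ev q l (ev pp2 l z)"
    using ev_simps(3)[OF qq(1), of w "l + \<epsilon>", unfolded qq, OF w(1) r] ev_simps(3)[OF qq(4), of w "l + \<epsilon>", unfolded qq, OF w(1) r] secs(4,5)[OF z] by simp_all
  have wm: "ev qq1 (l + \<epsilon>) w \<in> Sec (Cod SS p) (l + \<epsilon>)" "ev qq2 (l + \<epsilon>) w \<in> Sec (Cod SS q) (l + \<epsilon>)"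
    "ap (Cod SS p) (l + \<epsilon>) (ev qq1 (l + \<epsilon>) w) = ap Q (l + \<epsilon>) w" "ap (Cod SS q) (l + \<epsilon>) (ev qq2 (l + \<epsilon>) w) = ap Q (l + \<epsilon>) w"
    using ev_simps(1,2)[OF qq(1), of w "l + \<epsilon>"] ev_simps(1,2)[OF qq(4), of w "l + \<epsilon>"] qq w(1) by simp_all
  obtain s where s: "s \<in> Sec (Dom SS p) (l + \<epsilon>)" "rs (Dom SS p) (l + \<epsilon>) l 0 s = ev pp1 l z" "ev p (l + \<epsilon>) s = ev qq1 (l + \<epsilon>) w"
    using sec_lift_atD[OF assms(1) p secs(1)[OF z] wm(1) x(1)] .
  obtain t where t: "t \<in> Sec (Dom SS q) (l + \<epsilon>)" "rs (Dom SS q) (l + \<epsilon>) l 0 t = ev pp2 l z" "ev q (l + \<epsilon>) t = ev qq2 (l + \<epsilon>) w"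
    using sec_lift_atD[OF assms(2) q secs(2)[OF z] wm(2) x(2)] .
  have "ap (Dom SS p) (l + \<epsilon>) s = ap (Dom SS q) (l + \<epsilon>) t"
    using ev_simps(2)[OF p s(1)] ev_simps(2)[OF q t(1)] wm s t by simp
  then obtain u where u: "u \<in> Sec P (l + \<epsilon>)" "ev pp1 (l + \<epsilon>) u = s" "ev pp2 (l + \<epsilon>) u = t"
    using bprod_sec_pair[OF obs(1,2) s(1) t(1)] by blast
  have "rs P (l + \<epsilon>) l 0 u = z"
    by (rule bprod_sec_eqI[OF obs(1,2) obj_simps(4)[OF obs(5) u(1) r] z])
      (use ev_simps(3)[OF pp(1), of u "l + \<epsilon>", unfolded pp, OF u(1) r] ev_simps(3)[OF pp(4), of u "l + \<epsilon>", unfolded pp, OF u(1) r] u s t in simp_all)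
  moreover have "ev (par SS p q) (l + \<epsilon>) u = w"
    by (rule bprod_sec_eqI[OF obs(3,4) secs(3)[OF u(1)] w(1)]) (use secs(4,5)[OF u(1)] u s t in simp_all)
  ultimately show "\<exists>u\<in>Sec P (l + \<epsilon>). rs P (l + \<epsilon>) l 0 u = z \<and> ev K (l + \<epsilon>) u = a"
    using u(1) secs(6)[OF u(1)] w(2) by auto
qed

lemma par_sep_at:
  assumes "sep_at (underlying p) \<epsilon>" "sep_at (underlying q) \<epsilon>" and e: "0 < \<epsilon>"
  shows "sep_at (underlying K) \<epsilon>"
proof (rule sec_sep_atI[OF K(1)], unfold K(2,3))
  fix l x y assume l: "0 \<le> l" and x: "x \<in> Sec P (l + \<epsilon>)" and y: "y \<in> Sec P (l + \<epsilon>)"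
    and c: "rs P (l + \<epsilon>) l 0 x = rs P (l + \<epsilon>) l 0 y" and k: "ev K (l + \<epsilon>) x = ev K (l + \<epsilon>) y"
  have r: "0 \<le> l" "(0::real) \<le> 0" "0 + l \<le> l + \<epsilon>" using l e by simp_all
  have "ev (par SS p q) (l + \<epsilon>) x = ev (par SS p q) (l + \<epsilon>) y"
  proof (rule J_inj, unfold J(2))
    show "ev J (l + \<epsilon>) (ev (par SS p q) (l + \<epsilon>) x) = ev J (l + \<epsilon>) (ev (par SS p q) (l + \<epsilon>) y)"
      using secs(6)[OF x] secs(6)[OF y] k by metis
  qed (use secs(3)[OF x] secs(3)[OF y] in simp_all)
  then have "ev p (l + \<epsilon>) (ev pp1 (l + \<epsilon>) x) = ev p (l + \<epsilon>) (ev pp1 (l + \<epsilon>) y)"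
    "ev q (l + \<epsilon>) (ev pp2 (l + \<epsilon>) x) = ev q (l + \<epsilon>) (ev pp2 (l + \<epsilon>) y)"
    using secs(4,5)[OF x] secs(4,5)[OF y] by simp_all
  note kk = this
  have cc: "rs (Dom SS p) (l + \<epsilon>) l 0 (ev pp1 (l + \<epsilon>) x) = rs (Dom SS p) (l + \<epsilon>) l 0 (ev pp1 (l + \<epsilon>) y)"
    "rs (Dom SS q) (l + \<epsilon>) l 0 (ev pp2 (l + \<epsilon>) x) = rs (Dom SS q) (l + \<epsilon>) l 0 (ev pp2 (l + \<epsilon>) y)"
    using ev_simps(3)[OF pp(1), of x "l + \<epsilon>", unfolded pp, OF x r] ev_simps(3)[OF pp(1), of y "l + \<epsilon>", unfolded pp, OF y r]
      ev_simps(3)[OF pp(4), of x "l + \<epsilon>", unfolded pp, OF x r] ev_simps(3)[OF pp(4), of y "l + \<epsilon>", unfolded pp, OF y r] c by simp_all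
  show "x = y"
    by (rule bprod_sec_eqI[OF obs(1,2) x y sec_sep_atD[OF assms(1) p l secs(1)[OF x] secs(1)[OF y] cc(1) kk(1)]
        sec_sep_atD[OF assms(2) q l secs(2)[OF x] secs(2)[OF y] cc(2) kk(2)]])
qed

lemma par_inertial:
  assumes "inertial_map (underlying p)" "inertial_map (underlying q)"
  shows "inertial_map (underlying K)"
proof -
  note cp = SS_cases[OF p] and cq = SS_cases[OF q] and cK = SS_cases[OF K(1), unfolded K]
  obtain \<epsilon> where e: "0 < \<epsilon>" "\<And>\<delta>. \<lbrakk>0 < \<delta>; \<delta> \<le> \<epsilon>\<rbrakk> \<Longrightarrow> \<exists>g. (\<forall>l. \<forall>x\<in>Sec (Dom SS p) l. g l x \<in> Sec (Cod SS p) (l + \<delta>) \<and>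
      rs (Cod SS p) (l + \<delta>) l 0 (g l x) = ev p l x \<and>
      (\<forall>l' q. int_arr l l' q \<longrightarrow> g l' (rs (Dom SS p) l l' q x) = rs (Cod SS p) (l + \<delta>) (l' + \<delta>) q (g l x)))"
    using inertial_map_small[OF cp(1) assms(1)] unfolding cp(2,3) ev_def by metis
  obtain \<epsilon>' where e': "0 < \<epsilon>'" "\<And>\<delta>. \<lbrakk>0 < \<delta>; \<delta> \<le> \<epsilon>'\<rbrakk> \<Longrightarrow> \<exists>g. (\<forall>l. \<forall>x\<in>Sec (Dom SS q) l. g l x \<in> Sec (Cod SS q) (l + \<delta>) \<and>
      rs (Cod SS q) (l + \<delta>) l 0 (g l x) = ev q l x \<and>
      (\<forall>l' r. int_arr l l' r \<longrightarrow> g l' (rs (Dom SS q) l l' r x) = rs (Cod SS q) (l + \<delta>) (l' + \<delta>) r (g l x)))"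
    using inertial_map_small[OF cq(1) assms(2)] unfolding cq(2,3) ev_def by metis
  \<comment> \<open>The pair can be predicted only as far ahead as both factors.\<close>
  define \<delta> where "\<delta> = min \<epsilon> \<epsilon>'"
  have d: "0 < \<delta>" "\<delta> \<le> \<epsilon>" "\<delta> \<le> \<epsilon>'" using e(1) e'(1) by (simp_all add: \<delta>_def)
  obtain g where g: "\<And>l x. x \<in> Sec (Dom SS p) l \<Longrightarrow> g l x \<in> Sec (Cod SS p) (l + \<delta>)"
      "\<And>l x. x \<in> Sec (Dom SS p) l \<Longrightarrow> rs (Cod SS p) (l + \<delta>) l 0 (g l x) = ev p l x"
      "\<And>l l' r x. \<lbrakk>int_arr l l' r; x \<in> Sec (Dom SS p) l\<rbrakk> \<Longrightarrow> g l' (rs (Dom SS p) l l' r x) = rs (Cod SS p) (l + \<delta>) (l' + \<delta>) r (g l x)"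
    using e(2)[OF d(1,2)] by blast
  obtain h where h: "\<And>l x. x \<in> Sec (Dom SS q) l \<Longrightarrow> h l x \<in> Sec (Cod SS q) (l + \<delta>)"
      "\<And>l x. x \<in> Sec (Dom SS q) l \<Longrightarrow> rs (Cod SS q) (l + \<delta>) l 0 (h l x) = ev q l x"
      "\<And>l l' r x. \<lbrakk>int_arr l l' r; x \<in> Sec (Dom SS q) l\<rbrakk> \<Longrightarrow> h l' (rs (Dom SS q) l l' r x) = rs (Cod SS q) (l + \<delta>) (l' + \<delta>) r (h l x)"
    using e'(2)[OF d(1,3)] by blast
  \<comment> \<open>Paired predictions as a relation: a witness exists because both predictions keep
    the phase of \<open>z\<close>, and it is unique, so that the chosen \<open>w\<close> commutes
    with restriction.\<close>
  define W where "W l z w \<longleftrightarrow> w \<in> Sec Q (l + \<delta>) \<and> ev qq1 (l + \<delta>) w = g l (ev pp1 l z) \<and> ev qq2 (l + \<delta>) w = h l (ev pp2 l z)" for l z w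
  have W: "\<exists>w. W l z w" if z: "z \<in> Sec P l" for l z
  proof -
    note s = secs[OF z]
    have l: "0 \<le> l" "l \<le> l + \<delta>" using obj_simps(1)[OF obs(5) z] d by simp_all
    have "ap (Cod SS p) (l + \<delta>) (g l (ev pp1 l z)) = ap P l z"
      using obj_simps(6)[OF obs(3) g(1)[OF s(1)] l] g(2)[OF s(1)] ev_simps(2)[OF p s(1)] ev_simps(2)[OF pp(1), of z l] pp z by simp
    moreover have "ap (Cod SS q) (l + \<delta>) (h l (ev pp2 l z)) = ap P l z"
      using obj_simps(6)[OF obs(4) h(1)[OF s(2)] l] h(2)[OF s(2)] ev_simps(2)[OF q s(2)] ev_simps(2)[OF pp(4), of z l] pp z by simp
    ultimately have "ap (Cod SS p) (l + \<delta>) (g l (ev pp1 l z)) = ap (Cod SS q) (l + \<delta>) (h l (ev pp2 l z))" by simp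
    then show ?thesis using bprod_sec_pair[OF obs(3,4) g(1)[OF s(1)] h(1)[OF s(2)]] unfolding W_def by metis
  qed
  define w where "w l z = (SOME w. W l z w)" for l z
  have w: "W l z (w l z)" if "z \<in> Sec P l" for l z unfolding w_def by (rule someI_ex[OF W[OF that]])
  have W_eq: "u = v" if "W l z u" "W l z v" for l z u v
    by (rule bprod_sec_eqI[OF obs(3,4)]) (use that in \<open>auto simp: W_def\<close>)
  show ?thesis
  proof (rule inertial_mapI[OF cK(1) d(1), of "\<lambda>l z. ev J (l + \<delta>) (w l z)"], unfold cK(2,3))
    fix l z assume z: "z \<in> Sec P l"
    note s = secs[OF z] and w' = w[OF z, unfolded W_def]
    have l: "0 \<le> l" "(0::real) \<le> 0" "0 + l \<le> l + \<delta>" using obj_simps(1)[OF obs(5) z] d by simp_all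
    have wm: "w l z \<in> Sec Q (l + \<delta>)" using w' by simp
    show "ev J (l + \<delta>) (w l z) \<in> Sec (Cod SS J) (l + \<delta>)" using ev_simps(1)[OF J(1), unfolded J(2), OF wm] .
    have "rs Q (l + \<delta>) l 0 (w l z) = ev (par SS p q) l z"
      by (rule bprod_sec_eqI[OF obs(3,4) obj_simps(4)[OF obs(6) wm l] s(3)])
        (use ev_simps(3)[OF qq(1), unfolded qq, OF wm l] ev_simps(3)[OF qq(4), unfolded qq, OF wm l] w' g(2)[OF s(1)] h(2)[OF s(2)] s in simp_all)
    then show "rs (Cod SS J) (l + \<delta>) l 0 (ev J (l + \<delta>) (w l z)) = ap (underlying K) l z"
      using ev_simps(3)[OF J(1), unfolded J(2), OF wm l] s(6) by (simp add: ev_def)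
    fix l' r assume i: "int_arr l l' r"
    have i': "0 \<le> l' + \<delta>" "0 \<le> r" "r + (l' + \<delta>) \<le> l + \<delta>" "0 \<le> l'" "r + l' \<le> l" using i d by (simp_all add: int_arr_def)
    note i1 = i'(1-3) and i2 = i'(4,2,5)
    have z': "rs P l l' r z \<in> Sec P l'" using obj_simps(4)[OF obs(5) z i2] .
    have "W l' (rs P l l' r z) (rs Q (l + \<delta>) (l' + \<delta>) r (w l z))"
      unfolding W_def
      using obj_simps(4)[OF obs(6) wm i1] ev_simps(3)[OF qq(1), unfolded qq, OF wm i1] ev_simps(3)[OF qq(4), unfolded qq, OF wm i1] w'
        ev_simps(3)[OF pp(1), unfolded pp, OF z i2] ev_simps(3)[OF pp(4), unfolded pp, OF z i2] g(3)[OF i s(1)] h(3)[OF i s(2)] by simp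
    then have "w l' (rs P l l' r z) = rs Q (l + \<delta>) (l' + \<delta>) r (w l z)" using W_eq w[OF z'] by blast
    then show "ev J (l' + \<delta>) (w l' (rs P l l' r z)) = rs (Cod SS J) (l + \<delta>) (l' + \<delta>) r (ev J (l + \<delta>) (w l z))"
      using ev_simps(3)[OF J(1), unfolded J(2), OF wm i1] by simp
  qed
qed

end

text \<open>The points \<open>Pt\<close> turn invertibility on generalised elements into bijectivity
  on sections.\<close>

lemma hat_join_sections:
  assumes XY: "X \<in> typed_sets SS" "Y \<in> typed_sets SS"
  defines "J \<equiv> hat_join SS X Y :: 'u sync_map"
  shows "J \<in> Arr SS" "Dom SS J = bprod SS (hat SS X) (hat SS Y)"
    "\<lbrakk>w \<in> Sec (Dom SS J) l; w' \<in> Sec (Dom SS J) l; ev J l w = ev J l w'\<rbrakk> \<Longrightarrow> w = w'"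
    "a \<in> Sec (Cod SS J) l \<Longrightarrow> \<exists>w\<in>Sec (Dom SS J) l. ev J l w = a"
proof -
  note j = M.hat_join[OF XY, folded J_def]
  show J: "J \<in> Arr SS" "Dom SS J = bprod SS (hat SS X) (hat SS Y)" by (rule j)+
  note o = M.Dom_Obj[OF J(1)] M.Cod_Obj[OF J(1)]
  { assume w: "w \<in> Sec (Dom SS J) l" "w' \<in> Sec (Dom SS J) l" and e: "ev J l w = ev J l w'"
    have q: "ap (Dom SS J) l w = ap (Dom SS J) l w'" using ev_simps(2)[OF J(1) w(1)] ev_simps(2)[OF J(1) w(2)] e by simp
    have "Pt (Dom SS J) l w = Pt (Dom SS J) l w'"
      by (rule M.hat_join_inj[OF XY Pt[OF o(1) w(1)] Pt[OF o(1) w(2)]])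
        (use Pt_comp[OF J(1) refl w(1)] Pt_comp[OF J(1) refl w(2)] e q J in \<open>simp_all add: J_def[symmetric]\<close>)
    then show "w = w'" by (rule Pt_inj[OF o(1) w]) }
  assume a: "a \<in> Sec (Cod SS J) l"
  obtain u where u: "u \<in> Arr SS" "Dom SS u = pt Sync l (ap (Cod SS J) l a)" "Cod SS u = Dom SS J" "J \<star> u = Pt (Cod SS J) l a"
  proof -
    have "Cod SS (Pt (Cod SS J) l a) = hat SS (typed_sum X Y)" using j by simp
    from M.hat_join_surj[OF XY Pt[OF o(2) a] this] that show thesis unfolding J_def[symmetric] Pt_ends j(2) by blast
  qed
  obtain w where w: "w \<in> Sec (Dom SS J) l" "u = Pt (Dom SS J) l w"
    using Pt_surj[OF u(1,2) obj_simps(3)[OF o(2) a]] u(3) by metis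
  have "Pt (Cod SS J) l (ev J l w) = Pt (Cod SS J) l a" using u(4) Pt_comp[OF J(1) refl w(1)] w by simp
  then show "\<exists>w\<in>Sec (Dom SS J) l. ev J l w = a" using Pt_inj[OF o(2) ev_simps(1)[OF J(1) w(1)] a] w by blast
qed

context
  fixes X Y :: "('l, 'u) sync_box" and s t :: "'u sync_map"
  assumes s: "M.span X s" and t: "M.span Y t"
begin

private lemma typed: "fst X \<in> typed_sets SS" "snd X \<in> typed_sets SS" "fst Y \<in> typed_sets SS" "snd Y \<in> typed_sets SS"
  using M.span_typed_sets s t by blast+

lemma mul_leg_eqs:
  "leg_in SS (box_sum X Y) (M.mul X Y s t) = hat_join SS (fst X) (fst Y) \<star> par SS (leg_in SS X s) (leg_in SS Y t)"
  "leg_out SS (box_sum X Y) (M.mul X Y s t) = hat_join SS (snd X) (snd Y) \<star> par SS (leg_out SS X s) (leg_out SS Y t)"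
  unfolding leg_in_def[of _ "box_sum X Y"] leg_out_def[of _ "box_sum X Y"]
  using s t M.hat_join(1-3)[OF typed(1,3)] M.hat_join(1-3)[OF typed(2,4)]
  by (simp_all add: span_mul_ob_def del: M.par_simps(4))

lemma mul_inertial:
  assumes "inertial_map (underlying (leg_out SS X s))" "inertial_map (underlying (leg_out SS Y t))"
  shows "inertial_map (underlying (leg_out SS (box_sum X Y) (M.mul X Y s t)))"
  unfolding mul_leg_eqs
  by (rule par_inertial) (use M.span_simps[OF s] M.span_simps[OF t] hat_join_sections[OF typed(2,4)] assms in simp_all)

lemma mul_lift_at:
  assumes "lift_at (underlying (leg_in SS X s)) \<epsilon>" "lift_at (underlying (leg_in SS Y t)) \<epsilon>" "0 < \<epsilon>"
  shows "lift_at (underlying (leg_in SS (box_sum X Y) (M.mul X Y s t))) \<epsilon>"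
  unfolding mul_leg_eqs
  by (rule par_lift_at) (use M.span_simps[OF s] M.span_simps[OF t] hat_join_sections[OF typed(1,3)] assms in simp_all)

lemma mul_sep_at:
  assumes "sep_at (underlying (leg_in SS X s)) \<epsilon>" "sep_at (underlying (leg_in SS Y t)) \<epsilon>" "0 < \<epsilon>"
  shows "sep_at (underlying (leg_in SS (box_sum X Y) (M.mul X Y s t))) \<epsilon>"
  unfolding mul_leg_eqs
  by (rule par_sep_at) (use M.span_simps[OF s] M.span_simps[OF t] hat_join_sections[OF typed(1,3)] assms in simp_all)

end

section \<open>The action of a wiring diagram on machines\<close>

context
  fixes d :: "('l, 'u sheaf_map) wiring_diagram" and s :: "'u sync_map"
  assumes wd: "d \<in> wiring_diagrams SS" and s: "M.span (wdom d) s"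
begin

private abbreviation "S \<equiv> Dom SS s"
private abbreviation "T \<equiv> Dom SS (M.act d s)"
private abbreviation "yin \<equiv> hat SS (fst (wcod d))"
private abbreviation "xin \<equiv> hat SS (fst (wdom d))"
private abbreviation "xout \<equiv> hat SS (snd (wdom d))"
private abbreviation "s_in \<equiv> leg_in SS (wdom d) s"
private abbreviation "s_out \<equiv> leg_out SS (wdom d) s"
private abbreviation "t_in \<equiv> leg_in SS (wcod d) (M.act d s)"
private abbreviation "t_out \<equiv> leg_out SS (wcod d) (M.act d s)"
private abbreviation "pr \<equiv> M.act_pr d s"
private abbreviation "B \<equiv> bprod SS yin xout"
private abbreviation "y1 \<equiv> pr1 SS yin xout"
private abbreviation "y2 \<equiv> pr2 SS yin xout"

private lemma act_obs: "yin \<in> Obj SS" "xout \<in> Obj SS" "xin \<in> Obj SS" "B \<in> Obj SS" "S \<in> Obj SS" "T \<in> Obj SS"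
  using wiring_diagramD[OF wd] M.act_Arr(1)[OF wd s] M.span_simps(1)[OF s] by simp_all

private lemmas sl = M.span_simps[OF s] and tl = M.span_simps[OF M.span_act0[OF wd s]]
  and prs = M.act_pr_simps[OF wd s] and ys = M.pr_simps[OF act_obs(1,2)] and hi = M.hat_in(1-3)[OF wd]

text \<open>The section \<open>w\<close> of the base is the value of the first pullback leg at
  \<open>z\<close>; it pairs the outer input with the output that is fed back.\<close>

private lemma act_secs:
  assumes z: "z \<in> Sec T l"
  shows "ev pr l z \<in> Sec S l" "ap S l (ev pr l z) = ap T l z"
    "\<exists>w\<in>Sec B l. ev y1 l w = ev t_in l z \<and> ev y2 l w = ev s_out l (ev pr l z) \<and> ev (hat_in SS d) l w = ev s_in l (ev pr l z)"
proof -
  show p: "ev pr l z \<in> Sec S l" "ap S l (ev pr l z) = ap T l z" using ev_simps(1,2)[OF prs(1), unfolded prs, OF z] .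
  let ?u = "pb1 SS (M.act_base d) s"
  note u = M.act_base_pb1[OF wd s]
  have "Ident SS T \<in> Arr SS" "Cod SS (Ident SS T) = T" using act_obs(6) by simp_all
  note L = M.act_legs(1-3)[OF wd s this]
  have e: "s_out \<star> pr = y2 \<star> ?u" "s_in \<star> pr = hat_in SS d \<star> ?u" "t_in = y1 \<star> ?u"
    using L u prs sl tl by simp_all
  have zu: "z \<in> Sec (Dom SS ?u) l" using z u by simp
  have "ev y1 l (ev ?u l z) = ev t_in l z" unfolding e(3) using ev_comp[OF u(1) ys(1) _ zu] u ys by simp
  moreover have "ev y2 l (ev ?u l z) = ev s_out l (ev pr l z)"
    using arg_cong[OF e(1), of "\<lambda>F. ev F l z"] ev_comp[OF u(1) ys(4) _ zu] ev_comp[OF prs(1) sl(6), of z l] u ys prs sl z by simp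
  moreover have "ev (hat_in SS d) l (ev ?u l z) = ev s_in l (ev pr l z)"
    using arg_cong[OF e(2), of "\<lambda>F. ev F l z"] ev_comp[OF u(1) hi(1) _ zu] ev_comp[OF prs(1) sl(3), of z l] u hi prs sl z by simp
  moreover have "ev ?u l z \<in> Sec B l" using ev_simps(1)[OF u(1) zu] u by simp
  ultimately show "\<exists>w\<in>Sec B l. ev y1 l w = ev t_in l z \<and> ev y2 l w = ev s_out l (ev pr l z) \<and> ev (hat_in SS d) l w = ev s_in l (ev pr l z)"
    by blast
qed

private lemma act_sec_eqI:
  assumes z: "z \<in> Sec T l" "z' \<in> Sec T l" and e: "ev pr l z = ev pr l z'" "ev t_in l z = ev t_in l z'"
  shows "z = z'"
proof -
  have q: "ap T l z = ap T l z'" using act_secs(2)[OF z(1)] act_secs(2)[OF z(2)] e(1) by simp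
  have "Pt T l z = Pt T l z'"
    by (rule M.act_leg_eqI[OF wd s Pt[OF act_obs(6) z(1)] Pt[OF act_obs(6) z(2)]])
      (use Pt_comp[OF prs(1) prs(2)[symmetric]] Pt_comp[OF tl(3) tl(4)[symmetric]] z e q in simp_all)
  then show ?thesis by (rule Pt_inj[OF act_obs(6) z])
qed

text \<open>Section form of \<open>act_leg_elem\<close>. The point of \<open>w\<close> is the
  pairing of the points of its components, because a section of the product is determined by
  these.\<close>

private lemma act_sec_ex:
  assumes \<sigma>: "\<sigma> \<in> Sec S l" and w: "w \<in> Sec B l" and e: "ev y2 l w = ev s_out l \<sigma>" "ev (hat_in SS d) l w = ev s_in l \<sigma>"
  obtains z where "z \<in> Sec T l" "ev pr l z = \<sigma>" "ev t_in l z = ev y1 l w"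
proof -
  let ?y = "ev y1 l w"
  have y: "?y \<in> Sec yin l" "ap yin l ?y = ap B l w" using ev_simps(1,2)[OF ys(1), unfolded ys, OF w] .
  have o: "ev s_out l \<sigma> \<in> Sec xout l" "ap xout l (ev s_out l \<sigma>) = ap S l \<sigma>" using ev_simps(1,2)[OF sl(6), unfolded sl, OF \<sigma>] .
  have q: "ap B l w = ap S l \<sigma>" using ev_simps(2)[OF ys(4), unfolded ys, OF w] o(2) e(1) by simp
  obtain v where v: "v \<in> Sec B l" "ev y1 l v = ?y" "ev y2 l v = ev s_out l \<sigma>"
    "Pt B l v = pairing SS (Pt yin l ?y) (Pt xout l (ev s_out l \<sigma>))"
    using bprod_sec_pair[OF act_obs(1,2) y(1) o(1)] y o q by auto
  have vw: "v = w" by (rule bprod_sec_eqI[OF act_obs(1,2) v(1) w]) (use v e in simp_all)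
  have so: "s_out \<star> Pt S l \<sigma> = Pt xout l (ev s_out l \<sigma>)" using Pt_comp[OF sl(6) sl(7)[symmetric] \<sigma>] sl by simp
  have "s_in \<star> Pt S l \<sigma> = hat_in SS d \<star> pairing SS (Pt yin l ?y) (s_out \<star> Pt S l \<sigma>)"
    unfolding so v(4)[symmetric] vw
    using Pt_comp[OF sl(3) sl(4)[symmetric] \<sigma>] Pt_comp[OF hi(1) hi(2)[symmetric] w] hi sl e(2) by simp
  from M.act_leg_elem[OF wd s Pt[OF act_obs(5) \<sigma>] Pt_ends(2) Pt[OF act_obs(1) y(1)] Pt_ends(2) _ this]
  obtain x where x: "x \<in> Arr SS" "Dom SS x = pt Sync l (ap S l \<sigma>)" "Cod SS x = T" "pr \<star> x = Pt S l \<sigma>" "t_in \<star> x = Pt yin l ?y"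
    unfolding Pt_ends using y(2) q by metis
  obtain z where z: "z \<in> Sec T l" "x = Pt T l z" using Pt_surj[OF x(1,2) obj_simps(3)[OF act_obs(5) \<sigma>]] x(3) by metis
  have "Pt S l (ev pr l z) = Pt S l \<sigma>" using Pt_comp[OF prs(1) prs(2)[symmetric] z(1)] x z prs by simp
  then have 1: "ev pr l z = \<sigma>" using Pt_inj[OF act_obs(5) act_secs(1)[OF z(1)] \<sigma>] by simp
  have "Pt yin l (ev t_in l z) = Pt yin l ?y" using Pt_comp[OF tl(3) tl(4)[symmetric] z(1)] x z tl by simp
  then have "ev t_in l z = ?y" using Pt_inj[OF act_obs(1) _ y(1)] ev_simps(1)[OF tl(3), unfolded tl, OF z(1)] by simp
  then show thesis using that z(1) 1 by blast
qed

text \<open>The outer output is the inner output with a projection before it and a reindexing after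
  it, so the inner delay carries over.\<close>

lemma act_inertial:
  assumes i: "inertial_map (underlying s_out)"
  shows "inertial_map (underlying t_out)"
proof -
  have "Ident SS T \<in> Arr SS" "Cod SS (Ident SS T) = T" using act_obs(6) by simp_all
  note L = M.act_legs(4)[OF wd s this] and ho = M.hat_out(1-3)[OF wd]
  have e: "t_out = hat_out SS d \<star> (s_out \<star> pr)" using L tl prs sl by simp
  have sp: "s_out \<star> pr \<in> Arr SS" "Cod SS (s_out \<star> pr) = xout" using sl prs by simp_all
  have u: "underlying t_out = underlying (hat_out SS d) \<odot> (underlying s_out \<odot> underlying pr)"
    unfolding e using underlying_comp[OF sp(1) ho(1)] underlying_comp[OF prs(1) sl(6)] sp ho prs sl by simp
  show ?thesis unfolding u
    by (rule inertial_comp[OF i])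
      (use SS_cases[OF prs(1)] SS_cases[OF ho(1)] SS_cases[OF sl(6)] prs ho sl in simp_all)
qed

context
  assumes i: "inertial_map (underlying s_out)"
begin

private lemma future:
  obtains \<delta> g where "0 < \<delta>" "\<And>l x. x \<in> Sec S l \<Longrightarrow> g l x \<in> Sec xout (l + \<delta>)"
    "\<And>l x. x \<in> Sec S l \<Longrightarrow> rs xout (l + \<delta>) l 0 (g l x) = ev s_out l x"
    "\<And>l \<eta> x. \<lbrakk>0 \<le> l; 0 \<le> \<eta>; \<eta> \<le> \<delta>; x \<in> Sec S (l + \<eta>)\<rbrakk> \<Longrightarrow>
      ev s_out (l + \<eta>) x = rs xout (l + \<delta>) (l + \<eta>) 0 (g l (rs S (l + \<eta>) l 0 x))"
  using inertial_future[OF SS_cases(1)[OF sl(6)] i] unfolding SS_cases(2,3)[OF sl(6)] sl ev_def by metis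

text \<open>Inertia opens the loop: before any extension is chosen, the predicted output
  \<open>?o\<close> and the outer input determine what \<open>s\<close> will receive. Totality of
  \<open>s\<close> extends its state along this input, and inertia again shows that the extended
  state really emits \<open>?o\<close>, which closes the loop.\<close>

lemma act_lift_at:
  assumes tot: "\<And>\<epsilon>. 0 < \<epsilon> \<Longrightarrow> lift_at (underlying s_in) \<epsilon>" and e: "0 < \<epsilon>"
  shows "lift_at (underlying t_in) \<epsilon>"
proof -
  obtain \<delta> g where g: "0 < \<delta>" "\<And>l x. x \<in> Sec S l \<Longrightarrow> g l x \<in> Sec xout (l + \<delta>)"
    "\<And>l x. x \<in> Sec S l \<Longrightarrow> rs xout (l + \<delta>) l 0 (g l x) = ev s_out l x"
    "\<And>l \<eta> x. \<lbrakk>0 \<le> l; 0 \<le> \<eta>; \<eta> \<le> \<delta>; x \<in> Sec S (l + \<eta>)\<rbrakk> \<Longrightarrow>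
      ev s_out (l + \<eta>) x = rs xout (l + \<delta>) (l + \<eta>) 0 (g l (rs S (l + \<eta>) l 0 x))"
    using future by blast
  show ?thesis
  proof (rule lift_at_stepwise[OF SS_cases(1)[OF tl(3)] g(1) _ e])
    fix \<eta> assume h: "0 < \<eta>" "\<eta> \<le> \<delta>"
    show "lift_at (underlying t_in) \<eta>"
    proof (rule sec_lift_atI[OF tl(3)], unfold tl(4,5))
      fix l z y assume l: "0 \<le> l" and z: "z \<in> Sec T l" and y: "y \<in> Sec yin (l + \<eta>)" and c: "rs yin (l + \<eta>) l 0 y = ev t_in l z"
      let ?\<sigma> = "ev pr l z" and ?o = "rs xout (l + \<delta>) (l + \<eta>) 0 (g l (ev pr l z))"
      note a = act_secs[OF z]
      have r: "0 \<le> l" "(0::real) \<le> 0" "0 + l \<le> l + \<eta>" "l \<le> l + \<eta>" using l h by simp_all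
      note r3 = r(1-3) and r2 = r(1,4)
      note gm = g(2)[OF a(1)]
      have o: "?o \<in> Sec xout (l + \<eta>)" using obj_simps(4)[OF act_obs(2) gm, of "l + \<eta>" 0] l h by simp
      have or: "rs xout (l + \<eta>) l 0 ?o = ev s_out l ?\<sigma>"
        using sheaf_res_res[OF obj_simps(2)[OF act_obs(2) gm] gm, of l 0 0 "l + \<eta>" 0] g(3)[OF a(1)] l h by simp
      \<comment> \<open>Left restriction keeps phases, so the prolonged input and the predicted
        output both have the phase of \<open>z\<close> and can be paired.\<close>
      have "ap yin (l + \<eta>) y = ap T l z"
        using obj_simps(6)[OF act_obs(1) y r2] c ev_simps(2)[OF tl(3), unfolded tl, OF z] by simp
      moreover have "ap xout (l + \<eta>) ?o = ap T l z"
        using obj_simps(6)[OF act_obs(2) o r2] or ev_simps(2)[OF sl(6), unfolded sl, OF a(1)] a(2) by simp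
      ultimately have "ap yin (l + \<eta>) y = ap xout (l + \<eta>) ?o" by simp
      from bprod_sec_pair[OF act_obs(1,2) y o this]
      obtain w where w: "w \<in> Sec B (l + \<eta>)" "ev y1 (l + \<eta>) w = y" "ev y2 (l + \<eta>) w = ?o" by blast
      obtain w0 where w0: "w0 \<in> Sec B l" "ev y1 l w0 = ev t_in l z" "ev y2 l w0 = ev s_out l ?\<sigma>" "ev (hat_in SS d) l w0 = ev s_in l ?\<sigma>"
        using a(3) by blast
      have "rs B (l + \<eta>) l 0 w = w0"
        by (rule bprod_sec_eqI[OF act_obs(1,2) obj_simps(4)[OF act_obs(4) w(1) r3] w0(1)])
          (use ev_simps(3)[OF ys(1), unfolded ys, OF w(1) r3] ev_simps(3)[OF ys(4), unfolded ys, OF w(1) r3] w w0 c or in simp_all)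
      then have "rs xin (l + \<eta>) l 0 (ev (hat_in SS d) (l + \<eta>) w) = ev s_in l ?\<sigma>"
        using ev_simps(3)[OF hi(1), unfolded hi, OF w(1) r3] w0 by simp
      from sec_lift_atD[OF tot[OF h(1)] sl(3), unfolded sl, OF a(1) ev_simps(1)[OF hi(1), unfolded hi, OF w(1)] this]
      obtain \<sigma>' where s': "\<sigma>' \<in> Sec S (l + \<eta>)" "rs S (l + \<eta>) l 0 \<sigma>' = ?\<sigma>" "ev s_in (l + \<eta>) \<sigma>' = ev (hat_in SS d) (l + \<eta>) w" by blast
      \<comment> \<open>The prediction depends on the state up to \<open>l\<close> only, so the
        output of the extension is the one that went into its own input.\<close>
      have "ev y2 (l + \<eta>) w = ev s_out (l + \<eta>) \<sigma>'" using g(4)[OF l _ h(2) s'(1)] h s'(2) w(3) by simp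
      from act_sec_ex[OF s'(1) w(1) this s'(3)[symmetric]]
      obtain z' where z': "z' \<in> Sec T (l + \<eta>)" "ev pr (l + \<eta>) z' = \<sigma>'" "ev t_in (l + \<eta>) z' = y" using w(2) by metis
      have "rs T (l + \<eta>) l 0 z' = z"
        by (rule act_sec_eqI[OF obj_simps(4)[OF act_obs(6) z'(1) r3] z])
          (use ev_simps(3)[OF prs(1), unfolded prs, OF z'(1) r3] ev_simps(3)[OF tl(3), unfolded tl, OF z'(1) r3] z' s' c in simp_all)
      then show "\<exists>z'\<in>Sec T (l + \<eta>). rs T (l + \<eta>) l 0 z' = z \<and> ev t_in (l + \<eta>) z' = y" using z' by blast
    qed
  qed
qed

lemma act_sep_at:
  assumes det: "\<And>\<epsilon>. 0 < \<epsilon> \<Longrightarrow> sep_at (underlying s_in) \<epsilon>" and e: "0 < \<epsilon>"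
  shows "sep_at (underlying t_in) \<epsilon>"
proof -
  obtain \<delta> g where g: "0 < \<delta>" "\<And>l x. x \<in> Sec S l \<Longrightarrow> g l x \<in> Sec xout (l + \<delta>)"
    "\<And>l x. x \<in> Sec S l \<Longrightarrow> rs xout (l + \<delta>) l 0 (g l x) = ev s_out l x"
    "\<And>l \<eta> x. \<lbrakk>0 \<le> l; 0 \<le> \<eta>; \<eta> \<le> \<delta>; x \<in> Sec S (l + \<eta>)\<rbrakk> \<Longrightarrow>
      ev s_out (l + \<eta>) x = rs xout (l + \<delta>) (l + \<eta>) 0 (g l (rs S (l + \<eta>) l 0 x))"
    using future by blast
  show ?thesis
  proof (rule sep_at_stepwise[OF SS_cases(1)[OF tl(3)] g(1) _ e])
    fix \<eta> assume h: "0 < \<eta>" "\<eta> \<le> \<delta>"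
    show "sep_at (underlying t_in) \<eta>"
    proof (rule sec_sep_atI[OF tl(3)], unfold tl(4,5))
      fix l x y assume l: "0 \<le> l" and x: "x \<in> Sec T (l + \<eta>)" and y: "y \<in> Sec T (l + \<eta>)"
        and c: "rs T (l + \<eta>) l 0 x = rs T (l + \<eta>) l 0 y" and k: "ev t_in (l + \<eta>) x = ev t_in (l + \<eta>) y"
      have r: "0 \<le> l" "(0::real) \<le> 0" "0 + l \<le> l + \<eta>" using l h by simp_all
      note ax = act_secs[OF x] and ay = act_secs[OF y]
      have cs: "rs S (l + \<eta>) l 0 (ev pr (l + \<eta>) x) = rs S (l + \<eta>) l 0 (ev pr (l + \<eta>) y)"
        using ev_simps(3)[OF prs(1), unfolded prs, OF x r] ev_simps(3)[OF prs(1), unfolded prs, OF y r] c by simp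
      \<comment> \<open>States that agree up to \<open>l\<close> emit the same output up to
        \<open>l + \<eta>\<close>; with equal outer inputs they therefore also receive the same
        input.\<close>
      have so: "ev s_out (l + \<eta>) (ev pr (l + \<eta>) x) = ev s_out (l + \<eta>) (ev pr (l + \<eta>) y)"
        using g(4)[OF l _ h(2) ax(1)] g(4)[OF l _ h(2) ay(1)] h cs by simp
      obtain v where v: "v \<in> Sec B (l + \<eta>)" "ev y1 (l + \<eta>) v = ev t_in (l + \<eta>) x" "ev y2 (l + \<eta>) v = ev s_out (l + \<eta>) (ev pr (l + \<eta>) x)"
        "ev (hat_in SS d) (l + \<eta>) v = ev s_in (l + \<eta>) (ev pr (l + \<eta>) x)" using ax(3) by blast
      obtain w where w: "w \<in> Sec B (l + \<eta>)" "ev y1 (l + \<eta>) w = ev t_in (l + \<eta>) y" "ev y2 (l + \<eta>) w = ev s_out (l + \<eta>) (ev pr (l + \<eta>) y)"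
        "ev (hat_in SS d) (l + \<eta>) w = ev s_in (l + \<eta>) (ev pr (l + \<eta>) y)" using ay(3) by blast
      have "v = w" by (rule bprod_sec_eqI[OF act_obs(1,2) v(1) w(1)]) (use v w k so in simp_all)
      then have "ev s_in (l + \<eta>) (ev pr (l + \<eta>) x) = ev s_in (l + \<eta>) (ev pr (l + \<eta>) y)" using v w by simp
      then have "ev pr (l + \<eta>) x = ev pr (l + \<eta>) y"
        by (rule sec_sep_atD[OF det[OF h(1)] sl(3) l, unfolded sl, OF ax(1) ay(1) cs])
      then show "x = y" by (rule act_sec_eqI[OF x y _ k])
    qed
  qed
qed

end

end

section \<open>The unit machine\<close>

lemma Ident_lift_at:
  fixes f :: "'u sheaf_map"
  assumes f: "f \<in> Obj SS"
  shows "lift_at (underlying (Ident SS f)) \<epsilon>"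
proof -
  have I: "Ident SS f \<in> Arr SS" "Dom SS (Ident SS f) = f" "Cod SS (Ident SS f) = f" using f by simp_all
  show ?thesis by (rule sec_lift_atI[OF I(1)], unfold I(2,3)) auto
qed

lemma Ident_sep_at:
  fixes f :: "'u sheaf_map"
  assumes f: "f \<in> Obj SS"
  shows "sep_at (underlying (Ident SS f)) \<epsilon>"
proof -
  have I: "Ident SS f \<in> Arr SS" "Dom SS (Ident SS f) = f" "Cod SS (Ident SS f) = f" using f by simp_all
  show ?thesis by (rule sec_sep_atI[OF I(1)], unfold I(2,3)) auto
qed

text \<open>A section of the terminal object is determined by its phase, so that it extends uniquely.\<close>

lemma terminal_inertial:
  defines "f \<equiv> hat SS (Map.empty :: ('l, 'u sheaf_map) typed_set)"
  shows "inertial_map (underlying (Ident SS f))"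
proof -
  have f: "f \<in> Obj SS" unfolding f_def by simp
  have m: "f \<in> sheaf_maps" "tg f = Sync" using f by (simp_all add: SS_Obj)
  have eq: "x = y" if "x \<in> Sec f l" "y \<in> Sec f l" "ap f l x = ap f l y" for x y l
  proof (rule Pt_inj[OF f that(1,2)])
    show "Pt f l x = Pt f l y"
      by (rule M.hat_eqI[OF empty_typed_sets Pt[OF f that(1)] Pt[OF f that(2)]]) (use that in \<open>simp_all add: f_def\<close>)
  qed
  \<comment> \<open>The representable over \<open>Sync\<close> with phase \<theta> maps to the empty
    product, and this map is a section of phase \<theta>.\<close>
  have ex: "\<exists>x\<in>Sec f l. ap f l x = \<theta>" if \<theta>: "\<theta> \<in> sec Sync l" for l \<theta>
  proof -
    have d: "pt Sync l \<theta> \<in> Obj SS" using pt(1)[OF Sync_sheaf \<theta>] by (simp add: SS_Obj)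
    note t = M.hat_tuple(1-3)[OF empty_typed_sets d, of "\<lambda>_. undefined", simplified]
    show ?thesis using Pt_surj[OF t(1) t(2) \<theta>] t(3) unfolding f_def by metis
  qed
  \<comment> \<open>The phase forces the continuation, so every delay is possible; the length 1 is a
    convenient choice.\<close>
  define w where "w l x = (SOME y. y \<in> Sec f (l + 1) \<and> ap f (l + 1) y = ap f l x)" for l x
  have w: "w l x \<in> Sec f (l + 1)" "ap f (l + 1) (w l x) = ap f l x" if x: "x \<in> Sec f l" for l x
  proof -
    have "ap f l x \<in> sec Sync (l + 1)" using obj_simps(1,3)[OF f x] by (simp add: Sync_sec)
    then have "\<exists>y. y \<in> Sec f (l + 1) \<and> ap f (l + 1) y = ap f l x" using ex by blast
    from someI_ex[OF this] show "w l x \<in> Sec f (l + 1)" "ap f (l + 1) (w l x) = ap f l x" unfolding w_def by blast+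
  qed
  have I: "underlying (Ident SS f) \<in> sheaf_maps" using SS_cases(1)[of "Ident SS f"] f by simp
  show ?thesis
  proof (rule inertial_mapI[OF I zero_less_one, of w])
    fix l x assume "x \<in> sec (fst (underlying (Ident SS f))) l"
    then have x: "x \<in> Sec f l" by (simp add: underlying_Ident)
    have l: "0 \<le> l" using obj_simps(1)[OF f x] .
    note w' = w[OF x]
    show "w l x \<in> sec (fst (snd (underlying (Ident SS f)))) (l + 1)" using w' by (simp add: underlying_Ident)
    have "rs f (l + 1) l 0 (w l x) = x"
      by (rule eq[OF obj_simps(4)[OF f w'(1)] x]) (use obj_simps(6)[OF f w'(1), of l] w' l in simp_all)
    then show "res (fst (snd (underlying (Ident SS f)))) (l + 1) l 0 (w l x) = ap (underlying (Ident SS f)) l x"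
      using x by (simp add: underlying_Ident)
    fix l' q assume i: "int_arr l l' q"
    then have i': "0 \<le> l'" "0 \<le> q" "q + l' \<le> l" "int_arr (l + 1) (l' + 1) q" by (simp_all add: int_arr_def)
    have r: "rs f l l' q x \<in> Sec f l'" using obj_simps(4)[OF f x i'(1-3)] .
    have "w l' (rs f l l' q x) = rs f (l + 1) (l' + 1) q (w l x)"
    proof (rule eq[OF w(1)[OF r] obj_simps(4)[OF f w'(1)]])
      show "ap f (l' + 1) (w l' (rs f l l' q x)) = ap f (l' + 1) (rs f (l + 1) (l' + 1) q (w l x))"
        using w(2)[OF r] obj_simps(5)[OF f x i'(1-3)] obj_simps(5)[OF f w'(1), of "l' + 1" q] w'(2) Sync_res_indep[OF i i'(4)] i' by simp
    qed (use i' in simp_all)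
    then show "w l' (res (fst (underlying (Ident SS f))) l l' q x) = res (fst (snd (underlying (Ident SS f)))) (l + 1) (l' + 1) q (w l x)"
      by (simp add: underlying_Ident)
  qed
qed

end

section \<open>From properties of machines to subalgebras\<close>

context fincomplete
begin

lemma leg_eta:
  "leg_in C (empty_box :: ('l, 'o) box) (eta TYPE('l)) = Ident C (hat C (Map.empty :: ('l, 'o) typed_set))"
  "leg_out C (empty_box :: ('l, 'o) box) (eta TYPE('l)) = Ident C (hat C (Map.empty :: ('l, 'o) typed_set))"
proof -
  have O: "hat C (Map.empty :: ('l, 'o) typed_set) \<in> Obj C" by simp
  show "leg_in C (empty_box :: ('l, 'o) box) (eta TYPE('l)) = Ident C (hat C (Map.empty :: ('l, 'o) typed_set))"
    "leg_out C (empty_box :: ('l, 'o) box) (eta TYPE('l)) = Ident C (hat C (Map.empty :: ('l, 'o) typed_set))"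
    using O by (simp_all add: eta_def span_systems_def Let_def leg_in_def leg_out_def empty_box_def)
qed

text \<open>Actions and products of spans are spans in any case, so for a class cut out by a
  property \<open>Q\<close> only the closure of \<open>Q\<close> has to be checked.\<close>

lemma subalgebraI:
  fixes P :: "('l, 'o) box \<Rightarrow> 'm set"
  assumes P: "\<And>X s. is_box X \<Longrightarrow> s \<in> P X \<longleftrightarrow> span X s \<and> Q X s"
    and act: "\<And>d s. \<lbrakk>diagram d; span (wdom d) s; Q (wdom d) s\<rbrakk> \<Longrightarrow> Q (wcod d) (act d s)"
    and mul: "\<And>X Y s t. \<lbrakk>span X s; span Y t; Q X s; Q Y t\<rbrakk> \<Longrightarrow> Q (box_sum X Y) (mul X Y s t)"
    and eta: "Q empty_box (eta TYPE('l))"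
  shows "is_subalgebra (W :: (('l, 'o) box, ('l, 'o) wiring_diagram) monoidal_category) F P"
proof -
  have B: "X \<in> Obj W \<longleftrightarrow> is_box X" for X :: "('l, 'o) box" by (simp add: is_box_def mem_Times_iff)
  have A: "act d s \<in> P (wcod d)" if "diagram d" "s \<in> P (wdom d)" for d s
  proof -
    have "span (wdom d) s" "Q (wdom d) s" using P[OF is_box_ends(1)[OF that(1)], of s] that(2) by simp_all
    then show ?thesis using P[OF is_box_ends(2)[OF that(1)]] act[OF that(1)] span_act0[OF that(1)] by blast
  qed
  have N: "mul X Y s t \<in> P (box_sum X Y)" if "is_box X" "is_box Y" "s \<in> P X" "t \<in> P Y" for X Y s t
    using P[OF is_box_sum[OF that(1,2)]] P[OF that(1)] P[OF that(2)] that(3,4) mul mul_simps(1) by blast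
  have S: "P X \<subseteq> Obj (Fib (F :: ('l, 'o, 'm) span_algebra) X)" if "is_box X" for X
    using P[OF that] span_slice[OF that] by (auto simp: span_systems_def)
  have O: "OM (Act (F :: ('l, 'o, 'm) span_algebra) d) s = act d s"
    "OM (Mul (F :: ('l, 'o, 'm) span_algebra) X Y) (s, t) = mul X Y s t" for d X Y s t
    by (simp_all add: span_systems_def span_mul_def)
  have E: "Eta (F :: ('l, 'o, 'm) span_algebra) \<in> P empty_box" using P[OF is_box_empty] span_eta(1) eta by simp
  show ?thesis unfolding is_subalgebra_def
  proof (intro conjI ballI)
    show "P X \<subseteq> Obj (Fib F X)" if "X \<in> Obj W" for X using S that by (simp only: B)
    show "OM (Act F d) s \<in> P (Cod W d)" if "d \<in> Arr W" "s \<in> P (Dom W d)" for d s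
      using A that by (simp only: wiring_simps O)
    show "OM (Mul F X Y) (s, t) \<in> P (X \<oplus>\<^bsub>W\<^esub> Y)" if "X \<in> Obj W" "Y \<in> Obj W" "s \<in> P X" "t \<in> P Y" for X Y s t
      using N that by (simp only: B wiring_simps(7) O)
    show "Eta (F :: ('l, 'o, 'm) span_algebra) \<in> P (Unit W)" using E by simp
  qed
qed

end

context continuum
begin

lemma inertial_machines_iff:
  fixes X :: "('l, 'u) sync_box"
  assumes "M.is_box X"
  shows "s \<in> inertial_machines X \<longleftrightarrow> M.span X s \<and> inertial_map (underlying (leg_out SS X s))"
  using M.span_slice[OF assms, of s] by (simp add: inertial_machines_def Mch_Sync_def span_systems_def) blast

lemma total_machines_iff:
  fixes X :: "('l, 'u) sync_box"
  assumes "M.is_box X"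
  shows "s \<in> total_machines X \<longleftrightarrow> M.span X s \<and> inertial_map (underlying (leg_out SS X s)) \<and> (\<forall>\<epsilon>>0. lift_at (underlying (leg_in SS X s)) \<epsilon>)"
  using inertial_machines_iff[OF assms, of s] total_map_iff[OF SS_cases(1)[OF M.span_simps(3)], of X s]
  by (auto simp: total_machines_def)

lemma deterministic_machines_iff:
  fixes X :: "('l, 'u) sync_box"
  assumes "M.is_box X"
  shows "s \<in> deterministic_machines X \<longleftrightarrow> M.span X s \<and> inertial_map (underlying (leg_out SS X s)) \<and> (\<forall>\<epsilon>>0. sep_at (underlying (leg_in SS X s)) \<epsilon>)"
  using inertial_machines_iff[OF assms, of s] deterministic_map_iff[OF SS_cases(1)[OF M.span_simps(3)], of X s]
  by (auto simp: deterministic_machines_def)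

lemma eta_inertial: "inertial_map (underlying (leg_out SS (empty_box :: ('l, 'u) sync_box) (M.eta TYPE('l))))"
  unfolding M.leg_eta by (rule terminal_inertial)

lemma eta_lift_at: "lift_at (underlying (leg_in SS (empty_box :: ('l, 'u) sync_box) (M.eta TYPE('l)))) \<epsilon>"
  unfolding M.leg_eta by (rule Ident_lift_at) simp_all

lemma eta_sep_at: "sep_at (underlying (leg_in SS (empty_box :: ('l, 'u) sync_box) (M.eta TYPE('l)))) \<epsilon>"
  unfolding M.leg_eta by (rule Ident_sep_at) simp_all

lemma inertial_subalgebra: "is_subalgebra (W_Sync :: ('l, 'u) sync_wiring) Mch_Sync inertial_machines"
  unfolding W_Sync_def Mch_Sync_def
  by (rule M.subalgebraI[OF inertial_machines_iff]) (simp_all add: act_inertial mul_inertial eta_inertial)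

lemma total_subalgebra: "is_subalgebra (W_Sync :: ('l, 'u) sync_wiring) Mch_Sync total_machines"
  unfolding W_Sync_def Mch_Sync_def
  by (rule M.subalgebraI[OF total_machines_iff])
    (simp_all add: act_inertial mul_inertial eta_inertial act_lift_at mul_lift_at eta_lift_at)

lemma deterministic_subalgebra: "is_subalgebra (W_Sync :: ('l, 'u) sync_wiring) Mch_Sync deterministic_machines"
  unfolding W_Sync_def Mch_Sync_def
  by (rule M.subalgebraI[OF deterministic_machines_iff])
    (simp_all add: act_inertial mul_inertial eta_inertial act_sep_at mul_sep_at eta_sep_at)

lemma Int_subalgebra:
  assumes "is_subalgebra A G P" "is_subalgebra A G Q"
  shows "is_subalgebra A G (\<lambda>X. P X \<inter> Q X)"
  using assms unfolding is_subalgebra_def by blast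

end

theorem proposition4p4p5:
  assumes "\<exists>c :: real \<Rightarrow> 'u. inj c"
  shows "is_algebra (W_Sync :: ('l, 'u) sync_wiring) Mch_Sync \<and>
    is_subalgebra (W_Sync :: ('l, 'u) sync_wiring) Mch_Sync inertial_machines \<and>
    is_subalgebra (W_Sync :: ('l, 'u) sync_wiring) Mch_Sync total_machines \<and>
    is_subalgebra (W_Sync :: ('l, 'u) sync_wiring) Mch_Sync deterministic_machines \<and>
    is_subalgebra (W_Sync :: ('l, 'u) sync_wiring) Mch_Sync
      (\<lambda>X. total_machines X \<inter> deterministic_machines X)"
proof -
  obtain c :: "real \<Rightarrow> 'u" where "inj c" using assms by blast
  then interpret continuum c by (rule continuum.intro)
  have "is_algebra (W_Sync :: ('l, 'u) sync_wiring) Mch_Sync"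
    unfolding W_Sync_def Mch_Sync_def by (rule M.span_systems_algebra)
  then show ?thesis
    using inertial_subalgebra total_subalgebra deterministic_subalgebra Int_subalgebra[OF total_subalgebra deterministic_subalgebra] by blast
qed

end
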